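(* Let $n,d$ be integers with $0<d<n-1$, let $\Gamma\subset\mathbb{R}^n$ be a $d$-Ahlfors regular set with Ahlfors regular measure $\sigma$ of constant $C_\sigma$, assume $\Gamma$ is uniformly rectifiable with constant $C_0$, and let $\Omega=\mathbb{R}^n\setminus\Gamma$. Let $\beta>0$. Then there exist a scalar function $b$ and a vector function $\mathcal{V}$, both defined on $\Omega$, such that $$\int_\Gamma|X-y|^{-n}(X-y)\,d\sigma(y)=\big(b(X)\nabla D_\beta(X)+\mathcal{V}(X)\big)D_\beta(X)^{d+1-n}\qquad\text{for }X\in\Omega,$$ and (i) $C_1^{-1}\le b\le C_1$; (ii) $D_\beta\nabla b\in CM(C_1)$; (iii) $|\mathcal{V}|\le C_1$; (iv) $\mathcal{V}\in CM(C_1)$, where $C_1$ is a constant that depends only on $C_\sigma$, $C_0$, $\beta$, $n$ and $d$.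
   Context: Ahlfors regularity: $\Gamma$ is closed and $\sigma$ is a measure supported on $\Gamma$ with $C_\sigma^{-1}r^d\le\sigma(B(x,r))\le C_\sigma r^d$ for all $x\in\Gamma$, $r>0$. A flat measure is $\mu=c\mu_P$ with $c>0$ and $\mu_P$ the $d$-dimensional Hausdorff measure on an affine $d$-plane $P\subset\mathbb{R}^n$; $\mathcal{F}$ is the set of flat measures. $Lip(x,r)$ is the set of $1$-Lipschitz functions $f:\mathbb{R}^n\to\mathbb{R}$ vanishing outside $B(x,r)$; $\operatorname{dist}_{x,r}(\mu,\sigma)=r^{-d-1}\sup_{f\in Lip(x,r)}|\int f\,d\sigma-\int f\,d\mu|$; $\alpha_\sigma(x,r)=\inf_{\mu\in\mathcal{F}}\operatorname{dist}_{x,r}(\mu,\sigma)$. $\Gamma$ is uniformly rectifiable with constant $C_0$ if $$\int_0^r\int_{\Gamma\cap B(x,r)}|\alpha_\sigma(y,s)|^2\,d\sigma(y)\,\frac{ds}{s}\le C_0\,\sigma(B(x,r))\qquad\text{for all }x\in\Gamma,\ r>0.$$ For $X\in\Omega$, $D_\beta(X)=\big(\int_\Gamma|X-y|^{-d-\beta}\,d\sigma(y)\big)^{-1/\beta}$. A (scalar or vector) function $f$ on $\Omega$ satisfies $f\in CM(C)$ if $f\in L^\infty(\Omega)$ and $\int_{B(x,r)}|f(X)|^2\operatorname{dist}(X,\Gamma)^{d-n}\,dX\le C\,\sigma(B(x,r))$ for all $x\in\Gamma$, $r>0$. *)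

theory Defs
  imports "HOL-Analysis.Analysis"
begin

section \<open>Hausdorff measure\<close>

text \<open>
  The guard \<^term>\<open>bounded (U i)\<close> is needed because \<^const>\<open>diameter\<close> is unspecified on unbounded
  sets. The definition is meant for \<open>d > 0\<close>, when the empty members of a cover contribute
  \<open>0 ^ d = 0\<close>. No normalising factor is used; flat measures carry an arbitrary positive factor
  anyway.
\<close>

definition hausdorff_pre :: "nat \<Rightarrow> real \<Rightarrow> 'a::metric_space set \<Rightarrow> ennreal" where
  "hausdorff_pre d \<delta> A =
     (INF U \<in> {U :: nat \<Rightarrow> 'a set. A \<subseteq> (\<Union>i. U i) \<and> (\<forall>i. bounded (U i) \<and> diameter (U i) \<le> \<delta>)}.
        \<Sum>i. ennreal (diameter (U i) ^ d))"

definition hausdorff_outer :: "nat \<Rightarrow> 'a::metric_space set \<Rightarrow> ennreal" where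
  "hausdorff_outer d A = (SUP \<delta>\<in>{0<..}. hausdorff_pre d \<delta> A)"

definition hausdorff_measure :: "nat \<Rightarrow> 'a::metric_space measure" where
  "hausdorff_measure d = measure_of UNIV (sets borel) (hausdorff_outer d)"

text \<open>
  \<^const>\<open>measure_of\<close> returns the zero measure when its last argument is not countably additive.
  The lemmas up to \<open>emeasure_hausdorff_measure\<close> rule this out (Caratheodory's criterion for metric
  outer measures).
\<close>

definition hausdorff_gauge :: "nat \<Rightarrow> real \<Rightarrow> 'a::metric_space set \<Rightarrow> ennreal" where
  "hausdorff_gauge d \<delta> U = (if bounded U \<and> diameter U \<le> \<delta> then ennreal (diameter U ^ d) else \<infinity>)"

lemma hausdorff_gauge_positive:
  assumes "0 < d" "0 < \<delta>" shows "positive (Pow UNIV) (hausdorff_gauge d \<delta>)"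
  using assms by (auto simp: positive_def hausdorff_gauge_def)

lemma hausdorff_gauge_increasing: "increasing (Pow UNIV) (hausdorff_gauge d \<delta>)"
proof (unfold increasing_def, intro ballI impI)
  fix U V :: "'a set" assume "U \<subseteq> V"
  show "hausdorff_gauge d \<delta> U \<le> hausdorff_gauge d \<delta> V"
  proof (cases "bounded V \<and> diameter V \<le> \<delta>")
    case True
    then have "bounded U" "diameter U \<le> diameter V"
      using \<open>U \<subseteq> V\<close> by (auto intro: bounded_subset diameter_subset)
    moreover have "0 \<le> diameter U" using \<open>bounded U\<close> by (rule diameter_ge_0)
    ultimately show ?thesis
      using True by (auto simp: hausdorff_gauge_def intro!: ennreal_leI power_mono)
  qed (auto simp: hausdorff_gauge_def)
qed

lemma hausdorff_pre_eq_outer_measure: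
  assumes "0 < d" "0 < \<delta>"
  shows "hausdorff_pre d \<delta> = outer_measure (Pow UNIV) (hausdorff_gauge d \<delta>)"
proof
  fix A :: "'a set"
  interpret ring_of_sets "UNIV :: 'a set" "Pow UNIV"
    by (rule ring_of_sets_Pow)
  show "hausdorff_pre d \<delta> A = outer_measure (Pow UNIV) (hausdorff_gauge d \<delta>) A"
  proof (rule antisym)
    show "outer_measure (Pow UNIV) (hausdorff_gauge d \<delta>) A \<le> hausdorff_pre d \<delta> A"
      unfolding hausdorff_pre_def
    proof (intro INF_greatest, clarify)
      fix U :: "nat \<Rightarrow> 'a set"
      assume U: "A \<subseteq> (\<Union>i. U i)" "\<forall>i. bounded (U i) \<and> diameter (U i) \<le> \<delta>"
      have "outer_measure (Pow UNIV) (hausdorff_gauge d \<delta>) A \<le> (\<Sum>i. hausdorff_gauge d \<delta> (U i))"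
        by (rule outer_measure_le[OF hausdorff_gauge_positive[OF assms] hausdorff_gauge_increasing])
          (use U in auto)
      then show "outer_measure (Pow UNIV) (hausdorff_gauge d \<delta>) A \<le> (\<Sum>i. ennreal (diameter (U i) ^ d))"
        using U by (simp add: hausdorff_gauge_def)
    qed
  next
    show "hausdorff_pre d \<delta> A \<le> outer_measure (Pow UNIV) (hausdorff_gauge d \<delta>) A"
      unfolding outer_measure_def
    proof (intro INF_greatest, clarify)
      fix U :: "nat \<Rightarrow> 'a set" assume U: "A \<subseteq> (\<Union>i. U i)"
      show "hausdorff_pre d \<delta> A \<le> (\<Sum>i. hausdorff_gauge d \<delta> (U i))"
      proof (cases "\<forall>i. bounded (U i) \<and> diameter (U i) \<le> \<delta>")
        case True
        then show ?thesis
          unfolding hausdorff_pre_def hausdorff_gauge_def using U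
          by (intro INF_lower2[of U]) auto
      next
        case False
        then obtain i where "hausdorff_gauge d \<delta> (U i) = \<infinity>"
          unfolding hausdorff_gauge_def by (metis (full_types))
        moreover have "hausdorff_gauge d \<delta> (U i) \<le> (\<Sum>i. hausdorff_gauge d \<delta> (U i))"
          using sum_le_suminf[of "\<lambda>i. hausdorff_gauge d \<delta> (U i)" "{i}"] by simp
        ultimately show ?thesis by (simp add: top_unique)
      qed
    qed
  qed
qed

lemma outer_measure_space_hausdorff_outer:
  assumes "0 < d"
  shows "outer_measure_space (Pow UNIV) (hausdorff_outer d :: 'a::metric_space set \<Rightarrow> ennreal)"
proof -
  interpret ring_of_sets "UNIV :: 'a set" "Pow UNIV"
    by (rule ring_of_sets_Pow)
  have *: "outer_measure_space (Pow UNIV) (hausdorff_pre d \<delta> :: 'a set \<Rightarrow> ennreal)" if "0 < \<delta>" for \<delta>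
    unfolding hausdorff_pre_eq_outer_measure[OF assms that]
    by (intro outer_measure_space_outer_measure hausdorff_gauge_positive
        hausdorff_gauge_increasing assms that)
  have 1: "hausdorff_pre d \<delta> ({} :: 'a set) = 0" if "0 < \<delta>" for \<delta>
    using *[OF that] by (simp add: outer_measure_space_def positive_def)
  have 2: "hausdorff_pre d \<delta> A \<le> hausdorff_pre d \<delta> B"
    if "0 < \<delta>" "A \<subseteq> B" for \<delta> and A B :: "'a set"
    using *[OF that(1)] that(2) by (simp add: outer_measure_space_def increasing_def)
  have 3: "hausdorff_pre d \<delta> (\<Union>i. A i) \<le> (\<Sum>i. hausdorff_pre d \<delta> (A i))"
    if "0 < \<delta>" "disjoint_family A" for \<delta> and A :: "nat \<Rightarrow> 'a set"
    using *[OF that(1)] that(2) by (simp add: outer_measure_space_def countably_subadditive_def)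
  show ?thesis
    unfolding outer_measure_space_def
  proof (intro conjI)
    show "positive (Pow UNIV) (hausdorff_outer d :: 'a set \<Rightarrow> ennreal)"
      by (simp add: positive_def hausdorff_outer_def 1 SUP_constant bot_ennreal)
    show "increasing (Pow UNIV) (hausdorff_outer d :: 'a set \<Rightarrow> ennreal)"
      unfolding increasing_def hausdorff_outer_def
      by (intro ballI impI SUP_mono) (use 2 in \<open>auto intro!: bexI\<close>)
    show "countably_subadditive (Pow UNIV) (hausdorff_outer d :: 'a set \<Rightarrow> ennreal)"
      unfolding countably_subadditive_def
    proof (intro allI impI)
      fix A :: "nat \<Rightarrow> 'a set" assume A: "disjoint_family A"
      show "hausdorff_outer d (\<Union>i. A i) \<le> (\<Sum>i. hausdorff_outer d (A i))"
        unfolding hausdorff_outer_def[of d "\<Union>i. A i"]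
      proof (rule SUP_least)
        fix \<delta> :: real assume d: "\<delta> \<in> {0<..}"
        have "hausdorff_pre d \<delta> (\<Union>i. A i) \<le> (\<Sum>i. hausdorff_pre d \<delta> (A i))"
          using 3 A d by simp
        also have "\<dots> \<le> (\<Sum>i. hausdorff_outer d (A i))"
          using d by (intro suminf_le) (auto simp: hausdorff_outer_def intro: SUP_upper)
        finally show "hausdorff_pre d \<delta> (\<Union>i. A i) \<le> (\<Sum>i. hausdorff_outer d (A i))" .
      qed
    qed
  qed
qed

lemma hausdorff_outer_mono:
  "A \<subseteq> B \<Longrightarrow> hausdorff_outer d A \<le> hausdorff_outer d B"
  unfolding hausdorff_outer_def hausdorff_pre_def
  by (intro SUP_mono bexI[rotated] INF_superset_mono) auto

lemma hausdorff_outer_Un_le: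
  assumes "0 < d"
  shows "hausdorff_outer d (A \<union> B) \<le> hausdorff_outer d A + hausdorff_outer d B"
proof -
  interpret sigma_algebra UNIV "Pow (UNIV :: 'a set)" by (rule sigma_algebra_Pow)
  have "subadditive (Pow UNIV) (hausdorff_outer d :: 'a set \<Rightarrow> ennreal)"
    using outer_measure_space_hausdorff_outer[OF assms]
    by (intro countably_subadditive_subadditive) (auto simp: outer_measure_space_def)
  then have "hausdorff_outer d (A \<union> (B - A)) \<le> hausdorff_outer d A + hausdorff_outer d (B - A)"
    by (intro subadditiveD) auto
  also have "\<dots> \<le> hausdorff_outer d A + hausdorff_outer d B"
    by (intro add_left_mono hausdorff_outer_mono) auto
  finally show ?thesis by simp
qed

lemma hausdorff_outer_UN_le:
  fixes A :: "nat \<Rightarrow> 'a::metric_space set"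
  assumes "0 < d"
  shows "hausdorff_outer d (\<Union>i. A i) \<le> (\<Sum>i. hausdorff_outer d (A i))"
proof -
  have "hausdorff_outer d (\<Union>i. disjointed A i) \<le> (\<Sum>i. hausdorff_outer d (disjointed A i))"
    using outer_measure_space_hausdorff_outer[OF assms, where 'a='a]
    unfolding outer_measure_space_def countably_subadditive_def
    by (auto simp: disjoint_family_disjointed)
  also have "\<dots> \<le> (\<Sum>i. hausdorff_outer d (A i))"
    by (intro suminf_le hausdorff_outer_mono disjointed_subset) auto
  finally show ?thesis by (simp add: UN_disjointed_eq)
qed

lemma hausdorff_pre_antimono:
  assumes "\<delta> \<le> \<epsilon>"
  shows "hausdorff_pre d \<epsilon> A \<le> hausdorff_pre d \<delta> A"
  unfolding hausdorff_pre_def using assms by (intro INF_superset_mono) (auto intro: order_trans)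

lemma hausdorff_pre_separated:
  fixes E F :: "'a::metric_space set"
  assumes "0 < d" "0 < \<delta>" "\<delta> < \<epsilon>" "\<And>x y. x \<in> E \<Longrightarrow> y \<in> F \<Longrightarrow> \<epsilon> \<le> dist x y"
  shows "hausdorff_pre d \<delta> E + hausdorff_pre d \<delta> F \<le> hausdorff_pre d \<delta> (E \<union> F)"
  unfolding hausdorff_pre_def[of d \<delta> "E \<union> F"]
proof (intro INF_greatest, clarify)
  fix U :: "nat \<Rightarrow> 'a set"
  assume U: "E \<union> F \<subseteq> (\<Union>i. U i)" "\<forall>i. bounded (U i) \<and> diameter (U i) \<le> \<delta>"
  define V where "V i = (if U i \<inter> E = {} then {} else U i)" for i
  define W where "W i = (if U i \<inter> E = {} then U i else {})" for i
  have "E \<subseteq> (\<Union>i. V i)" using U(1) by (force simp: V_def)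
  moreover have "\<forall>i. bounded (V i) \<and> diameter (V i) \<le> \<delta>" using U(2) assms(2) by (auto simp: V_def)
  ultimately have E: "hausdorff_pre d \<delta> E \<le> (\<Sum>i. ennreal (diameter (V i) ^ d))"
    unfolding hausdorff_pre_def by (intro INF_lower) auto
  have "F \<subseteq> (\<Union>i. W i)"
  proof
    fix y assume "y \<in> F"
    then obtain i where i: "y \<in> U i" using U(1) by auto
    have "U i \<inter> E = {}"
    proof (rule ccontr)
      assume "U i \<inter> E \<noteq> {}"
      then obtain x where x: "x \<in> U i" "x \<in> E" by auto
      have "dist x y \<le> diameter (U i)" using x i U(2) by (auto intro: diameter_bounded_bound)
      then show False using U(2) assms(3) assms(4)[OF x(2) \<open>y \<in> F\<close>]
        by (meson dual_order.trans leD)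
    qed
    then show "y \<in> (\<Union>i. W i)" using i by (auto simp: W_def)
  qed
  moreover have "\<forall>i. bounded (W i) \<and> diameter (W i) \<le> \<delta>" using U(2) assms(2) by (auto simp: W_def)
  ultimately have F: "hausdorff_pre d \<delta> F \<le> (\<Sum>i. ennreal (diameter (W i) ^ d))"
    unfolding hausdorff_pre_def by (intro INF_lower) auto
  have "hausdorff_pre d \<delta> E + hausdorff_pre d \<delta> F
      \<le> (\<Sum>i. ennreal (diameter (V i) ^ d)) + (\<Sum>i. ennreal (diameter (W i) ^ d))"
    by (intro add_mono E F)
  also have "\<dots> = (\<Sum>i. ennreal (diameter (V i) ^ d) + ennreal (diameter (W i) ^ d))"
    by (intro suminf_add) auto
  also have "\<dots> = (\<Sum>i. ennreal (diameter (U i) ^ d))"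
    using assms(1) by (intro suminf_cong) (auto simp: V_def W_def)
  finally show "hausdorff_pre d \<delta> E + hausdorff_pre d \<delta> F \<le> (\<Sum>i. ennreal (diameter (U i) ^ d))" .
qed

lemma hausdorff_outer_separated:
  fixes E F :: "'a::metric_space set"
  assumes "0 < d" "0 < \<epsilon>" "\<And>x y. x \<in> E \<Longrightarrow> y \<in> F \<Longrightarrow> \<epsilon> \<le> dist x y"
  shows "hausdorff_outer d E + hausdorff_outer d F \<le> hausdorff_outer d (E \<union> F)"
proof -
  have "hausdorff_pre d \<delta> E + hausdorff_pre d \<delta>' F \<le> hausdorff_outer d (E \<union> F)"
    if "0 < \<delta>" "0 < \<delta>'" for \<delta> \<delta>'
  proof -
    define \<eta> where "\<eta> = min (min \<delta> \<delta>') (\<epsilon> / 2)"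
    have \<eta>: "0 < \<eta>" "\<eta> < \<epsilon>" "\<eta> \<le> \<delta>" "\<eta> \<le> \<delta>'" using that assms(2) by (auto simp: \<eta>_def)
    have "hausdorff_pre d \<delta> E + hausdorff_pre d \<delta>' F \<le> hausdorff_pre d \<eta> E + hausdorff_pre d \<eta> F"
      by (intro add_mono hausdorff_pre_antimono \<eta>)
    also have "\<dots> \<le> hausdorff_pre d \<eta> (E \<union> F)"
      using hausdorff_pre_separated[OF assms(1) \<eta>(1,2) assms(3)] by simp
    also have "\<dots> \<le> hausdorff_outer d (E \<union> F)"
      unfolding hausdorff_outer_def using \<eta> by (intro SUP_upper) auto
    finally show ?thesis .
  qed
  then show ?thesis
    by (simp add: hausdorff_outer_def[of d E] hausdorff_outer_def[of d F] SUP_le_iff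
        ennreal_SUP_add_left[symmetric] ennreal_SUP_add_right)
qed

lemma hausdorff_outer_shells:
  fixes R :: "nat \<Rightarrow> 'a::metric_space set"
  assumes "0 < d" "\<And>k. R k \<subseteq> A"
    and sep: "\<And>j k. j < k \<Longrightarrow> \<exists>\<epsilon>>0. \<forall>x\<in>R j. \<forall>y\<in>R k. \<epsilon> \<le> dist x y"
  shows "(\<Sum>k. hausdorff_outer d (R k)) \<le> hausdorff_outer d A"
proof (rule suminf_le_const[OF summableI])
  fix N
  have "(\<Sum>k<N. hausdorff_outer d (R k)) \<le> hausdorff_outer d (\<Union>k<N. R k)"
  proof (induction N)
    case 0
    then show ?case by simp
  next
    case (Suc N)
    obtain e where e: "\<And>j. j < N \<Longrightarrow> e j > 0 \<and> (\<forall>x\<in>R j. \<forall>y\<in>R N. e j \<le> dist x y)"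
      using sep[of _ N] by metis
    define \<epsilon> where "\<epsilon> = Min (insert (1::real) (e ` {..<N}))"
    have \<epsilon>: "0 < \<epsilon>" unfolding \<epsilon>_def using e by (subst Min_gr_iff) auto
    have \<epsilon>': "\<epsilon> \<le> dist x y" if xy: "x \<in> (\<Union>k<N. R k)" "y \<in> R N" for x y
    proof -
      obtain j where j: "j < N" "x \<in> R j" using xy by auto
      then have "\<epsilon> \<le> e j" unfolding \<epsilon>_def by (intro Min_le) auto
      then show ?thesis using e[OF j(1)] j xy(2) by force
    qed
    have "(\<Sum>k<Suc N. hausdorff_outer d (R k)) \<le> hausdorff_outer d (\<Union>k<N. R k) + hausdorff_outer d (R N)"
      using Suc by (simp add: add_right_mono)
    also have "\<dots> \<le> hausdorff_outer d ((\<Union>k<N. R k) \<union> R N)"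
      by (rule hausdorff_outer_separated[OF assms(1) \<epsilon> \<epsilon>'])
    finally show ?case by (simp add: lessThan_Suc Un_commute)
  qed
  also have "\<dots> \<le> hausdorff_outer d A" using assms(2) by (intro hausdorff_outer_mono) auto
  finally show "(\<Sum>k<N. hausdorff_outer d (R k)) \<le> hausdorff_outer d A" .
qed

lemma hausdorff_outer_closed:
  fixes C A :: "'a::metric_space set"
  assumes d: "0 < d" and "closed C" "C \<noteq> {}"
  shows "hausdorff_outer d (A \<inter> C) + hausdorff_outer d (A - C) \<le> hausdorff_outer d A"
proof (cases "hausdorff_outer d A = \<infinity>")
  case False
  let ?H = "hausdorff_outer d :: 'a set \<Rightarrow> ennreal"
  define S where "S n = {x\<in>A. 1 / real (Suc n) \<le> infdist x C}" for n
  define R where "R k = {x\<in>A. 1 / real (Suc (Suc k)) \<le> infdist x C \<and> infdist x C < 1 / real (Suc k)}" for k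
  have Rsep: "\<exists>\<epsilon>>0. \<forall>x\<in>R j. \<forall>y\<in>R k. \<epsilon> \<le> dist x y" if "Suc j < k" for j k
  proof (intro exI[of _ "1 / real (Suc (Suc j)) - 1 / real (Suc k)"] conjI ballI)
    show "0 < 1 / real (Suc (Suc j)) - 1 / real (Suc k)"
      using that by (auto intro!: divide_strict_left_mono)
    fix x y assume "x \<in> R j" "y \<in> R k"
    then show "1 / real (Suc (Suc j)) - 1 / real (Suc k) \<le> dist x y"
      using infdist_triangle[of x C y] by (auto simp: R_def)
  qed
  have RA: "R k \<subseteq> A" for k by (auto simp: R_def)
  have half: "(\<Sum>k. ?H (R (2 * k + p))) \<le> ?H A" for p
    by (rule hausdorff_outer_shells[OF d RA]) (rule Rsep, simp)
  have "(\<Sum>k. ?H (R k)) \<le> ?H A + ?H A"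
  proof (rule suminf_le_const[OF summableI])
    fix N
    have "(\<Sum>k<N. ?H (R k)) \<le> (\<Sum>k<2*N. ?H (R k))"
      by (intro sum_mono2) auto
    also have "\<dots> = (\<Sum>k<N. ?H (R (2 * k + 0))) + (\<Sum>k<N. ?H (R (2 * k + 1)))"
      by (induction N) (auto simp: ac_simps)
    also have "\<dots> \<le> (\<Sum>k. ?H (R (2 * k + 0))) + (\<Sum>k. ?H (R (2 * k + 1)))"
      by (intro add_mono sum_le_suminf) auto
    also have "\<dots> \<le> ?H A + ?H A" by (intro add_mono half)
    finally show "(\<Sum>k<N. ?H (R k)) \<le> ?H A + ?H A" .
  qed
  then have fin: "(\<Sum>k. ?H (R k)) < \<infinity>"
    using False by (metis ennreal_add_eq_top infinity_ennreal_def less_top top.not_eq_extremum top_unique)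
  have step: "?H (A \<inter> C) + ?H (A - C) \<le> ?H A + (\<Sum>k. ?H (R (k + n)))" for n
  proof -
    have "A - C \<subseteq> S n \<union> (\<Union>k. R (k + n))"
    proof
      fix x assume x: "x \<in> A - C"
      then have pos: "infdist x C > 0"
        using assms by (intro infdist_pos_not_in_closed) auto
      show "x \<in> S n \<union> (\<Union>k. R (k + n))"
      proof (cases "1 / real (Suc n) \<le> infdist x C")
        case True
        then show ?thesis using x by (auto simp: S_def)
      next
        case False
        let ?P = "\<lambda>m. 1 / real (Suc m) \<le> infdist x C"
        obtain m where "?P m" using reals_Archimedean[OF pos] by (auto simp: inverse_eq_divide intro: less_imp_le)
        define l where "l = (LEAST m. ?P m)"
        have l: "?P l" unfolding l_def by (rule LeastI[of ?P, OF \<open>?P m\<close>])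
        have "n < l"
        proof (rule ccontr)
          assume "\<not> n < l"
          then have "1 / real (Suc n) \<le> 1 / real (Suc l)" by (simp add: frac_le)
          then show False using l False by simp
        qed
        then have "\<not> ?P (l - 1)" unfolding l_def by (intro not_less_Least) (auto simp: l_def[symmetric])
        then have "x \<in> R (l - 1)" using l \<open>n < l\<close> x by (auto simp: R_def)
        then have "x \<in> R ((l - 1 - n) + n)" using \<open>n < l\<close> by simp
        then show ?thesis by blast
      qed
    qed
    then have "?H (A - C) \<le> ?H (S n \<union> (\<Union>k. R (k + n)))" by (rule hausdorff_outer_mono)
    also have "\<dots> \<le> ?H (S n) + ?H (\<Union>k. R (k + n))" by (rule hausdorff_outer_Un_le[OF d])
    also have "\<dots> \<le> ?H (S n) + (\<Sum>k. ?H (R (k + n)))"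
      by (intro add_left_mono hausdorff_outer_UN_le d)
    finally have 1: "?H (A - C) \<le> ?H (S n) + (\<Sum>k. ?H (R (k + n)))" .
    have "?H (A \<inter> C) + ?H (S n) \<le> ?H (A \<inter> C \<union> S n)"
    proof (rule hausdorff_outer_separated[OF d])
      show "0 < 1 / real (Suc n)" by simp
      fix x y assume "x \<in> A \<inter> C" "y \<in> S n"
      then show "1 / real (Suc n) \<le> dist x y"
        using infdist_le[of x C y] by (auto simp: S_def dist_commute)
    qed
    also have "\<dots> \<le> ?H A" by (intro hausdorff_outer_mono) (auto simp: S_def)
    finally have 2: "?H (A \<inter> C) + ?H (S n) \<le> ?H A" .
    have "?H (A \<inter> C) + ?H (A - C) \<le> (?H (A \<inter> C) + ?H (S n)) + (\<Sum>k. ?H (R (k + n)))"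
      using add_left_mono[OF 1, of "?H (A \<inter> C)"] by (simp add: add.assoc)
    also have "\<dots> \<le> ?H A + (\<Sum>k. ?H (R (k + n)))" by (intro add_right_mono 2)
    finally show ?thesis .
  qed
  define T where "T = ?H (A \<inter> C) + ?H (A - C)"
  have "T + (\<Sum>k<n. ?H (R k)) \<le> ?H A + (\<Sum>k. ?H (R k))" for n
    using add_right_mono[OF step[of n], of "\<Sum>k<n. ?H (R k)"]
      suminf_offset[of "\<lambda>k. ?H (R k)" n] by (simp add: T_def add.assoc)
  moreover have "(\<lambda>n. T + (\<Sum>k<n. ?H (R k))) \<longlonglongrightarrow> T + (\<Sum>k. ?H (R k))"
    by (intro tendsto_add tendsto_const summable_LIMSEQ) simp
  ultimately have "T + (\<Sum>k. ?H (R k)) \<le> ?H A + (\<Sum>k. ?H (R k))"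
    by (intro LIMSEQ_le_const2) auto
  then have "(\<Sum>k. ?H (R k)) + T \<le> (\<Sum>k. ?H (R k)) + ?H A" by (simp only: add.commute)
  then show ?thesis using fin unfolding T_def ennreal_add_left_cancel_le by auto
qed simp

lemma measure_space_hausdorff_outer:
  assumes d: "0 < d"
  shows "measure_space (UNIV :: 'a::metric_space set) (sets borel) (hausdorff_outer d)"
proof -
  let ?H = "hausdorff_outer d :: 'a set \<Rightarrow> ennreal"
  interpret P: sigma_algebra UNIV "Pow (UNIV :: 'a set)" by (rule sigma_algebra_Pow)
  define L where "L = lambda_system UNIV (Pow UNIV) ?H"
  have ms: "measure_space UNIV L ?H"
    unfolding L_def by (rule P.caratheodory_lemma[OF outer_measure_space_hausdorff_outer[OF d]])
  then interpret L: sigma_algebra UNIV L by (simp add: measure_space_def)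
  have "C \<in> L" if "closed C" for C
  proof (cases "C = {}")
    case False
    have "?H (A \<inter> C) + ?H (A - C) = ?H A" for A
    proof (rule antisym[OF hausdorff_outer_closed[OF d that False]])
      show "?H A \<le> ?H (A \<inter> C) + ?H (A - C)"
        using hausdorff_outer_Un_le[OF d, of "A \<inter> C" "A - C"] by (simp add: Int_Diff_Un)
    qed
    then show ?thesis unfolding L_def by (simp add: P.lambda_system_eq del: Pow_UNIV)
  qed auto
  then have "sets borel \<subseteq> L"
    unfolding borel_eq_closed by (subst sets_measure_of) (auto intro!: L.sigma_sets_subset)
  then have "positive (sets borel) ?H" "countably_additive (sets borel) ?H"
    using ms by (auto simp: measure_space_def positive_def countably_additive_def)
  then show ?thesis
    using sets.sigma_algebra_axioms[of "borel :: 'a measure"] by (simp add: measure_space_def)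
qed

lemma sets_hausdorff_measure [simp, measurable_cong]:
  "sets (hausdorff_measure d) = sets borel"
  unfolding hausdorff_measure_def
  using sets.sigma_sets_eq[of "borel :: 'a measure"] by simp

lemma emeasure_hausdorff_measure:
  assumes "0 < d" "A \<in> sets borel"
  shows "emeasure (hausdorff_measure d) A = hausdorff_outer d A"
proof -
  have "measure_space UNIV (sigma_sets UNIV (sets borel)) (hausdorff_outer d :: 'a set \<Rightarrow> ennreal)"
    using measure_space_hausdorff_outer[OF assms(1)] sets.sigma_sets_eq[of "borel :: 'a measure"]
    by simp
  then show ?thesis
    unfolding hausdorff_measure_def
    using assms(2) by (intro emeasure_measure_of_sigma[OF _ ])
      (use measure_space_hausdorff_outer[OF assms(1)] in \<open>auto simp: measure_space_def\<close>)
qed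


section \<open>Ahlfors regular and uniformly rectifiable sets\<close>

definition ahlfors_regular :: "nat \<Rightarrow> real \<Rightarrow> 'a::euclidean_space set \<Rightarrow> 'a measure \<Rightarrow> bool" where
  "ahlfors_regular d C \<Gamma> \<sigma> \<longleftrightarrow>
     C > 0 \<and> closed \<Gamma> \<and> sets \<sigma> = sets borel \<and> emeasure \<sigma> (- \<Gamma>) = 0 \<and>
     (\<forall>x\<in>\<Gamma>. \<forall>r>0. ennreal (r ^ d / C) \<le> emeasure \<sigma> (ball x r) \<and>
                    emeasure \<sigma> (ball x r) \<le> ennreal (C * r ^ d))"

definition flat_measures :: "nat \<Rightarrow> 'a::euclidean_space measure set" where
  "flat_measures d =
     {scale_measure (ennreal c) (density (hausdorff_measure d) (indicator P)) | c P.
        c > 0 \<and> affine P \<and> aff_dim P = int d}"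

definition Lip :: "'a::euclidean_space \<Rightarrow> real \<Rightarrow> ('a \<Rightarrow> real) set" where
  "Lip x r = {f. 1-lipschitz_on UNIV f \<and> (\<forall>y. y \<notin> ball x r \<longrightarrow> f y = 0)}"

definition lip_dist ::
    "nat \<Rightarrow> 'a::euclidean_space \<Rightarrow> real \<Rightarrow> 'a measure \<Rightarrow> 'a measure \<Rightarrow> ennreal" where
  "lip_dist d x r \<mu> \<sigma> =
     ennreal (r powr (- real d - 1)) *
     (SUP f\<in>Lip x r. ennreal \<bar>(\<integral>y. f y \<partial>\<sigma>) - (\<integral>y. f y \<partial>\<mu>)\<bar>)"

definition alpha :: "nat \<Rightarrow> 'a::euclidean_space measure \<Rightarrow> 'a \<Rightarrow> real \<Rightarrow> ennreal" where
  "alpha d \<sigma> x r = (INF \<mu>\<in>flat_measures d. lip_dist d x r \<mu> \<sigma>)"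

definition uniformly_rectifiable ::
    "nat \<Rightarrow> real \<Rightarrow> 'a::euclidean_space set \<Rightarrow> 'a measure \<Rightarrow> bool" where
  "uniformly_rectifiable d C \<Gamma> \<sigma> \<longleftrightarrow>
     C \<ge> 0 \<and>
     (\<forall>x\<in>\<Gamma>. \<forall>r>0.
        (\<integral>\<^sup>+ s\<in>{0<..<r}. (\<integral>\<^sup>+ y\<in>\<Gamma> \<inter> ball x r. (alpha d \<sigma> y s)\<^sup>2 \<partial>\<sigma>) * ennreal (1 / s) \<partial>lborel)
          \<le> ennreal C * emeasure \<sigma> (ball x r))"


section \<open>The regularised distance and the Carleson condition\<close>

definition D_fun ::
    "nat \<Rightarrow> 'a::euclidean_space set \<Rightarrow> 'a measure \<Rightarrow> real \<Rightarrow> 'a \<Rightarrow> real" where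
  "D_fun d \<Gamma> \<sigma> \<beta> X = (LINT y:\<Gamma>|\<sigma>. norm (X - y) powr (- real d - \<beta>)) powr (- (1 / \<beta>))"

definition grad :: "('a::real_inner \<Rightarrow> real) \<Rightarrow> 'a \<Rightarrow> 'a" where
  "grad f X = (THE D. GDERIV f X :> D)"

text \<open>
  The first two conjuncts say \<open>f \<in> L\<^sup>\<infinity>(\<Omega>)\<close> for \<open>\<Omega> = - \<Gamma>\<close>. As \<open>f\<close> is a function on \<open>\<Omega>\<close>,
  the integral runs over the part of the ball in \<open>\<Omega>\<close>.
\<close>

definition CM ::
    "nat \<Rightarrow> 'a::euclidean_space set \<Rightarrow> 'a measure \<Rightarrow> real \<Rightarrow> ('a \<Rightarrow> 'b::euclidean_space) \<Rightarrow> bool" where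
  "CM d \<Gamma> \<sigma> C f \<longleftrightarrow>
     f \<in> borel_measurable (lebesgue_on (- \<Gamma>)) \<and>
     (\<exists>K. AE X in lebesgue_on (- \<Gamma>). norm (f X) \<le> K) \<and>
     (\<forall>x\<in>\<Gamma>. \<forall>r>0.
        (\<integral>\<^sup>+ X\<in>ball x r - \<Gamma>.
            ennreal ((norm (f X))\<^sup>2 * infdist X \<Gamma> powr (real d - real DIM('a))) \<partial>lebesgue)
          \<le> ennreal C * emeasure \<sigma> (ball x r))"

end

theory Submission imports Defs begin

text \<open>
  Put \<open>A\<^sub>p(X) = \<integral>|X - y|\<^bsup>-d-p\<^esup> d\<sigma>(y)\<close>, \<open>S\<^sub>p(X) = \<integral>|X - y|\<^bsup>-d-p-2\<^esup> (X - y) d\<sigma>(y)\<close> and \<open>q = n - d - 2\<close>.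
  Then \<open>D\<^sub>\<beta> = A\<^sub>\<beta>\<^bsup>-1/\<beta>\<^esup>\<close>, and \<open>S\<^sub>\<beta>\<close> is a multiple of \<open>\<nabla>A\<^sub>\<beta>\<close>. Take \<open>b\<close> to be a constant times
  \<open>(A\<^bsub>2\<beta>\<^esub> / A\<^sub>\<beta>\<^sup>2)\<^bsup>q/\<beta>-1\<^esup>\<close>, with the constant chosen so that \<open>\<V> = 0\<close> when \<open>\<sigma>\<close> is flat. For flat \<open>\<sigma>\<close> the
  quotient \<open>A\<^bsub>2\<beta>\<^esub> / A\<^sub>\<beta>\<^sup>2\<close>, and hence \<open>b\<close>, is constant; so both \<open>\<V>\<close> and \<open>\<nabla>b\<close> measure the deviation of \<open>\<sigma>\<close>
  from flatness.

  The kernel \<open>|z|\<^bsup>-2a\<^esup>\<close> is a superposition of the bumps \<open>(1 - v|z|\<^sup>2)\<^sup>+\<close>, with density a multiple of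
  \<open>v\<^bsup>a-1\<^esup>\<close>, so \<open>\<sigma>\<close> enters only through the mass and the first moment of the bump at every scale.
  These determine a plane at each scale; Lipschitz test functions bound the error
  and the change of the plane from one scale to the next by \<open>\<alpha>\<close>. Summation over the scales
  gives \<open>|\<V>(X)| + |D\<^sub>\<beta>\<nabla>b(X)| \<le> K \<Sum>\<^sub>j 2\<^bsup>-\<epsilon>j\<^esup> \<alpha>(y, 2\<^sup>j r)\<close> for \<open>y \<in> \<Gamma>\<close> near \<open>X\<close> and \<open>r\<close> comparable with
  \<open>dist(X, \<Gamma>)\<close>. Averaging the square over \<open>y\<close> and Tonelli's theorem reduce the Carleson bounds to
  uniform rectifiability.
\<close>

section \<open>Bumps and flat measures\<close>

text \<open>The vector S_q has to become a multiple of S_\<beta> through a factor that is smooth in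
  X. For a flat measure of density c, at displacement w from the plane, A_p is a constant times c
  |w|^(-p) and S_p a constant times c |w|^(-p-2) w. So S_q is a multiple of |w|^(\<beta>-q)
  S_\<beta>: the density drops out, the distance does not. The quotient A_(2\<beta>) / A_\<beta> is
  free of c and gives |w|^(-\<beta>); this is the origin of the second exponent. The powers of
  A_\<beta> contained in D_\<beta> and its gradient leave A_(2\<beta>) / A_\<beta>^2, which is scale
  invariant, so b is bounded above and below by Ahlfors regularity alone. For d = n - 2 the exponent
  q is 0: A_q diverges but S_q converges, so S_q is estimated directly and not as a gradient. The
  bump is chosen because its integral over a plane is explicit, by Pythagoras and dilation, and
  because its centre of mass in the plane is exactly the foot of the perpendicular from X. Hence
  \<sigma> itself yields a plane at each scale, by dividing moment by mass.\<close>

lemma diameter_dilation_le: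
  fixes p :: "'a::real_normed_vector"
  assumes "bounded U"
  shows "diameter ((\<lambda>y. p + l *\<^sub>R (y - p)) ` U) \<le> \<bar>l\<bar> * diameter U"
proof (cases "U = {}")
  case False
  have "dist (p + l *\<^sub>R (y - p)) (p + l *\<^sub>R (z - p)) \<le> \<bar>l\<bar> * diameter U" if "y \<in> U" "z \<in> U" for y z
  proof -
    have "dist (p + l *\<^sub>R (y - p)) (p + l *\<^sub>R (z - p)) = \<bar>l\<bar> * dist y z"
      by (simp add: dist_norm flip: scaleR_diff_right norm_scaleR)
    also have "\<dots> \<le> \<bar>l\<bar> * diameter U"
      using diameter_bounded_bound[OF assms that] by (intro mult_left_mono) auto
    finally show ?thesis .
  qed
  then show ?thesis using False by (intro diameter_le) (auto simp: dist_norm)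
qed simp

lemma bounded_dilation:
  fixes p :: "'a::real_normed_vector"
  assumes "bounded U"
  shows "bounded ((\<lambda>y. p + l *\<^sub>R (y - p)) ` U)"
proof -
  have "bounded ((\<lambda>x. p + x) ` (\<lambda>x. l *\<^sub>R x) ` (\<lambda>x. - p + x) ` U)"
    by (intro bounded_translation bounded_scaling assms)
  then show ?thesis by (simp add: image_image)
qed

lemma dilation_inverse:
  fixes p :: "'a::real_normed_vector"
  assumes "l \<noteq> 0"
  shows "p + l *\<^sub>R ((p + (1 / l) *\<^sub>R (y - p)) - p) = y" "p + (1 / l) *\<^sub>R ((p + l *\<^sub>R (y - p)) - p) = y"
  using assms by auto

text \<open>A cover of the image pulls back under the inverse dilation to a cover of
  \<open>A\<close> whose diameters are divided by |l|. The reverse inequality is the same statement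
  for the dilation by 1 / l.\<close>

lemma hausdorff_pre_dilation:
  fixes p :: "'a::real_normed_vector"
  assumes l: "l \<noteq> 0"
  shows "ennreal (\<bar>l\<bar> ^ d) * hausdorff_pre d \<delta> A
    \<le> hausdorff_pre d (\<bar>l\<bar> * \<delta>) ((\<lambda>y. p + l *\<^sub>R (y - p)) ` A)"
  unfolding hausdorff_pre_def[of d "\<bar>l\<bar> * \<delta>"]
proof (intro INF_greatest, clarify)
  fix U :: "nat \<Rightarrow> 'a set"
  assume U: "(\<lambda>y. p + l *\<^sub>R (y - p)) ` A \<subseteq> (\<Union>i. U i)" "\<forall>i. bounded (U i) \<and> diameter (U i) \<le> \<bar>l\<bar> * \<delta>"
  define V where "V i = (\<lambda>y. p + (1 / l) *\<^sub>R (y - p)) ` U i" for i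
  have dV: "\<bar>l\<bar> * diameter (V i) \<le> diameter (U i)" for i
    using diameter_dilation_le[of "U i" p "1 / l"] U(2) l by (simp add: V_def field_simps)
  have bV: "bounded (V i)" for i unfolding V_def using U(2) by (intro bounded_dilation) auto
  have "\<bar>l\<bar> * diameter (V i) \<le> \<bar>l\<bar> * \<delta>" for i using dV[of i] U(2) by (meson order_trans)
  then have "diameter (V i) \<le> \<delta>" for i using l by simp
  moreover have "A \<subseteq> (\<Union>i. V i)"
  proof
    fix a assume "a \<in> A"
    then obtain i where "p + l *\<^sub>R (a - p) \<in> U i" using U(1) by auto
    then have "a \<in> V i" unfolding V_def using dilation_inverse(2)[OF l, of p a]
      by (metis (no_types, lifting) image_eqI)
    then show "a \<in> (\<Union>i. V i)" by auto
  qed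
  ultimately have "hausdorff_pre d \<delta> A \<le> (\<Sum>i. ennreal (diameter (V i) ^ d))"
    unfolding hausdorff_pre_def using bV by (intro INF_lower) auto
  then have "ennreal (\<bar>l\<bar> ^ d) * hausdorff_pre d \<delta> A \<le> (\<Sum>i. ennreal (\<bar>l\<bar> ^ d) * ennreal (diameter (V i) ^ d))"
    by (simp add: mult_left_mono)
  also have "\<dots> \<le> (\<Sum>i. ennreal (diameter (U i) ^ d))"
  proof (intro suminf_le summableI)
    fix i
    have "0 \<le> diameter (V i)" using bV by (rule diameter_ge_0)
    then show "ennreal (\<bar>l\<bar> ^ d) * ennreal (diameter (V i) ^ d) \<le> ennreal (diameter (U i) ^ d)"
      using dV[of i] by (auto simp flip: ennreal_mult power_mult_distrib intro!: ennreal_leI power_mono)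
  qed
  finally show "ennreal (\<bar>l\<bar> ^ d) * hausdorff_pre d \<delta> A \<le> (\<Sum>i. ennreal (diameter (U i) ^ d))" .
qed

lemma hausdorff_outer_dilation_le:
  fixes p :: "'a::real_normed_vector"
  assumes l: "l \<noteq> 0"
  shows "ennreal (\<bar>l\<bar> ^ d) * hausdorff_outer d A \<le> hausdorff_outer d ((\<lambda>y. p + l *\<^sub>R (y - p)) ` A)"
proof -
  have "ennreal (\<bar>l\<bar> ^ d) * hausdorff_outer d A = (SUP \<delta>\<in>{0<..}. ennreal (\<bar>l\<bar> ^ d) * hausdorff_pre d \<delta> A)"
    unfolding hausdorff_outer_def by (rule SUP_mult_left_ennreal)
  also have "\<dots> \<le> hausdorff_outer d ((\<lambda>y. p + l *\<^sub>R (y - p)) ` A)"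
    unfolding hausdorff_outer_def
    using l by (intro SUP_least order_trans[OF hausdorff_pre_dilation[OF l, of d _ A p]] SUP_upper) auto
  finally show ?thesis .
qed

lemma hausdorff_outer_dilation:
  fixes p :: "'a::real_normed_vector"
  assumes l: "l \<noteq> 0"
  shows "hausdorff_outer d ((\<lambda>y. p + l *\<^sub>R (y - p)) ` A) = ennreal (\<bar>l\<bar> ^ d) * hausdorff_outer d A"
proof (rule antisym)
  let ?B = "(\<lambda>y. p + l *\<^sub>R (y - p)) ` A"
  have "ennreal (\<bar>1 / l\<bar> ^ d) * hausdorff_outer d ?B \<le> hausdorff_outer d ((\<lambda>y. p + (1 / l) *\<^sub>R (y - p)) ` ?B)"
    using l by (intro hausdorff_outer_dilation_le) auto
  also have "(\<lambda>y. p + (1 / l) *\<^sub>R (y - p)) ` ?B = A"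
    unfolding image_image dilation_inverse[OF l] by simp
  finally have "ennreal (\<bar>l\<bar> ^ d) * (ennreal (\<bar>1 / l\<bar> ^ d) * hausdorff_outer d ?B) \<le> ennreal (\<bar>l\<bar> ^ d) * hausdorff_outer d A"
    by (rule mult_left_mono) simp
  moreover have "ennreal (\<bar>l\<bar> ^ d) * (ennreal (\<bar>1 / l\<bar> ^ d) * hausdorff_outer d ?B) = hausdorff_outer d ?B"
    using l by (simp add: mult.assoc[symmetric] flip: ennreal_mult power_mult_distrib)
  ultimately show "hausdorff_outer d ?B \<le> ennreal (\<bar>l\<bar> ^ d) * hausdorff_outer d A" by simp
qed (rule hausdorff_outer_dilation_le[OF l])

section \<open>Flat measures under dilations\<close>

lemma emeasure_density_indicator:
  assumes "A \<in> sets M" "B \<in> sets M"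
  shows "emeasure (density M (indicator A)) B = emeasure M (A \<inter> B)"
  using assms by (simp add: emeasure_density flip: indicator_inter_arith)

lemma flat_measure_dilation:
  fixes \<mu> :: "'a::euclidean_space measure"
  assumes d: "0 < d" and \<mu>: "\<mu> = scale_measure (ennreal c) (density (hausdorff_measure d) (indicator P))"
    and P: "affine P" "p \<in> P" and l: "l \<noteq> 0"
  shows "distr \<mu> borel (\<lambda>y. p + l *\<^sub>R (y - p)) = scale_measure (ennreal ((1 / \<bar>l\<bar>) ^ d)) \<mu>"
proof (rule measure_eqI)
  let ?\<phi> = "\<lambda>y. p + l *\<^sub>R (y - p)"
  have sets: "sets \<mu> = sets borel" using \<mu> by simp
  have Pb[measurable]: "P \<in> sets borel" using affine_closed[OF P(1)] by auto
  show "sets (distr \<mu> borel ?\<phi>) = sets (scale_measure (ennreal ((1 / \<bar>l\<bar>) ^ d)) \<mu>)"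
    using sets by simp
  have em: "emeasure \<mu> A = ennreal c * hausdorff_outer d (A \<inter> P)" if "A \<in> sets borel" for A
  proof -
    have "emeasure (density (hausdorff_measure d) (indicator P)) A = emeasure (hausdorff_measure d) (P \<inter> A)"
      using that by (intro emeasure_density_indicator) auto
    then show ?thesis using that d unfolding \<mu> by (simp add: emeasure_hausdorff_measure Int_commute)
  qed
  have in_P: "p + k *\<^sub>R (y - p) \<in> P" if "y \<in> P" for k y
    using mem_affine[OF P(1) P(2) that, of "1 - k" k] by (simp add: algebra_simps)
  fix A assume "A \<in> sets (distr \<mu> borel ?\<phi>)"
  then have A[measurable]: "A \<in> sets borel" by simp
  have m: "?\<phi> \<in> borel_measurable borel" by measurable
  have "?\<phi> ` (?\<phi> -` A \<inter> P) = A \<inter> P"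
  proof safe
    fix y assume "y \<in> A" "y \<in> P"
    then show "y \<in> ?\<phi> ` (?\<phi> -` A \<inter> P)"
      using dilation_inverse(1)[OF l, of p y] in_P[of y "1 / l"]
      by (intro image_eqI[of _ _ "p + (1 / l) *\<^sub>R (y - p)"]) auto
  qed (use in_P in auto)
  then have "hausdorff_outer d (A \<inter> P) = ennreal (\<bar>l\<bar> ^ d) * hausdorff_outer d (?\<phi> -` A \<inter> P)"
    using hausdorff_outer_dilation[OF l, of d p "?\<phi> -` A \<inter> P"] by simp
  then have "ennreal ((1 / \<bar>l\<bar>) ^ d) * hausdorff_outer d (A \<inter> P) = hausdorff_outer d (?\<phi> -` A \<inter> P)"
    using l by (simp add: mult.assoc[symmetric] flip: ennreal_mult power_mult_distrib)
  moreover have "?\<phi> -` A \<in> sets borel" using measurable_sets[OF m A] by simp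
  ultimately show "emeasure (distr \<mu> borel ?\<phi>) A = emeasure (scale_measure (ennreal ((1 / \<bar>l\<bar>) ^ d)) \<mu>) A"
    using sets sets_eq_imp_space_eq[OF sets]
    by (simp add: emeasure_distr em mult.left_commute measurable_cong_sets[OF sets refl])
qed

lemma integral_flat_dilation:
  fixes \<mu> :: "'a::euclidean_space measure" and f :: "'a \<Rightarrow> real"
  assumes d: "0 < d" and \<mu>: "\<mu> = scale_measure (ennreal c) (density (hausdorff_measure d) (indicator P))"
    and P: "affine P" "p \<in> P" and l: "l \<noteq> 0" and f[measurable]: "f \<in> borel_measurable borel"
  shows "(\<integral>y. f (p + l *\<^sub>R (y - p)) \<partial>\<mu>) = (1 / \<bar>l\<bar>) ^ d * (\<integral>y. f y \<partial>\<mu>)"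
proof -
  have sets: "sets \<mu> = sets borel" using \<mu> by simp
  have "(\<integral>y. f (p + l *\<^sub>R (y - p)) \<partial>\<mu>) = (\<integral>y. f y \<partial>distr \<mu> borel (\<lambda>y. p + l *\<^sub>R (y - p)))"
    by (subst integral_distr) (auto simp: measurable_cong_sets[OF sets refl])
  also have "\<dots> = (\<integral>y. f y \<partial>scale_measure (ennreal ((1 / \<bar>l\<bar>) ^ d)) \<mu>)"
    by (simp only: flat_measure_dilation[OF d \<mu> P l])
  also have "scale_measure (ennreal ((1 / \<bar>l\<bar>) ^ d)) \<mu> = density \<mu> (\<lambda>_. ennreal ((1 / \<bar>l\<bar>) ^ d))"
    by (rule measure_eqI) (auto simp: emeasure_density nn_integral_cmult)
  also have "(\<integral>y. f y \<partial>density \<mu> (\<lambda>_. ennreal ((1 / \<bar>l\<bar>) ^ d))) = (\<integral>y. (1 / \<bar>l\<bar>) ^ d * f y \<partial>\<mu>)"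
    by (subst integral_density) (auto simp: measurable_cong_sets[OF sets refl])
  finally show ?thesis by simp
qed

section \<open>Mass and first moment of a bump against a flat measure\<close>

definition bump :: "real \<Rightarrow> 'a::real_normed_vector \<Rightarrow> real" where
  "bump v z = max 0 (1 - v * (norm z)\<^sup>2)"

text \<open>Closed form of the integral of \<open>bump v (X - y)\<close> over a plane:
  \<open>w\<close> is X minus its projection onto the plane, \<open>c\<close> the mass of the unit
  bump centred on the plane.\<close>

definition flat_mass :: "nat \<Rightarrow> real \<Rightarrow> 'a::real_normed_vector \<Rightarrow> real \<Rightarrow> real" where
  "flat_mass d c w v = c * v powr (- (real d / 2)) * bump v w powr (1 + real d / 2)"

lemma bump_comp_measurable[measurable (raw)]:
  fixes g :: "'b \<Rightarrow> 'a::euclidean_space"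
  assumes [measurable]: "f \<in> borel_measurable M" "g \<in> borel_measurable M"
  shows "(\<lambda>x. bump (f x) (g x)) \<in> borel_measurable M"
  unfolding bump_def by measurable

lemma bump_nonneg: "0 \<le> bump v z" and bump_le_1: "0 \<le> v \<Longrightarrow> bump v z \<le> 1"
  by (auto simp: bump_def)

text \<open>By Pythagoras the bump around X, restricted to the plane, is a rescaled bump around the
  projection p, and a dilation reduces it to the unit bump. Reflection in p gives the first moment;
  moment divided by mass is \<open>w\<close> at every scale.\<close>

lemma flat_measure_mass:
  fixes \<mu> :: "'a::euclidean_space measure" and X :: 'a
  assumes d: "0 < d" and \<mu>: "\<mu> \<in> flat_measures d"
  obtains c w where "0 \<le> c" "\<And>v. 0 < v \<Longrightarrow> (\<integral>y. bump v (X - y) \<partial>\<mu>) = flat_mass d c w v"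
    "\<And>v e. 0 < v \<Longrightarrow> (\<integral>y. bump v (X - y) * ((X - y) \<bullet> e) \<partial>\<mu>) = flat_mass d c w v * (w \<bullet> e)"
proof -
  obtain k P where \<mu>k: "\<mu> = scale_measure (ennreal k) (density (hausdorff_measure d) (indicator P))"
    and P: "affine P" "aff_dim P = int d"
    using \<mu> unfolding flat_measures_def by auto
  have "P \<noteq> {}" using P(2) by auto
  define p where "p = closest_point P X"
  have pP: "p \<in> P" unfolding p_def using closest_point_in_set affine_closed P \<open>P \<noteq> {}\<close> by blast
  define w where "w = X - p"
  have sets[measurable_cong]: "sets \<mu> = sets borel" using \<mu>k by simp
  have Pb[measurable]: "P \<in> sets borel" using affine_closed[OF P(1)] by auto
  have AEP: "AE y in \<mu>. y \<in> P"
  proof (rule AE_I)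
    show "{y \<in> space \<mu>. y \<notin> P} \<subseteq> - P" by auto
    show "- P \<in> sets \<mu>" by (simp add: sets)
    have "emeasure (density (hausdorff_measure d) (indicator P)) (- P) = emeasure (hausdorff_measure d) (P \<inter> - P)"
      by (intro emeasure_density_indicator) auto
    then show "emeasure \<mu> (- P) = 0" unfolding \<mu>k by simp
  qed
  have orth: "(norm (X - y))\<^sup>2 = (norm w)\<^sup>2 + (norm (y - p))\<^sup>2" if y: "y \<in> P" for y
  proof -
    have c: "convex P" "closed P" using P affine_imp_convex affine_closed by auto
    have 1: "w \<bullet> (y - p) \<le> 0"
      unfolding w_def p_def by (rule closest_point_dot[OF c y])
    \<comment> \<open>The closest point property gives only one sign; the reflected point 2p - y,
      also in the plane, gives the other.\<close>
    have "p + (-1) *\<^sub>R (y - p) \<in> P"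
      using mem_affine[OF P(1) pP y, of 2 "-1"] by (simp add: algebra_simps scaleR_2)
    then have "w \<bullet> ((p + (-1) *\<^sub>R (y - p)) - p) \<le> 0"
      unfolding w_def p_def by (rule closest_point_dot[OF c])
    then have 2: "w \<bullet> (y - p) = 0" using 1 by (simp add: inner_diff_right)
    have "(norm (X - y))\<^sup>2 = (norm (w - (y - p)))\<^sup>2" by (simp add: w_def)
    also have "\<dots> = (norm w)\<^sup>2 + (norm (y - p))\<^sup>2"
      using 2 by (simp add: power2_norm_eq_inner inner_diff_left inner_diff_right inner_commute)
    finally show ?thesis .
  qed
  define c where "c = (\<integral>y. bump 1 (y - p) \<partial>\<mu>)"
  have c0: "0 \<le> c" unfolding c_def by (intro Bochner_Integration.integral_nonneg) (auto simp: bump_nonneg)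
  have mass: "(\<integral>y. bump v (X - y) \<partial>\<mu>) = flat_mass d c w v" if v: "0 < v" for v
  proof (cases "1 \<le> v * (norm w)\<^sup>2")
    case True
    have "(\<integral>y. bump v (X - y) \<partial>\<mu>) = (\<integral>y. 0 \<partial>\<mu>)"
    proof (rule integral_cong_AE)
      show "AE y in \<mu>. bump v (X - y) = 0"
        using AEP
      proof eventually_elim
        case (elim y)
        have "1 \<le> v * (norm (X - y))\<^sup>2" using True v unfolding orth[OF elim] by (simp add: algebra_simps add_increasing2)
        then show ?case by (simp add: bump_def)
      qed
    qed measurable
    then show ?thesis using True by (simp add: flat_mass_def bump_def)
  next
    case False
    \<comment> \<open>With s = 1 - v |w|^2 and l^2 = v / s, Pythagoras turns 1 - v |X - y|^2 into s
      (1 - l^2 |y - p|^2) on the plane.\<close>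
    define s where "s = bump v w"
    have s: "s = 1 - v * (norm w)\<^sup>2" "0 < s" using False by (auto simp: s_def bump_def)
    define l where "l = sqrt (v / s)"
    have l: "l > 0" "l\<^sup>2 = v / s" using v s by (auto simp: l_def)
    have "(\<integral>y. bump v (X - y) \<partial>\<mu>) = (\<integral>y. s * bump 1 ((p + l *\<^sub>R (y - p)) - p) \<partial>\<mu>)"
    proof (rule integral_cong_AE)
      show "AE y in \<mu>. bump v (X - y) = s * bump 1 ((p + l *\<^sub>R (y - p)) - p)"
        using AEP
      proof eventually_elim
        case (elim y)
        have "1 - v * (norm (X - y))\<^sup>2 = s * (1 - l\<^sup>2 * (norm (y - p))\<^sup>2)"
          using s(2) unfolding orth[OF elim] l by (simp add: s(1) field_simps)
        then show ?case using s(2) by (simp add: bump_def power_mult_distrib max_def zero_le_mult_iff)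
      qed
    qed measurable
    also have "\<dots> = s * ((1 / \<bar>l\<bar>) ^ d * c)"
      unfolding c_def using integral_flat_dilation[OF d \<mu>k P(1) pP, of l "\<lambda>y. bump 1 (y - p)"] l by simp
    also have "(1 / \<bar>l\<bar>) ^ d = v powr (- (real d / 2)) * s powr (real d / 2)"
    proof -
      have "(1 / \<bar>l\<bar>) = (s / v) powr (1 / 2)" using l(1) v s(2) by (simp add: l_def real_sqrt_divide powr_half_sqrt)
      then have "(1 / \<bar>l\<bar>) ^ d = (s / v) powr (real d / 2)"
        using v s(2) by (simp add: powr_powr flip: powr_realpow)
      then show ?thesis using v s(2) by (simp add: powr_divide powr_minus field_simps)
    qed
    finally show ?thesis using s(2) by (simp add: flat_mass_def s_def[symmetric] powr_add mult_ac)
  qed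
  \<comment> \<open>The reflection y -> 2p - y preserves the flat measure and, on the plane, |X -
    y|; it replaces X - y by 2w - (X - y). Hence J = 2 (w \<bullet> e) mass - J.\<close>
  have moment: "(\<integral>y. bump v (X - y) * ((X - y) \<bullet> e) \<partial>\<mu>) = flat_mass d c w v * (w \<bullet> e)" if v: "0 < v" for v e
  proof -
    define J where "J = (\<integral>y. bump v (X - y) * ((X - y) \<bullet> e) \<partial>\<mu>)"
    let ?g = "\<lambda>y. bump v (X - (p + (-1) *\<^sub>R (y - p))) * ((X - (p + (-1) *\<^sub>R (y - p))) \<bullet> e)"
    have J2: "J = (\<integral>y. ?g y \<partial>\<mu>)"
      unfolding J_def using integral_flat_dilation[OF d \<mu>k P(1) pP, of "-1" "\<lambda>y. bump v (X - y) * ((X - y) \<bullet> e)"]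
      by simp
    have "(\<integral>y. ?g y \<partial>\<mu>) = (\<integral>y. bump v (X - y) * (2 * (w \<bullet> e) - (X - y) \<bullet> e) \<partial>\<mu>)"
    proof (rule integral_cong_AE)
      show "AE y in \<mu>. ?g y = bump v (X - y) * (2 * (w \<bullet> e) - (X - y) \<bullet> e)"
        using AEP
      proof eventually_elim
        case (elim y)
        have q: "p + (-1) *\<^sub>R (y - p) \<in> P"
          using mem_affine[OF P(1) pP elim, of 2 "-1"] by (simp add: algebra_simps scaleR_2)
        have "(norm (X - (p + (-1) *\<^sub>R (y - p))))\<^sup>2 = (norm (X - y))\<^sup>2"
          using orth[OF q] orth[OF elim] by (simp add: norm_minus_commute)
        then show ?case by (simp add: bump_def w_def inner_diff_left inner_add_left algebra_simps)
      qed
    qed measurable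
    then have J3: "J = (\<integral>y. bump v (X - y) * (2 * (w \<bullet> e) - (X - y) \<bullet> e) \<partial>\<mu>)" using J2 by simp
    have "(\<integral>y. bump v (X - y) \<partial>\<mu>) * (w \<bullet> e) = J"
    proof (cases "integrable \<mu> (\<lambda>y. bump v (X - y))")
      case True
      have int: "integrable \<mu> (\<lambda>y. bump v (X - y) * ((X - y) \<bullet> e))"
      proof (rule Bochner_Integration.integrable_bound)
        show "integrable \<mu> (\<lambda>y. (norm e / sqrt v) * bump v (X - y))" using True by simp
        show "AE y in \<mu>. norm (bump v (X - y) * ((X - y) \<bullet> e)) \<le> norm ((norm e / sqrt v) * bump v (X - y))"
        proof (rule AE_I2)
          fix y
          show "norm (bump v (X - y) * ((X - y) \<bullet> e)) \<le> norm ((norm e / sqrt v) * bump v (X - y))"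
          proof (cases "1 \<le> v * (norm (X - y))\<^sup>2")
            case False
            then have "(sqrt v * norm (X - y))\<^sup>2 \<le> 1\<^sup>2" using v by (simp add: power_mult_distrib)
            then have "sqrt v * norm (X - y) \<le> 1" by (rule power2_le_imp_le) simp
            then have "norm (X - y) \<le> 1 / sqrt v" using v by (simp add: field_simps)
            then have "norm (X - y) * norm e \<le> norm e / sqrt v"
              using mult_right_mono[of "norm (X - y)" "1 / sqrt v" "norm e"] by simp
            then have "\<bar>(X - y) \<bullet> e\<bar> \<le> norm e / sqrt v"
              using Cauchy_Schwarz_ineq2[of "X - y" e] by linarith
            from mult_left_mono[OF this bump_nonneg[of v "X - y"]] show ?thesis
              using bump_nonneg[of v "X - y"] v by (simp add: abs_mult mult.commute)
          qed (simp add: bump_def)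
        qed
      qed measurable
      have "J = (\<integral>y. 2 * (w \<bullet> e) * bump v (X - y) - bump v (X - y) * ((X - y) \<bullet> e) \<partial>\<mu>)"
        unfolding J3 by (intro Bochner_Integration.integral_cong) (auto simp: algebra_simps)
      also have "\<dots> = 2 * (w \<bullet> e) * (\<integral>y. bump v (X - y) \<partial>\<mu>) - J"
        unfolding J_def using True int by (subst Bochner_Integration.integral_diff) auto
      finally show ?thesis by simp
    next
      \<comment> \<open>The Bochner integral of the bump is now 0 by convention, so it remains to
        see that J vanishes too.\<close>
      case False
      have m0: "(\<integral>y. bump v (X - y) \<partial>\<mu>) = 0" using False by (rule not_integrable_integral_eq)
      show ?thesis
      proof (cases "integrable \<mu> (\<lambda>y. bump v (X - y) * ((X - y) \<bullet> e))")
        case True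
        \<comment> \<open>The moment integrand and its reflection are both integrable, and their sum
          is 2 (w \<bullet> e) times the non-integrable bump.\<close>
        have "w \<bullet> e = 0"
        proof (rule ccontr)
          assume we: "w \<bullet> e \<noteq> 0"
          have "integrable \<mu> ?g"
          proof -
            have "integrable (distr \<mu> borel (\<lambda>y. p + (-1) *\<^sub>R (y - p))) (\<lambda>y. bump v (X - y) * ((X - y) \<bullet> e))"
              using flat_measure_dilation[OF d \<mu>k P(1) pP, of "-1"] True by simp
            then show ?thesis by (subst (asm) integrable_distr_eq) auto
          qed
          then have "integrable \<mu> (\<lambda>y. bump v (X - y) * (2 * (w \<bullet> e) - (X - y) \<bullet> e))"
          proof (rule integrable_cong_AE_imp)
            show "AE y in \<mu>. ?g y = bump v (X - y) * (2 * (w \<bullet> e) - (X - y) \<bullet> e)"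
              using AEP
            proof eventually_elim
              case (elim y)
              have q: "p + (-1) *\<^sub>R (y - p) \<in> P"
                using mem_affine[OF P(1) pP elim, of 2 "-1"] by (simp add: algebra_simps scaleR_2)
              have "(norm (X - (p + (-1) *\<^sub>R (y - p))))\<^sup>2 = (norm (X - y))\<^sup>2"
                using orth[OF q] orth[OF elim] by (simp add: norm_minus_commute)
              then show ?case by (simp add: bump_def w_def inner_diff_left inner_add_left algebra_simps)
            qed
          qed measurable
          from Bochner_Integration.integrable_add[OF this True]
          have "integrable \<mu> (\<lambda>y. 2 * (w \<bullet> e) * bump v (X - y))" by (simp add: algebra_simps)
          then show False using we False by simp
        qed
        then have "J = (\<integral>y. - (bump v (X - y) * ((X - y) \<bullet> e)) \<partial>\<mu>)"
          by (subst J3) simp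
        then have "J = - J" by (simp add: J_def)
        then show ?thesis using m0 by simp
      next
        case False
        then show ?thesis using m0 by (simp add: J_def not_integrable_integral_eq)
      qed
    qed
    then show ?thesis unfolding mass[OF v] J_def by simp
  qed
  show ?thesis by (rule that[OF c0 mass moment])
qed

section \<open>Riesz potentials of Ahlfors regular measures\<close>

text \<open>The substitution t = v \<omega>. It serves twice: s = 2 writes a power of |z| as a
  superposition of bumps, and s = 2 + d / 2 integrates \<open>flat_mass\<close> over all v.\<close>

lemma nn_integral_Beta_kernel:
  fixes a s \<omega> :: real
  assumes a: "0 < a" and s: "0 < s" and w: "0 < \<omega>"
  shows "(\<integral>\<^sup>+v. ennreal (indicator {0<..} v * v powr (a - 1) * max 0 (1 - v * \<omega>) powr (s - 1)) \<partial>lborel)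
    = ennreal (\<omega> powr (- a) * Beta a s)"
proof -
  let ?f = "\<lambda>t::real. indicator {0..1} t * (t powr (a - 1) * (1 - t) powr (s - 1))"
  have B0: "0 \<le> Beta a s"
    by (rule has_integral_nonneg[OF has_integral_Beta_real[OF a s]]) auto
  have "ennreal (Beta a s) = (\<integral>\<^sup>+t. ennreal (?f t) \<partial>lborel)"
    using nn_integral_has_integral_lebesgue[OF _ has_integral_Beta_real[OF a s]] by (simp add: mult.commute)
  also have "\<dots> = ennreal \<bar>\<omega>\<bar> * (\<integral>\<^sup>+v. ennreal (?f (0 + \<omega> * v)) \<partial>lborel)"
    by (rule nn_integral_real_affine) (use w in auto)
  also have "(\<lambda>v. ?f (0 + \<omega> * v)) = (\<lambda>v. \<omega> powr (a - 1) *
      (indicator {0<..} v * v powr (a - 1) * max 0 (1 - v * \<omega>) powr (s - 1)))"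
  proof
    fix v
    consider "v \<le> 0" | "0 < v" "v * \<omega> < 1" | "0 < v" "1 \<le> v * \<omega>" by linarith
    then show "?f (0 + \<omega> * v) = \<omega> powr (a - 1) *
      (indicator {0<..} v * v powr (a - 1) * max 0 (1 - v * \<omega>) powr (s - 1))"
      using w by cases (auto simp: indicator_def powr_mult mult.commute zero_le_mult_iff)
  qed
  also have "ennreal \<bar>\<omega>\<bar> * (\<integral>\<^sup>+v. ennreal (\<omega> powr (a - 1) *
      (indicator {0<..} v * v powr (a - 1) * max 0 (1 - v * \<omega>) powr (s - 1))) \<partial>lborel)
    = ennreal (\<omega> powr a) * (\<integral>\<^sup>+v. ennreal (indicator {0<..} v * v powr (a - 1) * max 0 (1 - v * \<omega>) powr (s - 1)) \<partial>lborel)"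
  proof -
    have "\<omega> * \<omega> powr (a - 1) = \<omega> powr a" using w by (simp add: powr_diff)
    then show ?thesis using w
      by (subst ennreal_mult', simp, subst nn_integral_cmult, simp)
        (simp add: mult.assoc[symmetric] flip: ennreal_mult)
  qed
  finally have *: "ennreal (Beta a s) = ennreal (\<omega> powr a) * (\<integral>\<^sup>+v. ennreal (indicator {0<..} v * v powr (a - 1) * max 0 (1 - v * \<omega>) powr (s - 1)) \<partial>lborel)" .
  have "ennreal (\<omega> powr (- a) * Beta a s) = ennreal (\<omega> powr (- a)) * ennreal (Beta a s)"
    using B0 by (simp add: ennreal_mult)
  also have "\<dots> = ennreal (\<omega> powr (-a) * \<omega> powr a) * (\<integral>\<^sup>+v. ennreal (indicator {0<..} v * v powr (a - 1) * max 0 (1 - v * \<omega>) powr (s - 1)) \<partial>lborel)"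
    unfolding * by (simp add: mult.assoc ennreal_mult)
  also have "\<omega> powr (-a) * \<omega> powr a = 1" using w by (simp flip: powr_add)
  finally show ?thesis by simp
qed

lemma Beta_pos: "0 < a \<Longrightarrow> 0 < b \<Longrightarrow> 0 < Beta a (b::real)"
  by (simp add: Beta_def Gamma_real_pos)

lemma nn_integral_bump_kernel:
  fixes z :: "'a::euclidean_space"
  assumes "0 < a" "z \<noteq> 0"
  shows "(\<integral>\<^sup>+v. ennreal (indicator {0<..} v * v powr (a - 1) * bump v z) \<partial>lborel)
    = ennreal (norm z powr (- (2 * a)) * Beta a 2)"
proof -
  have "(norm z)\<^sup>2 powr (- a) = norm z powr (- (2 * a))"
    using assms(2) by (simp add: powr_powr flip: powr_numeral)
  then show ?thesis
    using nn_integral_Beta_kernel[OF assms(1), of 2 "(norm z)\<^sup>2"] assms(2)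
    by (simp add: bump_def)
qed

lemma nn_integral_powr_0:
  fixes c q :: real
  assumes "0 < q" "0 \<le> c"
  shows "(\<integral>\<^sup>+v. ennreal (indicator {0<..<c} v * v powr (q - 1)) \<partial>lborel) = ennreal (c powr q / q)"
proof -
  have "((\<lambda>x. x powr (q - 1)) has_integral (c powr (q - 1 + 1) / (q - 1 + 1))) {0..c}"
    using assms by (intro has_integral_powr_from_0) auto
  then have "((\<lambda>x. x powr (q - 1)) has_integral (c powr q / q)) {0<..<c}"
    by (simp add: has_integral_Icc_iff_Ioo)
  from nn_integral_has_integral_lebesgue[OF _ this] show ?thesis
    by (simp add: mult.commute)
qed

section \<open>Balls and bumps in an Ahlfors regular set\<close>

text \<open>The empty set is excluded because \<open>infdist\<close> to it is 0 by convention; it is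
  treated separately at the end.\<close>

locale ahlfors =
  fixes d :: nat and C :: real and \<Gamma> :: "'a::euclidean_space set" and \<sigma> :: "'a measure"
  assumes regular: "ahlfors_regular d C \<Gamma> \<sigma>" and d_pos: "0 < d" and nonempty: "\<Gamma> \<noteq> {}"
begin

lemma C_pos: "0 < C" and closed_\<Gamma>: "closed \<Gamma>" and sets_\<sigma>[measurable_cong]: "sets \<sigma> = sets borel"
  using regular by (auto simp: ahlfors_regular_def)

lemma space_\<sigma>[simp]: "space \<sigma> = UNIV"
  using sets_eq_imp_space_eq[OF sets_\<sigma>] by simp

lemma \<Gamma>_measurable[measurable]: "\<Gamma> \<in> sets borel"
  using closed_\<Gamma> by auto

lemma AE_in_\<Gamma>: "AE y in \<sigma>. y \<in> \<Gamma>"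
  using regular \<Gamma>_measurable by (intro AE_I[of _ _ "- \<Gamma>"]) (auto simp: ahlfors_regular_def sets_\<sigma>)

lemma infdist_pos: "X \<notin> \<Gamma> \<Longrightarrow> 0 < infdist X \<Gamma>"
  using closed_\<Gamma> nonempty by (rule infdist_pos_not_in_closed)

lemma nearest: obtains y where "y \<in> \<Gamma>" "dist X y = infdist X \<Gamma>"
  using infdist_attains_inf[OF closed_\<Gamma> nonempty, of X] by metis

lemma AE_ge_infdist: "AE y in \<sigma>. infdist X \<Gamma> \<le> norm (X - y)"
  using AE_in_\<Gamma> by eventually_elim (metis infdist_le dist_norm)

lemma emeasure_ball_ge: "y \<in> \<Gamma> \<Longrightarrow> 0 < t \<Longrightarrow> ennreal (t ^ d / C) \<le> emeasure \<sigma> (ball y t)"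
  using regular by (auto simp: ahlfors_regular_def)

lemma emeasure_ball_le_center: "y \<in> \<Gamma> \<Longrightarrow> 0 < t \<Longrightarrow> emeasure \<sigma> (ball y t) \<le> ennreal (C * t ^ d)"
  using regular by (auto simp: ahlfors_regular_def)

text \<open>The centre is arbitrary here: a ball that meets \<Gamma> lies in a ball of twice the
  radius centred on \<Gamma>, and any other ball is a null set.\<close>

lemma emeasure_ball_le:
  assumes t: "0 < t"
  shows "emeasure \<sigma> (ball X t) \<le> ennreal (C * 2 ^ d * t ^ d)"
proof (cases "ball X t \<inter> \<Gamma> = {}")
  case True
  then have "emeasure \<sigma> (ball X t) \<le> emeasure \<sigma> (- \<Gamma>)"
    by (intro emeasure_mono) (auto simp: sets_\<sigma>)
  also have "\<dots> = 0" using regular by (simp add: ahlfors_regular_def)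
  finally show ?thesis by simp
next
  case False
  then obtain x where x: "x \<in> \<Gamma>" "dist X x < t" by auto
  have "ball X t \<subseteq> ball x (2 * t)"
  proof
    fix z assume "z \<in> ball X t"
    then show "z \<in> ball x (2 * t)" using x(2) dist_triangle[of x z X] by (simp add: dist_commute)
  qed
  then have "emeasure \<sigma> (ball X t) \<le> emeasure \<sigma> (ball x (2 * t))"
    by (intro emeasure_mono) (auto simp: sets_\<sigma>)
  also have "\<dots> \<le> ennreal (C * (2 * t) ^ d)" using x(1) t by (intro emeasure_ball_le_center) auto
  finally show ?thesis by (simp add: power_mult_distrib mult.assoc)
qed

sublocale sigma_finite_measure \<sigma>
proof
  show "\<exists>A. countable A \<and> A \<subseteq> sets \<sigma> \<and> \<Union> A = space \<sigma> \<and> (\<forall>a\<in>A. emeasure \<sigma> a \<noteq> \<infinity>)"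
  proof (intro exI[of _ "range (\<lambda>n. ball 0 (real n + 1))"] conjI ballI)
    show "\<Union> (range (\<lambda>n. ball (0::'a) (real n + 1))) = space \<sigma>"
    proof -
      have "\<exists>n. norm x < real n + 1" for x :: 'a
        using reals_Archimedean2[of "norm x"] by (metis less_add_one order.strict_trans)
      then show ?thesis by auto
    qed
    fix A :: "'a set" assume "A \<in> range (\<lambda>n. ball 0 (real n + 1))"
    then obtain n where "A = ball 0 (real n + 1)" by auto
    then show "emeasure \<sigma> A \<noteq> \<infinity>" using emeasure_ball_le[of "real n + 1" 0]
      by (metis ennreal_neq_top infinity_ennreal_def neq_top_trans of_nat_0_le_iff add_nonneg_pos zero_less_one)
  qed (auto simp: sets_\<sigma>)
qed

lemma bump_eq_0:
  assumes "0 < v" "1 / sqrt v \<le> norm z"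
  shows "bump v z = 0"
proof -
  have "1 \<le> sqrt v * norm z" using assms by (simp add: field_simps)
  then have "1\<^sup>2 \<le> (sqrt v * norm z)\<^sup>2" by (intro power_mono) auto
  then show ?thesis using assms(1) by (simp add: bump_def power_mult_distrib)
qed

lemma nn_integral_bump_le:
  assumes v: "0 < v"
  shows "(\<integral>\<^sup>+y. ennreal (bump v (X - y)) \<partial>\<sigma>) \<le> ennreal (C * 2 ^ d * v powr (- (real d / 2)))"
proof -
  have "(\<integral>\<^sup>+y. ennreal (bump v (X - y)) \<partial>\<sigma>) \<le> (\<integral>\<^sup>+y. indicator (ball X (1 / sqrt v)) y \<partial>\<sigma>)"
  proof (intro nn_integral_mono)
    fix y
    show "ennreal (bump v (X - y)) \<le> indicator (ball X (1 / sqrt v)) y"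
      using bump_eq_0[OF v, of "X - y"] bump_le_1[of v "X - y"] v
      by (cases "y \<in> ball X (1 / sqrt v)") (auto simp: dist_norm)
  qed
  also have "\<dots> = emeasure \<sigma> (ball X (1 / sqrt v))" by (simp add: sets_\<sigma>)
  also have "\<dots> \<le> ennreal (C * 2 ^ d * (1 / sqrt v) ^ d)" using v by (intro emeasure_ball_le) auto
  also have "(1 / sqrt v) ^ d = v powr (- (real d / 2))"
  proof -
    have "1 / sqrt v = v powr (- (1 / 2))" using v by (simp add: powr_minus_divide powr_half_sqrt)
    then show ?thesis using v by (simp add: powr_powr flip: powr_realpow)
  qed
  finally show ?thesis .
qed

lemma integrable_bump: "0 < v \<Longrightarrow> integrable \<sigma> (\<lambda>y. bump v (X - y))"
  by (intro integrableI_bounded)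
    (auto simp: bump_nonneg intro: le_less_trans[OF nn_integral_bump_le])

text \<open>The bump with parameter v lives in |z| < v^(-1/2), so for v \<ge> dist(X, \<Gamma>)^(-2)
  it does not reach \<Gamma>. This cuts the integrals over v off at a finite bound.\<close>

lemma AE_bump_eq_0:
  assumes "X \<notin> \<Gamma>" "1 / (infdist X \<Gamma>)\<^sup>2 \<le> v"
  shows "AE y in \<sigma>. bump v (X - y) = 0"
  using AE_ge_infdist[of X]
proof eventually_elim
  case (elim y)
  have r: "0 < infdist X \<Gamma>" by (rule infdist_pos[OF assms(1)])
  have "1 / (norm (X - y))\<^sup>2 \<le> 1 / (infdist X \<Gamma>)\<^sup>2"
    using r elim by (intro divide_left_mono power_mono mult_pos_pos) auto
  then have "1 / (norm (X - y))\<^sup>2 \<le> v" using assms(2) by simp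
  moreover have "0 < (norm (X - y))\<^sup>2" using r elim by (intro zero_less_power) linarith
  ultimately have "1 \<le> v * (norm (X - y))\<^sup>2" by (simp only: pos_divide_le_eq)
  then show ?case by (simp add: bump_def)
qed

section \<open>Size of the Riesz potentials\<close>

text \<open>Obtained by integrating the bound C 2^d v^(-d/2) for the bump mass against v^(a/2-1) up
  to v = dist(X, \<Gamma>)^(-2) and dividing by the Beta factor of the superposition.\<close>

definition riesz_bound :: "real \<Rightarrow> real" where
  "riesz_bound a = C * 2 ^ d * 2 / (a - real d) / Beta (a / 2) 2"

lemma riesz_bound_pos: "real d < a \<Longrightarrow> 0 < riesz_bound a"
  using C_pos by (auto simp: riesz_bound_def intro!: divide_pos_pos mult_pos_pos Beta_pos)

lemma AE_ne: "X \<notin> \<Gamma> \<Longrightarrow> AE y in \<sigma>. X - y \<noteq> 0"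
  using AE_in_\<Gamma> by eventually_elim auto

text \<open>Tonelli applied to the superposition of bumps. The weight \<open>h = 1\<close> gives the
  size of the scalar potentials; the norm of \<open>g\<close> as weight gives the integrability for
  Fubini in the vector case.\<close>

lemma kernel_swap:
  fixes h :: "'a \<Rightarrow> real"
  assumes X: "X \<notin> \<Gamma>" and a: "0 < a" and [measurable]: "h \<in> borel_measurable borel" and h: "\<And>y. 0 \<le> h y"
  shows "(\<integral>\<^sup>+v. \<integral>\<^sup>+y. ennreal (indicator {0<..} v * v powr (a - 1) * bump v (X - y) * h y) \<partial>\<sigma> \<partial>lborel)
    = ennreal (Beta a 2) * (\<integral>\<^sup>+y. ennreal (norm (X - y) powr (- (2 * a)) * h y) \<partial>\<sigma>)"
proof -
  interpret L: sigma_finite_measure "lborel :: real measure" by (rule sigma_finite_lborel)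
  interpret pair_sigma_finite "lborel :: real measure" \<sigma> ..
  have [measurable]: "(\<lambda>(v, y). ennreal (indicator {0<..} v * v powr (a - 1) * bump v (X - y) * h y))
      \<in> borel_measurable (lborel \<Otimes>\<^sub>M \<sigma>)"
    unfolding bump_def by measurable
  have "(\<integral>\<^sup>+v. \<integral>\<^sup>+y. ennreal (indicator {0<..} v * v powr (a - 1) * bump v (X - y) * h y) \<partial>\<sigma> \<partial>lborel)
     = (\<integral>\<^sup>+y. \<integral>\<^sup>+v. ennreal (indicator {0<..} v * v powr (a - 1) * bump v (X - y) * h y) \<partial>lborel \<partial>\<sigma>)"
    using Fubini[of "\<lambda>(v, y). ennreal (indicator {0<..} v * v powr (a - 1) * bump v (X - y) * h y)"] by simp
  also have "\<dots> = (\<integral>\<^sup>+y. ennreal (Beta a 2) * ennreal (norm (X - y) powr (- (2 * a)) * h y) \<partial>\<sigma>)"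
  proof (rule nn_integral_cong_AE)
    show "AE y in \<sigma>. (\<integral>\<^sup>+v. ennreal (indicator {0<..} v * v powr (a - 1) * bump v (X - y) * h y) \<partial>lborel)
        = ennreal (Beta a 2) * ennreal (norm (X - y) powr (- (2 * a)) * h y)"
      using AE_ne[OF X]
    proof eventually_elim
      case (elim y)
      have "(\<integral>\<^sup>+v. ennreal (indicator {0<..} v * v powr (a - 1) * bump v (X - y) * h y) \<partial>lborel)
         = (\<integral>\<^sup>+v. ennreal (indicator {0<..} v * v powr (a - 1) * bump v (X - y)) * ennreal (h y) \<partial>lborel)"
        using h bump_nonneg[of _ "X - y"] by (simp add: ennreal_mult)
      also have "\<dots> = (\<integral>\<^sup>+v. ennreal (indicator {0<..} v * v powr (a - 1) * bump v (X - y)) \<partial>lborel) * ennreal (h y)"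
        by (rule nn_integral_multc) (simp add: bump_def)
      also have "\<dots> = ennreal (Beta a 2) * ennreal (norm (X - y) powr (- (2 * a)) * h y)"
        unfolding nn_integral_bump_kernel[OF a elim]
        using h[of y] Beta_pos[OF a, of 2] by (simp add: mult_ac flip: ennreal_mult)
      finally show ?case .
    qed
  qed
  also have "\<dots> = ennreal (Beta a 2) * (\<integral>\<^sup>+y. ennreal (norm (X - y) powr (- (2 * a)) * h y) \<partial>\<sigma>)"
    by (intro nn_integral_cmult) measurable
  finally show ?thesis .
qed

lemma nn_integral_riesz_le:
  assumes X: "X \<notin> \<Gamma>" and a: "real d < a"
  shows "(\<integral>\<^sup>+y. ennreal (norm (X - y) powr (- a)) \<partial>\<sigma>) \<le> ennreal (riesz_bound a * infdist X \<Gamma> powr (real d - a))"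
proof -
  let ?r = "infdist X \<Gamma>"
  have r: "0 < ?r" by (rule infdist_pos[OF X])
  have a2: "0 < a / 2" using a by simp
  have B: "0 < Beta (a / 2) 2" using a2 by (rule Beta_pos) simp
  have "ennreal (Beta (a / 2) 2) * (\<integral>\<^sup>+y. ennreal (norm (X - y) powr (- a)) \<partial>\<sigma>)
    = (\<integral>\<^sup>+v. \<integral>\<^sup>+y. ennreal (indicator {0<..} v * v powr (a / 2 - 1) * bump v (X - y)) \<partial>\<sigma> \<partial>lborel)"
    using kernel_swap[OF X a2, of "\<lambda>_. 1"] by simp
  also have "\<dots> \<le> (\<integral>\<^sup>+v. ennreal (C * 2 ^ d) * ennreal (indicator {0<..<1 / ?r\<^sup>2} v * v powr ((a - real d) / 2 - 1)) \<partial>lborel)"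
  proof (intro nn_integral_mono)
    fix v :: real
    consider "v \<le> 0" | "0 < v" "v < 1 / ?r\<^sup>2" | "0 < v" "1 / ?r\<^sup>2 \<le> v" by linarith
    then show "(\<integral>\<^sup>+y. ennreal (indicator {0<..} v * v powr (a / 2 - 1) * bump v (X - y)) \<partial>\<sigma>)
      \<le> ennreal (C * 2 ^ d) * ennreal (indicator {0<..<1 / ?r\<^sup>2} v * v powr ((a - real d) / 2 - 1))"
    proof cases
      case 2
      have "(\<integral>\<^sup>+y. ennreal (indicator {0<..} v * v powr (a / 2 - 1) * bump v (X - y)) \<partial>\<sigma>)
         = ennreal (v powr (a / 2 - 1)) * (\<integral>\<^sup>+y. ennreal (bump v (X - y)) \<partial>\<sigma>)"
        using 2 by (simp add: ennreal_mult' nn_integral_cmult)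
      also have "\<dots> \<le> ennreal (v powr (a / 2 - 1)) * ennreal (C * 2 ^ d * v powr (- (real d / 2)))"
        by (intro mult_left_mono nn_integral_bump_le 2) auto
      also have "\<dots> = ennreal (C * 2 ^ d) * ennreal (v powr ((a - real d) / 2 - 1))"
      proof -
        have "(a - real d) / 2 - 1 = (a / 2 - 1) + (- (real d / 2))" by (simp add: field_simps)
        then have "v powr (a / 2 - 1) * v powr (- (real d / 2)) = v powr ((a - real d) / 2 - 1)"
          by (simp only: powr_add)
        then show ?thesis using C_pos by (simp add: mult_ac flip: ennreal_mult)
      qed
      finally show ?thesis using 2 by simp
    next
      case 3
      have "(\<integral>\<^sup>+y. ennreal (indicator {0<..} v * v powr (a / 2 - 1) * bump v (X - y)) \<partial>\<sigma>) = 0"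
        using AE_bump_eq_0[OF X 3(2)] by (subst nn_integral_0_iff_AE) auto
      then show ?thesis by simp
    qed simp
  qed
  also have "\<dots> = ennreal (C * 2 ^ d) * ennreal ((1 / ?r\<^sup>2) powr ((a - real d) / 2) / ((a - real d) / 2))"
    using a by (subst nn_integral_cmult) (simp_all add: nn_integral_powr_0)
  also have "(1 / ?r\<^sup>2) powr ((a - real d) / 2) = ?r powr (real d - a)"
  proof -
    have "1 / ?r\<^sup>2 = ?r powr (-2)" using r by (simp add: powr_minus_divide)
    moreover have "- 2 * ((a - real d) / 2) = real d - a" by simp
    ultimately show ?thesis by (simp only: powr_powr)
  qed
  also have "ennreal (C * 2 ^ d) * ennreal (?r powr (real d - a) / ((a - real d) / 2))
    = ennreal (Beta (a / 2) 2) * ennreal (riesz_bound a * ?r powr (real d - a))"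
    using C_pos B a by (simp add: riesz_bound_def field_simps flip: ennreal_mult)
  finally show ?thesis
    using B by (subst (asm) ennreal_mult_le_mult_iff) auto
qed

lemma
  assumes X: "X \<notin> \<Gamma>" and a: "real d < a"
  shows riesz_integrable: "integrable \<sigma> (\<lambda>y. norm (X - y) powr (- a))"
    and riesz_le: "(\<integral>y. norm (X - y) powr (- a) \<partial>\<sigma>) \<le> riesz_bound a * infdist X \<Gamma> powr (real d - a)"
proof -
  show *: "integrable \<sigma> (\<lambda>y. norm (X - y) powr (- a))"
    by (intro integrableI_bounded) (auto intro: le_less_trans[OF nn_integral_riesz_le[OF X a]])
  have "ennreal (\<integral>y. norm (X - y) powr (- a) \<partial>\<sigma>) \<le> ennreal (riesz_bound a * infdist X \<Gamma> powr (real d - a))"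
    using nn_integral_riesz_le[OF X a] by (subst (asm) nn_integral_eq_integral[OF *]) auto
  then show "(\<integral>y. norm (X - y) powr (- a) \<partial>\<sigma>) \<le> riesz_bound a * infdist X \<Gamma> powr (real d - a)"
    using riesz_bound_pos[OF a] by (subst (asm) ennreal_le_iff) auto
qed

text \<open>The ball of radius r = dist(X, \<Gamma>) around a nearest point already suffices: there
  |X - y| \<le> 2r, and its mass is at least r^d / C.\<close>

lemma riesz_ge:
  assumes X: "X \<notin> \<Gamma>" and a: "real d < a"
  shows "2 powr (- a) / C * infdist X \<Gamma> powr (real d - a) \<le> (\<integral>y. norm (X - y) powr (- a) \<partial>\<sigma>)"
proof -
  let ?r = "infdist X \<Gamma>"
  have r: "0 < ?r" by (rule infdist_pos[OF X])
  obtain y0 where y0: "y0 \<in> \<Gamma>" "dist X y0 = ?r" by (rule nearest)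
  have fin: "emeasure \<sigma> (ball y0 ?r) < \<infinity>"
    using emeasure_ball_le[OF r, of y0] by (simp add: le_less_trans)
  have "ennreal (?r ^ d / C) \<le> emeasure \<sigma> (ball y0 ?r)" using emeasure_ball_ge[OF y0(1) r] .
  then have m: "?r ^ d / C \<le> measure \<sigma> (ball y0 ?r)"
    using fin by (simp add: emeasure_eq_ennreal_measure ennreal_le_iff)
  have "2 powr (- a) / C * ?r powr (real d - a) = (2 * ?r) powr (- a) * (?r ^ d / C)"
    using r by (simp add: powr_diff powr_minus powr_mult powr_realpow field_simps)
  also have "\<dots> \<le> (2 * ?r) powr (- a) * measure \<sigma> (ball y0 ?r)"
    by (intro mult_left_mono m) auto
  also have "\<dots> = (\<integral>y. indicator (ball y0 ?r) y * (2 * ?r) powr (- a) \<partial>\<sigma>)"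
    using fin by (simp add: sets_\<sigma>)
  also have "\<dots> \<le> (\<integral>y. norm (X - y) powr (- a) \<partial>\<sigma>)"
  proof (rule integral_mono_AE)
    show "integrable \<sigma> (\<lambda>y. indicator (ball y0 ?r) y * (2 * ?r) powr (- a))"
      using fin by (intro integrable_mult_left integrable_real_indicator) (auto simp: sets_\<sigma>)
    show "integrable \<sigma> (\<lambda>y. norm (X - y) powr (- a))" by (rule riesz_integrable[OF X a])
    show "AE y in \<sigma>. indicator (ball y0 ?r) y * (2 * ?r) powr (- a) \<le> norm (X - y) powr (- a)"
      using AE_ne[OF X]
    proof eventually_elim
      case (elim y)
      show ?case
      proof (cases "y \<in> ball y0 ?r")
        case True
        have "norm (X - y) \<le> 2 * ?r"
          using True y0(2) dist_triangle[of X y y0] by (simp add: dist_norm)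
        then have "(2 * ?r) powr (- a) \<le> norm (X - y) powr (- a)"
          using elim a by (intro powr_mono2') auto
        then show ?thesis using True by simp
      qed simp
    qed
  qed
  finally show ?thesis .
qed

text \<open>\<open>j\<close> is the growth of the numerator: 0 for the scalar potentials, 1 for the
  factor X - y. The vector potentials therefore converge in a larger range of exponents.\<close>

lemma riesz_vector_integrable:
  fixes g :: "'a \<Rightarrow> 'b::{banach, second_countable_topology}"
  assumes X: "X \<notin> \<Gamma>" and a: "real d < a - j" and [measurable]: "g \<in> borel_measurable borel"
    and g: "\<And>y. X \<noteq> y \<Longrightarrow> norm (g y) \<le> norm (X - y) powr j"
  shows "integrable \<sigma> (\<lambda>y. norm (X - y) powr (- a) *\<^sub>R g y)"
    and "norm (\<integral>y. norm (X - y) powr (- a) *\<^sub>R g y \<partial>\<sigma>) \<le> riesz_bound (a - j) * infdist X \<Gamma> powr (real d - (a - j))"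
proof -
  have le: "norm (norm (X - y) powr (- a) *\<^sub>R g y) \<le> norm (X - y) powr (- (a - j))" for y
    using mult_left_mono[OF g[of y], of "norm (X - y) powr (- a)"]
    by (cases "X = y") (simp_all flip: powr_add add: algebra_simps)
  show *: "integrable \<sigma> (\<lambda>y. norm (X - y) powr (- a) *\<^sub>R g y)"
    by (rule Bochner_Integration.integrable_bound[OF riesz_integrable[OF X a]]) (use le in auto)
  have "norm (\<integral>y. norm (X - y) powr (- a) *\<^sub>R g y \<partial>\<sigma>) \<le> (\<integral>y. norm (X - y) powr (- (a - j)) \<partial>\<sigma>)"
    by (intro order_trans[OF integral_norm_bound] integral_mono integrable_norm *
        riesz_integrable[OF X a] le)
  also have "\<dots> \<le> riesz_bound (a - j) * infdist X \<Gamma> powr (real d - (a - j))"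
    by (rule riesz_le[OF X a])
  finally show "norm (\<integral>y. norm (X - y) powr (- a) *\<^sub>R g y \<partial>\<sigma>) \<le> riesz_bound (a - j) * infdist X \<Gamma> powr (real d - (a - j))" .
qed

text \<open>\<open>kernel_swap\<close> for the norm of \<open>g\<close> supplies absolute
  integrability on the product; then Fubini applies.\<close>

lemma riesz_representation:
  fixes g :: "'a \<Rightarrow> 'b::{banach, second_countable_topology}"
  assumes X: "X \<notin> \<Gamma>" and a: "0 < a" "real d < 2 * a - j" and [measurable]: "g \<in> borel_measurable borel"
    and g: "\<And>y. X \<noteq> y \<Longrightarrow> norm (g y) \<le> norm (X - y) powr j"
  shows "integrable lborel (\<lambda>v. (indicator {0<..} v * v powr (a - 1)) *\<^sub>R (\<integral>y. bump v (X - y) *\<^sub>R g y \<partial>\<sigma>))"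
    and "(\<integral>v. (indicator {0<..} v * v powr (a - 1)) *\<^sub>R (\<integral>y. bump v (X - y) *\<^sub>R g y \<partial>\<sigma>) \<partial>lborel)
      = Beta a 2 *\<^sub>R (\<integral>y. norm (X - y) powr (- (2 * a)) *\<^sub>R g y \<partial>\<sigma>)"
proof -
  note fst = nn_integral_fst
  interpret L: sigma_finite_measure "lborel :: real measure" by (rule sigma_finite_lborel)
  interpret pair_sigma_finite "lborel :: real measure" \<sigma> ..
  let ?f = "\<lambda>v y. (indicator {0<..} v * v powr (a - 1)) *\<^sub>R (bump v (X - y) *\<^sub>R g y)"
  have [measurable]: "(\<lambda>(v, y). ?f v y) \<in> borel_measurable (lborel \<Otimes>\<^sub>M \<sigma>)"
    unfolding bump_def by measurable
  have B: "0 < Beta a 2" using a(1) by (rule Beta_pos) simp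
  have "(\<integral>\<^sup>+v. \<integral>\<^sup>+y. ennreal (norm (?f v y)) \<partial>\<sigma> \<partial>lborel)
     = (\<integral>\<^sup>+v. \<integral>\<^sup>+y. ennreal (indicator {0<..} v * v powr (a - 1) * bump v (X - y) * norm (g y)) \<partial>\<sigma> \<partial>lborel)"
    using bump_nonneg[of _ "X - _"] by (simp add: mult_ac)
  also have "\<dots> = ennreal (Beta a 2) * (\<integral>\<^sup>+y. ennreal (norm (X - y) powr (- (2 * a)) * norm (g y)) \<partial>\<sigma>)"
    by (rule kernel_swap[OF X a(1)]) auto
  also have "\<dots> < \<infinity>"
  proof -
    have "integrable \<sigma> (\<lambda>y. norm (X - y) powr (- (2 * a)) *\<^sub>R g y)"
      by (rule riesz_vector_integrable(1)[OF X, where j = j]) (use a(2) g in auto)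
    then have "(\<integral>\<^sup>+y. ennreal (norm (X - y) powr (- (2 * a)) * norm (g y)) \<partial>\<sigma>) < \<infinity>"
      unfolding integrable_iff_bounded by simp
    then show ?thesis by (simp add: ennreal_mult_less_top)
  qed
  finally have fin: "(\<integral>\<^sup>+v. \<integral>\<^sup>+y. ennreal (norm (?f v y)) \<partial>\<sigma> \<partial>lborel) < \<infinity>" .
  have int: "integrable (lborel \<Otimes>\<^sub>M \<sigma>) (\<lambda>(v, y). ?f v y)"
  proof (rule integrableI_bounded)
    have "(\<integral>\<^sup>+p. ennreal (norm (?f (fst p) (snd p))) \<partial>(lborel \<Otimes>\<^sub>M \<sigma>)) < \<infinity>"
      using fin fst[of "\<lambda>p. ennreal (norm (?f (fst p) (snd p)))" lborel]
      by (simp del: norm_scaleR)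
    then show "(\<integral>\<^sup>+p. ennreal (norm (case p of (v, y) \<Rightarrow> ?f v y)) \<partial>(lborel \<Otimes>\<^sub>M \<sigma>)) < \<infinity>"
      by (simp only: case_prod_unfold)
  qed measurable
  have eq: "(\<integral>y. ?f v y \<partial>\<sigma>) = (indicator {0<..} v * v powr (a - 1)) *\<^sub>R (\<integral>y. bump v (X - y) *\<^sub>R g y \<partial>\<sigma>)" for v
    by (rule integral_scaleR_right)
  show "integrable lborel (\<lambda>v. (indicator {0<..} v * v powr (a - 1)) *\<^sub>R (\<integral>y. bump v (X - y) *\<^sub>R g y \<partial>\<sigma>))"
    using integrable_fst[OF int] unfolding eq .
  have "(\<integral>v. (\<integral>y. ?f v y \<partial>\<sigma>) \<partial>lborel) = (\<integral>y. (\<integral>v. ?f v y \<partial>lborel) \<partial>\<sigma>)"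
    by (rule Fubini_integral[OF int, symmetric])
  also have "\<dots> = (\<integral>y. Beta a 2 *\<^sub>R norm (X - y) powr (- (2 * a)) *\<^sub>R g y \<partial>\<sigma>)"
  proof (rule integral_cong_AE)
    show "AE y in \<sigma>. (\<integral>v. ?f v y \<partial>lborel) = Beta a 2 *\<^sub>R norm (X - y) powr (- (2 * a)) *\<^sub>R g y"
      using AE_ne[OF X]
    proof eventually_elim
      case (elim y)
      have "(\<integral>v. indicator {0<..} v * v powr (a - 1) * bump v (X - y) \<partial>lborel) = norm (X - y) powr (- (2 * a)) * Beta a 2"
        using nn_integral_bump_kernel[OF a(1) elim] B bump_nonneg[of _ "X - y"]
        by (intro integral_eq_nn_integral[THEN trans]) (auto simp: bump_def)
      moreover have "integrable lborel (\<lambda>v. indicator {0<..} v * v powr (a - 1) * bump v (X - y))"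
        using nn_integral_bump_kernel[OF a(1) elim] bump_nonneg[of _ "X - y"]
        by (intro integrableI_nonneg) (auto simp: bump_def)
      moreover have "(\<integral>v. ?f v y \<partial>lborel) = (\<integral>v. (indicator {0<..} v * v powr (a - 1) * bump v (X - y)) *\<^sub>R g y \<partial>lborel)"
        by simp
      ultimately have "(\<integral>v. ?f v y \<partial>lborel) = (norm (X - y) powr (- (2 * a)) * Beta a 2) *\<^sub>R g y"
        by (simp only: integral_scaleR_left)
      then show ?case by (simp add: mult.commute)
    qed
  qed measurable
  also have "\<dots> = Beta a 2 *\<^sub>R (\<integral>y. norm (X - y) powr (- (2 * a)) *\<^sub>R g y \<partial>\<sigma>)"
    by (rule integral_scaleR_right)
  finally show "(\<integral>v. (indicator {0<..} v * v powr (a - 1)) *\<^sub>R (\<integral>y. bump v (X - y) *\<^sub>R g y \<partial>\<sigma>) \<partial>lborel)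
      = Beta a 2 *\<^sub>R (\<integral>y. norm (X - y) powr (- (2 * a)) *\<^sub>R g y \<partial>\<sigma>)"
    unfolding eq .
qed

end

section \<open>Approximation by the potentials of a plane\<close>

lemma integral_powr_0:
  fixes c q :: real
  assumes "0 < q" "0 \<le> c"
  shows "integrable lborel (\<lambda>v. indicator {0<..<c} v * v powr (q - 1))"
    and "(\<integral>v. indicator {0<..<c} v * v powr (q - 1) \<partial>lborel) = c powr q / q"
  using nn_integral_powr_0[OF assms] assms
  by (auto intro!: integrableI_nonneg integral_eq_nn_integral[THEN trans])

text \<open>In the scale t = v^(-1/2) the factor (v r^2)^(-\<epsilon>/2) is (t/r)^\<epsilon>: the
  error may grow slowly with the scale, and the integral near v = 0 still converges since \<epsilon>
  < q. The cut at 4 / r^2 is the scale t = r / 2, up to which neither \<sigma> nor a plane at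
  distance at least r / 2 from X is seen.\<close>

lemma norm_weighted_integral_diff_le:
  fixes N N0 :: "real \<Rightarrow> 'b::{banach, second_countable_topology}"
  assumes int: "integrable lborel (\<lambda>v. (indicator {0<..} v * v powr (a - 1)) *\<^sub>R N v)"
      "integrable lborel (\<lambda>v. (indicator {0<..} v * v powr (a - 1)) *\<^sub>R N0 v)"
    and r: "0 < r" and q: "a - b = q / 2" "\<epsilon> < q" and E: "0 \<le> E"
    and le: "\<And>v. 0 < v \<Longrightarrow> v < 4 / r\<^sup>2 \<Longrightarrow> norm (N v - N0 v) \<le> E * v powr (- b) * (v * r\<^sup>2) powr (- (\<epsilon> / 2))"
    and eq: "\<And>v. 4 / r\<^sup>2 \<le> v \<Longrightarrow> N v = N0 v"
  shows "norm ((\<integral>v. (indicator {0<..} v * v powr (a - 1)) *\<^sub>R N v \<partial>lborel)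
      - (\<integral>v. (indicator {0<..} v * v powr (a - 1)) *\<^sub>R N0 v \<partial>lborel))
    \<le> E * (2 powr (q - \<epsilon>) * 2 / (q - \<epsilon>)) * r powr (- q)"
proof -
  let ?k = "\<lambda>v::real. indicator {0<..} v * v powr (a - 1)"
  let ?g = "\<lambda>v. indicator {0<..<4 / r\<^sup>2} v * v powr ((q - \<epsilon>) / 2 - 1)"
  have r2: "(r\<^sup>2) powr s = r powr (2 * s)" for s using r by (simp add: powr_powr flip: powr_numeral)
  have q': "0 < (q - \<epsilon>) / 2" using q by simp
  have "norm ((\<integral>v. ?k v *\<^sub>R N v \<partial>lborel) - (\<integral>v. ?k v *\<^sub>R N0 v \<partial>lborel))
     = norm (\<integral>v. ?k v *\<^sub>R N v - ?k v *\<^sub>R N0 v \<partial>lborel)"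
    using int by (subst Bochner_Integration.integral_diff) auto
  also have "\<dots> \<le> (\<integral>v. (E * r powr (- \<epsilon>)) * ?g v \<partial>lborel)"
  proof (rule Bochner_Integration.integral_norm_bound_integral)
    show "integrable lborel (\<lambda>v. ?k v *\<^sub>R N v - ?k v *\<^sub>R N0 v)"
      using int by (rule Bochner_Integration.integrable_diff)
    show "integrable lborel (\<lambda>v. (E * r powr (- \<epsilon>)) * ?g v)"
      using r by (intro integrable_mult_right integral_powr_0 q') auto
    fix v :: real
    consider "v \<le> 0" | "0 < v" "v < 4 / r\<^sup>2" | "4 / r\<^sup>2 \<le> v" by linarith
    then show "norm (?k v *\<^sub>R N v - ?k v *\<^sub>R N0 v) \<le> (E * r powr (- \<epsilon>)) * ?g v"
    proof cases
      case 2
      have "norm (?k v *\<^sub>R N v - ?k v *\<^sub>R N0 v) = v powr (a - 1) * norm (N v - N0 v)"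
        using 2 by (simp flip: scaleR_diff_right)
      also have "\<dots> \<le> v powr (a - 1) * (E * v powr (- b) * (v * r\<^sup>2) powr (- (\<epsilon> / 2)))"
        using le[OF 2] by (intro mult_left_mono) auto
      also have "\<dots> = (E * r powr (- \<epsilon>)) * (v powr (a - 1) * v powr (- b) * v powr (- (\<epsilon> / 2)))"
        using 2 r by (simp add: powr_mult r2)
      also have "v powr (a - 1) * v powr (- b) * v powr (- (\<epsilon> / 2)) = v powr ((a - 1) + (- b) + (- (\<epsilon> / 2)))"
        by (simp only: powr_add)
      also have "(a - 1) + (- b) + (- (\<epsilon> / 2)) = (q - \<epsilon>) / 2 - 1" using q(1) by (simp add: field_simps)
      finally show ?thesis using 2 by simp
    qed (use r E eq[of v] in auto)
  qed
  also have "\<dots> = E * r powr (- \<epsilon>) * ((4 / r\<^sup>2) powr ((q - \<epsilon>) / 2) / ((q - \<epsilon>) / 2))"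
    using r by (subst integral_mult_right_zero, subst integral_powr_0(2)[OF q']) auto
  also have "(4 / r\<^sup>2) powr ((q - \<epsilon>) / 2) = 2 powr (q - \<epsilon>) * r powr (- (q - \<epsilon>))"
  proof -
    have "4 / r\<^sup>2 = (2 / r) powr 2" using r by (simp add: power_divide)
    moreover have "2 * ((q - \<epsilon>) / 2) = q - \<epsilon>" by simp
    ultimately have "(4 / r\<^sup>2) powr ((q - \<epsilon>) / 2) = (2 / r) powr (q - \<epsilon>)" by (simp only: powr_powr)
    then show ?thesis using r by (simp add: powr_divide powr_diff)
  qed
  also have "E * r powr (- \<epsilon>) * (2 powr (q - \<epsilon>) * r powr (- (q - \<epsilon>)) / ((q - \<epsilon>) / 2))
    = E * (2 powr (q - \<epsilon>) * 2 / (q - \<epsilon>)) * (r powr (- \<epsilon>) * r powr (- (q - \<epsilon>)))" by (simp add: field_simps)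
  also have "r powr (- \<epsilon>) * r powr (- (q - \<epsilon>)) = r powr (- q)" by (simp flip: powr_add)
  finally show ?thesis .
qed

lemma flat_mass_integral:
  fixes w :: "'a::euclidean_space"
  assumes p: "0 < p" and w: "w \<noteq> 0" and c: "0 \<le> c"
  shows "integrable lborel (\<lambda>v. (indicator {0<..} v * v powr ((real d + p) / 2 - 1)) * flat_mass d c w v)"
    and "(\<integral>v. (indicator {0<..} v * v powr ((real d + p) / 2 - 1)) * flat_mass d c w v \<partial>lborel)
      = c * Beta (p / 2) (2 + real d / 2) * norm w powr (- p)"
proof -
  let ?f = "\<lambda>v. indicator {0<..} v * v powr (p / 2 - 1) * max 0 (1 - v * (norm w)\<^sup>2) powr ((2 + real d / 2) - 1)"
  have eq: "(indicator {0<..} v * v powr ((real d + p) / 2 - 1)) * flat_mass d c w v = c * ?f v" for v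
  proof (cases "0 < v")
    case True
    have "v powr ((real d + p) / 2 - 1) * v powr (- (real d / 2)) = v powr (((real d + p) / 2 - 1) + (- (real d / 2)))"
      by (simp only: powr_add)
    also have "((real d + p) / 2 - 1) + (- (real d / 2)) = p / 2 - 1" by (simp add: field_simps)
    finally show ?thesis using True by (simp add: flat_mass_def bump_def mult_ac)
  qed simp
  have nw: "((norm w)\<^sup>2) powr (- (p / 2)) = norm w powr (- p)"
    using w by (simp add: powr_powr flip: powr_numeral)
  have B: "0 < Beta (p / 2) (2 + real d / 2)" using p by (intro Beta_pos) auto
  have nn: "(\<integral>\<^sup>+v. ennreal (?f v) \<partial>lborel) = ennreal (norm w powr (- p) * Beta (p / 2) (2 + real d / 2))"
    using nn_integral_Beta_kernel[of "p / 2" "2 + real d / 2" "(norm w)\<^sup>2"] p w nw by simp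
  have int: "integrable lborel ?f"
    using nn by (intro integrableI_nonneg) auto
  moreover have "(\<integral>v. ?f v \<partial>lborel) = norm w powr (- p) * Beta (p / 2) (2 + real d / 2)"
    using nn B by (intro integral_eq_nn_integral[THEN trans]) auto
  ultimately show "integrable lborel (\<lambda>v. (indicator {0<..} v * v powr ((real d + p) / 2 - 1)) * flat_mass d c w v)"
    "(\<integral>v. (indicator {0<..} v * v powr ((real d + p) / 2 - 1)) * flat_mass d c w v \<partial>lborel)
      = c * Beta (p / 2) (2 + real d / 2) * norm w powr (- p)"
    unfolding eq by (simp_all only: integrable_mult_right integral_mult_right_zero mult_ac)
qed

section \<open>The potentials and their values for flat measures\<close>

definition riesz :: "nat \<Rightarrow> 'a::euclidean_space measure \<Rightarrow> real \<Rightarrow> 'a \<Rightarrow> real" where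
  "riesz d \<sigma> p X = (\<integral>y. norm (X - y) powr (- (real d + p)) \<partial>\<sigma>)"

definition riesz_vec :: "nat \<Rightarrow> 'a::euclidean_space measure \<Rightarrow> real \<Rightarrow> 'a \<Rightarrow> 'a" where
  "riesz_vec d \<sigma> p X = (\<integral>y. norm (X - y) powr (- (real d + p + 2)) *\<^sub>R (X - y) \<partial>\<sigma>)"

text \<open>The ratio of the two Beta factors: a flat measure with parameters c, w has A_p equal to
  c |w|^(-p) times this constant.\<close>

definition riesz_const :: "nat \<Rightarrow> real \<Rightarrow> real" where
  "riesz_const d p = Beta (p / 2) (2 + real d / 2) / Beta ((real d + p) / 2) 2"

lemma riesz_const_pos: "0 < p \<Longrightarrow> 0 < riesz_const d p"
  unfolding riesz_const_def by (intro divide_pos_pos Beta_pos) auto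

text \<open>Two ways to differentiate the potential of a plane agree: the gradient of A_p is -(d +
  p) S_p, and for A_p = c k_p |w|^(-p) it is -p c k_p |w|^(-p-2) w. Formally this is the recursion
  of the Beta function in numerator and denominator.\<close>

lemma riesz_const_rec:
  assumes p: "0 < p"
  shows "(real d + p) * riesz_const d (p + 2) = p * riesz_const d p"
proof -
  have "0 < real d + p" using p by (simp add: add_nonneg_pos)
  then have "0 < (real d + p) / 2" by simp
  moreover from this have "0 < (real d + p) / 2 + 1" by linarith
  ultimately have dp: "0 < (real d + p) / 2" "0 < (real d + p) / 2 + 1" .
  have 1: "(p / 2 + (2 + real d / 2)) * Beta (p / 2 + 1) (2 + real d / 2) = p / 2 * Beta (p / 2) (2 + real d / 2)"
    using p by (intro Beta_plus1_left) (auto dest: nonpos_Ints_nonpos)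
  have 2: "((real d + p) / 2 + 2) * Beta ((real d + p) / 2 + 1) 2 = (real d + p) / 2 * Beta ((real d + p) / 2) 2"
    using dp by (intro Beta_plus1_left) (auto dest: nonpos_Ints_nonpos)
  define B1 where "B1 = Beta (p / 2) (2 + real d / 2)"
  define B2 where "B2 = Beta ((real d + p) / 2) 2"
  define B3 where "B3 = Beta (p / 2 + 1) (2 + real d / 2)"
  define B4 where "B4 = Beta ((real d + p) / 2 + 1) 2"
  have pos: "0 < B2" "0 < B4" unfolding B2_def B4_def using dp by (auto intro!: Beta_pos)
  have "(p + 2) / 2 = p / 2 + 1" "(real d + (p + 2)) / 2 = (real d + p) / 2 + 1" by (simp_all add: field_simps)
  then have r1: "riesz_const d (p + 2) = B3 / B4" unfolding riesz_const_def B3_def B4_def by (simp only:)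
  have r2: "riesz_const d p = B1 / B2" unfolding riesz_const_def B1_def B2_def by simp
  define k where "k = real d + p + 4"
  have k: "k * B3 = p * B1" "k * B4 = (real d + p) * B2"
    using 1 2 unfolding B1_def B2_def B3_def B4_def k_def by (simp_all add: field_simps)
  have "k * ((real d + p) * B3 * B2) = (k * B3) * ((real d + p) * B2)" by (simp only: mult_ac)
  also have "\<dots> = k * (p * B1 * B4)" unfolding k(1) k(2)[symmetric] by (simp only: mult_ac)
  finally have e: "(real d + p) * B3 * B2 = p * B1 * B4" using p unfolding k_def by simp
  have "(real d + p) * (B3 / B4) = ((real d + p) * B3 * B2) / (B4 * B2)" using pos by simp
  also have "\<dots> = p * (B1 / B2)" unfolding e using pos by simp
  finally show ?thesis unfolding r1 r2 .
qed

text \<open>Taylor's formula along the segment from z to z + h. The condition on h keeps |z + t h|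
  \<ge> |z| / 2, so the second derivative is dominated by |z|^(-a-2), a kernel that is integrable
  over \<Gamma>.\<close>

lemma norm_powr_taylor:
  fixes z h :: "'a::real_inner"
  assumes a: "0 < a" and z: "z \<noteq> 0" and h: "norm h \<le> norm z / 2"
  shows "\<bar>norm (z + h) powr (- a) - norm z powr (- a) + a * norm z powr (- a - 2) * (z \<bullet> h)\<bar>
    \<le> a * (a + 3) * 2 powr (a + 2) * norm z powr (- a - 2) * (norm h)\<^sup>2"
proof -
  define s where "s = a / 2"
  define q where "q t = (norm z)\<^sup>2 + 2 * t * (z \<bullet> h) + t\<^sup>2 * (norm h)\<^sup>2" for t
  define q' where "q' t = 2 * (z \<bullet> h) + 2 * t * (norm h)\<^sup>2" for t
  have q: "q t = (norm (z + t *\<^sub>R h))\<^sup>2" for t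
    unfolding q_def by (simp only: power2_norm_eq_inner) (simp add: inner_add_left inner_add_right inner_commute power2_eq_square)
  have lower: "norm z / 2 \<le> norm (z + t *\<^sub>R h)" if "0 \<le> t" "t \<le> 1" for t
  proof -
    have "norm (t *\<^sub>R h) \<le> norm h" using that mult_left_le_one_le[of "norm h" t] by simp
    then show ?thesis using h norm_diff_ineq[of z "t *\<^sub>R h"] by linarith
  qed
  have pos: "0 < q t" if "0 \<le> t" "t \<le> 1" for t
    using lower[OF that] z unfolding q by (intro zero_less_power) (smt (verit) zero_less_norm_iff half_gt_zero)
  \<comment> \<open>\<open>D m\<close> for m \<le> 2 is the m-th derivative of t -> |z + t h|^(-a),
    written through the quadratic polynomial q.\<close>
  define D where "D m t = (if m = 0 then q t powr (- s) else if m = Suc 0 then - s * q t powr (- s - 1) * q' t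
     else s * (s + 1) * q t powr (- s - 2) * (q' t)\<^sup>2 - s * q t powr (- s - 1) * (2 * (norm h)\<^sup>2))" for m :: nat and t
  have dq: "(q has_real_derivative q' t) (at t)" for t
    unfolding q_def[abs_def] q'_def by (auto intro!: derivative_eq_intros)
  have dq': "(q' has_real_derivative 2 * (norm h)\<^sup>2) (at t)" for t
    unfolding q'_def[abs_def] by (auto intro!: derivative_eq_intros)
  have deriv: "\<forall>m t. m < 2 \<and> 0 \<le> t \<and> t \<le> 1 \<longrightarrow> (D m has_real_derivative D (Suc m) t) (at t)"
  proof (intro allI impI)
    fix m :: nat and t :: real assume m: "m < 2 \<and> 0 \<le> t \<and> t \<le> 1"
    then have qt: "0 < q t" using pos by auto
    have dp: "((\<lambda>t. q t powr k) has_real_derivative k * q t powr (k - 1) * q' t) (at t)" for k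
      using has_real_derivative_powr[OF qt, of k] dq[of t] by (rule DERIV_chain2)
    consider "m = 0" | "m = Suc 0" using m by linarith
    then show "(D m has_real_derivative D (Suc m) t) (at t)"
    proof cases
      case 1
      then show ?thesis unfolding D_def[abs_def] using dp[of "- s"] by simp
    next
      case 2
      have "((\<lambda>t. - s * q t powr (- s - 1) * q' t) has_real_derivative
        (- s * ((- s - 1) * q t powr (- s - 1 - 1) * q' t)) * q' t + 2 * (norm h)\<^sup>2 * (- s * q t powr (- s - 1))) (at t)"
        by (intro DERIV_mult DERIV_cmult dp dq')
      moreover have "(- s * ((- s - 1) * u * q' t)) * q' t + 2 * (norm h)\<^sup>2 * (- s * x)
          = s * (s + 1) * u * (q' t)\<^sup>2 - s * x * (2 * (norm h)\<^sup>2)" for u x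
        by (simp add: power2_eq_square algebra_simps)
      moreover have "- s - 1 - 1 = - s - 2" by simp
      moreover have "D m = (\<lambda>t. - s * q t powr (- s - 1) * q' t)"
        "D (Suc m) t = s * (s + 1) * q t powr (- s - 2) * (q' t)\<^sup>2 - s * q t powr (- s - 1) * (2 * (norm h)\<^sup>2)"
        using 2 by (simp_all add: D_def fun_eq_iff)
      ultimately show ?thesis by (simp only:)
    qed
  qed
  obtain t where t: "0 < t" "t < 1" and tay: "D 0 1 = (\<Sum>m<2. D m 0 / fact m * (1 - 0) ^ m) + D 2 t / fact 2 * (1 - 0)\<^sup>2"
    using Taylor_up[of 2 D "D 0" 0 1 0] deriv by auto
  have D2: "D 2 t = s * (s + 1) * q t powr (- s - 2) * (q' t)\<^sup>2 - s * q t powr (- s - 1) * (2 * (norm h)\<^sup>2)"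
    by (simp add: D_def)
  have qt: "0 < q t" using pos t by auto
  have "(q' t)\<^sup>2 \<le> 4 * q t * (norm h)\<^sup>2"
  proof -
    have "q' t = 2 * ((z + t *\<^sub>R h) \<bullet> h)"
      by (simp add: q'_def inner_add_left power2_norm_eq_inner)
    moreover have "((z + t *\<^sub>R h) \<bullet> h)\<^sup>2 \<le> (norm (z + t *\<^sub>R h))\<^sup>2 * (norm h)\<^sup>2"
      using Cauchy_Schwarz_ineq[of "z + t *\<^sub>R h" h] by (simp add: power2_norm_eq_inner)
    ultimately show ?thesis unfolding q by (simp add: power_mult_distrib)
  qed
  then have "q t powr (- s - 2) * (q' t)\<^sup>2 \<le> q t powr (- s - 2) * (4 * q t * (norm h)\<^sup>2)"
    by (intro mult_left_mono) auto
  also have "\<dots> = 4 * (q t powr (- s - 2) * q t powr 1) * (norm h)\<^sup>2" using qt by simp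
  also have "q t powr (- s - 2) * q t powr 1 = q t powr ((- s - 2) + 1)" by (simp only: powr_add)
  also have "(- s - 2) + 1 = - s - 1" by simp
  finally have "s * (s + 1) * (q t powr (- s - 2) * (q' t)\<^sup>2) \<le> s * (s + 1) * (4 * q t powr (- s - 1) * (norm h)\<^sup>2)"
    using a by (intro mult_left_mono) (auto simp: s_def)
  moreover have "0 \<le> s * (s + 1) * (q t powr (- s - 2) * (q' t)\<^sup>2)" "0 \<le> s * q t powr (- s - 1) * (2 * (norm h)\<^sup>2)"
    using a by (auto simp: s_def)
  ultimately have D2b: "\<bar>D 2 t\<bar> \<le> s * (s + 1) * (4 * q t powr (- s - 1) * (norm h)\<^sup>2) + s * q t powr (- s - 1) * (2 * (norm h)\<^sup>2)"
    unfolding D2 by (simp only: abs_le_iff mult.assoc) linarith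
  have qb: "q t powr (- s - 1) \<le> 2 powr (a + 2) * norm z powr (- a - 2)"
  proof -
    have "q t powr (- s - 1) = norm (z + t *\<^sub>R h) powr (2 * (- s - 1))"
      using qt unfolding q by (simp add: powr_powr flip: powr_numeral)
    also have "2 * (- s - 1) = - a - 2" by (simp add: s_def)
    also have "norm (z + t *\<^sub>R h) powr (- a - 2) \<le> (norm z / 2) powr (- a - 2)"
      using lower[of t] t z a by (intro powr_mono2') auto
    also have "\<dots> = 2 powr (a + 2) * norm z powr (- a - 2)"
    proof -
      have e: "- a - 2 = - (a + 2)" by simp
      have "(norm z / 2) powr (- a - 2) = norm z powr (- a - 2) / 2 powr (- a - 2)"
        by (rule powr_divide)
      also have "2 powr (- a - 2) = 1 / 2 powr (a + 2)" by (simp only: e powr_minus_divide)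
      finally show ?thesis by (simp only: divide_divide_eq_right mult_1 div_by_1 mult.commute)
    qed
    finally show ?thesis .
  qed
  have D2le: "\<bar>D 2 t\<bar> \<le> (s * (s + 1) * 4 + s * 2) * ((2 powr (a + 2) * norm z powr (- a - 2)) * (norm h)\<^sup>2)"
  proof -
    have "\<bar>D 2 t\<bar> \<le> (s * (s + 1) * 4 + s * 2) * (q t powr (- s - 1) * (norm h)\<^sup>2)"
      using D2b by (simp add: algebra_simps)
    also have "\<dots> \<le> (s * (s + 1) * 4 + s * 2) * ((2 powr (a + 2) * norm z powr (- a - 2)) * (norm h)\<^sup>2)"
      using a qb by (intro mult_left_mono mult_right_mono) (auto simp: s_def)
    finally show ?thesis .
  qed
  have "D 0 1 = norm (z + h) powr (- a)"
    unfolding D_def q by (simp add: s_def powr_powr flip: powr_numeral)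
  moreover have "D 0 0 = norm z powr (- a)"
    unfolding D_def q by (simp add: s_def powr_powr flip: powr_numeral)
  moreover have "D 1 0 = - (a * norm z powr (- a - 2) * (z \<bullet> h))"
  proof -
    have "q 0 powr (- s - 1) = norm z powr (2 * (- s - 1))" unfolding q by (simp add: powr_powr flip: powr_numeral)
    also have "2 * (- s - 1) = - a - 2" by (simp add: s_def)
    finally show ?thesis by (simp add: D_def q'_def s_def)
  qed
  moreover have "D 0 1 = D 0 0 + D 1 0 + D 2 t / 2"
    using tay by (simp add: numeral_2_eq_2)
  ultimately have "norm (z + h) powr (- a) - norm z powr (- a) + a * norm z powr (- a - 2) * (z \<bullet> h) = D 2 t / 2"
    by linarith
  then have "\<bar>norm (z + h) powr (- a) - norm z powr (- a) + a * norm z powr (- a - 2) * (z \<bullet> h)\<bar> = \<bar>D 2 t\<bar> / 2"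
    by (simp only: abs_divide abs_numeral)
  also have "\<dots> \<le> (s * (s + 1) * 4 + s * 2) * ((2 powr (a + 2) * norm z powr (- a - 2)) * (norm h)\<^sup>2)"
    using D2le by linarith
  also have "s * (s + 1) * 4 + s * 2 = a * (a + 3)" by (simp add: s_def field_simps)
  finally show ?thesis by (simp add: mult_ac)
qed

context ahlfors begin

abbreviation "A p X \<equiv> riesz d \<sigma> p X"
abbreviation "S p X \<equiv> riesz_vec d \<sigma> p X"

lemma flat_mass_eq_0:
  assumes r: "0 < r" and w: "r / 2 \<le> norm w" and v: "4 / r\<^sup>2 \<le> v"
  shows "flat_mass d c w v = 0"
proof -
  have "r\<^sup>2 / 4 \<le> (norm w)\<^sup>2" using power_mono[OF w, of 2] r by (simp add: power_divide)
  moreover have "0 < v" using v r by (meson divide_pos_pos less_le_trans zero_less_numeral zero_less_power)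
  moreover have "1 \<le> v * (r\<^sup>2 / 4)" using v r by (simp add: field_simps)
  ultimately have "1 \<le> v * (norm w)\<^sup>2" by (meson mult_left_mono less_imp_le order_trans)
  then show ?thesis by (simp add: flat_mass_def bump_def)
qed

lemma moments_eq_0:
  assumes X: "X \<notin> \<Gamma>" and v: "4 / (infdist X \<Gamma>)\<^sup>2 \<le> v"
  shows "(\<integral>y. bump v (X - y) \<partial>\<sigma>) = 0" "(\<integral>y. bump v (X - y) *\<^sub>R (X - y) \<partial>\<sigma>) = 0"
proof -
  have "1 / (infdist X \<Gamma>)\<^sup>2 \<le> 4 / (infdist X \<Gamma>)\<^sup>2" by (intro divide_right_mono) auto
  then have AE0: "AE y in \<sigma>. bump v (X - y) = 0" using v by (intro AE_bump_eq_0[OF X]) linarith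
  then show "(\<integral>y. bump v (X - y) \<partial>\<sigma>) = 0" "(\<integral>y. bump v (X - y) *\<^sub>R (X - y) \<partial>\<sigma>) = 0"
    by (auto intro!: integral_eq_zero_AE)
qed

text \<open>The potentials of \<sigma> and of the plane are integrals over v against the same
  weight, so errors in the bump masses integrate to an error in A_p.\<close>

lemma riesz_flat_approx:
  fixes c :: real and w :: 'a
  assumes X: "X \<notin> \<Gamma>" and E: "0 \<le> E" and c: "0 \<le> c" and w: "infdist X \<Gamma> / 2 \<le> norm w"
    and mass: "\<And>v. 0 < v \<Longrightarrow> v < 4 / (infdist X \<Gamma>)\<^sup>2 \<Longrightarrow>
      \<bar>(\<integral>y. bump v (X - y) \<partial>\<sigma>) - flat_mass d c w v\<bar>
        \<le> E * v powr (- (real d / 2)) * (v * (infdist X \<Gamma>)\<^sup>2) powr (- (\<epsilon> / 2))"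
    and p: "0 < p" "\<epsilon> < p"
  shows "\<bar>A p X - c * riesz_const d p * norm w powr (- p)\<bar>
      \<le> 2 powr (p - \<epsilon>) * 2 / (p - \<epsilon>) / Beta ((real d + p) / 2) 2 * E * infdist X \<Gamma> powr (- p)"
proof -
  let ?r = "infdist X \<Gamma>" and ?a = "(real d + p) / 2"
  have r: "0 < ?r" by (rule infdist_pos[OF X])
  have w0: "w \<noteq> 0" using w r by auto
  have B: "0 < Beta ?a 2" using p by (intro Beta_pos) auto
  have e: "2 * ?a = real d + p" by simp
  have rep: "integrable lborel (\<lambda>v. (indicator {0<..} v * v powr (?a - 1)) *\<^sub>R (\<integral>y. bump v (X - y) \<partial>\<sigma>))"
    "(\<integral>v. (indicator {0<..} v * v powr (?a - 1)) *\<^sub>R (\<integral>y. bump v (X - y) \<partial>\<sigma>) \<partial>lborel) = Beta ?a 2 * A p X"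
    using riesz_representation[OF X, of ?a 0 "\<lambda>y. 1::real", unfolded e] p d_pos
    by (auto simp: riesz_def add_pos_pos)
  have "norm ((\<integral>v. (indicator {0<..} v * v powr (?a - 1)) *\<^sub>R (\<integral>y. bump v (X - y) \<partial>\<sigma>) \<partial>lborel)
      - (\<integral>v. (indicator {0<..} v * v powr (?a - 1)) *\<^sub>R flat_mass d c w v \<partial>lborel))
    \<le> E * (2 powr (p - \<epsilon>) * 2 / (p - \<epsilon>)) * ?r powr (- p)"
  proof (rule norm_weighted_integral_diff_le[OF rep(1) _ r])
    show "?a - real d / 2 = p / 2" by (simp add: field_simps)
  qed (use p E mass moments_eq_0(1)[OF X] flat_mass_eq_0[OF r w] flat_mass_integral(1)[OF p(1) w0 c] in auto)
  then have "norm (Beta ?a 2 * A p X - c * Beta (p / 2) (2 + real d / 2) * norm w powr (- p))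
    \<le> E * (2 powr (p - \<epsilon>) * 2 / (p - \<epsilon>)) * ?r powr (- p)"
    unfolding rep(2) unfolding real_scaleR_def flat_mass_integral(2)[OF p(1) w0 c] .
  moreover have "Beta ?a 2 * A p X - c * Beta (p / 2) (2 + real d / 2) * norm w powr (- p)
    = Beta ?a 2 * (A p X - c * riesz_const d p * norm w powr (- p))"
    using B by (simp add: riesz_const_def right_diff_distrib)
  ultimately have "Beta ?a 2 * \<bar>A p X - c * riesz_const d p * norm w powr (- p)\<bar>
    \<le> E * (2 powr (p - \<epsilon>) * 2 / (p - \<epsilon>)) * ?r powr (- p)"
    using B by (simp add: abs_mult)
  then have "\<bar>A p X - c * riesz_const d p * norm w powr (- p)\<bar>
    \<le> E * (2 powr (p - \<epsilon>) * 2 / (p - \<epsilon>)) * ?r powr (- p) / Beta ?a 2"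
    using B by (simp only: pos_le_divide_eq mult.commute)
  also have "E * (2 powr (p - \<epsilon>) * 2 / (p - \<epsilon>)) * ?r powr (- p) / Beta ?a 2
    = 2 powr (p - \<epsilon>) * 2 / (p - \<epsilon>) / Beta ?a 2 * E * ?r powr (- p)"
    unfolding divide_inverse by (simp only: mult_ac)
  finally show ?thesis .
qed

text \<open>The range p > -1 matters: it contains p = q = 0, which occurs for d = n - 2. The first
  moment carries one more length than the mass, hence (d + 1) / 2 in the exponent.\<close>

lemma riesz_vec_flat_approx:
  fixes c :: real and w :: 'a
  assumes X: "X \<notin> \<Gamma>" and E: "0 \<le> E" and c: "0 \<le> c" and w: "infdist X \<Gamma> / 2 \<le> norm w"
    and moment: "\<And>v. 0 < v \<Longrightarrow> v < 4 / (infdist X \<Gamma>)\<^sup>2 \<Longrightarrow>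
      norm ((\<integral>y. bump v (X - y) *\<^sub>R (X - y) \<partial>\<sigma>) - flat_mass d c w v *\<^sub>R w)
        \<le> E * v powr (- ((real d + 1) / 2)) * (v * (infdist X \<Gamma>)\<^sup>2) powr (- (\<epsilon> / 2))"
    and p: "- 1 < p" "\<epsilon> < p + 1"
  shows "norm (S p X - (c * riesz_const d (p + 2) * norm w powr (- (p + 2))) *\<^sub>R w)
      \<le> 2 powr (p + 1 - \<epsilon>) * 2 / (p + 1 - \<epsilon>) / Beta ((real d + (p + 2)) / 2) 2 * E * infdist X \<Gamma> powr (- (p + 1))"
proof -
  let ?r = "infdist X \<Gamma>" and ?a = "(real d + (p + 2)) / 2"
  have r: "0 < ?r" by (rule infdist_pos[OF X])
  have w0: "w \<noteq> 0" using w r by auto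
  have a: "0 < ?a" using p by simp
  have B: "0 < Beta ?a 2" using a by (intro Beta_pos) auto
  have e: "2 * ?a = real d + p + 2" by simp
  have rep: "integrable lborel (\<lambda>v. (indicator {0<..} v * v powr (?a - 1)) *\<^sub>R (\<integral>y. bump v (X - y) *\<^sub>R (X - y) \<partial>\<sigma>))"
    "(\<integral>v. (indicator {0<..} v * v powr (?a - 1)) *\<^sub>R (\<integral>y. bump v (X - y) *\<^sub>R (X - y) \<partial>\<sigma>) \<partial>lborel) = Beta ?a 2 *\<^sub>R S p X"
    using riesz_representation[OF X a, of 1 "\<lambda>y. X - y", unfolded e] p by (simp_all add: riesz_vec_def)
  have f: "integrable lborel (\<lambda>v. (indicator {0<..} v * v powr (?a - 1)) * flat_mass d c w v)"
    "(\<integral>v. (indicator {0<..} v * v powr (?a - 1)) * flat_mass d c w v \<partial>lborel)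
      = c * Beta ((p + 2) / 2) (2 + real d / 2) * norm w powr (- (p + 2))"
    by (rule flat_mass_integral; use p w0 c in simp)+
  have flat: "integrable lborel (\<lambda>v. (indicator {0<..} v * v powr (?a - 1)) *\<^sub>R (flat_mass d c w v *\<^sub>R w))"
    "(\<integral>v. (indicator {0<..} v * v powr (?a - 1)) *\<^sub>R (flat_mass d c w v *\<^sub>R w) \<partial>lborel)
      = (c * Beta ((p + 2) / 2) (2 + real d / 2) * norm w powr (- (p + 2))) *\<^sub>R w"
    unfolding scaleR_scaleR using f by (simp_all only: integrable_scaleR_left integral_scaleR_left)
  have "norm ((\<integral>v. (indicator {0<..} v * v powr (?a - 1)) *\<^sub>R (\<integral>y. bump v (X - y) *\<^sub>R (X - y) \<partial>\<sigma>) \<partial>lborel)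
      - (\<integral>v. (indicator {0<..} v * v powr (?a - 1)) *\<^sub>R (flat_mass d c w v *\<^sub>R w) \<partial>lborel))
    \<le> E * (2 powr (p + 1 - \<epsilon>) * 2 / (p + 1 - \<epsilon>)) * ?r powr (- (p + 1))"
  proof (rule norm_weighted_integral_diff_le[OF rep(1) flat(1) r])
    show "?a - (real d + 1) / 2 = (p + 1) / 2" by (simp add: field_simps)
    show "(\<integral>y. bump v (X - y) *\<^sub>R (X - y) \<partial>\<sigma>) = flat_mass d c w v *\<^sub>R w" if "4 / ?r\<^sup>2 \<le> v" for v
      using moments_eq_0(2)[OF X that] flat_mass_eq_0[OF r w that] by simp
  qed (use p E moment in auto)
  then have "norm (Beta ?a 2 *\<^sub>R S p X - (c * Beta ((p + 2) / 2) (2 + real d / 2) * norm w powr (- (p + 2))) *\<^sub>R w)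
    \<le> E * (2 powr (p + 1 - \<epsilon>) * 2 / (p + 1 - \<epsilon>)) * ?r powr (- (p + 1))"
    unfolding rep(2) flat(2) .
  moreover have "Beta ?a 2 *\<^sub>R S p X - (c * Beta ((p + 2) / 2) (2 + real d / 2) * norm w powr (- (p + 2))) *\<^sub>R w
    = Beta ?a 2 *\<^sub>R (S p X - (c * riesz_const d (p + 2) * norm w powr (- (p + 2))) *\<^sub>R w)"
    using B by (simp add: riesz_const_def scaleR_diff_right)
  ultimately have "Beta ?a 2 * norm (S p X - (c * riesz_const d (p + 2) * norm w powr (- (p + 2))) *\<^sub>R w)
    \<le> E * (2 powr (p + 1 - \<epsilon>) * 2 / (p + 1 - \<epsilon>)) * ?r powr (- (p + 1))"
    using B by (simp only: norm_scaleR abs_of_pos)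
  then have "norm (S p X - (c * riesz_const d (p + 2) * norm w powr (- (p + 2))) *\<^sub>R w)
    \<le> E * (2 powr (p + 1 - \<epsilon>) * 2 / (p + 1 - \<epsilon>)) * ?r powr (- (p + 1)) / Beta ?a 2"
    using B by (simp only: pos_le_divide_eq mult.commute)
  also have "\<dots> = 2 powr (p + 1 - \<epsilon>) * 2 / (p + 1 - \<epsilon>) / Beta ?a 2 * E * ?r powr (- (p + 1))"
    unfolding divide_inverse by (simp only: mult_ac)
  finally show ?thesis .
qed

text \<open>Differentiation under the integral sign; the Taylor remainder integrates to |h|^2 times
  a potential with kernel exponent d + p + 2.\<close>

lemma riesz_GDERIV:
  assumes X: "X \<notin> \<Gamma>" and p: "0 < p"
  shows "GDERIV (A p) X :> (- (real d + p)) *\<^sub>R S p X"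
proof -
  let ?r = "infdist X \<Gamma>" and ?a = "real d + p"
  have r: "0 < ?r" by (rule infdist_pos[OF X])
  define K where "K = ?a * (?a + 3) * 2 powr (?a + 2) * (\<integral>y. norm (X - y) powr (- (?a + 2)) \<partial>\<sigma>)"
  have intS: "integrable \<sigma> (\<lambda>y. norm (X - y) powr (- (?a + 2)) *\<^sub>R (X - y))"
    by (rule riesz_vector_integrable(1)[OF X, where j = 1]) (use p in auto)
  have est: "\<bar>A p (X + h) - A p X + ?a * (S p X \<bullet> h)\<bar> \<le> K * (norm h)\<^sup>2" if h: "norm h \<le> ?r / 2" for h
  proof -
    have Xh: "X + h \<notin> \<Gamma>"
    proof
      assume "X + h \<in> \<Gamma>"
      then have "?r \<le> dist X (X + h)" by (rule infdist_le)
      then show False using h r by (simp add: dist_norm)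
    qed
    have i1: "integrable \<sigma> (\<lambda>y. norm (X + h - y) powr (- ?a))" "integrable \<sigma> (\<lambda>y. norm (X - y) powr (- ?a))"
      using riesz_integrable[OF Xh, of ?a] riesz_integrable[OF X, of ?a] p by auto
    have i2: "integrable \<sigma> (\<lambda>y. norm (X - y) powr (- (?a + 2)) * ((X - y) \<bullet> h))"
      using integrable_inner_left[of h, OF intS] by simp
    have i3: "integrable \<sigma> (\<lambda>y. norm (X - y) powr (- (?a + 2)))"
      using riesz_integrable[OF X, of "?a + 2"] p by auto
    have "S p X \<bullet> h = (\<integral>y. norm (X - y) powr (- (?a + 2)) * ((X - y) \<bullet> h) \<partial>\<sigma>)"
      using integral_inner_left[of h, OF intS] by (simp add: riesz_vec_def)
    then have "A p (X + h) - A p X + ?a * (S p X \<bullet> h)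
      = (\<integral>y. norm (X + h - y) powr (- ?a) - norm (X - y) powr (- ?a) + ?a * (norm (X - y) powr (- (?a + 2)) * ((X - y) \<bullet> h)) \<partial>\<sigma>)"
      unfolding riesz_def using i1 i2 by simp
    moreover have "\<bar>\<integral>y. norm (X + h - y) powr (- ?a) - norm (X - y) powr (- ?a) + ?a * (norm (X - y) powr (- (?a + 2)) * ((X - y) \<bullet> h)) \<partial>\<sigma>\<bar>
      \<le> (\<integral>y. ?a * (?a + 3) * 2 powr (?a + 2) * norm (X - y) powr (- (?a + 2)) * (norm h)\<^sup>2 \<partial>\<sigma>)"
    proof (rule order_trans[OF integral_abs_bound integral_mono_AE])
      show "integrable \<sigma> (\<lambda>y. \<bar>norm (X + h - y) powr (- ?a) - norm (X - y) powr (- ?a) + ?a * (norm (X - y) powr (- (?a + 2)) * ((X - y) \<bullet> h))\<bar>)"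
        using i1 i2 by (intro integrable_abs Bochner_Integration.integrable_add Bochner_Integration.integrable_diff integrable_mult_right)
      show "integrable \<sigma> (\<lambda>y. ?a * (?a + 3) * 2 powr (?a + 2) * norm (X - y) powr (- (?a + 2)) * (norm h)\<^sup>2)"
        using i3 by (intro integrable_mult_right integrable_mult_left)
      show "AE y in \<sigma>. \<bar>norm (X + h - y) powr (- ?a) - norm (X - y) powr (- ?a) + ?a * (norm (X - y) powr (- (?a + 2)) * ((X - y) \<bullet> h))\<bar>
         \<le> ?a * (?a + 3) * 2 powr (?a + 2) * norm (X - y) powr (- (?a + 2)) * (norm h)\<^sup>2"
        using AE_ge_infdist[of X]
      proof eventually_elim
        case (elim y)
        have "X + h - y = (X - y) + h" "- (?a + 2) = - ?a - 2" by simp_all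
        then show ?case
          using norm_powr_taylor[of ?a "X - y" h] elim r h p by (simp only: mult.assoc) fastforce
      qed
    qed
    moreover have "(\<integral>y. ?a * (?a + 3) * 2 powr (?a + 2) * norm (X - y) powr (- (?a + 2)) * (norm h)\<^sup>2 \<partial>\<sigma>) = K * (norm h)\<^sup>2"
      unfolding K_def by simp
    ultimately show ?thesis by (simp only:)
  qed
  show ?thesis
    unfolding gderiv_def
  proof (rule has_derivativeI_sandwich)
    show "0 < ?r / 2" using r by simp
    show "bounded_linear (\<lambda>h. h \<bullet> (- ?a *\<^sub>R S p X))" by (rule bounded_linear_inner_left)
    show "((\<lambda>Y. K * norm (Y - X)) \<longlongrightarrow> 0) (at X)"
      by (rule tendsto_eq_intros refl | simp)+
    fix Y assume Y: "Y \<noteq> X" "dist Y X < ?r / 2"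
    have "\<bar>A p Y - A p X - (Y - X) \<bullet> (- ?a *\<^sub>R S p X)\<bar> \<le> K * (norm (Y - X))\<^sup>2"
      using est[of "Y - X"] Y by (simp add: dist_norm inner_commute algebra_simps)
    then show "norm (A p Y - A p X - (Y - X) \<bullet> (- ?a *\<^sub>R S p X)) / norm (Y - X) \<le> K * norm (Y - X)"
      using Y by (simp add: divide_le_eq power2_eq_square mult_ac)
  qed
qed

end

section \<open>Planes at a single scale\<close>

text \<open>\<open>flat_mass\<close> in the scale variable t = v^(-1/2), as a function of |w| / t,
  without the factor c t^d. It vanishes once the plane is at distance t or more.\<close>

definition profile :: "nat \<Rightarrow> real \<Rightarrow> real" where
  "profile d x = max 0 (1 - x\<^sup>2) powr (1 + real d / 2)"

lemma profile_nonneg: "0 \<le> profile d x" and profile_le_1: "profile d x \<le> 1"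
  by (auto simp: profile_def intro!: powr_le1)

lemma profile_pos: "0 \<le> x \<Longrightarrow> x < 1 \<Longrightarrow> 0 < profile d x"
proof -
  assume "0 \<le> x" "x < 1"
  then have "x\<^sup>2 < 1" by (simp add: power_less_one_iff abs_square_less_1)
  then show ?thesis by (simp add: profile_def)
qed

lemma profile_eq_0: "1 \<le> x \<Longrightarrow> profile d x = 0"
  by (simp add: profile_def)

lemma profile_antimono: "0 \<le> x \<Longrightarrow> x \<le> y \<Longrightarrow> profile d y \<le> profile d x"
proof -
  assume "0 \<le> x" "x \<le> y"
  then have "x\<^sup>2 \<le> y\<^sup>2" by (intro power_mono)
  then show ?thesis unfolding profile_def by (intro powr_mono2) auto
qed

lemma flat_mass_profile:
  assumes "0 < t"
  shows "flat_mass d c w (1 / t\<^sup>2) = c * t ^ d * profile d (norm w / t)"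
proof -
  have "(1 / t\<^sup>2) powr (- (real d / 2)) = t powr real d"
  proof -
    have "1 / t\<^sup>2 = t powr (- 2)" using assms by (simp add: powr_minus_divide)
    then show ?thesis by (simp add: powr_powr)
  qed
  also have "\<dots> = t ^ d" using assms by (simp add: powr_realpow)
  finally show ?thesis by (simp add: flat_mass_def profile_def bump_def power_divide)
qed

lemma powr_lipschitz_unit:
  fixes a b q :: real
  assumes "0 \<le> a" "a \<le> 1" "0 \<le> b" "b \<le> 1" "1 \<le> q"
  shows "\<bar>a powr q - b powr q\<bar> \<le> q * \<bar>a - b\<bar>"
proof -
  have *: "\<bar>a powr q - b powr q\<bar> \<le> q * \<bar>a - b\<bar>" if ab: "0 \<le> a" "a < b" "b \<le> 1" for a b :: real
  proof -
    have "\<exists>l z. a < z \<and> z < b \<and> ((\<lambda>x. x powr q) has_real_derivative l) (at z) \<and> b powr q - a powr q = (b - a) * l"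
    proof (rule MVT)
      show "continuous_on {a..b} (\<lambda>x. x powr q)"
        using assms(5) ab by (intro continuous_on_powr') (auto intro: continuous_intros)
      fix x assume "a < x" "x < b"
      then show "(\<lambda>x. x powr q) differentiable at x"
        unfolding real_differentiable_def using ab has_real_derivative_powr[of x q] by auto
    qed (use ab in auto)
    then obtain k z where z: "a < z" "z < b" "((\<lambda>x. x powr q) has_real_derivative k) (at z)" "b powr q - a powr q = (b - a) * k"
      by auto
    have "k = q * z powr (q - 1)"
      using DERIV_unique[OF z(3) has_real_derivative_powr] z ab by auto
    moreover have "z powr (q - 1) \<le> 1" using z ab assms(5) by (intro powr_le1) auto
    ultimately have "0 \<le> k" "k \<le> q" using assms(5) by (auto simp: mult_left_le)
    then have "0 \<le> (b - a) * k" "(b - a) * k \<le> (b - a) * q" using ab by (auto intro: mult_left_mono)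
    moreover have "\<bar>a powr q - b powr q\<bar> = \<bar>(b - a) * k\<bar>" "\<bar>a - b\<bar> = b - a"
      using z(4) ab by (simp_all add: abs_minus_commute)
    ultimately show ?thesis by (simp add: mult.commute)
  qed
  show ?thesis
    using *[of a b] *[of b a] assms by (cases a b rule: linorder_cases) (auto simp: abs_minus_commute)
qed

lemma profile_lipschitz:
  assumes "0 \<le> x" "0 \<le> y"
  shows "\<bar>profile d x - profile d y\<bar> \<le> (2 + real d) * \<bar>x - y\<bar>"
proof -
  \<comment> \<open>The profile is 0 beyond 1, so truncating the arguments removes the maximum from
    its definition.\<close>
  define a where "a = min x 1"
  define b where "b = min y 1"
  have ab: "0 \<le> a" "a \<le> 1" "0 \<le> b" "b \<le> 1" using assms by (auto simp: a_def b_def)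
  have px: "profile d x = (1 - a\<^sup>2) powr (1 + real d / 2)" "profile d y = (1 - b\<^sup>2) powr (1 + real d / 2)"
  proof -
    have "max 0 (1 - x\<^sup>2) = 1 - (min x 1)\<^sup>2" if "0 \<le> x" for x :: real
    proof (cases "x \<le> 1")
      case True then show ?thesis using that by (simp add: power_le_one)
    next
      case False
      then have "1 \<le> x\<^sup>2" by (simp add: one_le_power)
      then show ?thesis using False by simp
    qed
    then show "profile d x = (1 - a\<^sup>2) powr (1 + real d / 2)" "profile d y = (1 - b\<^sup>2) powr (1 + real d / 2)"
      using assms by (auto simp: profile_def a_def b_def)
  qed
  have sq: "0 \<le> 1 - a\<^sup>2" "1 - a\<^sup>2 \<le> 1" "0 \<le> 1 - b\<^sup>2" "1 - b\<^sup>2 \<le> 1" using ab by (auto simp: power_le_one)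
  have "\<bar>profile d x - profile d y\<bar> \<le> (1 + real d / 2) * \<bar>(1 - a\<^sup>2) - (1 - b\<^sup>2)\<bar>"
    unfolding px using sq by (intro powr_lipschitz_unit) auto
  also have "\<bar>(1 - a\<^sup>2) - (1 - b\<^sup>2)\<bar> = \<bar>a - b\<bar> * (a + b)"
  proof -
    have "(1 - a\<^sup>2) - (1 - b\<^sup>2) = - ((a - b) * (a + b))" by (simp add: algebra_simps power2_eq_square)
    then show ?thesis using ab by (simp add: abs_mult)
  qed
  also have "(1 + real d / 2) * (\<bar>a - b\<bar> * (a + b)) \<le> (1 + real d / 2) * (\<bar>x - y\<bar> * 2)"
    using ab by (intro mult_left_mono mult_mono) (auto simp: a_def b_def min_def)
  finally show ?thesis by (simp add: algebra_simps)
qed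

lemma profile_norm_diff:
  fixes w w' :: "'a::real_normed_vector"
  assumes t: "0 < t"
  shows "\<bar>profile d (norm w / t) - profile d (norm w' / t)\<bar> \<le> (2 + real d) * (norm (w - w') / t)"
proof -
  have "\<bar>profile d (norm w / t) - profile d (norm w' / t)\<bar> \<le> (2 + real d) * \<bar>norm w / t - norm w' / t\<bar>"
    using t by (intro profile_lipschitz) auto
  also have "\<bar>norm w / t - norm w' / t\<bar> = \<bar>norm w - norm w'\<bar> / t"
    using t by (simp flip: diff_divide_distrib)
  also have "(2 + real d) * (\<bar>norm w - norm w'\<bar> / t) \<le> (2 + real d) * (norm (w - w') / t)"
    using t norm_triangle_ineq3[of w w'] by (intro mult_left_mono divide_right_mono) auto
  finally show ?thesis .
qed

lemma flat_diff_le: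
  fixes w w' :: "'a::real_normed_vector"
  assumes t: "0 < t" and c: "0 \<le> c"
  shows "\<bar>c * profile d (norm w / t) - c' * profile d (norm w' / t)\<bar>
      \<le> \<bar>c - c'\<bar> + c * ((2 + real d) * (norm (w - w') / t))"
proof -
  have "c * profile d (norm w / t) - c' * profile d (norm w' / t)
    = (c - c') * profile d (norm w' / t) + c * (profile d (norm w / t) - profile d (norm w' / t))"
    by (simp add: algebra_simps)
  also have "\<bar>\<dots>\<bar> \<le> \<bar>c - c'\<bar> * profile d (norm w' / t) + c * \<bar>profile d (norm w / t) - profile d (norm w' / t)\<bar>"
    using c profile_nonneg by (intro order_trans[OF abs_triangle_ineq]) (simp add: abs_mult)
  also have "\<dots> \<le> \<bar>c - c'\<bar> * 1 + c * ((2 + real d) * (norm (w - w') / t))"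
    using c by (intro add_mono mult_left_mono profile_le_1 profile_norm_diff t) auto
  finally show ?thesis by simp
qed

lemma scaleR_diff_le:
  fixes w w' :: "'a::real_normed_vector"
  assumes "0 \<le> m"
  shows "norm (m *\<^sub>R w - m' *\<^sub>R w') \<le> \<bar>m - m'\<bar> * norm w' + m * norm (w - w')"
proof -
  have "m *\<^sub>R w - m' *\<^sub>R w' = (m - m') *\<^sub>R w' + m *\<^sub>R (w - w')" by (simp add: algebra_simps)
  then show ?thesis using assms norm_triangle_ineq[of "(m - m') *\<^sub>R w'" "m *\<^sub>R (w - w')"] by simp
qed


section \<open>Recovering a plane from its mass and moment\<close>

text \<open>With m, m' the two masses, m (w - w') = (m w - m' w') + (m' - m) w' controls the
  displacement first. The masses then control the densities, because the profile is Lipschitz and at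
  least \<open>g\<close> at w.\<close>

lemma flat_stability:
  fixes w w' :: "'a::real_normed_vector"
  assumes t: "0 < t" and l: "0 < l" "l \<le> c * profile d (norm w / t)" and g: "0 < g" "g \<le> profile d (norm w / t)"
    and c: "0 \<le> c" "c \<le> k" and c': "0 \<le> c'" and w': "norm w' \<le> 2 * t"
    and small: "3 * (2 + real d) / l * \<delta> \<le> g / 2"
    and mass: "\<bar>c * profile d (norm w / t) - c' * profile d (norm w' / t)\<bar> \<le> \<delta>"
    and moment: "norm ((c * profile d (norm w / t)) *\<^sub>R w - (c' * profile d (norm w' / t)) *\<^sub>R w') \<le> \<delta> * t"
  shows "norm (w - w') \<le> 3 / l * \<delta> * t" "\<bar>c - c'\<bar> \<le> 2 / g * (1 + k * (3 * (2 + real d) / l)) * \<delta>"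
proof -
  define m where "m = c * profile d (norm w / t)"
  define m' where "m' = c' * profile d (norm w' / t)"
  have \<delta>: "0 \<le> \<delta>" using mass by linarith
  have "m *\<^sub>R (w - w') = (m *\<^sub>R w - m' *\<^sub>R w') + (m' - m) *\<^sub>R w'" by (simp add: algebra_simps)
  then have "norm (m *\<^sub>R (w - w')) \<le> norm (m *\<^sub>R w - m' *\<^sub>R w') + \<bar>m' - m\<bar> * norm w'"
    using norm_triangle_ineq[of "m *\<^sub>R w - m' *\<^sub>R w'" "(m' - m) *\<^sub>R w'"] by simp
  also have "\<dots> \<le> \<delta> * t + \<delta> * (2 * t)"
    using moment mass w' \<delta> by (intro add_mono mult_mono) (auto simp: m_def m'_def)
  finally have "m * norm (w - w') \<le> 3 * \<delta> * t" using l c by (simp add: m_def)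
  moreover have "l * norm (w - w') \<le> m * norm (w - w')" using l by (intro mult_right_mono) (auto simp: m_def)
  ultimately have "l * norm (w - w') \<le> 3 * \<delta> * t" by linarith
  then show w: "norm (w - w') \<le> 3 / l * \<delta> * t" using l by (simp add: field_simps)
  have pd: "\<bar>profile d (norm w / t) - profile d (norm w' / t)\<bar> \<le> 3 * (2 + real d) / l * \<delta>"
  proof -
    have "\<bar>profile d (norm w / t) - profile d (norm w' / t)\<bar> \<le> (2 + real d) * (norm (w - w') / t)"
      by (rule profile_norm_diff[OF t])
    also have "norm (w - w') / t \<le> 3 / l * \<delta>" using w t by (simp add: pos_divide_le_eq)
    finally show ?thesis by (simp add: mult_left_mono mult_ac)
  qed
  have "(c - c') * profile d (norm w / t) = (m - m') - c' * (profile d (norm w / t) - profile d (norm w' / t))"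
    by (simp add: m_def m'_def algebra_simps)
  then have "\<bar>c - c'\<bar> * profile d (norm w / t) \<le> \<bar>m - m'\<bar> + c' * \<bar>profile d (norm w / t) - profile d (norm w' / t)\<bar>"
    using profile_nonneg[of d "norm w / t"] c'
    by (metis abs_mult abs_of_nonneg abs_triangle_ineq4)
  also have "\<dots> \<le> \<delta> + c' * (3 * (2 + real d) / l * \<delta>)"
    using mass pd c' by (intro add_mono mult_left_mono) (auto simp: m_def m'_def)
  \<comment> \<open>No bound on c' is given; it is replaced by |c - c'| + k, and the smallness of
    \<delta> allows half of |c - c'| g to be absorbed on the left.\<close>
  also have "\<dots> \<le> \<delta> + (\<bar>c - c'\<bar> + k) * (3 * (2 + real d) / l * \<delta>)"
    using c l \<delta> by (intro add_left_mono mult_right_mono) auto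
  also have "\<dots> = \<delta> + \<bar>c - c'\<bar> * (3 * (2 + real d) / l * \<delta>) + k * (3 * (2 + real d) / l * \<delta>)"
    by (simp only: distrib_right add.assoc)
  also have "\<dots> \<le> \<delta> + \<bar>c - c'\<bar> * (g / 2) + k * (3 * (2 + real d) / l * \<delta>)"
    by (intro add_mono mult_left_mono small order_refl) auto
  finally have "\<bar>c - c'\<bar> * profile d (norm w / t) \<le> \<delta> + \<bar>c - c'\<bar> * (g / 2) + k * (3 * (2 + real d) / l * \<delta>)" .
  moreover have "\<bar>c - c'\<bar> * g \<le> \<bar>c - c'\<bar> * profile d (norm w / t)" using g by (intro mult_left_mono) auto
  moreover have "\<bar>c - c'\<bar> * g = \<bar>c - c'\<bar> * (g / 2) + \<bar>c - c'\<bar> * (g / 2)" by simp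
  ultimately have "\<bar>c - c'\<bar> * (g / 2) \<le> \<delta> + k * (3 * (2 + real d) / l * \<delta>)" by linarith
  then have "\<bar>c - c'\<bar> \<le> (\<delta> + k * (3 * (2 + real d) / l * \<delta>)) / (g / 2)" using g by (simp only: pos_le_divide_eq half_gt_zero)
  also have "\<dots> = 2 / g * (1 + k * (3 * (2 + real d) / l)) * \<delta>" using g l by (simp add: field_simps)
  finally show "\<bar>c - c'\<bar> \<le> 2 / g * (1 + k * (3 * (2 + real d) / l)) * \<delta>" .
qed

section \<open>Lipschitz test functions\<close>

lemma bump_lipschitz:
  fixes X :: "'a::real_normed_vector"
  assumes t: "0 < t"
  shows "(2 / t)-lipschitz_on UNIV (\<lambda>y. bump (1 / t\<^sup>2) (X - y))"
proof (rule lipschitz_onI)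
  fix y z :: 'a
  define a where "a = min (norm (X - y) / t) 1"
  define b where "b = min (norm (X - z) / t) 1"
  have ab: "0 \<le> a" "a \<le> 1" "0 \<le> b" "b \<le> 1" using t by (auto simp: a_def b_def)
  have eq: "bump (1 / t\<^sup>2) (X - y) = 1 - a\<^sup>2" "bump (1 / t\<^sup>2) (X - z) = 1 - b\<^sup>2"
    using t by (auto simp: bump_def a_def b_def min_def max_def power_divide power_le_one divide_le_eq)
  have "dist (bump (1 / t\<^sup>2) (X - y)) (bump (1 / t\<^sup>2) (X - z)) = \<bar>a - b\<bar> * (a + b)"
  proof -
    have "(1 - a\<^sup>2) - (1 - b\<^sup>2) = - ((a - b) * (a + b))" by (simp add: algebra_simps power2_eq_square)
    then show ?thesis using ab by (simp add: abs_mult eq dist_real_def)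
  qed
  also have "\<dots> \<le> \<bar>norm (X - y) / t - norm (X - z) / t\<bar> * 2"
    using ab by (intro mult_mono) (auto simp: a_def b_def min_def)
  also have "\<bar>norm (X - y) / t - norm (X - z) / t\<bar> = \<bar>norm (X - y) - norm (X - z)\<bar> / t"
    using t by (simp flip: diff_divide_distrib)
  also have "\<dots> \<le> dist y z / t"
    using t norm_triangle_ineq3[of "X - y" "X - z"] by (intro divide_right_mono) (auto simp: dist_norm norm_minus_commute)
  finally show "dist (bump (1 / t\<^sup>2) (X - y)) (bump (1 / t\<^sup>2) (X - z)) \<le> 2 / t * dist y z" by (simp add: mult.commute)
qed (use t in auto)

lemma bump_scale_eq_0: "0 < t \<Longrightarrow> t \<le> norm z \<Longrightarrow> bump (1 / t\<^sup>2) z = 0"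
proof -
  assume "0 < t" "t \<le> norm z"
  then have "t\<^sup>2 \<le> (norm z)\<^sup>2" by (intro power_mono) auto
  then show ?thesis using \<open>0 < t\<close> by (simp add: bump_def field_simps)
qed

lemma bump_Lip:
  fixes X :: "'a::euclidean_space"
  assumes t: "0 < t" and sub: "ball X t \<subseteq> ball x R"
  shows "(\<lambda>y. t / 2 * bump (1 / t\<^sup>2) (X - y)) \<in> Lip x R"
proof -
  have "(\<bar>t / 2\<bar> * (2 / t))-lipschitz_on UNIV (\<lambda>y. t / 2 * bump (1 / t\<^sup>2) (X - y))"
    by (intro lipschitz_on_cmult_real bump_lipschitz t)
  moreover have "bump (1 / t\<^sup>2) (X - y) = 0" if "y \<notin> ball x R" for y
  proof -
    have "y \<notin> ball X t" using that sub by auto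
    then show ?thesis using t by (intro bump_scale_eq_0) (auto simp: dist_norm)
  qed
  ultimately show ?thesis using t by (simp add: Lip_def)
qed

text \<open>Product rule: slope 1 from the linear factor, where the bump is at most 1, and slope 2
  from the bump, whose slope 2 / t meets |X - z| \<le> t.\<close>

lemma bump_inner_Lip:
  fixes X e :: "'a::euclidean_space"
  assumes t: "0 < t" and e: "norm e \<le> 1" and sub: "ball X t \<subseteq> ball x R"
  shows "(\<lambda>y. bump (1 / t\<^sup>2) (X - y) * ((X - y) \<bullet> e) / 3) \<in> Lip x R"
proof -
  let ?b = "\<lambda>y. bump (1 / t\<^sup>2) (X - y)"
  have "3-lipschitz_on UNIV (\<lambda>y. ?b y * ((X - y) \<bullet> e))"
  proof (rule lipschitz_onI)
    \<comment> \<open>It suffices that one of the two points lies within t of X; if neither does,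
      both values are 0.\<close>
    have main: "\<bar>?b y * ((X - y) \<bullet> e) - ?b z * ((X - z) \<bullet> e)\<bar> \<le> 3 * dist y z" if z: "norm (X - z) \<le> t" for y z
    proof -
      have "?b y * ((X - y) \<bullet> e) - ?b z * ((X - z) \<bullet> e) = ?b y * ((z - y) \<bullet> e) + (?b y - ?b z) * ((X - z) \<bullet> e)"
        by (simp add: algebra_simps inner_diff_left)
      also have "\<bar>\<dots>\<bar> \<le> ?b y * \<bar>(z - y) \<bullet> e\<bar> + \<bar>?b y - ?b z\<bar> * \<bar>(X - z) \<bullet> e\<bar>"
        using bump_nonneg[of "1 / t\<^sup>2" "X - y"] by (intro order_trans[OF abs_triangle_ineq]) (simp add: abs_mult)
      also have "\<dots> \<le> 1 * dist y z + (2 / t * dist y z) * t"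
      proof (intro add_mono mult_mono)
        show "?b y \<le> 1" using t by (intro bump_le_1) auto
        show "\<bar>(z - y) \<bullet> e\<bar> \<le> dist y z"
          using Cauchy_Schwarz_ineq2[of "z - y" e] mult_left_le[OF e, of "norm (z - y)"]
          by (simp add: dist_norm norm_minus_commute)
        show "\<bar>(X - z) \<bullet> e\<bar> \<le> t"
          using Cauchy_Schwarz_ineq2[of "X - z" e] mult_left_le[OF e, of "norm (X - z)"] z by simp
        show "\<bar>?b y - ?b z\<bar> \<le> 2 / t * dist y z"
          using lipschitz_onD[OF bump_lipschitz[OF t], of y z X] by (simp add: dist_real_def)
      qed (use t in auto)
      finally show ?thesis using t by simp
    qed
    fix y z :: 'a
    show "dist (?b y * ((X - y) \<bullet> e)) (?b z * ((X - z) \<bullet> e)) \<le> 3 * dist y z"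
    proof (cases "norm (X - z) \<le> t")
      case True then show ?thesis using main by (simp add: dist_real_def)
    next
      case F: False
      show ?thesis
      proof (cases "norm (X - y) \<le> t")
        case True then show ?thesis using main[OF True, of z] by (simp add: dist_real_def abs_minus_commute dist_commute)
      next
        case False then show ?thesis using F bump_scale_eq_0[OF t, of "X - y"] bump_scale_eq_0[OF t, of "X - z"] by simp
      qed
    qed
  qed auto
  then have "(\<bar>1 / 3\<bar> * 3)-lipschitz_on UNIV (\<lambda>y. 1 / 3 * (?b y * ((X - y) \<bullet> e)))"
    by (rule lipschitz_on_cmult_real)
  moreover have "bump (1 / t\<^sup>2) (X - y) = 0" if "y \<notin> ball x R" for y
  proof -
    have "y \<notin> ball X t" using that sub by auto
    then show ?thesis using t by (intro bump_scale_eq_0) (auto simp: dist_norm)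
  qed
  ultimately show ?thesis by (simp add: Lip_def)
qed

lemma lip_dist_test:
  assumes f: "f \<in> Lip x R" and R: "0 < R" and \<delta>: "lip_dist d x R \<mu> \<sigma> < ennreal \<delta>"
  shows "\<bar>(\<integral>y. f y \<partial>\<sigma>) - (\<integral>y. f y \<partial>\<mu>)\<bar> \<le> R ^ Suc d * \<delta>"
proof -
  let ?D = "\<bar>(\<integral>y. f y \<partial>\<sigma>) - (\<integral>y. f y \<partial>\<mu>)\<bar>"
  have "ennreal (R powr (- real d - 1) * ?D) = ennreal (R powr (- real d - 1)) * ennreal ?D"
    by (simp add: ennreal_mult)
  also have "\<dots> \<le> lip_dist d x R \<mu> \<sigma>"
    unfolding lip_dist_def by (intro mult_left_mono SUP_upper f) auto
  finally have "ennreal (R powr (- real d - 1) * ?D) < ennreal \<delta>" using \<delta> by (rule le_less_trans)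
  then have "R powr (- real d - 1) * ?D < \<delta>" by (simp add: ennreal_less_iff)
  moreover have "R powr (- real d - 1) = 1 / R ^ Suc d"
  proof -
    have "- real d - 1 = - real (Suc d)" by simp
    then show ?thesis using R by (simp only: powr_minus_divide powr_realpow)
  qed
  ultimately show ?thesis using R by (simp add: field_simps)
qed

context ahlfors begin

section \<open>Mass and first moment of \<sigma> at one scale\<close>

definition "m X t = (\<integral>y. bump (1 / t\<^sup>2) (X - y) \<partial>\<sigma>)"
definition "M X t = (\<integral>y. bump (1 / t\<^sup>2) (X - y) *\<^sub>R (X - y) \<partial>\<sigma>)"

definition "cU = C * 2 ^ d"
text \<open>If \<Gamma> comes within t / 2 of X, the ball of radius 3t/4 around X contains a ball of
  radius t / 4 centred on \<Gamma>, and there the bump is at least 1 - 9/16.\<close>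

definition "cL = 7 / 16 * (1 / 4) ^ d / C"

lemma m_le: "0 < t \<Longrightarrow> m X t \<le> cU * t ^ d"
proof -
  assume t: "0 < t"
  have "ennreal (m X t) = (\<integral>\<^sup>+y. ennreal (bump (1 / t\<^sup>2) (X - y)) \<partial>\<sigma>)"
    unfolding m_def using t by (intro nn_integral_eq_integral[symmetric] integrable_bump) (auto simp: bump_nonneg)
  also have "\<dots> \<le> ennreal (C * 2 ^ d * (1 / t\<^sup>2) powr (- (real d / 2)))"
    using t by (intro nn_integral_bump_le) auto
  also have "(1 / t\<^sup>2) powr (- (real d / 2)) = t ^ d"
  proof -
    have "1 / t\<^sup>2 = t powr (- 2)" using t by (simp add: powr_minus_divide)
    then show ?thesis using t by (simp add: powr_powr powr_realpow)
  qed
  finally show "m X t \<le> cU * t ^ d" using C_pos t by (subst (asm) ennreal_le_iff) (auto simp: cU_def)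
qed

lemma integrable_bump_vec: "0 < t \<Longrightarrow> integrable \<sigma> (\<lambda>y. bump (1 / t\<^sup>2) (X - y) *\<^sub>R (X - y))"
  and norm_bump_vec_le: "0 < t \<Longrightarrow> norm (bump (1 / t\<^sup>2) (X - y) *\<^sub>R (X - y)) \<le> t * bump (1 / t\<^sup>2) (X - y)"
proof -
  assume t: "0 < t"
  show *: "norm (bump (1 / t\<^sup>2) (X - y) *\<^sub>R (X - y)) \<le> t * bump (1 / t\<^sup>2) (X - y)" for y
  proof (cases "t \<le> norm (X - y)")
    case True
    then show ?thesis using bump_scale_eq_0[OF t, of "X - y"] by simp
  next
    case False
    then have "bump (1 / t\<^sup>2) (X - y) * norm (X - y) \<le> bump (1 / t\<^sup>2) (X - y) * t"
      by (intro mult_left_mono bump_nonneg) auto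
    then show ?thesis using bump_nonneg[of "1 / t\<^sup>2" "X - y"] by (simp add: mult.commute)
  qed
  show "integrable \<sigma> (\<lambda>y. bump (1 / t\<^sup>2) (X - y) *\<^sub>R (X - y))"
  proof (rule Bochner_Integration.integrable_bound)
    show "integrable \<sigma> (\<lambda>y. t * bump (1 / t\<^sup>2) (X - y))" using t by (intro integrable_mult_right integrable_bump) auto
    show "AE y in \<sigma>. norm (bump (1 / t\<^sup>2) (X - y) *\<^sub>R (X - y)) \<le> norm (t * bump (1 / t\<^sup>2) (X - y))"
      by (intro AE_I2 order_trans[OF *]) simp
  qed measurable
qed

lemma ball_mass_ge:
  assumes t: "0 < t" and y: "y \<in> \<Gamma>" "dist X y \<le> t / 2"
  shows "emeasure \<sigma> (ball X (3 * t / 4)) < \<infinity>" "(t / 4) ^ d / C \<le> measure \<sigma> (ball X (3 * t / 4))"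
proof -
  show fin: "emeasure \<sigma> (ball X (3 * t / 4)) < \<infinity>"
    using emeasure_ball_le[of "3 * t / 4" X] t by (simp add: le_less_trans)
  have "ball y (t / 4) \<subseteq> ball X (3 * t / 4)"
  proof
    fix z assume "z \<in> ball y (t / 4)"
    then show "z \<in> ball X (3 * t / 4)" using y(2) dist_triangle[of X z y] by simp
  qed
  then have "emeasure \<sigma> (ball y (t / 4)) \<le> emeasure \<sigma> (ball X (3 * t / 4))"
    by (intro emeasure_mono) (auto simp: sets_\<sigma>)
  then have "ennreal ((t / 4) ^ d / C) \<le> emeasure \<sigma> (ball X (3 * t / 4))"
    using emeasure_ball_ge[OF y(1), of "t / 4"] t by simp
  then show "(t / 4) ^ d / C \<le> measure \<sigma> (ball X (3 * t / 4))"
    using fin by (simp add: emeasure_eq_ennreal_measure ennreal_le_iff)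
qed

lemma bump_ge:
  assumes t: "0 < t" and z: "norm z < 3 * t / 4"
  shows "7 / 16 \<le> bump (1 / t\<^sup>2) z"
proof -
  have "(norm z)\<^sup>2 \<le> (3 * t / 4)\<^sup>2" using z by (intro power_mono) auto
  then have "(norm z)\<^sup>2 / t\<^sup>2 \<le> 9 / 16" using t by (simp add: divide_le_eq power_divide power_mult_distrib)
  then have "7 / 16 \<le> 1 - (norm z)\<^sup>2 / t\<^sup>2" by linarith
  then show ?thesis by (simp add: bump_def le_max_iff_disj)
qed

lemma cL_pos: "0 < cL" using C_pos by (simp add: cL_def)

text \<open>The second bound keeps the centre of mass strictly inside the support: |M| is at most
  the integral of |X - y| times the bump, and on the ball of radius 3t/4 the factor |X - y| stays
  below t by at least t / 4.\<close>

lemma m_ge: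
  assumes t: "0 < t" and y: "y \<in> \<Gamma>" "dist X y \<le> t / 2"
  shows "cL * t ^ d \<le> m X t" and "t / 4 * (cL * t ^ d) + norm (M X t) \<le> t * m X t"
proof -
  let ?B = "ball X (3 * t / 4)" and ?b = "\<lambda>y. bump (1 / t\<^sup>2) (X - y)"
  note B = ball_mass_ge[OF t y]
  have int: "integrable \<sigma> ?b" using t by (intro integrable_bump) auto
  have ind: "integrable \<sigma> (indicator ?B :: 'a \<Rightarrow> real)" using B(1) by (simp add: sets_\<sigma>)
  have cL: "cL * t ^ d = 7 / 16 * ((t / 4) ^ d / C)" by (simp add: cL_def power_divide)
  also have "\<dots> \<le> 7 / 16 * measure \<sigma> ?B" using B(2) by simp
  finally have le: "cL * t ^ d \<le> 7 / 16 * measure \<sigma> ?B" .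
  also have "\<dots> = (\<integral>y. 7 / 16 * indicator ?B y \<partial>\<sigma>)" using B(1) by (simp add: sets_\<sigma>)
  also have "\<dots> \<le> m X t"
    unfolding m_def
  proof (intro integral_mono integrable_mult_right ind int)
    fix y show "7 / 16 * indicator ?B y \<le> ?b y"
      using bump_ge[OF t, of "X - y"] bump_nonneg[of "1 / t\<^sup>2" "X - y"] by (auto simp: indicator_def dist_norm)
  qed
  finally show "cL * t ^ d \<le> m X t" .
  have "t / 4 * (cL * t ^ d) \<le> t / 4 * (7 / 16 * measure \<sigma> ?B)" using le t by (intro mult_left_mono) auto
  also have "\<dots> = (\<integral>y. t / 4 * (7 / 16) * indicator ?B y \<partial>\<sigma>)" using B(1) by (simp add: sets_\<sigma>)
  also have "\<dots> \<le> (\<integral>y. t * ?b y - norm (?b y *\<^sub>R (X - y)) \<partial>\<sigma>)"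
  proof (rule integral_mono)
    show "integrable \<sigma> (\<lambda>y. t / 4 * (7 / 16) * indicator ?B y :: real)" by (intro integrable_mult_right ind)
    show "integrable \<sigma> (\<lambda>y. t * ?b y - norm (?b y *\<^sub>R (X - y)))"
      by (intro Bochner_Integration.integrable_diff integrable_mult_right int integrable_norm integrable_bump_vec t)
    fix y
    show "t / 4 * (7 / 16) * indicator ?B y \<le> t * ?b y - norm (?b y *\<^sub>R (X - y))"
    proof (cases "y \<in> ?B")
      case True
      then have n: "norm (X - y) < 3 * t / 4" by (simp add: dist_norm)
      have "t / 4 * (7 / 16) \<le> (t - norm (X - y)) * ?b y"
        using n bump_ge[OF t n] t by (intro mult_mono) auto
      also have "\<dots> = t * ?b y - norm (?b y *\<^sub>R (X - y))"
        using bump_nonneg[of "1 / t\<^sup>2" "X - y"] by (simp add: left_diff_distrib mult.commute)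
      finally show ?thesis using True by simp
    qed (use norm_bump_vec_le[OF t, of X y] in simp)
  qed
  also have "\<dots> = t * m X t - (\<integral>y. norm (?b y *\<^sub>R (X - y)) \<partial>\<sigma>)"
    unfolding m_def
    by (subst Bochner_Integration.integral_diff)
      (auto intro!: integrable_mult_right int integrable_norm integrable_bump_vec t simp del: norm_scaleR)
  also have "\<dots> \<le> t * m X t - norm (M X t)"
    unfolding M_def using integral_norm_bound[of \<sigma> "\<lambda>y. ?b y *\<^sub>R (X - y)"] by simp
  finally show "t / 4 * (cL * t ^ d) + norm (M X t) \<le> t * m X t" by simp
qed

text \<open>X minus the centre of mass of the bump; in the flat case this is the displacement from
  the plane. \<open>dens\<close> is then fixed so that \<open>flat_mass\<close> with these
  parameters reproduces mass and moment of this scale exactly.\<close>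

definition "pos X t = (1 / m X t) *\<^sub>R M X t"
definition "dens X t = m X t / (t ^ d * profile d (norm (pos X t) / t))"
text \<open>The relative distance of the centre of mass from the edge of the support: the slack t /
  4 * cL * t^d of \<open>m_ge\<close> divided by the largest possible t * m. \<open>gap\<close> is
  the resulting lower bound of the profile.\<close>

definition "eta = cL / (4 * cU)"
definition "gap = profile d (1 - eta)"

lemma cU_pos: "0 < cU" using C_pos by (simp add: cU_def)

text \<open>The a priori bounds at one scale. The profile at the centre of mass is at least
  \<open>gap\<close>, so the division by it in \<open>dens\<close> costs only a constant.\<close>

lemma single_scale:
  assumes t: "0 < t" and y: "y \<in> \<Gamma>" "dist X y \<le> t / 2"
  shows "norm (pos X t) \<le> (1 - eta) * t" "0 < gap" "gap \<le> profile d (norm (pos X t) / t)"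
    "m X t = t ^ d * (dens X t * profile d (norm (pos X t) / t))"
    "M X t = (t ^ d * (dens X t * profile d (norm (pos X t) / t))) *\<^sub>R pos X t"
    "cL \<le> dens X t * profile d (norm (pos X t) / t)" "cL \<le> dens X t" "dens X t \<le> cU / gap"
    "norm (pos X t) \<le> t"
proof -
  have td: "0 < t ^ d" using t by simp
  have m: "cL * t ^ d \<le> m X t" "m X t \<le> cU * t ^ d" using m_ge(1)[OF t y] m_le[OF t] by auto
  have m0: "0 < m X t" using m(1) cL_pos td by (meson less_le_trans mult_pos_pos)
  have LU: "cL \<le> cU" using order_trans[OF m] td by simp
  have eta: "0 < eta" "eta \<le> 1 / 4" using cL_pos cU_pos LU by (auto simp: eta_def field_simps)
  have "norm (M X t) \<le> t * m X t - t / 4 * (cL * t ^ d)" using m_ge(2)[OF t y] by simp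
  also have "\<dots> \<le> t * m X t - t * (eta * m X t)"
  proof -
    have "eta * m X t \<le> eta * (cU * t ^ d)" using m(2) eta by (intro mult_left_mono) auto
    also have "\<dots> = cL * t ^ d / 4" using cU_pos by (simp add: eta_def)
    finally have "t * (eta * m X t) \<le> t * (cL * t ^ d / 4)" using t by (intro mult_left_mono) auto
    then show ?thesis by simp
  qed
  finally have "norm (M X t) \<le> (1 - eta) * t * m X t" by (simp add: algebra_simps)
  then show p: "norm (pos X t) \<le> (1 - eta) * t" using m0 by (simp add: pos_def divide_le_eq)
  show g: "0 < gap" unfolding gap_def using eta by (intro profile_pos) auto
  show gp: "gap \<le> profile d (norm (pos X t) / t)"
    unfolding gap_def using p t by (intro profile_antimono) (auto simp: divide_le_eq)
  then have pp: "0 < profile d (norm (pos X t) / t)" using g by simp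
  show meq: "m X t = t ^ d * (dens X t * profile d (norm (pos X t) / t))" using t pp by (simp add: dens_def)
  show "M X t = (t ^ d * (dens X t * profile d (norm (pos X t) / t))) *\<^sub>R pos X t"
    unfolding meq[symmetric] using m0 by (simp add: pos_def)
  have "t ^ d * cL \<le> t ^ d * (dens X t * profile d (norm (pos X t) / t))" using m(1) unfolding meq by (simp add: mult.commute)
  then show L: "cL \<le> dens X t * profile d (norm (pos X t) / t)" using td by simp
  have "t ^ d * (dens X t * profile d (norm (pos X t) / t)) \<le> t ^ d * cU" using m(2) unfolding meq by (simp add: mult.commute)
  then have U: "dens X t * profile d (norm (pos X t) / t) \<le> cU" using td by simp
  have d0: "0 \<le> dens X t" unfolding dens_def using m0 td pp by auto
  show "cL \<le> dens X t" using L mult_left_mono[OF profile_le_1 d0, of d "norm (pos X t) / t"] by simp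
  have "dens X t * gap \<le> cU" using U mult_left_mono[OF gp d0] by linarith
  then show "dens X t \<le> cU / gap" using g by (simp add: pos_le_divide_eq)
  show "norm (pos X t) \<le> t" using p eta t by (smt (verit) mult_le_cancel_right1)
qed

end

section \<open>Comparison of scales\<close>

text \<open>Truncation at 1 makes \<alpha> a real number and the weighted series below summable.
  Where \<alpha> is not small, a priori bounds take over, so no strength is lost.\<close>

definition alpha1 :: "nat \<Rightarrow> 'a::euclidean_space measure \<Rightarrow> 'a \<Rightarrow> real \<Rightarrow> real" where
  "alpha1 d \<sigma> y s = enn2real (min 1 (alpha d \<sigma> y s))"

lemma alpha1_nonneg: "0 \<le> alpha1 d \<sigma> y s" and alpha1_le_1: "alpha1 d \<sigma> y s \<le> 1"
  and ennreal_alpha1: "ennreal (alpha1 d \<sigma> y s) = min 1 (alpha d \<sigma> y s)"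
proof -
  have "min 1 (alpha d \<sigma> y s) < top" by (rule le_less_trans[of _ 1]) auto
  then show e: "ennreal (alpha1 d \<sigma> y s) = min 1 (alpha d \<sigma> y s)" by (simp add: alpha1_def)
  show "0 \<le> alpha1 d \<sigma> y s" by (simp add: alpha1_def)
  have "ennreal (alpha1 d \<sigma> y s) \<le> 1" unfolding e by simp
  then show "alpha1 d \<sigma> y s \<le> 1" by (simp add: ennreal_le_1)
qed

lemma alpha_less_ennreal:
  assumes "alpha1 d \<sigma> y s < \<delta>" "\<delta> \<le> 1"
  shows "alpha d \<sigma> y s < ennreal \<delta>"
proof -
  have "min 1 (alpha d \<sigma> y s) < ennreal \<delta>"
    using assms(1) alpha1_nonneg[of d \<sigma> y s] unfolding ennreal_alpha1[symmetric] by (simp add: ennreal_less_iff)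
  moreover have "ennreal \<delta> \<le> 1" using assms(2) by (simp add: ennreal_le_1)
  ultimately show ?thesis by (auto simp: min_less_iff_disj)
qed

context ahlfors begin

text \<open>3 undoes the normalisation of the moment test function; 16 is the radius 2 * t0 of the
  test ball divided by the smallest scale t0 / 8.\<close>

definition "test = (3::real) * 16 ^ Suc d"

lemma test_pos: "0 < test" by (simp add: test_def)

text \<open>One nearly optimal flat measure for the ball of radius 2 * t0 around y serves all scales
  between t0 / 8 and t0, since all these bumps around X are supported in that ball.\<close>

lemma flat_test:
  assumes t0: "0 < t0" and y: "dist X y \<le> t0 / 2" and \<delta>: "alpha d \<sigma> y (2 * t0) < ennreal \<delta>"
  obtains c w where "0 \<le> c"
    "\<And>t. t0 / 8 \<le> t \<Longrightarrow> t \<le> t0 \<Longrightarrow> \<bar>m X t - t ^ d * (c * profile d (norm w / t))\<bar> \<le> test * \<delta> * t ^ d"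
    "\<And>t. t0 / 8 \<le> t \<Longrightarrow> t \<le> t0 \<Longrightarrow>
      norm (M X t - (t ^ d * (c * profile d (norm w / t))) *\<^sub>R w) \<le> test * \<delta> * (t ^ d * t)"
proof -
  obtain \<mu> where \<mu>: "\<mu> \<in> flat_measures d" "lip_dist d y (2 * t0) \<mu> \<sigma> < ennreal \<delta>"
    using \<delta> unfolding alpha_def INF_less_iff by blast
  have \<delta>0: "0 < \<delta>" using \<mu>(2) by (cases "0 < \<delta>") (auto simp: ennreal_neg not_less)
  obtain c w where c: "0 \<le> c" and mass: "\<And>v. 0 < v \<Longrightarrow> (\<integral>y. bump v (X - y) \<partial>\<mu>) = flat_mass d c w v"
    and moment: "\<And>v e. 0 < v \<Longrightarrow> (\<integral>y. bump v (X - y) * ((X - y) \<bullet> e) \<partial>\<mu>) = flat_mass d c w v * (w \<bullet> e)"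
    by (rule flat_measure_mass[OF d_pos \<mu>(1), of X]) (rule that; assumption)
  have R: "(2 * t0) ^ Suc d * \<delta> \<le> 16 ^ Suc d * \<delta> * (t ^ d * t)" if t: "t0 / 8 \<le> t" for t
  proof -
    have "(2 * t0) ^ Suc d \<le> (16 * t) ^ Suc d" using t t0 by (intro power_mono) auto
    then have "(2 * t0) ^ Suc d * \<delta> \<le> (16 * t) ^ Suc d * \<delta>" using \<delta>0 by (intro mult_right_mono) auto
    also have "\<dots> = 16 ^ Suc d * \<delta> * (t ^ d * t)" by (simp add: power_mult_distrib)
    finally show ?thesis .
  qed
  have sub: "ball X t \<subseteq> ball y (2 * t0)" if "t \<le> t0" for t
  proof
    fix z assume "z \<in> ball X t"
    then show "z \<in> ball y (2 * t0)" using y that t0 dist_triangle[of y z X] by (simp add: dist_commute)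
  qed
  show ?thesis
  proof (rule that[OF c])
    fix t assume t: "t0 / 8 \<le> t" "t \<le> t0"
    have tp: "0 < t" using t t0 by linarith
    then have fm: "flat_mass d c w (1 / t\<^sup>2) = t ^ d * (c * profile d (norm w / t))"
      by (simp add: flat_mass_profile mult_ac)
    have v: "0 < 1 / t\<^sup>2" using tp by simp
    have "\<bar>(\<integral>y. t / 2 * bump (1 / t\<^sup>2) (X - y) \<partial>\<sigma>) - (\<integral>y. t / 2 * bump (1 / t\<^sup>2) (X - y) \<partial>\<mu>)\<bar> \<le> (2 * t0) ^ Suc d * \<delta>"
      using t0 by (intro lip_dist_test[OF bump_Lip[OF tp sub[OF t(2)]] _ \<mu>(2)]) auto
    also have "\<dots> \<le> 16 ^ Suc d * \<delta> * (t ^ d * t)" by (rule R[OF t(1)])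
    finally have "\<bar>t / 2 * m X t - t / 2 * flat_mass d c w (1 / t\<^sup>2)\<bar> \<le> 16 ^ Suc d * \<delta> * (t ^ d * t)"
      unfolding m_def integral_mult_right_zero mass[OF v] .
    also have "\<dots> = t / 2 * (2 * 16 ^ Suc d * \<delta> * t ^ d)" by simp
    also have "t / 2 * m X t - t / 2 * flat_mass d c w (1 / t\<^sup>2) = t / 2 * (m X t - flat_mass d c w (1 / t\<^sup>2))"
      by (simp add: right_diff_distrib)
    also have "\<bar>t / 2 * (m X t - flat_mass d c w (1 / t\<^sup>2))\<bar> = t / 2 * \<bar>m X t - flat_mass d c w (1 / t\<^sup>2)\<bar>"
      using tp by (simp add: abs_mult)
    finally have "\<bar>m X t - flat_mass d c w (1 / t\<^sup>2)\<bar> \<le> 2 * 16 ^ Suc d * \<delta> * t ^ d"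
      using tp by (simp only: mult_le_cancel_left_pos half_gt_zero)
    also have "\<dots> \<le> test * \<delta> * t ^ d" using \<delta>0 tp by (intro mult_right_mono) (auto simp: test_def)
    finally show "\<bar>m X t - t ^ d * (c * profile d (norm w / t))\<bar> \<le> test * \<delta> * t ^ d" unfolding fm .
    \<comment> \<open>Testing in the direction of the error vector itself turns its norm into a
      scalar integral.\<close>
    define u where "u = M X t - (t ^ d * (c * profile d (norm w / t))) *\<^sub>R w"
    have "\<bar>(\<integral>y. bump (1 / t\<^sup>2) (X - y) * ((X - y) \<bullet> sgn u) / 3 \<partial>\<sigma>) - (\<integral>y. bump (1 / t\<^sup>2) (X - y) * ((X - y) \<bullet> sgn u) / 3 \<partial>\<mu>)\<bar>
      \<le> (2 * t0) ^ Suc d * \<delta>"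
      using t0 by (intro lip_dist_test[OF bump_inner_Lip[OF tp _ sub[OF t(2)]] _ \<mu>(2)]) (auto simp: norm_sgn)
    also have "\<dots> \<le> 16 ^ Suc d * \<delta> * (t ^ d * t)" by (rule R[OF t(1)])
    also have "(\<integral>y. bump (1 / t\<^sup>2) (X - y) * ((X - y) \<bullet> sgn u) / 3 \<partial>\<mu>) = flat_mass d c w (1 / t\<^sup>2) * (w \<bullet> sgn u) / 3"
      unfolding integral_divide_zero moment[OF v] ..
    also have "(\<integral>y. bump (1 / t\<^sup>2) (X - y) * ((X - y) \<bullet> sgn u) / 3 \<partial>\<sigma>) = (M X t \<bullet> sgn u) / 3"
      unfolding integral_divide_zero M_def
      using integral_inner_left[of "sgn u", OF integrable_bump_vec[OF tp, of X]] by simp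
    finally have "\<bar>M X t \<bullet> sgn u - flat_mass d c w (1 / t\<^sup>2) * (w \<bullet> sgn u)\<bar> \<le> 3 * (16 ^ Suc d * \<delta> * (t ^ d * t))"
      by linarith
    moreover have "M X t \<bullet> sgn u - flat_mass d c w (1 / t\<^sup>2) * (w \<bullet> sgn u) = u \<bullet> sgn u"
      unfolding u_def fm by (simp add: inner_diff_left)
    moreover have "u \<bullet> sgn u = norm u"
      by (cases "u = 0") (auto simp: sgn_div_norm power2_norm_eq_inner[symmetric] power2_eq_square)
    ultimately show "norm (M X t - (t ^ d * (c * profile d (norm w / t))) *\<^sub>R w) \<le> test * \<delta> * (t ^ d * t)"
      unfolding u_def[symmetric] by (simp add: test_def)
  qed
qed

definition "densU = cU / gap"
definition "lipL = 3 * (2 + real d) / cL"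
definition "stabW = 3 / cL"
definition "stabC = 2 / gap * (1 + densU * lipL)"
text \<open>Threshold for comparison with a nearly optimal flat measure: the second entry keeps its
  plane within 2 * t0 of X, the third is the smallness condition of
  \<open>flat_stability\<close>.\<close>

definition "smallA = min 1 (min (cL / (2 * test)) (gap / (2 * lipL * test)))"
definition "boundA = stabC * test + densU * ((2 + real d) * (8 * (stabW * test)))"
text \<open>The first summand is a trivial bound divided by the threshold, for large \<delta>; the
  other summands cover small \<delta>.\<close>

definition "constA = (cU + 9 * densU) / smallA + (test + 16 * boundA + 8 * (densU * (stabW * test)))"

lemma lipL_pos: "0 < lipL" using cL_pos by (auto simp: lipL_def intro!: divide_pos_pos)
lemma stabW_pos: "0 < stabW" using cL_pos by (auto simp: stabW_def intro!: divide_pos_pos)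

lemma const_pos:
  assumes "0 < gap"
  shows "0 < stabC" "0 < smallA" "0 < boundA" "0 < constA" "0 < densU"
proof -
  show k: "0 < densU" using assms cU_pos by (simp add: densU_def)
  show sC: "0 < stabC" unfolding stabC_def using k lipL_pos assms by (intro mult_pos_pos divide_pos_pos add_pos_pos) auto
  show sA: "0 < smallA" unfolding smallA_def using assms cL_pos lipL_pos test_pos by auto
  show bA: "0 < boundA" unfolding boundA_def using sC k test_pos stabW_pos by (intro add_pos_pos mult_pos_pos add_pos_nonneg) auto
  have "0 < (cU + 9 * densU) / smallA" using k sA cU_pos by (intro divide_pos_pos add_pos_pos) auto
  moreover have "0 < densU * (stabW * test)" using k stabW_pos test_pos by (intro mult_pos_pos)
  ultimately show "0 < constA" unfolding constA_def using bA test_pos by linarith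
qed

text \<open>The plane is read off \<open>\<sigma>\<close> itself through the first moment, so no bound on an almost
  optimal flat measure is needed when \<open>\<alpha>\<close> is not small.\<close>

lemma scale_approx_aux:
  assumes t0: "0 < t0" and y: "y \<in> \<Gamma>" "dist X y \<le> t0 / 2" and \<delta>: "alpha1 d \<sigma> y (2 * t0) < \<delta>"
    and t: "t0 / 8 \<le> t" "t \<le> t0"
  shows "\<bar>m X t - t ^ d * (dens X t0 * profile d (norm (pos X t0) / t))\<bar> \<le> constA * \<delta> * t ^ d"
    and "norm (M X t - (t ^ d * (dens X t0 * profile d (norm (pos X t0) / t))) *\<^sub>R pos X t0) \<le> constA * \<delta> * (t ^ d * t)"
proof -
  note s0 = single_scale[OF t0 y]
  note cp = const_pos[OF s0(2)]
  define c where "c = dens X t0"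
  define w where "w = pos X t0"
  have c: "0 \<le> c" "c \<le> densU" using s0 cL_pos by (auto simp: c_def densU_def)
  have w: "norm w \<le> t0" using s0 by (simp add: w_def)
  have tp: "0 < t" "t0 \<le> 8 * t" using t t0 by auto
  have td: "0 < t ^ d" using tp by simp
  have \<delta>0: "0 < \<delta>" using \<delta> alpha1_nonneg[of d \<sigma> y "2 * t0"] by linarith
  have cG: "0 \<le> c * profile d (norm w / t)" "c * profile d (norm w / t) \<le> densU"
    using c profile_nonneg[of d "norm w / t"] mult_left_mono[OF profile_le_1 c(1), of d "norm w / t"] by (auto simp: mult_nonneg_nonneg)
  have "\<bar>m X t - t ^ d * (c * profile d (norm w / t))\<bar> \<le> constA * \<delta> * t ^ d \<and>
    norm (M X t - (t ^ d * (c * profile d (norm w / t))) *\<^sub>R w) \<le> constA * \<delta> * (t ^ d * t)"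
  proof (cases "smallA \<le> \<delta>")
    \<comment> \<open>\<delta> is not small, and the sizes of \<sigma> and of the plane read off
      from it give the bound.\<close>
    case True
    have m: "0 \<le> m X t" "m X t \<le> cU * t ^ d"
      using m_le[OF tp(1)] by (auto simp: m_def intro!: Bochner_Integration.integral_nonneg bump_nonneg)
    have "(cU + 9 * densU) / smallA * smallA \<le> constA * \<delta>"
    proof (intro mult_mono)
      have "0 \<le> test + 16 * boundA + 8 * (densU * (stabW * test))"
        using cp test_pos stabW_pos by (intro add_nonneg_nonneg mult_nonneg_nonneg) auto
      then show "(cU + 9 * densU) / smallA \<le> constA" unfolding constA_def by linarith
    qed (use True cp in auto)
    then have big: "cU + 9 * densU \<le> constA * \<delta>" using cp by simp
    have "\<bar>m X t - t ^ d * (c * profile d (norm w / t))\<bar> \<le> m X t + t ^ d * (c * profile d (norm w / t))"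
      using m(1) cG(1) td by (simp add: abs_le_iff)
    also have "\<dots> \<le> cU * t ^ d + t ^ d * densU" using m cG td by (intro add_mono mult_left_mono) auto
    also have "\<dots> = (cU + densU) * t ^ d" by (simp add: algebra_simps)
    also have "\<dots> \<le> (constA * \<delta>) * t ^ d" using big td cp by (intro mult_right_mono) auto
    finally have 1: "\<bar>m X t - t ^ d * (c * profile d (norm w / t))\<bar> \<le> constA * \<delta> * t ^ d" .
    have "norm (M X t) \<le> (\<integral>y. t * bump (1 / t\<^sup>2) (X - y) \<partial>\<sigma>)"
      unfolding M_def using tp
      by (intro order_trans[OF integral_norm_bound] integral_mono integrable_norm integrable_bump_vec
          integrable_mult_right integrable_bump norm_bump_vec_le) auto
    also have "\<dots> = t * m X t" by (simp add: m_def)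
    also have "\<dots> \<le> t * (cU * t ^ d)" using m tp by (intro mult_left_mono) auto
    finally have Mb: "norm (M X t) \<le> cU * (t ^ d * t)" by (simp add: mult_ac)
    have "norm (M X t - (t ^ d * (c * profile d (norm w / t))) *\<^sub>R w)
      \<le> norm (M X t) + norm ((t ^ d * (c * profile d (norm w / t))) *\<^sub>R w)" by (rule norm_triangle_ineq4)
    also have "norm ((t ^ d * (c * profile d (norm w / t))) *\<^sub>R w) = (t ^ d * (c * profile d (norm w / t))) * norm w"
      using cG td by simp
    also have "\<dots> \<le> (t ^ d * densU) * (8 * t)"
      using cG td w tp cp by (intro mult_mono mult_left_mono mult_nonneg_nonneg) auto
    also have "norm (M X t) + (t ^ d * densU) * (8 * t) \<le> cU * (t ^ d * t) + (t ^ d * densU) * (8 * t)"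
      using Mb by simp
    also have "\<dots> = (cU + 8 * densU) * (t ^ d * t)" by (simp add: algebra_simps)
    also have "\<dots> \<le> (constA * \<delta>) * (t ^ d * t)" using big td tp cp by (intro mult_right_mono) auto
    finally show ?thesis using 1 by simp
  next
    case False
    then have small: "\<delta> \<le> 1" "\<delta> < cL / (2 * test)" "\<delta> < gap / (2 * lipL * test)" by (auto simp: smallA_def)
    obtain c' w' where c': "0 \<le> c'"
      and mass: "\<And>t. t0 / 8 \<le> t \<Longrightarrow> t \<le> t0 \<Longrightarrow> \<bar>m X t - t ^ d * (c' * profile d (norm w' / t))\<bar> \<le> test * \<delta> * t ^ d"
      and moment: "\<And>t. t0 / 8 \<le> t \<Longrightarrow> t \<le> t0 \<Longrightarrow>
        norm (M X t - (t ^ d * (c' * profile d (norm w' / t))) *\<^sub>R w') \<le> test * \<delta> * (t ^ d * t)"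
      by (rule flat_test[OF t0 y(2) alpha_less_ennreal[OF \<delta> small(1)]]) (rule that; assumption)
    have t0d: "0 < t0 ^ d" using t0 by simp
    have mass0: "\<bar>c * profile d (norm w / t0) - c' * profile d (norm w' / t0)\<bar> \<le> test * \<delta>"
    proof -
      have "\<bar>t0 ^ d * (c * profile d (norm w / t0)) - t0 ^ d * (c' * profile d (norm w' / t0))\<bar> \<le> test * \<delta> * t0 ^ d"
        using mass[of t0] t0 s0(4) by (simp add: c_def w_def)
      then have "t0 ^ d * \<bar>c * profile d (norm w / t0) - c' * profile d (norm w' / t0)\<bar> \<le> t0 ^ d * (test * \<delta>)"
        using t0d by (simp add: abs_mult mult.commute flip: right_diff_distrib)
      then show ?thesis using t0d by simp
    qed
    have moment0: "norm ((c * profile d (norm w / t0)) *\<^sub>R w - (c' * profile d (norm w' / t0)) *\<^sub>R w') \<le> test * \<delta> * t0"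
    proof -
      have "norm (t0 ^ d *\<^sub>R ((c * profile d (norm w / t0)) *\<^sub>R w - (c' * profile d (norm w' / t0)) *\<^sub>R w')) \<le> test * \<delta> * (t0 ^ d * t0)"
        using moment[of t0] t0 s0(5) by (simp add: c_def w_def scaleR_diff_right)
      then have "t0 ^ d * norm ((c * profile d (norm w / t0)) *\<^sub>R w - (c' * profile d (norm w' / t0)) *\<^sub>R w') \<le> t0 ^ d * (test * \<delta> * t0)"
        using t0d by (simp add: mult_ac)
      then show ?thesis using t0d by simp
    qed
    \<comment> \<open>A plane that far away has no bump mass at scale t0, whereas \<sigma> has at
      least cL * t0^d.\<close>
    have w't: "norm w' \<le> 2 * t0"
    proof (rule ccontr)
      assume "\<not> norm w' \<le> 2 * t0"
      then have "profile d (norm w' / t0) = 0" using t0 by (intro profile_eq_0) (simp add: le_divide_eq)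
      then have "cL \<le> test * \<delta>" using mass0 s0(6) by (simp add: c_def w_def)
      then show False using small(2) test_pos cL_pos by (simp add: less_divide_eq mult_ac)
    qed
    have sm: "3 * (2 + real d) / cL * (test * \<delta>) \<le> gap / 2"
    proof -
      have "\<delta> * (2 * lipL * test) \<le> gap" using small(3) lipL_pos test_pos by (simp add: less_divide_eq)
      then show ?thesis unfolding lipL_def[symmetric] by (simp add: mult_ac)
    qed
    have st: "norm (w - w') \<le> stabW * (test * \<delta>) * t0" "\<bar>c - c'\<bar> \<le> stabC * (test * \<delta>)"
      unfolding stabW_def stabC_def lipL_def
      by (rule flat_stability[OF t0 cL_pos _ s0(2) _ c(1,2) c' w't sm mass0 moment0];
          use s0 in \<open>simp add: c_def w_def\<close>)+
    have wt: "norm (w - w') / t \<le> 8 * (stabW * test) * \<delta>"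
    proof -
      have "stabW * (test * \<delta>) * t0 \<le> stabW * (test * \<delta>) * (8 * t)"
        using tp stabW_pos test_pos \<delta>0 by (intro mult_left_mono) auto
      then have "norm (w - w') \<le> stabW * (test * \<delta>) * (8 * t)" using st(1) by linarith
      then show ?thesis using tp by (simp add: divide_le_eq mult_ac)
    qed
    \<comment> \<open>Stability at scale t0 makes the two planes close, hence also their masses at
      scale t; t0 / t is at most 8.\<close>
    have fd: "\<bar>c * profile d (norm w / t) - c' * profile d (norm w' / t)\<bar> \<le> boundA * \<delta>"
    proof -
      have "\<bar>c * profile d (norm w / t) - c' * profile d (norm w' / t)\<bar> \<le> \<bar>c - c'\<bar> + c * ((2 + real d) * (norm (w - w') / t))"
        by (rule flat_diff_le[OF tp(1) c(1)])
      also have "\<dots> \<le> stabC * (test * \<delta>) + densU * ((2 + real d) * (8 * (stabW * test) * \<delta>))"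
        using st(2) c wt cp tp by (intro add_mono mult_mono mult_left_mono) auto
      finally show ?thesis by (simp add: boundA_def algebra_simps)
    qed
    have "\<bar>m X t - t ^ d * (c * profile d (norm w / t))\<bar>
      \<le> \<bar>m X t - t ^ d * (c' * profile d (norm w' / t))\<bar> + \<bar>t ^ d * (c * profile d (norm w / t)) - t ^ d * (c' * profile d (norm w' / t))\<bar>"
      by linarith
    also have "\<bar>t ^ d * (c * profile d (norm w / t)) - t ^ d * (c' * profile d (norm w' / t))\<bar>
      = t ^ d * \<bar>c * profile d (norm w / t) - c' * profile d (norm w' / t)\<bar>"
      using td by (simp add: abs_mult flip: right_diff_distrib)
    also have "\<bar>m X t - t ^ d * (c' * profile d (norm w' / t))\<bar> + \<dots> \<le> test * \<delta> * t ^ d + t ^ d * (boundA * \<delta>)"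
      using mass[OF t] fd td by (intro add_mono mult_left_mono) auto
    also have "\<dots> = (test + boundA) * \<delta> * t ^ d" by (simp add: algebra_simps)
    also have "\<dots> \<le> constA * \<delta> * t ^ d"
    proof (intro mult_right_mono)
      have "0 \<le> (cU + 9 * densU) / smallA" "0 \<le> densU * (stabW * test)"
        using cp cU_pos stabW_pos test_pos by (auto intro!: divide_nonneg_nonneg add_nonneg_nonneg mult_nonneg_nonneg simp: less_imp_le)
      then show "test + boundA \<le> constA" unfolding constA_def using cp(3) by linarith
    qed (use \<delta>0 td in auto)
    finally have 1: "\<bar>m X t - t ^ d * (c * profile d (norm w / t))\<bar> \<le> constA * \<delta> * t ^ d" .
    let ?a = "c * profile d (norm w / t)" and ?a' = "c' * profile d (norm w' / t)"
    have "norm (?a *\<^sub>R w - ?a' *\<^sub>R w') \<le> \<bar>?a - ?a'\<bar> * norm w' + ?a * norm (w - w')"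
      by (rule scaleR_diff_le[OF cG(1)])
    also have "\<bar>?a - ?a'\<bar> * norm w' \<le> (boundA * \<delta>) * (16 * t)"
      using fd w't tp cp \<delta>0 by (intro mult_mono) auto
    also have "?a * norm (w - w') \<le> densU * (8 * (stabW * test) * \<delta> * t)"
      using cG wt tp cp by (intro mult_mono) (auto simp: divide_le_eq)
    finally have va: "norm (?a *\<^sub>R w - ?a' *\<^sub>R w') \<le> (boundA * \<delta>) * (16 * t) + densU * (8 * (stabW * test) * \<delta> * t)"
      by simp
    have "M X t - (t ^ d * ?a) *\<^sub>R w = (M X t - (t ^ d * ?a') *\<^sub>R w') - t ^ d *\<^sub>R (?a *\<^sub>R w - ?a' *\<^sub>R w')"
      by (simp add: scaleR_diff_right)
    then have "norm (M X t - (t ^ d * ?a) *\<^sub>R w) \<le> norm (M X t - (t ^ d * ?a') *\<^sub>R w') + norm (t ^ d *\<^sub>R (?a *\<^sub>R w - ?a' *\<^sub>R w'))"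
      by (simp only: norm_triangle_ineq4)
    also have "norm (t ^ d *\<^sub>R (?a *\<^sub>R w - ?a' *\<^sub>R w')) = t ^ d * norm (?a *\<^sub>R w - ?a' *\<^sub>R w')" using td by simp
    also have "norm (M X t - (t ^ d * ?a') *\<^sub>R w') + t ^ d * norm (?a *\<^sub>R w - ?a' *\<^sub>R w')
      \<le> test * \<delta> * (t ^ d * t) + t ^ d * ((boundA * \<delta>) * (16 * t) + densU * (8 * (stabW * test) * \<delta> * t))"
      using moment[OF t] va td by (intro add_mono mult_left_mono) auto
    also have "\<dots> = (test + 16 * boundA + 8 * (densU * (stabW * test))) * \<delta> * (t ^ d * t)" by (simp add: algebra_simps)
    also have "\<dots> \<le> constA * \<delta> * (t ^ d * t)"
    proof (intro mult_right_mono)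
      have "0 \<le> (cU + 9 * densU) / smallA"
        using cp cU_pos by (auto intro!: divide_nonneg_nonneg add_nonneg_nonneg simp: less_imp_le)
      then show "test + 16 * boundA + 8 * (densU * (stabW * test)) \<le> constA" unfolding constA_def by linarith
    qed (use \<delta>0 td tp in auto)
    finally show ?thesis using 1 by simp
  qed
  then show "\<bar>m X t - t ^ d * (dens X t0 * profile d (norm (pos X t0) / t))\<bar> \<le> constA * \<delta> * t ^ d"
    "norm (M X t - (t ^ d * (dens X t0 * profile d (norm (pos X t0) / t))) *\<^sub>R pos X t0) \<le> constA * \<delta> * (t ^ d * t)"
    by (auto simp: c_def w_def)
qed

end

text \<open>The infimum in \<open>alpha\<close> need not be attained, so estimates are available for
  every \<delta> above \<alpha>; here \<delta> decreases to \<alpha>.\<close>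

lemma le_mult_limit:
  fixes L K B \<alpha> :: real
  assumes "\<And>\<delta>. \<alpha> < \<delta> \<Longrightarrow> L \<le> K * \<delta> * B"
  shows "L \<le> K * \<alpha> * B"
proof (rule tendsto_lowerbound)
  show "((\<lambda>\<delta>. K * \<delta> * B) \<longlongrightarrow> K * \<alpha> * B) (at_right \<alpha>)" by (intro tendsto_intros)
  show "\<forall>\<^sub>F \<delta> in at_right \<alpha>. L \<le> K * \<delta> * B"
    using assms by (auto simp: eventually_at_filter)
qed simp

text \<open>For j \<le> k one has 1 \<le> 2^(\<epsilon>(k-j)). An unweighted sum up to k is thus
  traded for one fixed convergent series, at the price 2^(\<epsilon>k).\<close>

lemma sum_le_weighted_suminf:
  fixes f :: "nat \<Rightarrow> real"
  assumes f: "\<And>j. 0 \<le> f j" "\<And>j. f j \<le> 1" and \<epsilon>: "0 < \<epsilon>"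
  shows "summable (\<lambda>j. 2 powr (- \<epsilon> * real j) * f j)"
    and "(\<Sum>j\<le>k. f j) \<le> 2 powr (\<epsilon> * real k) * (\<Sum>j. 2 powr (- \<epsilon> * real j) * f j)"
proof -
  have g: "2 powr (- \<epsilon> * real j) = (2 powr (- \<epsilon>)) ^ j" for j by (simp add: powr_powr flip: powr_realpow)
  have "2 powr (- \<epsilon>) < 1" using \<epsilon> by (simp add: powr_less_one)
  then have "summable (\<lambda>j. (2 powr (- \<epsilon>)) ^ j :: real)" by (intro summable_geometric) auto
  then show s: "summable (\<lambda>j. 2 powr (- \<epsilon> * real j) * f j)"
    unfolding g by (rule summable_comparison_test') (use f in \<open>auto simp: mult_left_le\<close>)
  have "(\<Sum>j\<le>k. f j) \<le> (\<Sum>j\<le>k. 2 powr (\<epsilon> * real k) * (2 powr (- \<epsilon> * real j) * f j))"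
  proof (rule sum_mono)
    fix j assume "j \<in> {..k}"
    then have "1 \<le> (2::real) powr (\<epsilon> * real k + (- \<epsilon> * real j))"
      using \<epsilon> by (intro ge_one_powr_ge_zero) (auto simp: mult_left_mono)
    then have "1 * f j \<le> 2 powr (\<epsilon> * real k + (- \<epsilon> * real j)) * f j" using f(1) by (intro mult_right_mono) auto
    then show "f j \<le> 2 powr (\<epsilon> * real k) * (2 powr (- \<epsilon> * real j) * f j)" by (simp only: powr_add mult_1 mult.assoc)
  qed
  also have "\<dots> = 2 powr (\<epsilon> * real k) * (\<Sum>j\<le>k. 2 powr (- \<epsilon> * real j) * f j)" by (simp only: sum_distrib_left)
  also have "\<dots> \<le> 2 powr (\<epsilon> * real k) * (\<Sum>j. 2 powr (- \<epsilon> * real j) * f j)"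
    using f s by (intro mult_left_mono sum_le_suminf) auto
  finally show "(\<Sum>j\<le>k. f j) \<le> 2 powr (\<epsilon> * real k) * (\<Sum>j. 2 powr (- \<epsilon> * real j) * f j)" .
qed

context ahlfors begin

section \<open>Telescoping the planes over dyadic scales\<close>

lemma scale_approx:
  assumes t0: "0 < t0" and y: "y \<in> \<Gamma>" "dist X y \<le> t0 / 2" and t: "t0 / 8 \<le> t" "t \<le> t0"
  shows "\<bar>m X t - t ^ d * (dens X t0 * profile d (norm (pos X t0) / t))\<bar> \<le> constA * alpha1 d \<sigma> y (2 * t0) * t ^ d"
    and "norm (M X t - (t ^ d * (dens X t0 * profile d (norm (pos X t0) / t))) *\<^sub>R pos X t0)
      \<le> constA * alpha1 d \<sigma> y (2 * t0) * (t ^ d * t)"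
  by (rule le_mult_limit, rule scale_approx_aux[OF t0 y _ t], assumption)+

text \<open>The last summand is for \<alpha> that is not small: the densities differ by at most
  \<open>densU\<close> and the displacements by at most 3t.\<close>

definition "constB = stabW * constA + stabC * constA + (3 + densU) * (2 * lipL * constA / gap)"

text \<open>At scale t, the plane of scale t reproduces mass and moment exactly and the plane of
  scale 2t does so up to \<alpha> at radius 4t; stability compares the two.\<close>

lemma scale_step:
  assumes t: "0 < t" and y: "y \<in> \<Gamma>" "dist X y \<le> t / 2"
  shows "\<bar>dens X t - dens X (2 * t)\<bar> \<le> constB * alpha1 d \<sigma> y (4 * t)"
    and "norm (pos X t - pos X (2 * t)) \<le> constB * alpha1 d \<sigma> y (4 * t) * t"
proof -
  define \<alpha> where "\<alpha> = alpha1 d \<sigma> y (4 * t)"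
  have \<alpha>0: "0 \<le> \<alpha>" by (simp add: \<alpha>_def alpha1_nonneg)
  have t2: "0 < 2 * t" and y2: "dist X y \<le> 2 * t / 2" using t y by auto
  note s1 = single_scale[OF t y]
  note s2 = single_scale[OF t2 y(1) y2]
  note cp = const_pos[OF s1(2)]
  have td: "0 < t ^ d" using t by simp
  have c1: "0 \<le> dens X t" "dens X t \<le> densU" using s1 cL_pos by (auto simp: densU_def)
  have c2: "0 \<le> dens X (2 * t)" "dens X (2 * t) \<le> densU" using s2 cL_pos by (auto simp: densU_def)
  define p where "p = stabW * constA"
  define q where "q = stabC * constA"
  define h where "h = 2 * lipL * constA / gap"
  have pqh: "0 \<le> p" "0 \<le> q" "0 \<le> h" "constB = p + q + (3 + densU) * h"
    using cp stabW_pos lipL_pos s1(2) unfolding p_def q_def h_def constB_def by (auto intro!: mult_nonneg_nonneg divide_nonneg_nonneg less_imp_le)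
  have dh: "0 \<le> densU * h" using pqh cp by simp
  have "\<bar>dens X t - dens X (2 * t)\<bar> \<le> constB * \<alpha> \<and> norm (pos X t - pos X (2 * t)) \<le> constB * \<alpha> * t"
  proof (cases "lipL * (constA * \<alpha>) \<le> gap / 2")
    case True
    have mass: "\<bar>dens X t * profile d (norm (pos X t) / t) - dens X (2 * t) * profile d (norm (pos X (2 * t)) / t)\<bar> \<le> constA * \<alpha>"
    proof -
      have "\<bar>t ^ d * (dens X t * profile d (norm (pos X t) / t)) - t ^ d * (dens X (2 * t) * profile d (norm (pos X (2 * t)) / t))\<bar>
          \<le> constA * \<alpha> * t ^ d"
        using scale_approx(1)[OF t2 y(1) y2, of t] t s1(4) by (simp add: \<alpha>_def)
      then have "t ^ d * \<bar>dens X t * profile d (norm (pos X t) / t) - dens X (2 * t) * profile d (norm (pos X (2 * t)) / t)\<bar> \<le> t ^ d * (constA * \<alpha>)"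
        using td by (simp add: abs_mult mult.commute flip: right_diff_distrib)
      then show ?thesis using td by simp
    qed
    have moment: "norm ((dens X t * profile d (norm (pos X t) / t)) *\<^sub>R pos X t
        - (dens X (2 * t) * profile d (norm (pos X (2 * t)) / t)) *\<^sub>R pos X (2 * t)) \<le> constA * \<alpha> * t" (is "norm ?D \<le> _")
    proof -
      have "norm (t ^ d *\<^sub>R ?D) \<le> constA * \<alpha> * (t ^ d * t)"
        using scale_approx(2)[OF t2 y(1) y2, of t] t s1(5) by (simp add: \<alpha>_def scaleR_diff_right)
      then have "t ^ d * norm ?D \<le> t ^ d * (constA * \<alpha> * t)" using td by (simp add: mult_ac)
      then show ?thesis using td by simp
    qed
    have w2: "norm (pos X (2 * t)) \<le> 2 * t" using s2(9) .
    have sm: "3 * (2 + real d) / cL * (constA * \<alpha>) \<le> gap / 2" using True by (simp add: lipL_def)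
    have st: "norm (pos X t - pos X (2 * t)) \<le> stabW * (constA * \<alpha>) * t" "\<bar>dens X t - dens X (2 * t)\<bar> \<le> stabC * (constA * \<alpha>)"
      unfolding stabW_def stabC_def lipL_def densU_def[symmetric]
      by (rule flat_stability[OF t cL_pos s1(6) s1(2) s1(3) c1 c2(1) w2 sm mass moment])+
    have "p * \<alpha> \<le> constB * \<alpha>" "q * \<alpha> \<le> constB * \<alpha>"
      using pqh dh \<alpha>0 by (auto intro!: mult_right_mono simp: distrib_right)
    then show ?thesis using st mult_right_mono[of "p * \<alpha>" "constB * \<alpha>" t] t by (simp add: p_def q_def mult.assoc)
  next
    \<comment> \<open>Now \<alpha> is at least 1 / h, so bounded differences are at most a multiple
      of \<alpha>.\<close>
    case False
    then have "1 \<le> h * \<alpha>" using s1(2) by (simp add: h_def field_simps)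
    then have one: "(3 + densU) * 1 \<le> (3 + densU) * (h * \<alpha>)" using cp by (intro mult_left_mono) auto
    also have "\<dots> \<le> constB * \<alpha>"
      using mult_right_mono[of "(3 + densU) * h" constB \<alpha>] pqh \<alpha>0 by (simp add: mult.assoc)
    finally have big: "3 + densU \<le> constB * \<alpha>" by simp
    have "\<bar>dens X t - dens X (2 * t)\<bar> \<le> densU" using c1 c2 by linarith
    moreover have "norm (pos X t - pos X (2 * t)) \<le> 3 * t"
      using s1(9) s2(9) norm_triangle_ineq4[of "pos X t" "pos X (2 * t)"] by linarith
    moreover have "3 * t \<le> constB * \<alpha> * t" using big cp t by (intro mult_right_mono) auto
    ultimately show ?thesis using big by linarith
  qed
  then show "\<bar>dens X t - dens X (2 * t)\<bar> \<le> constB * alpha1 d \<sigma> y (4 * t)"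
    "norm (pos X t - pos X (2 * t)) \<le> constB * alpha1 d \<sigma> y (4 * t) * t"
    by (auto simp: \<alpha>_def)
qed

lemma constB_nonneg: "0 < gap \<Longrightarrow> 0 \<le> constB"
  using const_pos stabW_pos lipL_pos unfolding constB_def
  by (auto intro!: add_nonneg_nonneg mult_nonneg_nonneg divide_nonneg_nonneg less_imp_le)

text \<open>Displacement errors are measured against the final scale, which dominates all earlier
  ones. Step j gives the summand j + 1; the summand 0 is slack that \<open>flat_approx\<close> uses
  for k = 0.\<close>

lemma scale_chain:
  assumes t: "0 < t" and y: "y \<in> \<Gamma>" "dist X y \<le> t / 2"
  shows "\<bar>dens X (2 ^ k * t) - dens X t\<bar> \<le> constB * (\<Sum>j\<le>k. alpha1 d \<sigma> y (2 * (2 ^ j * t)))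
    \<and> norm (pos X (2 ^ k * t) - pos X t) \<le> constB * (\<Sum>j\<le>k. alpha1 d \<sigma> y (2 * (2 ^ j * t))) * (2 ^ k * t)"
proof (induction k)
  case 0
  have "0 \<le> constB" using single_scale(2)[OF t y] by (rule constB_nonneg)
  then show ?case using t by (auto intro!: mult_nonneg_nonneg simp: alpha1_nonneg)
next
  case (Suc k)
  define s where "s = 2 ^ k * t"
  have "1 * t \<le> 2 ^ k * t" using t by (intro mult_right_mono) auto
  then have ts: "t \<le> s" unfolding s_def by linarith
  have s: "0 < s" "dist X y \<le> s / 2" using t y(2) ts by (auto intro: order_trans)
  have B: "0 \<le> constB" using single_scale(2)[OF t y] by (rule constB_nonneg)
  have e: "2 ^ Suc k * t = 2 * s" "2 * (2 ^ Suc k * t) = 4 * s" by (simp_all add: s_def)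
  define A where "A = (\<Sum>j\<le>k. alpha1 d \<sigma> y (2 * (2 ^ j * t)))"
  define a where "a = alpha1 d \<sigma> y (4 * s)"
  have pos: "0 \<le> A" "0 \<le> a" by (auto simp: A_def a_def alpha1_nonneg intro!: sum_nonneg)
  have sum: "(\<Sum>j\<le>Suc k. alpha1 d \<sigma> y (2 * (2 ^ j * t))) = A + a"
    unfolding A_def a_def e(2)[symmetric] by simp
  note st = scale_step[OF s(1) y(1) s(2), folded a_def]
  have IH: "\<bar>dens X s - dens X t\<bar> \<le> constB * A" "norm (pos X s - pos X t) \<le> constB * A * s"
    using Suc by (auto simp: s_def A_def)
  have "\<bar>dens X (2 * s) - dens X t\<bar> \<le> constB * (A + a)"
    using st(1) IH(1) by (simp add: distrib_left)
  moreover have "norm (pos X (2 * s) - pos X t) \<le> constB * (A + a) * (2 * s)"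
  proof -
    have "norm (pos X (2 * s) - pos X t) \<le> norm (pos X s - pos X (2 * s)) + norm (pos X s - pos X t)"
      using norm_triangle_ineq[of "pos X (2 * s) - pos X s" "pos X s - pos X t"] by (simp add: norm_minus_commute)
    also have "\<dots> \<le> constB * (A + a) * s" using st(2) IH(2) by (simp add: algebra_simps)
    also have "\<dots> \<le> constB * (A + a) * (2 * s)" using B pos s by (intro mult_left_mono mult_nonneg_nonneg) auto
    finally show ?thesis .
  qed
  ultimately show ?case unfolding e(1) sum by simp
qed

definition "constD = constA + 8 * (constB + densU * ((2 + real d) * (8 * constB))) + 8 * (densU * constB)"

definition "tail \<epsilon> y r = (\<Sum>j. 2 powr (- \<epsilon> * real j) * alpha1 d \<sigma> y (2 * (2 ^ j * (4 * r))))"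

lemma tail_bounds:
  assumes \<epsilon>: "0 < \<epsilon>"
  shows "0 \<le> tail \<epsilon> y r" "alpha1 d \<sigma> y (8 * r) \<le> tail \<epsilon> y r"
    "summable (\<lambda>j. 2 powr (- \<epsilon> * real j) * alpha1 d \<sigma> y (2 * (2 ^ j * (4 * r))))"
    "(\<Sum>j\<le>k. alpha1 d \<sigma> y (2 * (2 ^ j * (4 * r)))) \<le> 2 powr (\<epsilon> * real k) * tail \<epsilon> y r"
proof -
  note w = sum_le_weighted_suminf[where f = "\<lambda>j. alpha1 d \<sigma> y (2 * (2 ^ j * (4 * r)))", OF alpha1_nonneg alpha1_le_1 \<epsilon>]
  show "summable (\<lambda>j. 2 powr (- \<epsilon> * real j) * alpha1 d \<sigma> y (2 * (2 ^ j * (4 * r))))" by (rule w(1))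
  show "(\<Sum>j\<le>k. alpha1 d \<sigma> y (2 * (2 ^ j * (4 * r)))) \<le> 2 powr (\<epsilon> * real k) * tail \<epsilon> y r" for k
    unfolding tail_def by (rule w(2))
  from this[of 0] show "alpha1 d \<sigma> y (8 * r) \<le> tail \<epsilon> y r" by simp
  then show "0 \<le> tail \<epsilon> y r" using alpha1_nonneg[of d \<sigma> y "8 * r"] by linarith
qed

text \<open>The plane of scale 4r works at all scales t \<ge> r / 2. A dyadic scale s comparable
  with t has its own plane with error \<alpha>, and the chain from 4r to s costs the values of
  \<alpha> in between, together at most a multiple of (t/r)^\<epsilon> times
  \<open>tail\<close>.\<close>

lemma flat_approx:
  assumes r: "0 < r" and y: "y \<in> \<Gamma>" "dist X y \<le> 2 * r" and \<epsilon>: "0 < \<epsilon>" and t: "r / 2 \<le> t"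
  defines "c \<equiv> dens X (4 * r)" and "w \<equiv> pos X (4 * r)"
  shows "\<bar>m X t - t ^ d * (c * profile d (norm w / t))\<bar> \<le> constD * (2 powr \<epsilon> * tail \<epsilon> y r) * (t / r) powr \<epsilon> * t ^ d"
    and "norm (M X t - (t ^ d * (c * profile d (norm w / t))) *\<^sub>R w) \<le> constD * (2 powr \<epsilon> * tail \<epsilon> y r) * (t / r) powr \<epsilon> * (t ^ d * t)"
proof -
  have tp: "0 < t" using r t by linarith
  have td: "0 < t ^ d" using tp by simp
  \<comment> \<open>The least k with t \<le> 2^k (4r). The case k = 0 must reach down to t = r / 2,
    hence the range t0 / 8 \<le> t in \<open>scale_approx\<close>.\<close>
  obtain k where k: "2 ^ k * (4 * r) / 8 \<le> t" "t \<le> 2 ^ k * (4 * r)" "2 ^ k \<le> 2 * t / r"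
  proof (cases "t \<le> 4 * r")
    case True
    then show ?thesis using that[of 0] t r by (simp add: field_simps)
  next
    case False
    have "\<exists>k. t \<le> 2 ^ k * (4 * r)"
    proof -
      obtain k where "t / (4 * r) < 2 ^ k" using real_arch_pow[of 2 "t / (4 * r)"] by auto
      then show ?thesis using r by (intro exI[of _ k]) (simp add: divide_less_eq)
    qed
    then obtain k where k: "t \<le> 2 ^ k * (4 * r)" "\<And>i. i < k \<Longrightarrow> \<not> t \<le> 2 ^ i * (4 * r)"
      using exists_least_iff[of "\<lambda>k. t \<le> 2 ^ k * (4 * r)"] by auto
    obtain i where i: "k = Suc i" using k(1) False by (cases k) auto
    have "2 ^ i * (4 * r) < t" using k(2)[of i] i by simp
    then show ?thesis using k(1) r i tp by (intro that[of k]) (auto simp: field_simps)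
  qed
  define s where "s = 2 ^ k * (4 * r)"
  have "1 * (4 * r) \<le> 2 ^ k * (4 * r)" using r by (intro mult_right_mono) auto
  then have rs: "4 * r \<le> s" unfolding s_def by linarith
  have ks: "s / 8 \<le> t" "t \<le> s" using k(1,2) by (auto simp: s_def)
  have s: "0 < s" "dist X y \<le> s / 2" "s / 8 \<le> t" "t \<le> s" "s \<le> 8 * t" "4 * r \<le> s"
    using r y(2) rs ks by auto
  have r4: "0 < 4 * r" "dist X y \<le> 4 * r / 2" using r y(2) by auto
  note s0 = single_scale[OF r4(1) y(1) r4(2), folded c_def w_def]
  note sk = single_scale[OF s(1) y(1) s(2)]
  note cp = const_pos[OF s0(2)]
  have B: "0 \<le> constB" using s0(2) by (rule constB_nonneg)
  define c' where "c' = dens X s"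
  define w' where "w' = pos X s"
  define A where "A = (\<Sum>j\<le>k. alpha1 d \<sigma> y (2 * (2 ^ j * (4 * r))))"
  have A0: "0 \<le> A" by (auto simp: A_def alpha1_nonneg intro!: sum_nonneg)
  have ch: "\<bar>c' - c\<bar> \<le> constB * A" "norm (w' - w) \<le> constB * A * s"
    using scale_chain[OF r4(1) y(1) r4(2), of k] unfolding c'_def w'_def c_def w_def A_def s_def by auto
  have ak: "alpha1 d \<sigma> y (2 * s) \<le> A"
    unfolding A_def s_def by (rule member_le_sum[of k "{..k}"]) (auto simp: alpha1_nonneg)
  have c': "0 \<le> c'" "c' \<le> densU" using sk cL_pos by (auto simp: c'_def densU_def)
  have cG: "0 \<le> c' * profile d (norm w' / t)" "c' * profile d (norm w' / t) \<le> densU"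
    using c' profile_nonneg[of d "norm w' / t"] mult_left_mono[OF profile_le_1 c'(1), of d "norm w' / t"] by auto
  have wt: "norm (w' - w) \<le> 8 * constB * A * t"
  proof -
    have "constB * A * s \<le> constB * A * (8 * t)" using B A0 s by (intro mult_left_mono) auto
    then show ?thesis using ch(2) by (simp add: mult_ac)
  qed
  have w8: "norm w \<le> 8 * t" using s0(9) s by linarith
  define b where "b = constB + densU * ((2 + real d) * (8 * constB))"
  have D_eq: "constD = constA + 8 * b + 8 * (densU * constB)" by (simp add: constD_def b_def)
  let ?a = "c' * profile d (norm w' / t)" and ?z = "c * profile d (norm w / t)"
  have b0: "0 \<le> b" unfolding b_def using B cp by (intro add_nonneg_nonneg mult_nonneg_nonneg) auto
  have dB: "0 \<le> densU * constB" using B cp by simp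
  have fd: "\<bar>?a - ?z\<bar> \<le> b * A"
  proof -
    have "\<bar>?a - ?z\<bar> \<le> \<bar>c' - c\<bar> + c' * ((2 + real d) * (norm (w' - w) / t))" by (rule flat_diff_le[OF tp c'(1)])
    also have "\<dots> \<le> constB * A + densU * ((2 + real d) * (8 * constB * A))"
      using ch(1) c' wt tp cp by (intro add_mono mult_mono mult_left_mono mult_nonneg_nonneg) (auto simp: divide_le_eq)
    finally show ?thesis by (simp add: b_def algebra_simps)
  qed
  have AE: "A \<le> (2 powr \<epsilon> * tail \<epsilon> y r) * (t / r) powr \<epsilon>"
  proof -
    have "A \<le> 2 powr (\<epsilon> * real k) * tail \<epsilon> y r" unfolding A_def by (rule tail_bounds(4)[OF \<epsilon>])
    also have "2 powr (\<epsilon> * real k) = (2 ^ k) powr \<epsilon>" by (simp add: powr_powr mult.commute flip: powr_realpow)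
    also have "\<dots> * tail \<epsilon> y r \<le> (2 * (t / r)) powr \<epsilon> * tail \<epsilon> y r"
      using k(3) \<epsilon> tail_bounds(1)[OF \<epsilon>] by (intro mult_right_mono powr_mono2) auto
    also have "\<dots> = (2 powr \<epsilon> * tail \<epsilon> y r) * (t / r) powr \<epsilon>" using tp r by (subst powr_mult) (auto simp: mult_ac)
    finally show ?thesis .
  qed
  have KA: "constA * alpha1 d \<sigma> y (2 * s) \<le> constA * A" using ak cp by (intro mult_left_mono) auto
  have D0: "0 \<le> constD" unfolding D_eq using cp(4) b0 dB by linarith
  have fin: "constD * A * Z \<le> constD * (2 powr \<epsilon> * tail \<epsilon> y r) * (t / r) powr \<epsilon> * Z" if "0 \<le> Z" for Z
    using mult_right_mono[OF mult_left_mono[OF AE D0] that] by (simp add: mult.assoc)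
  have "\<bar>m X t - t ^ d * ?z\<bar> \<le> \<bar>m X t - t ^ d * ?a\<bar> + \<bar>t ^ d * ?a - t ^ d * ?z\<bar>" by linarith
  also have "\<bar>t ^ d * ?a - t ^ d * ?z\<bar> = t ^ d * \<bar>?a - ?z\<bar>" using td by (simp add: abs_mult flip: right_diff_distrib)
  also have "\<bar>m X t - t ^ d * ?a\<bar> + t ^ d * \<bar>?a - ?z\<bar> \<le> constA * A * t ^ d + t ^ d * (b * A)"
  proof (intro add_mono mult_left_mono fd)
    have "\<bar>m X t - t ^ d * ?a\<bar> \<le> constA * alpha1 d \<sigma> y (2 * s) * t ^ d"
      unfolding c'_def w'_def by (rule scale_approx(1)[OF s(1) y(1) s(2) s(3) s(4)])
    also have "\<dots> \<le> constA * A * t ^ d" using KA td by (intro mult_right_mono) auto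
    finally show "\<bar>m X t - t ^ d * ?a\<bar> \<le> constA * A * t ^ d" .
  qed (use td in auto)
  also have "\<dots> = (constA + b) * A * t ^ d" by (simp add: algebra_simps)
  also have "\<dots> \<le> constD * A * t ^ d"
  proof (intro mult_right_mono)
    show "constA + b \<le> constD" unfolding D_eq using b0 dB by linarith
  qed (use A0 td in auto)
  also note fin[of "t ^ d"]
  finally show "\<bar>m X t - t ^ d * (c * profile d (norm w / t))\<bar> \<le> constD * (2 powr \<epsilon> * tail \<epsilon> y r) * (t / r) powr \<epsilon> * t ^ d"
    using td by simp
  have va: "norm (?a *\<^sub>R w' - ?z *\<^sub>R w) \<le> (b * A) * (8 * t) + densU * (8 * constB * A * t)"
  proof -
    have "norm (?a *\<^sub>R w' - ?z *\<^sub>R w) \<le> \<bar>?a - ?z\<bar> * norm w + ?a * norm (w' - w)"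
      by (rule scaleR_diff_le[OF cG(1)])
    also have "\<dots> \<le> (b * A) * (8 * t) + densU * (8 * constB * A * t)"
      by (intro add_mono mult_mono fd w8 cG wt mult_nonneg_nonneg b0 A0) (use cp in auto)
    finally show ?thesis .
  qed
  have "M X t - (t ^ d * ?z) *\<^sub>R w = (M X t - (t ^ d * ?a) *\<^sub>R w') + t ^ d *\<^sub>R (?a *\<^sub>R w' - ?z *\<^sub>R w)"
    by (simp add: scaleR_diff_right)
  then have "norm (M X t - (t ^ d * ?z) *\<^sub>R w) \<le> norm (M X t - (t ^ d * ?a) *\<^sub>R w') + norm (t ^ d *\<^sub>R (?a *\<^sub>R w' - ?z *\<^sub>R w))"
    by (simp only: norm_triangle_ineq)
  also have "norm (t ^ d *\<^sub>R (?a *\<^sub>R w' - ?z *\<^sub>R w)) = t ^ d * norm (?a *\<^sub>R w' - ?z *\<^sub>R w)" using td by simp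
  also have "norm (M X t - (t ^ d * ?a) *\<^sub>R w') + t ^ d * norm (?a *\<^sub>R w' - ?z *\<^sub>R w)
    \<le> constA * A * (t ^ d * t) + t ^ d * ((b * A) * (8 * t) + densU * (8 * constB * A * t))"
  proof (intro add_mono mult_left_mono va)
    have "norm (M X t - (t ^ d * ?a) *\<^sub>R w') \<le> constA * alpha1 d \<sigma> y (2 * s) * (t ^ d * t)"
      unfolding c'_def w'_def by (rule scale_approx(2)[OF s(1) y(1) s(2) s(3) s(4)])
    also have "\<dots> \<le> constA * A * (t ^ d * t)" using KA td tp by (intro mult_right_mono) auto
    finally show "norm (M X t - (t ^ d * ?a) *\<^sub>R w') \<le> constA * A * (t ^ d * t)" .
  qed (use td in auto)
  also have "\<dots> = constD * A * (t ^ d * t)" unfolding D_eq by (simp add: algebra_simps)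
  also note fin[of "t ^ d * t"]
  finally show "norm (M X t - (t ^ d * (c * profile d (norm w / t))) *\<^sub>R w) \<le> constD * (2 powr \<epsilon> * tail \<epsilon> y r) * (t / r) powr \<epsilon> * (t ^ d * t)"
    using td tp by simp
qed

end

section \<open>Pointwise bounds\<close>

text \<open>Mean value theorem; the sum of both endpoint powers bounds the derivative whatever the
  sign of its exponent.\<close>

lemma powr_lipschitz_between:
  fixes x y e k1 k2 :: real
  assumes k: "0 < k1" and x: "k1 \<le> x" "x \<le> k2" and y: "k1 \<le> y" "y \<le> k2"
  shows "\<bar>x powr e - y powr e\<bar> \<le> \<bar>e\<bar> * (k1 powr (e - 1) + k2 powr (e - 1)) * \<bar>x - y\<bar>"
proof -
  have *: "\<bar>x powr e - y powr e\<bar> \<le> \<bar>e\<bar> * (k1 powr (e - 1) + k2 powr (e - 1)) * \<bar>x - y\<bar>"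
    if xy: "x < y" "k1 \<le> x" "y \<le> k2" for x y
  proof -
    have "\<exists>z. x < z \<and> z < y \<and> y powr e - x powr e = (y - x) * (e * z powr (e - 1))"
      using xy k by (intro MVT2) (auto intro!: has_real_derivative_powr)
    then obtain z where z: "x < z" "z < y" "y powr e - x powr e = (y - x) * (e * z powr (e - 1))" by auto
    have "z powr (e - 1) \<le> k1 powr (e - 1) + k2 powr (e - 1)"
    proof (cases "0 \<le> e - 1")
      case True
      then have "z powr (e - 1) \<le> k2 powr (e - 1)" using z xy k by (intro powr_mono2) auto
      then show ?thesis by (simp add: add_increasing)
    next
      case False
      then have "z powr (e - 1) \<le> k1 powr (e - 1)" using z xy k by (intro powr_mono2') auto
      then show ?thesis by (simp add: add_increasing2)
    qed
    then have "\<bar>e\<bar> * z powr (e - 1) \<le> \<bar>e\<bar> * (k1 powr (e - 1) + k2 powr (e - 1))" by (intro mult_left_mono) auto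
    then have "(y - x) * (\<bar>e\<bar> * z powr (e - 1)) \<le> (y - x) * (\<bar>e\<bar> * (k1 powr (e - 1) + k2 powr (e - 1)))"
      by (rule mult_left_mono) (use xy in auto)
    moreover have "\<bar>x powr e - y powr e\<bar> = (y - x) * (\<bar>e\<bar> * z powr (e - 1))"
      using xy z(3) by (subst abs_minus_commute) (simp add: abs_mult)
    moreover have "\<bar>x - y\<bar> = y - x" using xy by simp
    ultimately show ?thesis by (simp only: mult_ac)
  qed
  show ?thesis
    using *[of x y] *[of y x] x y by (cases x y rule: linorder_cases) (auto simp: abs_minus_commute)
qed

lemma powr_between_le:
  fixes x e k1 k2 :: real
  assumes "0 < k1" "k1 \<le> x" "x \<le> k2"
  shows "x powr e \<le> k1 powr e + k2 powr e"
proof (cases "0 \<le> e")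
  case True
  then have "x powr e \<le> k2 powr e" using assms by (intro powr_mono2) auto
  then show ?thesis by (simp add: add_increasing)
next
  case False
  then have "x powr e \<le> k1 powr e" using assms by (intro powr_mono2') auto
  then show ?thesis by (simp add: add_increasing2)
qed

context ahlfors begin

section \<open>Potentials of \<sigma> against potentials of a plane\<close>

definition "small1 = cL * profile d (1 / 2) / (2 * constA)"
definition "errA \<epsilon> p = 2 powr (p - \<epsilon>) * 2 / (p - \<epsilon>) / Beta ((real d + p) / 2) 2 * (constD * 2 powr \<epsilon>)"
definition "errS \<epsilon> p = 2 powr (p + 1 - \<epsilon>) * 2 / (p + 1 - \<epsilon>) / Beta ((real d + (p + 2)) / 2) 2 * (constD * 2 powr \<epsilon>)"
definition "lowA p = 2 powr (- (real d + p)) / C"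
definition "upA p = riesz_bound (real d + p)"
definition "upS p = riesz_bound (real d + p + 1)"

lemma A_bounds:
  assumes X: "X \<notin> \<Gamma>" and p: "0 < p"
  shows "lowA p * infdist X \<Gamma> powr (- p) \<le> A p X" "A p X \<le> upA p * infdist X \<Gamma> powr (- p)" "0 < A p X"
proof -
  show 1: "lowA p * infdist X \<Gamma> powr (- p) \<le> A p X"
    using riesz_ge[OF X, of "real d + p"] p by (simp add: lowA_def riesz_def)
  show "A p X \<le> upA p * infdist X \<Gamma> powr (- p)"
    using riesz_le[OF X, of "real d + p"] p by (simp add: upA_def riesz_def)
  have "0 < lowA p * infdist X \<Gamma> powr (- p)"
    using infdist_pos[OF X] C_pos by (simp add: lowA_def)
  then show "0 < A p X" using 1 by linarith
qed

lemma S_bound: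
  assumes X: "X \<notin> \<Gamma>" and p: "- 1 < p"
  shows "norm (S p X) \<le> upS p * infdist X \<Gamma> powr (- (p + 1))"
proof -
  have "norm (S p X) \<le> riesz_bound (real d + p + 2 - 1) * infdist X \<Gamma> powr (real d - (real d + p + 2 - 1))"
    unfolding riesz_vec_def by (rule riesz_vector_integrable(2)[OF X]) (use p in auto)
  also have "real d - (real d + p + 2 - 1) = - (p + 1)" by simp
  also have "real d + p + 2 - 1 = real d + p + 1" by simp
  finally show ?thesis by (simp only: upS_def)
qed

lemma gap_pos: "0 < gap"
proof -
  obtain y where "y \<in> \<Gamma>" using nonempty by auto
  then show ?thesis using single_scale(2)[of 1 y y] by simp
qed

lemma small1_pos: "0 < small1"
  using const_pos(4)[OF gap_pos] cL_pos profile_pos[of "1 / 2" d]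
  by (auto simp: small1_def intro!: divide_pos_pos mult_pos_pos)

text \<open>A plane closer than r / 2 would have bump mass at least cL * profile d (1/2) * r^d at
  scale r, where \<sigma> has none because \<Gamma> is at distance r; \<open>small1\<close> excludes
  this. With |w| \<ge> r / 2 the estimates over all scales integrate to estimates of the
  potentials.\<close>

lemma near_flat:
  assumes X: "X \<notin> \<Gamma>" and y: "y \<in> \<Gamma>" "dist X y \<le> 2 * infdist X \<Gamma>" and \<epsilon>: "0 < \<epsilon>"
    and small: "alpha1 d \<sigma> y (8 * infdist X \<Gamma>) < small1"
  obtains c w where "0 < c" "infdist X \<Gamma> / 2 \<le> norm w" "norm w \<le> 4 * infdist X \<Gamma>"
    "\<And>p. 0 < p \<Longrightarrow> \<epsilon> < p \<Longrightarrow> \<bar>A p X - c * riesz_const d p * norm w powr (- p)\<bar>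
      \<le> errA \<epsilon> p * tail \<epsilon> y (infdist X \<Gamma>) * infdist X \<Gamma> powr (- p)"
    "\<And>p. - 1 < p \<Longrightarrow> \<epsilon> < p + 1 \<Longrightarrow> norm (S p X - (c * riesz_const d (p + 2) * norm w powr (- (p + 2))) *\<^sub>R w)
      \<le> errS \<epsilon> p * tail \<epsilon> y (infdist X \<Gamma>) * infdist X \<Gamma> powr (- (p + 1))"
proof -
  let ?r = "infdist X \<Gamma>"
  have r: "0 < ?r" by (rule infdist_pos[OF X])
  have r4: "0 < 4 * ?r" "dist X y \<le> 4 * ?r / 2" using r y by auto
  define c where "c = dens X (4 * ?r)"
  define w where "w = pos X (4 * ?r)"
  note s0 = single_scale[OF r4(1) y(1) r4(2), folded c_def w_def]
  note cp = const_pos[OF s0(2)]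
  have c: "0 < c" using s0(7) cL_pos by linarith
  have w4: "norm w \<le> 4 * ?r" by (rule s0(9))
  have w2: "?r / 2 \<le> norm w"
  proof (rule ccontr)
    assume "\<not> ?r / 2 \<le> norm w"
    then have "norm w / ?r \<le> 1 / 2" using r by (simp add: divide_le_eq)
    then have p: "profile d (1 / 2) \<le> profile d (norm w / ?r)" using r by (intro profile_antimono) auto
    have m0: "m X ?r = 0"
      unfolding m_def using AE_bump_eq_0[OF X order_refl] by (intro integral_eq_zero_AE)
    have "\<bar>m X ?r - ?r ^ d * (c * profile d (norm w / ?r))\<bar> \<le> constA * alpha1 d \<sigma> y (2 * (4 * ?r)) * ?r ^ d"
      unfolding c_def w_def using r by (intro scale_approx(1)[OF r4(1) y(1) r4(2)]) auto
    then have "c * profile d (norm w / ?r) * ?r ^ d \<le> constA * alpha1 d \<sigma> y (8 * ?r) * ?r ^ d"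
      using m0 r c profile_nonneg[of d "norm w / ?r"] by (simp add: abs_mult mult_ac)
    then have "c * profile d (norm w / ?r) \<le> constA * alpha1 d \<sigma> y (8 * ?r)"
      using r by simp
    also have "\<dots> < constA * small1" using small cp by (intro mult_strict_left_mono) auto
    also have "constA * small1 = cL * profile d (1 / 2) / 2" using cp by (simp add: small1_def)
    also have "\<dots> < cL * profile d (1 / 2)" using cL_pos profile_pos[of "1 / 2" d] by simp
    also have "\<dots> \<le> c * profile d (norm w / ?r)" using s0(7) p cL_pos profile_nonneg[of d "1 / 2"] c by (intro mult_mono) auto
    finally show False by simp
  qed
  define E where "E = constD * (2 powr \<epsilon> * tail \<epsilon> y ?r)"
  have D0: "0 \<le> constD"
    unfolding constD_def using cp constB_nonneg[OF s0(2)]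
    by (intro add_nonneg_nonneg mult_nonneg_nonneg) (auto intro: less_imp_le)
  have E0: "0 \<le> E" unfolding E_def using D0 tail_bounds(1)[OF \<epsilon>] by (intro mult_nonneg_nonneg) auto
  \<comment> \<open>Dictionary for t = v^(-1/2): v < 4 / r^2 means t > r / 2.\<close>
  have conv: "?r / 2 \<le> 1 / sqrt v" "1 / (1 / sqrt v)\<^sup>2 = v" "(1 / sqrt v) ^ d = v powr (- (real d / 2))"
    "(1 / sqrt v) ^ d * (1 / sqrt v) = v powr (- ((real d + 1) / 2))"
    "(1 / sqrt v / ?r) powr \<epsilon> = (v * ?r\<^sup>2) powr (- (\<epsilon> / 2))" "0 < 1 / sqrt v"
    if v: "0 < v" "v < 4 / ?r\<^sup>2" for v
  proof -
    show "0 < 1 / sqrt v" using v by simp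
    have "v * ?r\<^sup>2 < 4" using v r by (simp add: less_divide_eq)
    then have "(sqrt v * ?r)\<^sup>2 \<le> 2\<^sup>2" using v by (simp add: power_mult_distrib)
    then have "sqrt v * ?r \<le> 2" by (rule power2_le_imp_le) simp
    then show "?r / 2 \<le> 1 / sqrt v" using v by (simp add: field_simps)
    show "1 / (1 / sqrt v)\<^sup>2 = v" using v by (simp add: power_divide)
    have t: "1 / sqrt v = v powr (- (1 / 2))" using v by (simp add: powr_minus_divide powr_half_sqrt)
    show 1: "(1 / sqrt v) ^ d = v powr (- (real d / 2))" unfolding t using v by (simp add: powr_powr flip: powr_realpow)
    have "- ((real d + 1) / 2) = - (real d / 2) + - (1 / 2)" by (simp add: field_simps)
    then show "(1 / sqrt v) ^ d * (1 / sqrt v) = v powr (- ((real d + 1) / 2))" unfolding 1 unfolding t by (simp only: powr_add)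
    have "1 / sqrt v / ?r = (v * ?r\<^sup>2) powr (- (1 / 2))"
      using v r by (simp add: powr_minus_divide powr_half_sqrt real_sqrt_mult)
    then show "(1 / sqrt v / ?r) powr \<epsilon> = (v * ?r\<^sup>2) powr (- (\<epsilon> / 2))" by (simp add: powr_powr)
  qed
  have fm: "flat_mass d c w v = (1 / sqrt v) ^ d * (c * profile d (norm w / (1 / sqrt v)))"
    if v: "0 < v" "v < 4 / ?r\<^sup>2" for v
    using flat_mass_profile[OF conv(6)[OF v], of d c w] unfolding conv(2)[OF v] by (simp only: mult_ac)
  note fa = flat_approx[OF r y \<epsilon>, folded c_def w_def]
  have mass: "\<bar>(\<integral>y. bump v (X - y) \<partial>\<sigma>) - flat_mass d c w v\<bar>
        \<le> E * v powr (- (real d / 2)) * (v * ?r\<^sup>2) powr (- (\<epsilon> / 2))" if v: "0 < v" "v < 4 / ?r\<^sup>2" for v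
    using fa(1)[OF conv(1)[OF v]]
    unfolding fm[OF v] m_def conv(2)[OF v] conv(5)[OF v] E_def
    unfolding conv(3)[OF v] by (simp only: mult_ac)
  have moment: "norm ((\<integral>y. bump v (X - y) *\<^sub>R (X - y) \<partial>\<sigma>) - flat_mass d c w v *\<^sub>R w)
        \<le> E * v powr (- ((real d + 1) / 2)) * (v * ?r\<^sup>2) powr (- (\<epsilon> / 2))" if v: "0 < v" "v < 4 / ?r\<^sup>2" for v
    using fa(2)[OF conv(1)[OF v]]
    unfolding fm[OF v] M_def conv(2)[OF v] conv(5)[OF v] conv(4)[OF v] E_def
    by (simp only: mult_ac)
  show ?thesis
  proof (rule that[OF c w2 w4])
    fix p :: real assume p: "0 < p" "\<epsilon> < p"
    show "\<bar>A p X - c * riesz_const d p * norm w powr (- p)\<bar> \<le> errA \<epsilon> p * tail \<epsilon> y ?r * ?r powr (- p)"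
      using riesz_flat_approx[OF X E0 less_imp_le[OF c] w2 mass p] unfolding errA_def E_def by (simp only: mult_ac)
  next
    fix p :: real assume p: "- 1 < p" "\<epsilon> < p + 1"
    show "norm (S p X - (c * riesz_const d (p + 2) * norm w powr (- (p + 2))) *\<^sub>R w)
      \<le> errS \<epsilon> p * tail \<epsilon> y ?r * ?r powr (- (p + 1))"
      using riesz_vec_flat_approx[OF X E0 less_imp_le[OF c] w2 moment p] unfolding errS_def E_def by (simp only: mult_ac)
  qed
qed

section \<open>The logarithmic gradient of the quotient of potentials\<close>

definition "ratioK \<epsilon> p = ((real d + p) * errS \<epsilon> p + 2 * p * errA \<epsilon> p) / lowA p"
definition "gradK \<epsilon> \<beta> = ratioK \<epsilon> (2 * \<beta>) + 2 * ratioK \<epsilon> \<beta>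
  + ((real d + 2 * \<beta>) * (upS (2 * \<beta>) / lowA (2 * \<beta>)) + 2 * ((real d + \<beta>) * (upS \<beta> / lowA \<beta>))) / small1"

text \<open>Minus the gradient of log (A_(2\<beta>) / A_\<beta>^2).\<close>

definition "logrel \<beta> X = ((real d + 2 * \<beta>) / A (2 * \<beta>) X) *\<^sub>R S (2 * \<beta>) X - (2 * (real d + \<beta>) / A \<beta> X) *\<^sub>R S \<beta> X"

lemma lowA_pos: "0 < lowA p" using C_pos by (simp add: lowA_def)

lemma S_over_A_bound:
  assumes X: "X \<notin> \<Gamma>" and p: "0 < p"
  shows "norm (((real d + p) / A p X) *\<^sub>R S p X) \<le> (real d + p) * (upS p / lowA p) / infdist X \<Gamma>"
proof -
  let ?r = "infdist X \<Gamma>"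
  have r: "0 < ?r" by (rule infdist_pos[OF X])
  note AA = A_bounds[OF X p]
  have "norm (S p X) \<le> upS p * ?r powr (- (p + 1))" using p by (intro S_bound[OF X]) auto
  also have "?r powr (- (p + 1)) = ?r powr (- p) / ?r"
  proof -
    have "- (p + 1) = - p + - 1" by simp
    then show ?thesis using r by (simp only: powr_add powr_minus_divide powr_one) simp
  qed
  also have "upS p * (?r powr (- p) / ?r) = upS p / lowA p / ?r * (lowA p * ?r powr (- p))"
    using lowA_pos[of p] by simp
  also have "\<dots> \<le> upS p / lowA p / ?r * A p X"
    using AA(1) r lowA_pos[of p] riesz_bound_pos[of "real d + p + 1"] p
    by (intro mult_left_mono divide_nonneg_nonneg) (auto simp: upS_def intro: less_imp_le)
  finally have "norm (S p X) / A p X \<le> upS p / lowA p / ?r" using AA(3) by (simp add: pos_divide_le_eq)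
  then have "(real d + p) * (norm (S p X) / A p X) \<le> (real d + p) * (upS p / lowA p / ?r)"
    using p by (intro mult_left_mono) auto
  then show ?thesis using AA(3) p by (simp add: mult_ac)
qed

text \<open>For a plane (d + p) S_p / A_p equals p w / |w|^2, by \<open>riesz_const_rec\<close>. The
  errors of A_p and S_p pass to the quotient through the lower bound of A_p.\<close>

lemma S_over_A_flat:
  assumes X: "X \<notin> \<Gamma>" and p: "0 < p" and w: "infdist X \<Gamma> / 2 \<le> norm w" and \<tau>: "0 \<le> \<tau>"
    and A: "\<bar>A p X - c * riesz_const d p * norm w powr (- p)\<bar> \<le> errA \<epsilon> p * \<tau> * infdist X \<Gamma> powr (- p)"
    and S: "norm (S p X - (c * riesz_const d (p + 2) * norm w powr (- (p + 2))) *\<^sub>R w)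
      \<le> errS \<epsilon> p * \<tau> * infdist X \<Gamma> powr (- (p + 1))"
  shows "norm (((real d + p) / A p X) *\<^sub>R S p X - (p / (norm w)\<^sup>2) *\<^sub>R w) \<le> ratioK \<epsilon> p * \<tau> / infdist X \<Gamma>"
proof -
  let ?r = "infdist X \<Gamma>"
  have r: "0 < ?r" by (rule infdist_pos[OF X])
  have w0: "0 < norm w" using w r by linarith
  note AA = A_bounds[OF X p]
  define s where "s = c * riesz_const d (p + 2) * norm w powr (- (p + 2))"
  define a where "a = c * riesz_const d p * norm w powr (- p)"
  have rp: "?r powr (- (p + 1)) = ?r powr (- p) / ?r"
  proof -
    have "- (p + 1) = - p + - 1" by simp
    then show ?thesis using r by (simp only: powr_add powr_minus_divide powr_one) simp
  qed
  have sa: "(real d + p) * s = a * (p / (norm w)\<^sup>2)"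
  proof -
    have "norm w powr (- (p + 2)) = norm w powr (- p) / (norm w)\<^sup>2"
    proof -
      have "- (p + 2) = - p + - 2" by simp
      then show ?thesis using w0 by (simp only: powr_add powr_minus_divide) simp
    qed
    then have "(real d + p) * s = c * ((real d + p) * riesz_const d (p + 2)) * norm w powr (- p) / (norm w)\<^sup>2"
      by (simp add: s_def)
    also have "\<dots> = a * (p / (norm w)\<^sup>2)" unfolding riesz_const_rec[OF p] by (simp add: a_def)
    finally show ?thesis .
  qed
  have "A p X *\<^sub>R (((real d + p) / A p X) *\<^sub>R S p X - (p / (norm w)\<^sup>2) *\<^sub>R w)
    = (real d + p) *\<^sub>R (S p X - s *\<^sub>R w) + (a - A p X) *\<^sub>R ((p / (norm w)\<^sup>2) *\<^sub>R w)"
  proof -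
    define k where "k = p / (norm w)\<^sup>2"
    show ?thesis
      using AA(3) sa unfolding k_def[symmetric] by (simp add: scaleR_diff_right left_diff_distrib scaleR_diff_left)
  qed
  then have "norm (A p X *\<^sub>R (((real d + p) / A p X) *\<^sub>R S p X - (p / (norm w)\<^sup>2) *\<^sub>R w))
    \<le> norm ((real d + p) *\<^sub>R (S p X - s *\<^sub>R w)) + norm ((a - A p X) *\<^sub>R ((p / (norm w)\<^sup>2) *\<^sub>R w))"
    by (simp only: norm_triangle_ineq)
  also have "norm ((real d + p) *\<^sub>R (S p X - s *\<^sub>R w)) = (real d + p) * norm (S p X - s *\<^sub>R w)" using p by simp
  also have "norm ((a - A p X) *\<^sub>R ((p / (norm w)\<^sup>2) *\<^sub>R w)) = \<bar>A p X - a\<bar> * (p / norm w)"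
    using p w0 by (simp add: power2_eq_square abs_minus_commute abs_mult)
  also have "(real d + p) * norm (S p X - s *\<^sub>R w) + \<bar>A p X - a\<bar> * (p / norm w)
    \<le> (real d + p) * (errS \<epsilon> p * \<tau> * ?r powr (- (p + 1))) + (errA \<epsilon> p * \<tau> * ?r powr (- p)) * (p / (?r / 2))"
  proof (intro add_mono mult_left_mono mult_mono)
    show "p / norm w \<le> p / (?r / 2)" using w p mult_pos_pos[OF w0 half_gt_zero[OF r]] by (intro divide_left_mono) (auto simp: mult.commute)
    show "0 \<le> errA \<epsilon> p * \<tau> * ?r powr (- p)" using A by linarith
  qed (use A S p w0 in \<open>auto simp: a_def s_def\<close>)
  also have "\<dots> = ratioK \<epsilon> p * \<tau> / ?r * (lowA p * ?r powr (- p))"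
    using lowA_pos[of p] r unfolding rp by (simp add: ratioK_def field_simps)
  finally have 1: "A p X * norm (((real d + p) / A p X) *\<^sub>R S p X - (p / (norm w)\<^sup>2) *\<^sub>R w)
    \<le> ratioK \<epsilon> p * \<tau> / ?r * (lowA p * ?r powr (- p))" using AA(3) by simp
  have "0 \<le> ratioK \<epsilon> p * \<tau> / ?r"
  proof -
    have "0 \<le> A p X * norm (((real d + p) / A p X) *\<^sub>R S p X - (p / (norm w)\<^sup>2) *\<^sub>R w)" using AA(3) by simp
    then have "0 \<le> ratioK \<epsilon> p * \<tau> / ?r * (lowA p * ?r powr (- p))" using 1 by linarith
    moreover have "0 < lowA p * ?r powr (- p)" using lowA_pos[of p] r by simp
    ultimately show ?thesis by (simp only: zero_le_mult_iff) linarith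
  qed
  then have "ratioK \<epsilon> p * \<tau> / ?r * (lowA p * ?r powr (- p)) \<le> ratioK \<epsilon> p * \<tau> / ?r * A p X"
    by (rule mult_left_mono[OF AA(1)])
  then have "A p X * norm (((real d + p) / A p X) *\<^sub>R S p X - (p / (norm w)\<^sup>2) *\<^sub>R w) \<le> A p X * (ratioK \<epsilon> p * \<tau> / ?r)"
    using 1 unfolding mult.commute[of "A p X"] by linarith
  then show ?thesis using AA(3) by (simp only: mult_le_cancel_left_pos)
qed

lemma alpha1_le_tail:
  assumes "0 < \<epsilon>" "small1 \<le> alpha1 d \<sigma> y (8 * r)"
  shows "small1 \<le> tail \<epsilon> y r"
  using tail_bounds(2)[OF assms(1), of y r] assms(2) by linarith

lemma constD_nonneg: "0 \<le> constD"
  unfolding constD_def using const_pos[OF gap_pos] constB_nonneg[OF gap_pos]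
  by (intro add_nonneg_nonneg mult_nonneg_nonneg) (auto intro: less_imp_le)

lemma err_nonneg:
  "0 < p \<Longrightarrow> \<epsilon> < p \<Longrightarrow> 0 \<le> errA \<epsilon> p" "- 1 < p \<Longrightarrow> \<epsilon> < p + 1 \<Longrightarrow> 0 \<le> errS \<epsilon> p"
proof -
  show "0 \<le> errA \<epsilon> p" if "0 < p" "\<epsilon> < p"
  proof -
    have "0 < Beta ((real d + p) / 2) 2" using that by (intro Beta_pos) auto
    then show ?thesis unfolding errA_def using that constD_nonneg
      by (intro mult_nonneg_nonneg divide_nonneg_nonneg) auto
  qed
  show "0 \<le> errS \<epsilon> p" if "- 1 < p" "\<epsilon> < p + 1"
  proof -
    have "0 < Beta ((real d + (p + 2)) / 2) 2" using that by (intro Beta_pos) auto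
    then show ?thesis unfolding errS_def using that constD_nonneg
      by (intro mult_nonneg_nonneg divide_nonneg_nonneg) auto
  qed
qed

text \<open>The bound by size alone, for use where \<alpha> is not small.\<close>

lemma logrel_far:
  assumes X: "X \<notin> \<Gamma>" and \<beta>: "0 < \<beta>"
  shows "norm (logrel \<beta> X) \<le> ((real d + 2 * \<beta>) * (upS (2 * \<beta>) / lowA (2 * \<beta>)) + 2 * ((real d + \<beta>) * (upS \<beta> / lowA \<beta>))) / infdist X \<Gamma>"
proof -
  have "logrel \<beta> X = ((real d + 2 * \<beta>) / A (2 * \<beta>) X) *\<^sub>R S (2 * \<beta>) X - 2 *\<^sub>R (((real d + \<beta>) / A \<beta> X) *\<^sub>R S \<beta> X)"
    by (simp add: logrel_def)
  then have "norm (logrel \<beta> X) \<le> norm (((real d + 2 * \<beta>) / A (2 * \<beta>) X) *\<^sub>R S (2 * \<beta>) X)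
      + norm (2 *\<^sub>R (((real d + \<beta>) / A \<beta> X) *\<^sub>R S \<beta> X))"
    by (simp only: norm_triangle_ineq4)
  also have "\<dots> = norm (((real d + 2 * \<beta>) / A (2 * \<beta>) X) *\<^sub>R S (2 * \<beta>) X) + 2 * norm (((real d + \<beta>) / A \<beta> X) *\<^sub>R S \<beta> X)"
    by (simp only: norm_scaleR)
  also have "\<dots> \<le> (real d + 2 * \<beta>) * (upS (2 * \<beta>) / lowA (2 * \<beta>)) / infdist X \<Gamma>
      + 2 * ((real d + \<beta>) * (upS \<beta> / lowA \<beta>) / infdist X \<Gamma>)"
    using S_over_A_bound[OF X, of "2 * \<beta>"] S_over_A_bound[OF X, of \<beta>] \<beta> by (intro add_mono mult_left_mono) auto
  also have "\<dots> = ((real d + 2 * \<beta>) * (upS (2 * \<beta>) / lowA (2 * \<beta>)) + 2 * ((real d + \<beta>) * (upS \<beta> / lowA \<beta>))) / infdist X \<Gamma>"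
    by (simp only: add_divide_distrib times_divide_eq_right)
  finally show ?thesis .
qed

text \<open>The flat value p w / |w|^2 is linear in p, so its value at 2\<beta> and twice its value
  at \<beta> cancel. Where \<alpha> is not small, \<open>tail\<close> is at least
  \<open>small1\<close> and the bound by size is a multiple of it.\<close>

lemma logrel_bound:
  assumes X: "X \<notin> \<Gamma>" and y: "y \<in> \<Gamma>" "dist X y \<le> 2 * infdist X \<Gamma>" and \<epsilon>: "0 < \<epsilon>" "\<epsilon> < \<beta>"
  shows "norm (logrel \<beta> X) \<le> gradK \<epsilon> \<beta> * tail \<epsilon> y (infdist X \<Gamma>) / infdist X \<Gamma>"
proof -
  let ?r = "infdist X \<Gamma>"
  have r: "0 < ?r" by (rule infdist_pos[OF X])
  have \<beta>: "0 < \<beta>" "\<epsilon> < 2 * \<beta>" "\<epsilon> < \<beta> + 1" "\<epsilon> < 2 * \<beta> + 1" using \<epsilon> by auto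
  have t0: "0 \<le> tail \<epsilon> y ?r" by (rule tail_bounds(1)[OF \<epsilon>(1)])
  define F where "F = (real d + 2 * \<beta>) * (upS (2 * \<beta>) / lowA (2 * \<beta>)) + 2 * ((real d + \<beta>) * (upS \<beta> / lowA \<beta>))"
  define N where "N = ratioK \<epsilon> (2 * \<beta>) + 2 * ratioK \<epsilon> \<beta>"
  have "0 < upS (2 * \<beta>)" "0 < upS \<beta>" unfolding upS_def using \<beta> by (auto intro!: riesz_bound_pos)
  then have F0: "0 \<le> F" unfolding F_def using \<beta> lowA_pos[of "2 * \<beta>"] lowA_pos[of \<beta>]
    by (intro add_nonneg_nonneg mult_nonneg_nonneg divide_nonneg_nonneg) auto
  have N0: "0 \<le> N" unfolding N_def ratioK_def using \<beta> \<epsilon> lowA_pos[of "2 * \<beta>"] lowA_pos[of \<beta>]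
    by (intro add_nonneg_nonneg mult_nonneg_nonneg divide_nonneg_nonneg err_nonneg) auto
  have K: "gradK \<epsilon> \<beta> = N + F / small1" by (simp add: gradK_def N_def F_def)
  show ?thesis
  proof (cases "alpha1 d \<sigma> y (8 * ?r) < small1")
    case True
    obtain c w where cw: "0 < c" "?r / 2 \<le> norm w" "norm w \<le> 4 * ?r"
      and A: "\<And>p. 0 < p \<Longrightarrow> \<epsilon> < p \<Longrightarrow> \<bar>A p X - c * riesz_const d p * norm w powr (- p)\<bar>
        \<le> errA \<epsilon> p * tail \<epsilon> y ?r * ?r powr (- p)"
      and S: "\<And>p. - 1 < p \<Longrightarrow> \<epsilon> < p + 1 \<Longrightarrow> norm (S p X - (c * riesz_const d (p + 2) * norm w powr (- (p + 2))) *\<^sub>R w)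
        \<le> errS \<epsilon> p * tail \<epsilon> y ?r * ?r powr (- (p + 1))"
      by (rule near_flat[OF X y \<epsilon>(1) True]) (rule that; assumption)
    define u1 where "u1 = ((real d + 2 * \<beta>) / A (2 * \<beta>) X) *\<^sub>R S (2 * \<beta>) X - ((2 * \<beta>) / (norm w)\<^sup>2) *\<^sub>R w"
    define u2 where "u2 = ((real d + \<beta>) / A \<beta> X) *\<^sub>R S \<beta> X - (\<beta> / (norm w)\<^sup>2) *\<^sub>R w"
    have u1: "norm u1 \<le> ratioK \<epsilon> (2 * \<beta>) * tail \<epsilon> y ?r / ?r"
      unfolding u1_def by (rule S_over_A_flat[OF X _ cw(2) t0 A S]) (use \<beta> in auto)
    have u2: "norm u2 \<le> ratioK \<epsilon> \<beta> * tail \<epsilon> y ?r / ?r"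
      unfolding u2_def by (rule S_over_A_flat[OF X _ cw(2) t0 A S]) (use \<beta> \<epsilon> in auto)
    have "logrel \<beta> X = u1 - 2 *\<^sub>R u2"
      by (simp add: logrel_def u1_def u2_def scaleR_diff_right)
    then have "norm (logrel \<beta> X) \<le> norm u1 + norm (2 *\<^sub>R u2)" by (simp only: norm_triangle_ineq4)
    also have "\<dots> \<le> ratioK \<epsilon> (2 * \<beta>) * tail \<epsilon> y ?r / ?r + 2 * (ratioK \<epsilon> \<beta> * tail \<epsilon> y ?r / ?r)"
      using u1 u2 by simp
    also have "\<dots> = N * tail \<epsilon> y ?r / ?r" by (simp add: N_def distrib_right add_divide_distrib)
    also have "\<dots> \<le> gradK \<epsilon> \<beta> * tail \<epsilon> y ?r / ?r"
      using t0 r F0 small1_pos unfolding K by (intro divide_right_mono mult_right_mono) auto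
    finally show ?thesis .
  next
    case False
    then have st: "small1 \<le> tail \<epsilon> y ?r" using \<epsilon>(1) by (intro alpha1_le_tail) auto
    have "norm (logrel \<beta> X) \<le> F / ?r" unfolding F_def by (rule logrel_far[OF X \<beta>(1)])
    also have "F = F / small1 * small1" using small1_pos by simp
    also have "F / small1 * small1 / ?r \<le> gradK \<epsilon> \<beta> * tail \<epsilon> y ?r / ?r"
      using t0 r F0 N0 small1_pos st unfolding K by (intro divide_right_mono mult_mono) auto
    finally show ?thesis .
  qed
qed

section \<open>The residual after subtracting the gradient term\<close>

text \<open>Normalised so that \<open>resid\<close> is 0 for a plane: with k =
  \<open>riesz_const d\<close>, there S_q = k_(q+2) / k_(\<beta>+2) |w|^(\<beta>-q) S_\<beta> and
  A_(2\<beta>) / A_\<beta> = k_(2\<beta>) / k_\<beta> |w|^(-\<beta>).\<close>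

definition "kapP \<beta> q = riesz_const d (q + 2) / riesz_const d (\<beta> + 2) * (riesz_const d (2 * \<beta>) / riesz_const d \<beta>) powr (- (q / \<beta> - 1))"
definition "resid \<beta> q X = S q X - (kapP \<beta> q * (A (2 * \<beta>) X / A \<beta> X) powr (q / \<beta> - 1)) *\<^sub>R S \<beta> X"

definition "quoC \<beta> = riesz_const d (2 * \<beta>) / riesz_const d \<beta>"
text \<open>\<open>quo1\<close> and \<open>quo2\<close> enclose r^\<beta> A_(2\<beta>) / A_\<beta>
  both for \<sigma> and for the approximating plane, where r / 2 \<le> |w| \<le> 4r.
  \<open>quoP\<close> and \<open>quoL\<close> bound a power and its Lipschitz constant on this
  interval.\<close>

definition "quo1 \<beta> = min (lowA (2 * \<beta>) / upA \<beta>) (quoC \<beta> * 4 powr (- \<beta>))"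
definition "quo2 \<beta> = max (upA (2 * \<beta>) / lowA \<beta>) (quoC \<beta> * 2 powr \<beta>)"
definition "quoE \<epsilon> \<beta> = (errA \<epsilon> (2 * \<beta>) + quoC \<beta> * 2 powr \<beta> * errA \<epsilon> \<beta>) / lowA \<beta>"
definition "quoP \<beta> e = quo1 \<beta> powr e + quo2 \<beta> powr e"
definition "quoL \<beta> e = \<bar>e\<bar> * (quo1 \<beta> powr (e - 1) + quo2 \<beta> powr (e - 1))"
definition "residN \<epsilon> \<beta> q = errS \<epsilon> q + kapP \<beta> q * (quoL \<beta> (q / \<beta> - 1) * quoE \<epsilon> \<beta> * upS \<beta> + quoP \<beta> (q / \<beta> - 1) * errS \<epsilon> \<beta>)"
definition "residF \<beta> q = upS q + kapP \<beta> q * (quoP \<beta> (q / \<beta> - 1) * upS \<beta>)"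
definition "residK \<epsilon> \<beta> q = residN \<epsilon> \<beta> q + residF \<beta> q / small1"

lemma quo_pos:
  assumes \<beta>: "0 < \<beta>"
  shows "0 < quoC \<beta>" "0 < quo1 \<beta>" "0 < upA \<beta>" "0 < upS \<beta>" "0 \<le> quoP \<beta> e" "0 \<le> quoL \<beta> e"
proof -
  show q: "0 < quoC \<beta>" using riesz_const_pos[of \<beta>] riesz_const_pos[of "2 * \<beta>"] \<beta> by (simp add: quoC_def)
  show u: "0 < upA \<beta>" unfolding upA_def using \<beta> by (intro riesz_bound_pos) auto
  show "0 < upS \<beta>" unfolding upS_def using \<beta> by (intro riesz_bound_pos) auto
  show "0 < quo1 \<beta>" unfolding quo1_def using q u lowA_pos[of "2 * \<beta>"] by simp
  show "0 \<le> quoP \<beta> e" "0 \<le> quoL \<beta> e" by (auto simp: quoP_def quoL_def intro!: mult_nonneg_nonneg add_nonneg_nonneg)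
qed

lemma quotient_bounds:
  assumes X: "X \<notin> \<Gamma>" and \<beta>: "0 < \<beta>"
  shows "quo1 \<beta> \<le> infdist X \<Gamma> powr \<beta> * (A (2 * \<beta>) X / A \<beta> X)" "infdist X \<Gamma> powr \<beta> * (A (2 * \<beta>) X / A \<beta> X) \<le> quo2 \<beta>"
proof -
  let ?r = "infdist X \<Gamma>"
  have r: "0 < ?r" by (rule infdist_pos[OF X])
  have \<beta>2: "0 < 2 * \<beta>" using \<beta> by simp
  note b1 = A_bounds[OF X \<beta>] and b2 = A_bounds[OF X \<beta>2]
  have rr: "?r powr \<beta> * ?r powr (- (2 * \<beta>)) = ?r powr (- \<beta>)" by (simp flip: powr_add)
  have rb: "0 < ?r powr (- \<beta>)" using r by simp
  have cancel: "(?r powr \<beta> * (k * ?r powr (- (2 * \<beta>)))) / (k' * ?r powr (- \<beta>)) = k / k'" for k k'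
    unfolding mult.left_commute[of "?r powr \<beta>"] rr using rb by simp
  have "lowA (2 * \<beta>) / upA \<beta> = (?r powr \<beta> * (lowA (2 * \<beta>) * ?r powr (- (2 * \<beta>)))) / (upA \<beta> * ?r powr (- \<beta>))"
    by (rule cancel[symmetric])
  also have "\<dots> \<le> (?r powr \<beta> * A (2 * \<beta>) X) / A \<beta> X"
    using b1 b2 r lowA_pos[of "2 * \<beta>"] by (intro frac_le mult_left_mono mult_nonneg_nonneg) auto
  finally show "quo1 \<beta> \<le> ?r powr \<beta> * (A (2 * \<beta>) X / A \<beta> X)" by (simp add: quo1_def)
  have "(?r powr \<beta> * A (2 * \<beta>) X) / A \<beta> X \<le> (?r powr \<beta> * (upA (2 * \<beta>) * ?r powr (- (2 * \<beta>)))) / (lowA \<beta> * ?r powr (- \<beta>))"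
    using b1 b2 r lowA_pos[of \<beta>] quo_pos(3)[OF \<beta>2] by (intro frac_le mult_left_mono mult_nonneg_nonneg) auto
  also have "\<dots> = upA (2 * \<beta>) / lowA \<beta>" by (rule cancel)
  finally show "?r powr \<beta> * (A (2 * \<beta>) X / A \<beta> X) \<le> quo2 \<beta>" by (simp add: quo2_def)
qed

text \<open>Factoring out r^\<beta> leaves a quotient in a fixed interval, on which powers are
  Lipschitz with a constant independent of X.\<close>

lemma quotient_powr:
  assumes X: "X \<notin> \<Gamma>" and \<beta>: "0 < \<beta>"
  shows "(A (2 * \<beta>) X / A \<beta> X) powr (q / \<beta> - 1)
    = (infdist X \<Gamma> powr \<beta> * (A (2 * \<beta>) X / A \<beta> X)) powr (q / \<beta> - 1) * infdist X \<Gamma> powr (\<beta> - q)"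
proof -
  let ?r = "infdist X \<Gamma>"
  have r: "0 < ?r" by (rule infdist_pos[OF X])
  have "0 < A \<beta> X" "0 < A (2 * \<beta>) X" using A_bounds[OF X] \<beta> by auto
  then have "(?r powr \<beta> * (A (2 * \<beta>) X / A \<beta> X)) powr (q / \<beta> - 1) = (?r powr \<beta>) powr (q / \<beta> - 1) * (A (2 * \<beta>) X / A \<beta> X) powr (q / \<beta> - 1)"
    by (intro powr_mult)
  also have "(?r powr \<beta>) powr (q / \<beta> - 1) = ?r powr (q - \<beta>)"
  proof -
    have "\<beta> * (q / \<beta> - 1) = q - \<beta>" using \<beta> by (simp add: right_diff_distrib)
    then show ?thesis by (simp only: powr_powr)
  qed
  finally show ?thesis using r by (simp add: mult.commute mult.left_commute flip: powr_add)
qed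

lemma kapP_pos: "0 < \<beta> \<Longrightarrow> 0 \<le> q \<Longrightarrow> 0 < kapP \<beta> q"
proof -
  assume "0 < \<beta>" "0 \<le> q"
  then have "0 < riesz_const d (q + 2)" "0 < riesz_const d (\<beta> + 2)" by (auto intro!: riesz_const_pos)
  moreover have "0 < quoC \<beta> powr x" for x
    using quo_pos(1)[OF \<open>0 < \<beta>\<close>] by (metis less_irrefl powr_gt_zero)
  ultimately show ?thesis unfolding kapP_def quoC_def[symmetric] by (intro mult_pos_pos divide_pos_pos)
qed

lemma resid_far:
  assumes X: "X \<notin> \<Gamma>" and \<beta>: "0 < \<beta>" and q: "0 \<le> q"
  shows "norm (resid \<beta> q X) \<le> residF \<beta> q * infdist X \<Gamma> powr (- (q + 1))"
proof -
  let ?r = "infdist X \<Gamma>" and ?e = "q / \<beta> - 1"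
  have r: "0 < ?r" by (rule infdist_pos[OF X])
  define P where "P = ?r powr \<beta> * (A (2 * \<beta>) X / A \<beta> X)"
  have Pe: "P powr ?e \<le> quoP \<beta> ?e"
    unfolding quoP_def P_def using quotient_bounds[OF X \<beta>] by (intro powr_between_le quo_pos \<beta>)
  note kp = kapP_pos[OF \<beta> q]
  have rr: "?r powr (\<beta> - q) * ?r powr (- (\<beta> + 1)) = ?r powr (- (q + 1))" by (simp flip: powr_add)
  have "norm (resid \<beta> q X) \<le> norm (S q X) + norm ((kapP \<beta> q * (P powr ?e * ?r powr (\<beta> - q))) *\<^sub>R S \<beta> X)"
    unfolding resid_def quotient_powr[OF X \<beta>] P_def by (rule norm_triangle_ineq4)
  also have "norm ((kapP \<beta> q * (P powr ?e * ?r powr (\<beta> - q))) *\<^sub>R S \<beta> X) = kapP \<beta> q * (P powr ?e * ?r powr (\<beta> - q) * norm (S \<beta> X))"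
    using kp by (simp add: abs_mult)
  also have "norm (S q X) + kapP \<beta> q * (P powr ?e * ?r powr (\<beta> - q) * norm (S \<beta> X))
    \<le> upS q * ?r powr (- (q + 1)) + kapP \<beta> q * (quoP \<beta> ?e * ?r powr (\<beta> - q) * (upS \<beta> * ?r powr (- (\<beta> + 1))))"
    using S_bound[OF X, of q] S_bound[OF X, of \<beta>] q \<beta> Pe kp quo_pos[OF \<beta>]
    by (intro add_mono mult_left_mono mult_mono mult_nonneg_nonneg) auto
  also have "\<dots> = upS q * ?r powr (- (q + 1)) + kapP \<beta> q * (quoP \<beta> ?e * upS \<beta>) * (?r powr (\<beta> - q) * ?r powr (- (\<beta> + 1)))"
    by (simp only: mult_ac)
  also have "\<dots> = residF \<beta> q * ?r powr (- (q + 1))"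
    unfolding rr by (simp only: residF_def distrib_right)
  finally show ?thesis .
qed

lemma norm_diff3: "norm (a - b - c) \<le> norm a + norm b + norm (c :: 'a)"
  using norm_triangle_ineq4[of "a - b" c] norm_triangle_ineq4[of a b] by linarith

text \<open>The plane has residual 0, so three errors remain: that of S_q, that of the quotient
  inside the power, and that of S_\<beta>.\<close>

lemma resid_near:
  assumes X: "X \<notin> \<Gamma>" and \<beta>: "0 < \<beta>" and q: "0 \<le> q" and \<epsilon>: "0 < \<epsilon>" "\<epsilon> < \<beta>" "\<epsilon> < 1" and \<tau>: "0 \<le> \<tau>"
    and cw: "0 < c" "infdist X \<Gamma> / 2 \<le> norm w" "norm w \<le> 4 * infdist X \<Gamma>"
    and A: "\<And>p. 0 < p \<Longrightarrow> \<epsilon> < p \<Longrightarrow> \<bar>A p X - c * riesz_const d p * norm w powr (- p)\<bar>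
        \<le> errA \<epsilon> p * \<tau> * infdist X \<Gamma> powr (- p)"
    and S: "\<And>p. - 1 < p \<Longrightarrow> \<epsilon> < p + 1 \<Longrightarrow> norm (S p X - (c * riesz_const d (p + 2) * norm w powr (- (p + 2))) *\<^sub>R w)
        \<le> errS \<epsilon> p * \<tau> * infdist X \<Gamma> powr (- (p + 1))"
  shows "norm (resid \<beta> q X) \<le> residN \<epsilon> \<beta> q * \<tau> * infdist X \<Gamma> powr (- (q + 1))"
proof -
  let ?r = "infdist X \<Gamma>" and ?e = "q / \<beta> - 1"
  have r: "0 < ?r" by (rule infdist_pos[OF X])
  have w0: "0 < norm w" using cw r by linarith
  note kp = kapP_pos[OF \<beta> q] and qp = quo_pos[OF \<beta>]
  define P where "P = ?r powr \<beta> * (A (2 * \<beta>) X / A \<beta> X)"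
  define Q0 where "Q0 = quoC \<beta> * norm w powr (- \<beta>)"
  define P0 where "P0 = ?r powr \<beta> * Q0"
  have P: "quo1 \<beta> \<le> P" "P \<le> quo2 \<beta>" unfolding P_def using quotient_bounds[OF X \<beta>] by auto
  have wr: "4 powr (- \<beta>) \<le> ?r powr \<beta> * norm w powr (- \<beta>)" "?r powr \<beta> * norm w powr (- \<beta>) \<le> 2 powr \<beta>"
  proof -
    have e: "?r powr \<beta> * norm w powr (- \<beta>) = (norm w / ?r) powr (- \<beta>)"
      using r w0 by (simp add: powr_divide powr_minus field_simps)
    have wp: "0 < norm w / ?r" "norm w / ?r \<le> 4" "1 / 2 \<le> norm w / ?r"
      using divide_pos_pos[OF w0 r] cw r by (auto simp: divide_le_eq le_divide_eq)
    have "4 powr (- \<beta>) \<le> (norm w / ?r) powr (- \<beta>)"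
      using \<beta> by (intro powr_mono2' wp) auto
    then show "4 powr (- \<beta>) \<le> ?r powr \<beta> * norm w powr (- \<beta>)" unfolding e .
    have "(norm w / ?r) powr (- \<beta>) \<le> (1 / 2) powr (- \<beta>)"
      using wp(3) \<beta> by (intro powr_mono2') auto
    also have "(1 / 2) powr (- \<beta>) = 2 powr \<beta>" by (simp add: powr_divide powr_minus)
    finally show "?r powr \<beta> * norm w powr (- \<beta>) \<le> 2 powr \<beta>" unfolding e .
  qed
  have P0e: "P0 = quoC \<beta> * (?r powr \<beta> * norm w powr (- \<beta>))" by (simp add: P0_def Q0_def)
  have P0: "quo1 \<beta> \<le> P0" "P0 \<le> quo2 \<beta>"
    unfolding P0e quo1_def quo2_def using wr qp(1)
    by (auto intro!: min.coboundedI2 max.coboundedI2 mult_left_mono)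
  define a1 where "a1 = c * riesz_const d \<beta> * norm w powr (- \<beta>)"
  define a2 where "a2 = c * riesz_const d (2 * \<beta>) * norm w powr (- (2 * \<beta>))"
  have a12: "a2 = Q0 * a1"
  proof -
    have "norm w powr (- (2 * \<beta>)) = norm w powr (- \<beta>) * norm w powr (- \<beta>)" by (simp flip: powr_add)
    then show ?thesis unfolding a2_def a1_def Q0_def quoC_def using riesz_const_pos[OF \<beta>, of d] by simp
  qed
  have AA: "0 < A \<beta> X" "lowA \<beta> * ?r powr (- \<beta>) \<le> A \<beta> X" using A_bounds[OF X \<beta>] by auto
  have Q00: "0 \<le> Q0" using qp by (simp add: Q0_def)
  have eA: "\<bar>A \<beta> X - a1\<bar> \<le> errA \<epsilon> \<beta> * \<tau> * ?r powr (- \<beta>)" "\<bar>A (2 * \<beta>) X - a2\<bar> \<le> errA \<epsilon> (2 * \<beta>) * \<tau> * ?r powr (- (2 * \<beta>))"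
    using A[of \<beta>] A[of "2 * \<beta>"] \<beta> \<epsilon> by (auto simp: a1_def a2_def)
  have rr2: "?r powr \<beta> * ?r powr (- (2 * \<beta>)) = ?r powr (- \<beta>)" by (simp flip: powr_add)
  have PP0: "\<bar>P - P0\<bar> \<le> quoE \<epsilon> \<beta> * \<tau>"
  proof -
    have "A \<beta> X * (P - P0) = ?r powr \<beta> * (A (2 * \<beta>) X - a2) - P0 * (A \<beta> X - a1)"
      using AA(1) unfolding P_def P0_def a12 by (simp add: algebra_simps)
    then have "A \<beta> X * \<bar>P - P0\<bar> \<le> \<bar>?r powr \<beta> * (A (2 * \<beta>) X - a2)\<bar> + \<bar>P0 * (A \<beta> X - a1)\<bar>"
      using AA(1) by (metis abs_mult abs_of_pos abs_triangle_ineq4)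
    also have "\<dots> = ?r powr \<beta> * \<bar>A (2 * \<beta>) X - a2\<bar> + P0 * \<bar>A \<beta> X - a1\<bar>"
      using Q00 by (simp add: abs_mult P0_def)
    also have "\<dots> \<le> ?r powr \<beta> * (errA \<epsilon> (2 * \<beta>) * \<tau> * ?r powr (- (2 * \<beta>))) + (quoC \<beta> * 2 powr \<beta>) * (errA \<epsilon> \<beta> * \<tau> * ?r powr (- \<beta>))"
    proof (intro add_mono mult_left_mono mult_mono eA)
      show "P0 \<le> quoC \<beta> * 2 powr \<beta>" unfolding P0e using wr qp by (intro mult_left_mono) auto
    qed (use qp in auto)
    also have "\<dots> = errA \<epsilon> (2 * \<beta>) * \<tau> * (?r powr \<beta> * ?r powr (- (2 * \<beta>))) + quoC \<beta> * 2 powr \<beta> * errA \<epsilon> \<beta> * \<tau> * ?r powr (- \<beta>)"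
      by (simp only: mult_ac)
    also have "\<dots> = quoE \<epsilon> \<beta> * \<tau> * (lowA \<beta> * ?r powr (- \<beta>))"
      unfolding rr2 using lowA_pos[of \<beta>] by (simp add: quoE_def field_simps)
    also have "\<dots> \<le> quoE \<epsilon> \<beta> * \<tau> * A \<beta> X"
    proof (rule mult_left_mono[OF AA(2)])
      show "0 \<le> quoE \<epsilon> \<beta> * \<tau>"
        unfolding quoE_def using err_nonneg(1)[of \<beta> \<epsilon>] err_nonneg(1)[of "2 * \<beta>" \<epsilon>] \<beta> \<epsilon> \<tau> qp lowA_pos[of \<beta>]
        by (intro mult_nonneg_nonneg divide_nonneg_nonneg add_nonneg_nonneg) auto
    qed
    finally have "A \<beta> X * \<bar>P - P0\<bar> \<le> A \<beta> X * (quoE \<epsilon> \<beta> * \<tau>)" by (simp only: mult.commute)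
    then show ?thesis using AA(1) by (simp only: mult_le_cancel_left_pos)
  qed
  have E0: "0 \<le> quoE \<epsilon> \<beta>"
    unfolding quoE_def using err_nonneg(1)[of \<beta> \<epsilon>] err_nonneg(1)[of "2 * \<beta>" \<epsilon>] \<beta> \<epsilon> qp lowA_pos[of \<beta>]
    by (intro mult_nonneg_nonneg divide_nonneg_nonneg add_nonneg_nonneg) auto
  have PL: "\<bar>P powr ?e - P0 powr ?e\<bar> \<le> quoL \<beta> ?e * (quoE \<epsilon> \<beta> * \<tau>)"
  proof -
    have "\<bar>P powr ?e - P0 powr ?e\<bar> \<le> quoL \<beta> ?e * \<bar>P - P0\<bar>"
      unfolding quoL_def by (rule powr_lipschitz_between[OF qp(2) P P0])
    also have "\<dots> \<le> quoL \<beta> ?e * (quoE \<epsilon> \<beta> * \<tau>)" by (intro mult_left_mono PP0 qp)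
    finally show ?thesis .
  qed
  have P0P: "P0 powr ?e \<le> quoP \<beta> ?e" unfolding quoP_def by (rule powr_between_le[OF qp(2) P0])
  define sq where "sq = c * riesz_const d (q + 2) * norm w powr (- (q + 2))"
  define sb where "sb = c * riesz_const d (\<beta> + 2) * norm w powr (- (\<beta> + 2))"
  define \<rho> where "\<rho> = ?r powr (\<beta> - q)"
  \<comment> \<open>The cancellation for a plane: the powers of |w| and the normalising constants
    match.\<close>
  have sqb: "sq = kapP \<beta> q * (P0 powr ?e * \<rho>) * sb"
  proof -
    have "P0 powr ?e * \<rho> = Q0 powr ?e"
    proof -
      have "\<beta> * ?e = q - \<beta>" using \<beta> by (simp add: right_diff_distrib)
      then have "P0 powr ?e = ?r powr (q - \<beta>) * Q0 powr ?e"
        unfolding P0_def by (simp only: powr_mult powr_powr)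
      then show ?thesis using r by (simp add: \<rho>_def mult.commute mult.left_commute flip: powr_add)
    qed
    also have "Q0 powr ?e = quoC \<beta> powr ?e * norm w powr (\<beta> - q)"
    proof -
      have "- \<beta> * ?e = \<beta> - q" using \<beta> by (simp add: right_diff_distrib)
      then show ?thesis unfolding Q0_def by (simp only: powr_mult powr_powr)
    qed
    finally have 1: "P0 powr ?e * \<rho> = quoC \<beta> powr ?e * norm w powr (\<beta> - q)" .
    have 2: "quoC \<beta> powr (- ?e) * quoC \<beta> powr ?e = 1" using qp(1) by (simp flip: powr_add)
    have 3: "norm w powr (\<beta> - q) * norm w powr (- (\<beta> + 2)) = norm w powr (- (q + 2))" by (simp flip: powr_add)
    have "kapP \<beta> q * (P0 powr ?e * \<rho>) * sb
      = (quoC \<beta> powr (- ?e) * quoC \<beta> powr ?e) * (riesz_const d (q + 2) / riesz_const d (\<beta> + 2) * riesz_const d (\<beta> + 2)) * c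
        * (norm w powr (\<beta> - q) * norm w powr (- (\<beta> + 2)))"
      unfolding 1 kapP_def sb_def quoC_def[symmetric] by (simp only: mult_ac)
    also have "\<dots> = sq" unfolding 2 3 sq_def using riesz_const_pos[of "\<beta> + 2" d] \<beta> by simp
    finally show ?thesis ..
  qed
  have eS: "norm (S q X - sq *\<^sub>R w) \<le> errS \<epsilon> q * \<tau> * ?r powr (- (q + 1))" "norm (S \<beta> X - sb *\<^sub>R w) \<le> errS \<epsilon> \<beta> * \<tau> * ?r powr (- (\<beta> + 1))"
    unfolding sq_def sb_def using S[of q] S[of \<beta>] q \<beta> \<epsilon> by auto
  have Sb: "norm (S \<beta> X) \<le> upS \<beta> * ?r powr (- (\<beta> + 1))" using \<beta> by (intro S_bound[OF X]) auto
  have rr: "\<rho> * ?r powr (- (\<beta> + 1)) = ?r powr (- (q + 1))" unfolding \<rho>_def by (simp flip: powr_add)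
  have \<rho>0: "0 \<le> \<rho>" by (simp add: \<rho>_def)
  let ?k = "kapP \<beta> q"
  \<comment> \<open>The middle term keeps the true S_\<beta>, whose size is known; the last one
    keeps the flat power.\<close>
  have "resid \<beta> q X = (S q X - sq *\<^sub>R w) - (?k * (\<rho> * (P powr ?e - P0 powr ?e))) *\<^sub>R S \<beta> X
      - (?k * (\<rho> * P0 powr ?e)) *\<^sub>R (S \<beta> X - sb *\<^sub>R w)"
  proof -
    have "resid \<beta> q X = S q X - (?k * (P powr ?e * \<rho>)) *\<^sub>R S \<beta> X"
      unfolding resid_def quotient_powr[OF X \<beta>] P_def \<rho>_def ..
    moreover have "(?k * (\<rho> * P0 powr ?e)) *\<^sub>R (sb *\<^sub>R w) = sq *\<^sub>R w" unfolding sqb scaleR_scaleR by (simp only: mult_ac)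
    moreover have "(?k * (P powr ?e * \<rho>)) *\<^sub>R S \<beta> X = (?k * (\<rho> * (P powr ?e - P0 powr ?e))) *\<^sub>R S \<beta> X + (?k * (\<rho> * P0 powr ?e)) *\<^sub>R S \<beta> X"
    proof -
      have "?k * (P powr ?e * \<rho>) = ?k * (\<rho> * (P powr ?e - P0 powr ?e)) + ?k * (\<rho> * P0 powr ?e)" by (simp add: algebra_simps)
      then show ?thesis by (simp only: scaleR_add_left)
    qed
    moreover have "a - (b + d) = (a - x) - b - (d - x)" for a b d x :: 'a by simp
    ultimately show ?thesis by (simp only: scaleR_diff_right[of "?k * (\<rho> * P0 powr ?e)"])
  qed
  then have "norm (resid \<beta> q X) \<le> norm (S q X - sq *\<^sub>R w) + norm ((?k * (\<rho> * (P powr ?e - P0 powr ?e))) *\<^sub>R S \<beta> X)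
      + norm ((?k * (\<rho> * P0 powr ?e)) *\<^sub>R (S \<beta> X - sb *\<^sub>R w))"
    using norm_diff3 by (simp only:)
  also have "\<dots> = norm (S q X - sq *\<^sub>R w) + ?k * (\<rho> * \<bar>P powr ?e - P0 powr ?e\<bar>) * norm (S \<beta> X)
      + ?k * (\<rho> * P0 powr ?e) * norm (S \<beta> X - sb *\<^sub>R w)"
    using kp \<rho>0 by (simp add: abs_mult)
  also have "\<dots> \<le> errS \<epsilon> q * \<tau> * ?r powr (- (q + 1))
      + ?k * (\<rho> * (quoL \<beta> ?e * (quoE \<epsilon> \<beta> * \<tau>))) * (upS \<beta> * ?r powr (- (\<beta> + 1)))
      + ?k * (\<rho> * quoP \<beta> ?e) * (errS \<epsilon> \<beta> * \<tau> * ?r powr (- (\<beta> + 1)))"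
    using eS Sb PL P0P kp \<rho>0 qp E0 \<tau> by (intro add_mono mult_mono mult_left_mono mult_nonneg_nonneg) auto
  also have "\<dots> = errS \<epsilon> q * \<tau> * ?r powr (- (q + 1))
      + ?k * (quoL \<beta> ?e * quoE \<epsilon> \<beta> * upS \<beta>) * \<tau> * (\<rho> * ?r powr (- (\<beta> + 1)))
      + ?k * (quoP \<beta> ?e * errS \<epsilon> \<beta>) * \<tau> * (\<rho> * ?r powr (- (\<beta> + 1)))"
    by (simp only: mult_ac)
  also have "\<dots> = residN \<epsilon> \<beta> q * \<tau> * ?r powr (- (q + 1))"
    unfolding rr residN_def by (simp only: distrib_right distrib_left add.assoc)
  finally show ?thesis .
qed

lemma resid_bound:
  assumes X: "X \<notin> \<Gamma>" and y: "y \<in> \<Gamma>" "dist X y \<le> 2 * infdist X \<Gamma>"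
    and \<beta>: "0 < \<beta>" and q: "0 \<le> q" and \<epsilon>: "0 < \<epsilon>" "\<epsilon> < \<beta>" "\<epsilon> < 1"
  shows "norm (resid \<beta> q X) \<le> residK \<epsilon> \<beta> q * tail \<epsilon> y (infdist X \<Gamma>) * infdist X \<Gamma> powr (- (q + 1))"
proof -
  let ?r = "infdist X \<Gamma>"
  have t0: "0 \<le> tail \<epsilon> y ?r" by (rule tail_bounds(1)[OF \<epsilon>(1)])
  note kp = kapP_pos[OF \<beta> q] and qp = quo_pos[OF \<beta>]
  have uq: "0 < upS q" unfolding upS_def using q by (intro riesz_bound_pos) auto
  have F0: "0 \<le> residF \<beta> q" unfolding residF_def using uq kp qp by (intro add_nonneg_nonneg mult_nonneg_nonneg) auto
  have N0: "0 \<le> residN \<epsilon> \<beta> q"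
    unfolding residN_def quoE_def using kp qp \<beta> \<epsilon> q lowA_pos[of \<beta>]
    by (intro add_nonneg_nonneg mult_nonneg_nonneg divide_nonneg_nonneg err_nonneg) auto
  show ?thesis
  proof (cases "alpha1 d \<sigma> y (8 * ?r) < small1")
    case True
    obtain c w where cw: "0 < c" "?r / 2 \<le> norm w" "norm w \<le> 4 * ?r"
      and A: "\<And>p. 0 < p \<Longrightarrow> \<epsilon> < p \<Longrightarrow> \<bar>A p X - c * riesz_const d p * norm w powr (- p)\<bar>
        \<le> errA \<epsilon> p * tail \<epsilon> y ?r * ?r powr (- p)"
      and S: "\<And>p. - 1 < p \<Longrightarrow> \<epsilon> < p + 1 \<Longrightarrow> norm (S p X - (c * riesz_const d (p + 2) * norm w powr (- (p + 2))) *\<^sub>R w)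
        \<le> errS \<epsilon> p * tail \<epsilon> y ?r * ?r powr (- (p + 1))"
      by (rule near_flat[OF X y \<epsilon>(1) True]) (rule that; assumption)
    have "norm (resid \<beta> q X) \<le> residN \<epsilon> \<beta> q * tail \<epsilon> y ?r * ?r powr (- (q + 1))"
      by (rule resid_near[OF X \<beta> q \<epsilon> t0 cw A S])
    also have "\<dots> \<le> residK \<epsilon> \<beta> q * tail \<epsilon> y ?r * ?r powr (- (q + 1))"
      using t0 F0 small1_pos unfolding residK_def by (intro mult_right_mono) auto
    finally show ?thesis .
  next
    case False
    then have st: "small1 \<le> tail \<epsilon> y ?r" using \<epsilon>(1) by (intro alpha1_le_tail) auto
    have "norm (resid \<beta> q X) \<le> residF \<beta> q * ?r powr (- (q + 1))" by (rule resid_far[OF X \<beta> q])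
    also have "residF \<beta> q = residF \<beta> q / small1 * small1" using small1_pos by simp
    also have "residF \<beta> q / small1 * small1 * ?r powr (- (q + 1)) \<le> residK \<epsilon> \<beta> q * tail \<epsilon> y ?r * ?r powr (- (q + 1))"
      using t0 F0 N0 small1_pos st unfolding residK_def by (intro mult_right_mono mult_mono) auto
    finally show ?thesis .
  qed
qed

end

section \<open>The Carleson estimate\<close>

lemma le_mult_INF:
  fixes f :: "'i \<Rightarrow> ennreal"
  assumes c: "0 < c" and le: "\<And>i. i \<in> I \<Longrightarrow> a \<le> ennreal c * f i"
  shows "a \<le> ennreal c * (INF i\<in>I. f i)"
proof -
  have cc: "ennreal (1 / c) * ennreal c = 1" using c by (simp flip: ennreal_mult)
  have "ennreal (1 / c) * a \<le> (INF i\<in>I. f i)"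
  proof (rule INF_greatest)
    fix i assume "i \<in> I"
    then have "ennreal (1 / c) * a \<le> ennreal (1 / c) * (ennreal c * f i)" by (intro mult_left_mono le) auto
    also have "\<dots> = f i" by (simp only: mult.assoc[symmetric] cc) simp
    finally show "ennreal (1 / c) * a \<le> f i" .
  qed
  then have "ennreal c * (ennreal (1 / c) * a) \<le> ennreal c * (INF i\<in>I. f i)" by (rule mult_left_mono) simp
  moreover have "ennreal c * (ennreal (1 / c) * a) = (ennreal (1 / c) * ennreal c) * a" by (simp only: mult_ac)
  ultimately show ?thesis unfolding cc by simp
qed

text \<open>Test functions for the small ball are test functions for the large one; only the
  normalisation by the radius changes, by at most k^(d+1).\<close>

lemma alpha_ball_mono:
  fixes \<sigma> :: "'a::euclidean_space measure"
  assumes \<rho>: "0 < \<rho>" and s: "0 < s" and sub: "ball y \<rho> \<subseteq> ball z s" and k: "s / \<rho> \<le> k"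
  shows "alpha d \<sigma> y \<rho> \<le> ennreal (k ^ Suc d) * alpha d \<sigma> z s"
  unfolding alpha_def[of d \<sigma> z]
proof (rule le_mult_INF)
  have k0: "0 < k" using \<rho> s k by (meson divide_pos_pos less_le_trans)
  then show "0 < k ^ Suc d" by simp
  fix \<mu> :: "'a measure" assume \<mu>: "\<mu> \<in> flat_measures d"
  have Lip: "Lip y \<rho> \<subseteq> Lip z s" using sub unfolding Lip_def by blast
  have pw: "R powr (- real d - 1) = 1 / R ^ Suc d" if "0 < R" for R
  proof -
    have "- real d - 1 = - real (Suc d)" by simp
    then show ?thesis using that by (simp only: powr_minus_divide powr_realpow)
  qed
  have "\<rho> powr (- real d - 1) = (s / \<rho>) ^ Suc d * s powr (- real d - 1)"
    unfolding pw[OF \<rho>] pw[OF s] using s by (simp add: power_divide)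
  also have "\<dots> \<le> k ^ Suc d * s powr (- real d - 1)"
    using \<rho> s k by (intro mult_right_mono power_mono) auto
  finally have p: "ennreal (\<rho> powr (- real d - 1)) \<le> ennreal (k ^ Suc d) * ennreal (s powr (- real d - 1))"
    using k0 by (simp flip: ennreal_mult add: ennreal_leI)
  have "alpha d \<sigma> y \<rho> \<le> lip_dist d y \<rho> \<mu> \<sigma>" unfolding alpha_def by (rule INF_lower[OF \<mu>])
  also have "\<dots> \<le> (ennreal (k ^ Suc d) * ennreal (s powr (- real d - 1))) *
      (SUP f\<in>Lip z s. ennreal \<bar>(\<integral>y. f y \<partial>\<sigma>) - (\<integral>y. f y \<partial>\<mu>)\<bar>)"
    unfolding lip_dist_def by (intro mult_mono p SUP_subset_mono Lip) auto
  also have "\<dots> = ennreal (k ^ Suc d) * lip_dist d z s \<mu> \<sigma>" unfolding lip_dist_def by (simp only: mult.assoc)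
  finally show "alpha d \<sigma> y \<rho> \<le> ennreal (k ^ Suc d) * lip_dist d z s \<mu> \<sigma>" .
qed

text \<open>\<open>\<alpha>\<close> itself is not known to be measurable; this upper semicontinuous minorant is, and it still
  dominates \<open>\<alpha>\<close> at a smaller scale.\<close>

definition alpha_env :: "nat \<Rightarrow> 'a::euclidean_space measure \<Rightarrow> 'a \<Rightarrow> real \<Rightarrow> ennreal" where
  "alpha_env d \<sigma> y s = (INF p\<in>{(z, t). dist y z < s / 4 \<and> s / 2 < t \<and> t < 2 * s}. alpha d \<sigma> (fst p) (snd p))"

lemma alpha_env_le: "0 < s \<Longrightarrow> alpha_env d \<sigma> y s \<le> alpha d \<sigma> y s"
  unfolding alpha_env_def by (rule INF_lower2[of "(y, s)"]) auto

text \<open>Every ball in the infimum contains the ball of radius \<rho> around y, because \<rho> +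
  s/4 \<le> s/2 < t, and its radius is below 2s \<le> 16 \<rho>.\<close>

lemma alpha_le_env:
  assumes \<rho>: "0 < \<rho>" and s: "4 * \<rho> \<le> s" "s \<le> 8 * \<rho>"
  shows "alpha d \<sigma> y \<rho> \<le> ennreal (16 ^ Suc d) * alpha_env d \<sigma> y s"
  unfolding alpha_env_def
proof (rule le_mult_INF)
  fix p assume "p \<in> {(z, t). dist y z < s / 4 \<and> s / 2 < t \<and> t < 2 * s}"
  then obtain z t where p: "p = (z, t)" "dist y z < s / 4" "s / 2 < t" "t < 2 * s" by auto
  have "ball y \<rho> \<subseteq> ball z t"
  proof
    fix x assume "x \<in> ball y \<rho>"
    then show "x \<in> ball z t" using p s dist_triangle[of z x y] by (simp add: dist_commute)
  qed
  then show "alpha d \<sigma> y \<rho> \<le> ennreal (16 ^ Suc d) * alpha d \<sigma> (fst p) (snd p)"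
    using \<rho> s p by (intro alpha_ball_mono) (auto simp: divide_le_eq)
qed simp

text \<open>A strict sublevel set is the union of open sets of pairs (y, s), one for each centre and
  radius at which \<alpha> is small; openness makes the uncountable union harmless.\<close>

lemma alpha_env_measurable[measurable]:
  "(\<lambda>(y, s). alpha_env d \<sigma> y s) \<in> borel_measurable (borel \<Otimes>\<^sub>M borel)"
  unfolding borel_prod
proof (rule borel_measurableI_less)
  fix c :: ennreal
  have "{q \<in> space borel. (case q of (y, s) \<Rightarrow> alpha_env d \<sigma> y s) < c}
    = (\<Union>p\<in>{p. alpha d \<sigma> (fst p) (snd p) < c}. {q. dist (fst q) (fst p) < snd q / 4 \<and> snd q / 2 < snd p \<and> snd p < 2 * snd q})"
    by (auto simp: alpha_env_def INF_less_iff) blast+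
  moreover have "open {q. dist (fst q) (fst p) < snd q / 4 \<and> snd q / 2 < snd p \<and> snd p < 2 * snd q}" for p :: "'a \<times> real"
    by (intro open_Collect_conj open_Collect_less continuous_intros) auto
  ultimately show "{q \<in> space borel. (case q of (y, s) \<Rightarrow> alpha_env d \<sigma> y s) < c} \<in> sets borel"
    by (simp only:) (intro borel_open open_UN ballI)
qed

text \<open>The truncation at 1 bounds the contribution of scales larger than the ball, which the
  rectifiability condition does not see.\<close>

definition alpha_sq :: "nat \<Rightarrow> 'a::euclidean_space measure \<Rightarrow> 'a \<Rightarrow> real \<Rightarrow> ennreal" where
  "alpha_sq d \<sigma> y s = (min 1 (alpha_env d \<sigma> y s))\<^sup>2"

lemma alpha_sq_measurable[measurable]:
  "(\<lambda>(y, s). alpha_sq d \<sigma> y s) \<in> borel_measurable (borel \<Otimes>\<^sub>M borel)"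
  unfolding alpha_sq_def by measurable

lemma alpha_sq_comp_measurable[measurable (raw)]:
  assumes [measurable]: "f \<in> borel_measurable M" "g \<in> borel_measurable M"
  shows "(\<lambda>x. alpha_sq d \<sigma> (f x) (g x)) \<in> borel_measurable M"
  using measurable_compose[OF _ alpha_sq_measurable, of "\<lambda>x. (f x, g x)" M d \<sigma>] by simp

lemma alpha_sq_le_1: "alpha_sq d \<sigma> y s \<le> 1"
  unfolding alpha_sq_def by (intro power_le_one) auto

lemma alpha_sq_le: "0 < s \<Longrightarrow> alpha_sq d \<sigma> y s \<le> (alpha d \<sigma> y s)\<^sup>2"
  unfolding alpha_sq_def by (intro power_mono min.coboundedI2 alpha_env_le) auto

lemma alpha1_sq_le:
  assumes "0 < \<rho>" "4 * \<rho> \<le> s" "s \<le> 8 * \<rho>"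
  shows "ennreal ((alpha1 d \<sigma> y \<rho>)\<^sup>2) \<le> ennreal (256 ^ Suc d) * alpha_sq d \<sigma> y s"
proof -
  have "ennreal (alpha1 d \<sigma> y \<rho>) \<le> ennreal (16 ^ Suc d) * min 1 (alpha_env d \<sigma> y s)"
  proof (cases "alpha_env d \<sigma> y s \<le> 1")
    case True
    then show ?thesis using alpha_le_env[OF assms, of d \<sigma> y] unfolding ennreal_alpha1
      by (auto simp: min_def)
  next
    case False
    have "min 1 (alpha d \<sigma> y \<rho>) \<le> 1" by simp
    also have "(1::ennreal) \<le> ennreal (16 ^ Suc d)" using one_le_power[of "16::real" "Suc d"] by (simp only: ennreal_ge_1)
    finally have "min 1 (alpha d \<sigma> y \<rho>) \<le> ennreal (16 ^ Suc d) * 1" by (simp only: mult_1_right)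
    moreover have "min 1 (alpha_env d \<sigma> y s) = 1" using False by (intro min_absorb1) auto
    ultimately show ?thesis unfolding ennreal_alpha1 by (simp only:)
  qed
  then have "(ennreal (alpha1 d \<sigma> y \<rho>))\<^sup>2 \<le> (ennreal (16 ^ Suc d) * min 1 (alpha_env d \<sigma> y s))\<^sup>2"
    by (rule power_mono) simp
  also have "\<dots> = ennreal ((16 ^ Suc d)\<^sup>2) * alpha_sq d \<sigma> y s"
    unfolding alpha_sq_def by (simp only: power_mult_distrib ennreal_power zero_le_power zero_le_numeral)
  also have "(16 ^ Suc d)\<^sup>2 = (256::real) ^ Suc d"
  proof -
    have "((16::real) ^ Suc d)\<^sup>2 = (16\<^sup>2) ^ Suc d" by (simp only: power_mult[symmetric] mult.commute)
    then show ?thesis by simp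
  qed
  finally show ?thesis using alpha1_nonneg[of d \<sigma> y \<rho>] by (simp only: ennreal_power)
qed

section \<open>The squared tail as an integral over scales\<close>

lemma weighted_suminf_Cauchy_Schwarz:
  fixes f w :: "nat \<Rightarrow> real"
  assumes w: "summable w" "\<And>j. 0 \<le> w j" and f: "\<And>j. 0 \<le> f j" "\<And>j. f j \<le> 1"
  shows "(\<Sum>j. w j * f j)\<^sup>2 \<le> suminf w * (\<Sum>j. w j * (f j)\<^sup>2)"
proof -
  have s1: "summable (\<lambda>j. w j * f j)"
    using w f by (intro summable_comparison_test'[OF w(1)]) (auto simp: mult_left_le)
  have s2: "summable (\<lambda>j. w j * (f j)\<^sup>2)"
    using w f by (intro summable_comparison_test'[OF w(1)]) (auto simp: mult_left_le power_le_one)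
  have "(\<Sum>j<n. w j * f j)\<^sup>2 \<le> suminf w * (\<Sum>j. w j * (f j)\<^sup>2)" for n
  proof -
    have "(\<Sum>j<n. w j * f j)\<^sup>2 = (\<Sum>j<n. sqrt (w j) * (sqrt (w j) * f j))\<^sup>2"
      using w(2) by (simp add: mult.assoc[symmetric])
    also have "\<dots> \<le> (\<Sum>j<n. (sqrt (w j))\<^sup>2) * (\<Sum>j<n. (sqrt (w j) * f j)\<^sup>2)"
      by (rule Cauchy_Schwarz_ineq_sum)
    also have "\<dots> = (\<Sum>j<n. w j) * (\<Sum>j<n. w j * (f j)\<^sup>2)"
      using w(2) by (simp add: power_mult_distrib)
    also have "\<dots> \<le> suminf w * (\<Sum>j. w j * (f j)\<^sup>2)"
      using w s2 by (intro mult_mono sum_le_suminf) (auto intro!: sum_nonneg suminf_nonneg)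
    finally show ?thesis .
  qed
  moreover have "(\<lambda>n. (\<Sum>j<n. w j * f j)\<^sup>2) \<longlonglongrightarrow> (\<Sum>j. w j * f j)\<^sup>2"
    by (intro tendsto_power summable_LIMSEQ s1)
  ultimately show ?thesis by (intro LIMSEQ_le_const2) auto
qed

definition "tailK d \<epsilon> = 1 / (1 - (2::real) powr (- \<epsilon>)) * (2 * 256 ^ Suc d * 64 powr \<epsilon>)"

text \<open>The value at \<rho> = 8 r 2^j is dominated at every s between 4\<rho> and 8\<rho>, hence
  by the average over this interval of length 4\<rho>. There 1 / (4\<rho>) \<le> 2 / s and 2^(-j)
  \<le> 64 r / s.\<close>

lemma alpha1_sq_le_integral:
  fixes \<sigma> :: "'a::euclidean_space measure"
  assumes r: "0 < r" and \<epsilon>: "0 < \<epsilon>"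
  shows "ennreal (2 powr (- \<epsilon> * real j) * (alpha1 d \<sigma> y (2 * (2 ^ j * (4 * r))))\<^sup>2)
    \<le> ennreal (2 * 256 ^ Suc d * 64 powr \<epsilon>) *
      (\<integral>\<^sup>+s. indicator {32 * r * 2 ^ j..<64 * r * 2 ^ j} s * (ennreal ((r / s) powr \<epsilon> / s) * alpha_sq d \<sigma> y s) \<partial>lborel)"
proof -
  define \<rho> where "\<rho> = 2 * (2 ^ j * (4 * r))"
  have \<rho>: "0 < \<rho>" "32 * r * 2 ^ j = 4 * \<rho>" "64 * r * 2 ^ j = 8 * \<rho>" using r by (auto simp: \<rho>_def)
  define a where "a = (alpha1 d \<sigma> y \<rho>)\<^sup>2"
  define K where "K = 2 * 256 ^ Suc d * 64 powr \<epsilon>"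
  have a0: "0 \<le> a" by (simp add: a_def)
  have K0: "0 \<le> K" by (simp add: K_def)
  have [measurable]: "alpha_sq d \<sigma> y \<in> borel_measurable borel"
    using measurable_Pair2[OF alpha_sq_measurable, of y d \<sigma>] by simp
  have pt: "ennreal (2 powr (- \<epsilon> * real j) * a / (4 * \<rho>)) * indicator {4 * \<rho>..<8 * \<rho>} s
    \<le> ennreal K * (indicator {4 * \<rho>..<8 * \<rho>} s * (ennreal ((r / s) powr \<epsilon> / s) * alpha_sq d \<sigma> y s))" for s
  proof (cases "s \<in> {4 * \<rho>..<8 * \<rho>}")
    case True
    then have s: "4 * \<rho> \<le> s" "s \<le> 8 * \<rho>" "0 < s" using \<rho> by auto
    have "2 powr (- \<epsilon> * real j) = (1 / 2 ^ j) powr \<epsilon>"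
    proof -
      have "1 / 2 ^ j = (2::real) powr (- real j)" by (simp add: powr_minus_divide powr_realpow)
      then show ?thesis by (simp add: powr_powr mult.commute)
    qed
    also have "\<dots> \<le> (64 * (r / s)) powr \<epsilon>"
      using s r \<epsilon> \<rho>(3) by (intro powr_mono2) (auto simp: field_simps)
    also have "\<dots> = 64 powr \<epsilon> * (r / s) powr \<epsilon>" by (rule powr_mult)
    finally have 1: "2 powr (- \<epsilon> * real j) \<le> 64 powr \<epsilon> * (r / s) powr \<epsilon>" .
    have 2: "1 / (4 * \<rho>) \<le> 2 / s" using s \<rho> by (simp add: field_simps)
    have "2 powr (- \<epsilon> * real j) * a / (4 * \<rho>) = 2 powr (- \<epsilon> * real j) * (1 / (4 * \<rho>)) * a" by simp
    also have "\<dots> \<le> 64 powr \<epsilon> * (r / s) powr \<epsilon> * (2 / s) * a"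
      using 1 2 a0 \<rho> s by (intro mult_right_mono mult_mono) auto
    also have "\<dots> = 2 * 64 powr \<epsilon> * ((r / s) powr \<epsilon> / s) * a" by simp
    finally have "ennreal (2 powr (- \<epsilon> * real j) * a / (4 * \<rho>)) \<le> ennreal (2 * 64 powr \<epsilon> * ((r / s) powr \<epsilon> / s)) * ennreal a"
      using s a0 by (simp only: ennreal_leI flip: ennreal_mult'')
    also have "\<dots> \<le> ennreal (2 * 64 powr \<epsilon> * ((r / s) powr \<epsilon> / s)) * (ennreal (256 ^ Suc d) * alpha_sq d \<sigma> y s)"
      unfolding a_def by (intro mult_left_mono alpha1_sq_le \<rho> s) auto
    also have "\<dots> = ennreal K * (ennreal ((r / s) powr \<epsilon> / s) * alpha_sq d \<sigma> y s)"
    proof -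
      have "ennreal (2 * 64 powr \<epsilon> * ((r / s) powr \<epsilon> / s)) * ennreal (256 ^ Suc d) = ennreal K * ennreal ((r / s) powr \<epsilon> / s)"
        using s by (simp add: K_def mult_ac flip: ennreal_mult)
      then show ?thesis by (simp only: mult.assoc[symmetric])
    qed
    finally show ?thesis using True by simp
  qed simp
  have "ennreal (2 powr (- \<epsilon> * real j) * a) = ennreal (2 powr (- \<epsilon> * real j) * a / (4 * \<rho>)) * ennreal (4 * \<rho>)"
    using \<rho> a0 by (simp flip: ennreal_mult)
  also have "\<dots> = ennreal (2 powr (- \<epsilon> * real j) * a / (4 * \<rho>)) * emeasure lborel {4 * \<rho>..<8 * \<rho>}"
    using \<rho> by simp
  also have "\<dots> = (\<integral>\<^sup>+s. ennreal (2 powr (- \<epsilon> * real j) * a / (4 * \<rho>)) * indicator {4 * \<rho>..<8 * \<rho>} s \<partial>lborel)"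
    by (simp only: nn_integral_cmult_indicator[symmetric] sets_lborel atLeastLessThan_borel)
  also have "\<dots> \<le> (\<integral>\<^sup>+s. ennreal K * (indicator {4 * \<rho>..<8 * \<rho>} s * (ennreal ((r / s) powr \<epsilon> / s) * alpha_sq d \<sigma> y s)) \<partial>lborel)"
    by (intro nn_integral_mono pt)
  also have "\<dots> = ennreal K * (\<integral>\<^sup>+s. indicator {4 * \<rho>..<8 * \<rho>} s * (ennreal ((r / s) powr \<epsilon> / s) * alpha_sq d \<sigma> y s) \<partial>lborel)"
    by (intro nn_integral_cmult) measurable
  finally show ?thesis unfolding a_def K_def \<rho>(2,3) \<rho>_def[symmetric] .
qed

context ahlfors begin

text \<open>Cauchy-Schwarz with the weights 2^(-\<epsilon>j). The intervals from 32 r 2^j to 64 r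
  2^j are disjoint, so the dyadic sum is at most one integral over s \<ge> 32 r.\<close>

lemma tail_sq_le:
  assumes r: "0 < r" and \<epsilon>: "0 < \<epsilon>"
  shows "ennreal ((tail \<epsilon> y r)\<^sup>2) \<le> ennreal (tailK d \<epsilon>) *
      (\<integral>\<^sup>+s. indicator {32 * r..} s * (ennreal ((r / s) powr \<epsilon> / s) * alpha_sq d \<sigma> y s) \<partial>lborel)"
proof -
  define f where "f j = alpha1 d \<sigma> y (2 * (2 ^ j * (4 * r)))" for j :: nat
  define w where "w j = (2::real) powr (- \<epsilon> * real j)" for j :: nat
  define I where "I j = {32 * r * 2 ^ j..<64 * r * 2 ^ j}" for j :: nat
  define g where "g s = ennreal ((r / s) powr \<epsilon> / s) * alpha_sq d \<sigma> y s" for s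
  have [measurable]: "alpha_sq d \<sigma> y \<in> borel_measurable borel"
    using measurable_Pair2[OF alpha_sq_measurable, of y d \<sigma>] by simp
  have [measurable]: "g \<in> borel_measurable borel" unfolding g_def[abs_def] by measurable
  have wp: "w j = (2 powr (- \<epsilon>)) ^ j" for j by (simp add: w_def powr_powr flip: powr_realpow)
  have l1: "2 powr (- \<epsilon>) < 1" using \<epsilon> by (simp add: powr_less_one)
  have sw: "summable w" "suminf w = 1 / (1 - 2 powr (- \<epsilon>))"
    unfolding wp[abs_def] using l1 by (auto intro!: summable_geometric suminf_geometric)
  have f: "0 \<le> f j" "f j \<le> 1" for j by (simp_all add: f_def alpha1_nonneg alpha1_le_1)
  have s2: "summable (\<lambda>j. w j * (f j)\<^sup>2)"
    using f by (intro summable_comparison_test'[OF sw(1)]) (auto simp: w_def mult_left_le power_le_one)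
  have disj: "disjoint_family I"
  proof (unfold disjoint_family_on_def, intro ballI impI)
    have *: "I i \<inter> I j = {}" if "i < j" for i j
    proof -
      have "(2::real) ^ Suc i \<le> 2 ^ j" using that by (intro power_increasing) auto
      then have "64 * r * 2 ^ i \<le> 32 * r * 2 ^ j" using r by simp
      then show ?thesis by (auto simp: I_def)
    qed
    fix i j :: nat assume "i \<noteq> j"
    then show "I i \<inter> I j = {}" using *[of i j] *[of j i] by (cases "i < j") (auto simp: Int_commute)
  qed
  have UI: "(\<Union>j. I j) \<subseteq> {32 * r..}"
  proof
    fix s assume "s \<in> (\<Union>j. I j)"
    then obtain j where "32 * r * 2 ^ j \<le> s" by (auto simp: I_def)
    moreover have "32 * r * 1 \<le> 32 * r * 2 ^ j" using r by (intro mult_left_mono) auto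
    ultimately show "s \<in> {32 * r..}" by simp
  qed
  have "(tail \<epsilon> y r)\<^sup>2 \<le> suminf w * (\<Sum>j. w j * (f j)\<^sup>2)"
    unfolding tail_def f_def[symmetric] w_def[symmetric]
    by (rule weighted_suminf_Cauchy_Schwarz[OF sw(1) _ f]) (simp add: w_def)
  then have "ennreal ((tail \<epsilon> y r)\<^sup>2) \<le> ennreal (suminf w * (\<Sum>j. w j * (f j)\<^sup>2))" by (rule ennreal_leI)
  also have "\<dots> = ennreal (suminf w) * (\<Sum>j. ennreal (w j * (f j)\<^sup>2))"
  proof -
    have "(\<Sum>j. ennreal (w j * (f j)\<^sup>2)) = ennreal (\<Sum>j. w j * (f j)\<^sup>2)"
      by (rule suminf_ennreal2) (use s2 in \<open>auto simp: w_def\<close>)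
    moreover have "0 \<le> suminf w" unfolding sw(2) using l1 by simp
    ultimately show ?thesis using s2 by (simp add: ennreal_mult suminf_nonneg w_def)
  qed
  also have "\<dots> \<le> ennreal (suminf w) * (\<Sum>j. ennreal (2 * 256 ^ Suc d * 64 powr \<epsilon>) * (\<integral>\<^sup>+s. indicator (I j) s * g s \<partial>lborel))"
    unfolding w_def f_def I_def g_def
    by (intro mult_left_mono suminf_le summableI alpha1_sq_le_integral[OF r \<epsilon>]) auto
  also have "(\<Sum>j. ennreal (2 * 256 ^ Suc d * 64 powr \<epsilon>) * (\<integral>\<^sup>+s. indicator (I j) s * g s \<partial>lborel))
    = ennreal (2 * 256 ^ Suc d * 64 powr \<epsilon>) * (\<integral>\<^sup>+s. (\<Sum>j. indicator (I j) s * g s) \<partial>lborel)"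
    by (subst nn_integral_suminf) (auto simp: I_def ennreal_suminf_cmult)
  also have "(\<integral>\<^sup>+s. (\<Sum>j. indicator (I j) s * g s) \<partial>lborel) \<le> (\<integral>\<^sup>+s. indicator {32 * r..} s * g s \<partial>lborel)"
  proof (rule nn_integral_mono)
    fix s
    have "(\<Sum>j. indicator (I j) s * g s) = (\<Sum>j. indicator (I j) s) * g s" by (rule ennreal_suminf_multc)
    also have "\<dots> = indicator (\<Union>j. I j) s * g s" by (simp only: suminf_indicator[OF disj])
    also have "\<dots> \<le> indicator {32 * r..} s * g s"
      using UI by (intro mult_right_mono) (auto simp: indicator_def)
    finally show "(\<Sum>j. indicator (I j) s * g s) \<le> indicator {32 * r..} s * g s" .
  qed
  finally have "ennreal ((tail \<epsilon> y r)\<^sup>2) \<le> ennreal (suminf w) * (ennreal (2 * 256 ^ Suc d * 64 powr \<epsilon>) * (\<integral>\<^sup>+s. indicator {32 * r..} s * g s \<partial>lborel))"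
    by (simp add: mult_left_mono)
  also have "\<dots> = ennreal (tailK d \<epsilon>) * (\<integral>\<^sup>+s. indicator {32 * r..} s * g s \<partial>lborel)"
    unfolding tailK_def sw(2) using l1 by (simp add: mult.assoc[symmetric] flip: ennreal_mult)
  finally show ?thesis by (simp only: g_def)
qed

end

text \<open>|z|^(-a) is at most 2^(a+1) times the integral of t^(-a-1) over |z| < t < 2|z|. By
  Tonelli only volumes of balls of radius t < 2\<rho> remain, in place of polar coordinates.\<close>

lemma nn_integral_norm_powr_ball:
  fixes y :: "'a::euclidean_space"
  assumes \<epsilon>: "0 < \<epsilon>" "\<epsilon> < real DIM('a)" and \<rho>: "0 < \<rho>"
  defines "a \<equiv> real DIM('a) - \<epsilon>"
  shows "(\<integral>\<^sup>+X. ennreal (indicator (ball y \<rho>) X * norm (X - y) powr (- a)) \<partial>lborel)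
    \<le> ennreal (2 powr (a + 1) * unit_ball_vol (real DIM('a)) * (2 * \<rho>) powr \<epsilon> / \<epsilon>)"
proof -
  let ?n = "real DIM('a)" and ?\<omega> = "unit_ball_vol (real DIM('a))"
  have a: "0 < a" using \<epsilon> by (simp add: a_def)
  have \<omega>: "0 \<le> ?\<omega>" by simp
  have pt: "ennreal (indicator (ball y \<rho>) X * norm (X - y) powr (- a))
    \<le> (\<integral>\<^sup>+t. ennreal (2 powr (a + 1)) * (indicator {0<..<2 * \<rho>} t * ennreal (t powr (- a - 1)) * indicator (ball y t) X) \<partial>lborel)" for X
  proof (cases "X \<in> ball y \<rho> \<and> X \<noteq> y")
    case True
    define z where "z = norm (X - y)"
    have z: "0 < z" "z < \<rho>" using True by (auto simp: z_def dist_norm norm_minus_commute)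
    have "ennreal (z powr (- a)) = ennreal (2 powr (a + 1) * (2 * z) powr (- a - 1)) * ennreal z"
    proof -
      have "(2 * z) powr (- a - 1) = 2 powr (- (a + 1)) * z powr (- (a + 1))"
        using powr_mult[of 2 z "- (a + 1)"] by simp
      moreover have "2 powr (a + 1) * 2 powr (- (a + 1)) = (1::real)" by (simp flip: powr_add)
      moreover have "z powr (- (a + 1)) * z = z powr (- a)"
      proof -
        have "z powr (- a) = z powr (- (a + 1) + 1)" by simp
        also have "\<dots> = z powr (- (a + 1)) * z powr 1" by (rule powr_add)
        finally show ?thesis using z by simp
      qed
      ultimately have "2 powr (a + 1) * (2 * z) powr (- a - 1) * z = z powr (- a)"
        by (metis mult.assoc mult_1)
      then show ?thesis using z by (simp flip: ennreal_mult)
    qed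
    also have "\<dots> = (\<integral>\<^sup>+t. ennreal (2 powr (a + 1) * (2 * z) powr (- a - 1)) * indicator {z<..<2 * z} t \<partial>lborel)"
      using z by (subst nn_integral_cmult_indicator) auto
    also have "\<dots> \<le> (\<integral>\<^sup>+t. ennreal (2 powr (a + 1)) * (indicator {0<..<2 * \<rho>} t * ennreal (t powr (- a - 1)) * indicator (ball y t) X) \<partial>lborel)"
    proof (rule nn_integral_mono)
      fix t
      show "ennreal (2 powr (a + 1) * (2 * z) powr (- a - 1)) * indicator {z<..<2 * z} t
        \<le> ennreal (2 powr (a + 1)) * (indicator {0<..<2 * \<rho>} t * ennreal (t powr (- a - 1)) * indicator (ball y t) X)"
      proof (cases "t \<in> {z<..<2 * z}")
        case t: True
        then have "X \<in> ball y t" by (auto simp: z_def dist_norm norm_minus_commute)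
        moreover have "(2 * z) powr (- a - 1) \<le> t powr (- a - 1)" using t z a by (intro powr_mono2') auto
        ultimately show ?thesis using t z by (auto simp: ennreal_mult intro!: mult_left_mono ennreal_leI)
      qed simp
    qed
    finally show ?thesis using True by (simp add: z_def)
  qed auto
  have [measurable]: "Measurable.pred (borel \<Otimes>\<^sub>M borel) (\<lambda>p::'a \<times> real. fst p \<in> ball y (snd p))"
    unfolding mem_ball by measurable
  have ind: "indicator (ball y t) X = (indicator {p. fst p \<in> ball y (snd p)} (X, t) :: ennreal)" for t and X :: 'a
    by (simp add: indicator_def)
  have [measurable]: "{p::'a \<times> real. fst p \<in> ball y (snd p)} \<in> sets (borel \<Otimes>\<^sub>M borel)"
    using measurable_sets[of "\<lambda>p::'a \<times> real. fst p \<in> ball y (snd p)" "borel \<Otimes>\<^sub>M borel" "count_space UNIV" "{True}"]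
    by (simp add: vimage_def space_pair_measure)
  have "(\<integral>\<^sup>+X. ennreal (indicator (ball y \<rho>) X * norm (X - y) powr (- a)) \<partial>lborel)
    \<le> (\<integral>\<^sup>+X. \<integral>\<^sup>+t. ennreal (2 powr (a + 1)) * (indicator {0<..<2 * \<rho>} t * ennreal (t powr (- a - 1)) * indicator (ball y t) X) \<partial>lborel \<partial>lborel)"
    by (rule nn_integral_mono) (rule pt)
  also have "\<dots> = (\<integral>\<^sup>+t. \<integral>\<^sup>+X. ennreal (2 powr (a + 1)) * (indicator {0<..<2 * \<rho>} t * ennreal (t powr (- a - 1)) * indicator (ball y t) X) \<partial>lborel \<partial>lborel)"
    unfolding ind
    using lborel_pair.Fubini[of "\<lambda>(X, t). ennreal (2 powr (a + 1)) * (indicator {0<..<2 * \<rho>} t * ennreal (t powr (- a - 1)) * indicator {p. fst p \<in> ball y (snd p)} (X, t))"]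
    by simp
  also have "\<dots> = (\<integral>\<^sup>+t. ennreal (2 powr (a + 1) * ?\<omega>) * ennreal (indicator {0<..<2 * \<rho>} t * t powr (\<epsilon> - 1)) \<partial>lborel)"
  proof (rule nn_integral_cong)
    fix t :: real
    show "(\<integral>\<^sup>+X. ennreal (2 powr (a + 1)) * (indicator {0<..<2 * \<rho>} t * ennreal (t powr (- a - 1)) * indicator (ball y t) X) \<partial>lborel)
      = ennreal (2 powr (a + 1) * ?\<omega>) * ennreal (indicator {0<..<2 * \<rho>} t * t powr (\<epsilon> - 1))"
    proof (cases "t \<in> {0<..<2 * \<rho>}")
      case True
      have tt: "t powr (- a - 1) * t ^ DIM('a) = t powr (\<epsilon> - 1)"
      proof -
        have "t powr (- a - 1) * t ^ DIM('a) = t powr (- a - 1) * t powr ?n" using True by (simp add: powr_realpow)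
        also have "\<dots> = t powr (\<epsilon> - 1)" unfolding a_def by (simp flip: powr_add)
        finally show ?thesis .
      qed
      have "(\<integral>\<^sup>+X. ennreal (2 powr (a + 1)) * (indicator {0<..<2 * \<rho>} t * ennreal (t powr (- a - 1)) * indicator (ball y t) X) \<partial>lborel)
        = (\<integral>\<^sup>+X. ennreal (2 powr (a + 1) * t powr (- a - 1)) * indicator (ball y t) X \<partial>lborel)"
        using True by (simp add: ennreal_mult mult.assoc)
      also have "\<dots> = ennreal (2 powr (a + 1) * t powr (- a - 1)) * emeasure lborel (ball y t)"
        by (intro nn_integral_cmult_indicator) auto
      also have "\<dots> = ennreal (2 powr (a + 1) * t powr (- a - 1)) * ennreal (?\<omega> * t ^ DIM('a))"
        using True by (simp add: emeasure_ball)
      also have "\<dots> = ennreal (2 powr (a + 1) * ?\<omega> * (t powr (- a - 1) * t ^ DIM('a)))"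
        using True \<omega> by (simp add: mult_ac flip: ennreal_mult)
      finally show ?thesis using True \<omega> unfolding tt by (simp add: ennreal_mult)
    qed simp
  qed
  also have "\<dots> = ennreal (2 powr (a + 1) * ?\<omega>) * ennreal ((2 * \<rho>) powr \<epsilon> / \<epsilon>)"
    using \<epsilon> \<rho> by (subst nn_integral_cmult) (simp_all add: nn_integral_powr_0)
  also have "\<dots> = ennreal (2 powr (a + 1) * ?\<omega> * (2 * \<rho>) powr \<epsilon> / \<epsilon>)"
    using \<epsilon> \<omega> by (simp flip: ennreal_mult)
  finally show ?thesis .
qed

context ahlfors begin

section \<open>Averaging over \<Gamma> and Tonelli\<close>

definition "carlK \<epsilon> K = C * K\<^sup>2 * tailK d \<epsilon> * 2 powr (real DIM('a))"

text \<open>The factor r^(-n) (r/s)^\<epsilon> / s with r = dist(X, \<Gamma>) replaced by |X - y|,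
  which is comparable with it for the y that occur. This makes it explicitly integrable in
  X.\<close>

definition carl_kernel :: "real \<Rightarrow> 'a \<Rightarrow> real \<Rightarrow> 'a \<Rightarrow> 'a \<Rightarrow> real \<Rightarrow> real" where
  "carl_kernel \<epsilon> x0 \<rho> X y s = (if dist x0 y < 3 * \<rho> \<and> norm (X - y) < s \<and> norm (X - y) < 2 * \<rho>
   then norm (X - y) powr (\<epsilon> - real DIM('a)) * s powr (- \<epsilon> - 1) else 0)"

lemma carl_kernel_measurable[measurable (raw)]:
  assumes [measurable]: "f \<in> borel_measurable N" "g \<in> borel_measurable N" "h \<in> borel_measurable N"
  shows "(\<lambda>x. carl_kernel \<epsilon> x0 \<rho> (f x) (g x) (h x)) \<in> borel_measurable N"
  unfolding carl_kernel_def by measurable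

lemma tailK_pos: "0 < \<epsilon> \<Longrightarrow> 0 < tailK d \<epsilon>"
proof -
  assume "0 < \<epsilon>"
  then have "2 powr (- \<epsilon>) < (1::real)" by (simp add: powr_less_one)
  then show ?thesis by (simp add: tailK_def)
qed

text \<open>r^d is at most C \<sigma>(B(X, 2r)), so the value at X is dominated by an integral over
  points y of \<Gamma> with r \<le> |X - y| < 2r, and each of them admits the bound by
  \<open>tail\<close>.\<close>

lemma carleson_pointwise:
  fixes v :: real
  assumes \<epsilon>: "0 < \<epsilon>" "\<epsilon> < real DIM('a)" and K: "0 \<le> K" and X: "X \<notin> \<Gamma>" "X \<in> ball x0 \<rho>" and x0: "x0 \<in> \<Gamma>"
    and v: "0 \<le> v" "\<And>y. y \<in> \<Gamma> \<Longrightarrow> dist X y \<le> 2 * infdist X \<Gamma> \<Longrightarrow> v \<le> K * tail \<epsilon> y (infdist X \<Gamma>)"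
  shows "ennreal (v\<^sup>2 * infdist X \<Gamma> powr (real d - real DIM('a)))
    \<le> (\<integral>\<^sup>+y. \<integral>\<^sup>+s. ennreal (carlK \<epsilon> K * carl_kernel \<epsilon> x0 \<rho> X y s) * alpha_sq d \<sigma> y s \<partial>lborel \<partial>\<sigma>)"
proof -
  let ?r = "infdist X \<Gamma>" and ?n = "real DIM('a)"
  have r: "0 < ?r" by (rule infdist_pos[OF X(1)])
  have r\<rho>: "?r < \<rho>" using infdist_le[OF x0, of X] X(2) by (simp add: dist_commute)
  obtain y0 where y0: "y0 \<in> \<Gamma>" "dist X y0 = ?r" by (rule nearest)
  have "ball y0 ?r \<subseteq> ball X (2 * ?r)"
  proof
    fix z assume "z \<in> ball y0 ?r"
    then show "z \<in> ball X (2 * ?r)" using y0(2) dist_triangle[of X z y0] by simp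
  qed
  then have "emeasure \<sigma> (ball y0 ?r) \<le> emeasure \<sigma> (ball X (2 * ?r))" by (intro emeasure_mono) (auto simp: sets_\<sigma>)
  then have big: "ennreal (?r ^ d / C) \<le> emeasure \<sigma> (ball X (2 * ?r))"
    using emeasure_ball_ge[OF y0(1) r] by simp
  have rd: "?r powr (real d - ?n) = ?r powr (- ?n) * ?r ^ d"
  proof -
    have "?r powr (real d - ?n) = ?r powr (- ?n + real d)" by (simp add: add.commute)
    then show ?thesis using r by (simp only: powr_add powr_realpow)
  qed
  have "ennreal (v\<^sup>2 * ?r powr (real d - ?n)) = ennreal (C * v\<^sup>2 * ?r powr (- ?n)) * ennreal (?r ^ d / C)"
    using C_pos r v(1) unfolding rd by (simp add: field_simps flip: ennreal_mult)
  also have "\<dots> \<le> ennreal (C * v\<^sup>2 * ?r powr (- ?n)) * emeasure \<sigma> (ball X (2 * ?r))"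
    by (intro mult_left_mono big) auto
  also have "\<dots> = (\<integral>\<^sup>+y. ennreal (C * v\<^sup>2 * ?r powr (- ?n)) * indicator (ball X (2 * ?r)) y \<partial>\<sigma>)"
    by (intro nn_integral_cmult_indicator[symmetric]) (auto simp: sets_\<sigma>)
  also have "\<dots> \<le> (\<integral>\<^sup>+y. \<integral>\<^sup>+s. ennreal (carlK \<epsilon> K * carl_kernel \<epsilon> x0 \<rho> X y s) * alpha_sq d \<sigma> y s \<partial>lborel \<partial>\<sigma>)"
  proof (rule nn_integral_mono_AE)
    show "AE y in \<sigma>. ennreal (C * v\<^sup>2 * ?r powr (- ?n)) * indicator (ball X (2 * ?r)) y
      \<le> (\<integral>\<^sup>+s. ennreal (carlK \<epsilon> K * carl_kernel \<epsilon> x0 \<rho> X y s) * alpha_sq d \<sigma> y s \<partial>lborel)"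
      using AE_in_\<Gamma>
    proof eventually_elim
      case (elim y)
      show ?case
      proof (cases "y \<in> ball X (2 * ?r)")
        case True
        define z where "z = norm (X - y)"
        have z: "?r \<le> z" "z < 2 * ?r" using True infdist_le[OF elim, of X] by (auto simp: z_def dist_norm)
        have "dist x0 y \<le> dist x0 X + dist X y" by (rule dist_triangle)
        then have xy: "dist x0 y < 3 * \<rho>" using X(2) True r\<rho> by simp
        define t where "t = tail \<epsilon> y ?r"
        have t: "0 \<le> t" "v \<le> K * t" using tail_bounds(1)[OF \<epsilon>(1)] v(2)[OF elim] True by (auto simp: t_def)
        have "v\<^sup>2 \<le> (K * t)\<^sup>2" using v(1) t by (intro power_mono) auto
        then have "C * ?r powr (- ?n) * v\<^sup>2 \<le> C * ?r powr (- ?n) * (K\<^sup>2 * t\<^sup>2)"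
          using C_pos by (intro mult_left_mono) (auto simp: power_mult_distrib)
        then have "ennreal (C * v\<^sup>2 * ?r powr (- ?n)) \<le> ennreal (C * K\<^sup>2 * ?r powr (- ?n)) * ennreal (t\<^sup>2)"
          using C_pos by (simp add: mult_ac ennreal_leI flip: ennreal_mult)
        also have "\<dots> \<le> ennreal (C * K\<^sup>2 * ?r powr (- ?n)) * (ennreal (tailK d \<epsilon>) *
            (\<integral>\<^sup>+s. indicator {32 * ?r..} s * (ennreal ((?r / s) powr \<epsilon> / s) * alpha_sq d \<sigma> y s) \<partial>lborel))"
          unfolding t_def by (intro mult_left_mono tail_sq_le r \<epsilon>) auto
        also have "\<dots> = (\<integral>\<^sup>+s. ennreal (C * K\<^sup>2 * ?r powr (- ?n) * tailK d \<epsilon>) *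
            (indicator {32 * ?r..} s * (ennreal ((?r / s) powr \<epsilon> / s) * alpha_sq d \<sigma> y s)) \<partial>lborel)"
          using C_pos tailK_pos[OF \<epsilon>(1)]
          by (subst nn_integral_cmult) (simp_all add: mult.assoc[symmetric] flip: ennreal_mult)
        also have "\<dots> \<le> (\<integral>\<^sup>+s. ennreal (carlK \<epsilon> K * carl_kernel \<epsilon> x0 \<rho> X y s) * alpha_sq d \<sigma> y s \<partial>lborel)"
        proof (rule nn_integral_mono)
          fix s :: real
          show "ennreal (C * K\<^sup>2 * ?r powr (- ?n) * tailK d \<epsilon>) *
              (indicator {32 * ?r..} s * (ennreal ((?r / s) powr \<epsilon> / s) * alpha_sq d \<sigma> y s))
            \<le> ennreal (carlK \<epsilon> K * carl_kernel \<epsilon> x0 \<rho> X y s) * alpha_sq d \<sigma> y s"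
          proof (cases "32 * ?r \<le> s")
            case s: True
            have s0: "0 < s" using s r by linarith
            \<comment> \<open>The cut-offs of the kernel are met, since |X - y| < 2r while 32 r
              \<le> s and r < \<rho>.\<close>
            have ker: "carl_kernel \<epsilon> x0 \<rho> X y s = z powr (\<epsilon> - ?n) * s powr (- \<epsilon> - 1)"
              using xy z s r r\<rho> by (simp add: carl_kernel_def z_def[symmetric])
            have "?r powr (- ?n) * ((?r / s) powr \<epsilon> / s) = ?r powr (\<epsilon> - ?n) * s powr (- \<epsilon> - 1)"
            proof -
              have "?r powr (\<epsilon> - ?n) = ?r powr (- ?n) * ?r powr \<epsilon>" by (simp flip: powr_add)
              moreover have "(?r / s) powr \<epsilon> / s = ?r powr \<epsilon> * (inverse (s powr \<epsilon>) * inverse s)"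
                unfolding powr_divide unfolding divide_inverse by (simp only: mult.assoc)
              moreover have "s powr (- \<epsilon> - 1) = inverse (s powr \<epsilon>) * inverse s"
              proof -
                have "s powr (- \<epsilon> - 1) = s powr (- \<epsilon> + - 1)" by simp
                also have "\<dots> = s powr (- \<epsilon>) * s powr (- 1)" by (rule powr_add)
                finally show ?thesis using s0 by (simp add: powr_minus)
              qed
              ultimately show ?thesis by (simp only: mult.assoc)
            qed
            also have "?r powr (\<epsilon> - ?n) \<le> 2 powr ?n * z powr (\<epsilon> - ?n)"
            proof -
              have "?r powr (\<epsilon> - ?n) \<le> (z / 2) powr (\<epsilon> - ?n)" using z r \<epsilon> by (intro powr_mono2') auto
              also have "\<dots> = 2 powr (?n - \<epsilon>) * z powr (\<epsilon> - ?n)"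
              proof -
                have "\<epsilon> - ?n = - (?n - \<epsilon>)" by simp
                then have h: "2 powr (\<epsilon> - ?n) = inverse (2 powr (?n - \<epsilon>))" by (simp only: powr_minus)
                show ?thesis by (subst powr_divide) (simp only: h divide_inverse inverse_inverse_eq mult.commute)
              qed
              also have "\<dots> \<le> 2 powr ?n * z powr (\<epsilon> - ?n)" using \<epsilon> by (intro mult_right_mono powr_mono) auto
              finally show ?thesis .
            qed
            finally have le: "?r powr (- ?n) * ((?r / s) powr \<epsilon> / s) \<le> 2 powr ?n * z powr (\<epsilon> - ?n) * s powr (- \<epsilon> - 1)"
              by (simp add: mult_right_mono)
            have "C * K\<^sup>2 * ?r powr (- ?n) * tailK d \<epsilon> * ((?r / s) powr \<epsilon> / s)
              = (C * K\<^sup>2 * tailK d \<epsilon>) * (?r powr (- ?n) * ((?r / s) powr \<epsilon> / s))" by (simp only: mult_ac)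
            also have "\<dots> \<le> (C * K\<^sup>2 * tailK d \<epsilon>) * (2 powr ?n * z powr (\<epsilon> - ?n) * s powr (- \<epsilon> - 1))"
              using C_pos tailK_pos[OF \<epsilon>(1)] by (intro mult_left_mono le) auto
            also have "\<dots> = carlK \<epsilon> K * carl_kernel \<epsilon> x0 \<rho> X y s" unfolding ker carlK_def by (simp only: mult_ac)
            finally have "ennreal (C * K\<^sup>2 * ?r powr (- ?n) * tailK d \<epsilon>) * ennreal ((?r / s) powr \<epsilon> / s)
              \<le> ennreal (carlK \<epsilon> K * carl_kernel \<epsilon> x0 \<rho> X y s)"
              using C_pos tailK_pos[OF \<epsilon>(1)] s0 by (simp add: ennreal_leI flip: ennreal_mult)
            from mult_right_mono[OF this, of "alpha_sq d \<sigma> y s"] show ?thesis using s by (simp add: mult.assoc)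
          qed simp
        qed
        finally show ?thesis using True by simp
      qed simp
    qed
  qed
  finally show ?thesis .
qed

definition "carlM \<epsilon> = 2 powr (real DIM('a) - \<epsilon> + 1) * unit_ball_vol (real DIM('a)) * 2 powr \<epsilon> / \<epsilon>"

text \<open>Integrating X over a ball of radius min(s, 2\<rho>) gives min(s, 2\<rho>)^\<epsilon>
  s^(-\<epsilon>-1). This is at most 1 / s for s < 3\<rho>, the weight in the rectifiability
  condition, and has a convergent tail beyond, where \<open>alpha_sq\<close> \<le> 1 is
  enough.\<close>

lemma carl_kernel_integral:
  assumes \<epsilon>: "0 < \<epsilon>" "\<epsilon> < real DIM('a)" and \<rho>: "0 < \<rho>" and k: "0 \<le> k"
  shows "(\<integral>\<^sup>+X. ennreal (k * carl_kernel \<epsilon> x0 \<rho> X y s) * alpha_sq d \<sigma> y s \<partial>lborel)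
    \<le> ennreal (k * carlM \<epsilon>) * (indicator (ball x0 (3 * \<rho>)) y * (indicator {0<..<3 * \<rho>} s * (ennreal (1 / s) * alpha_sq d \<sigma> y s)
        + indicator {3 * \<rho>..} s * ennreal ((2 * \<rho>) powr \<epsilon> * s powr (- \<epsilon> - 1))))"
proof (cases "0 < s \<and> dist x0 y < 3 * \<rho>")
  case False
  then have "carl_kernel \<epsilon> x0 \<rho> X y s = 0" for X
  proof (cases "dist x0 y < 3 * \<rho>")
    case True
    then have "s \<le> 0" using False by simp
    then have "\<not> norm (X - y) < s" using norm_ge_zero[of "X - y"] by linarith
    then show ?thesis by (simp add: carl_kernel_def)
  qed (simp add: carl_kernel_def)
  then show ?thesis by simp
next
  case True
  let ?n = "real DIM('a)"
  define \<mu> where "\<mu> = min s (2 * \<rho>)"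
  have \<mu>: "0 < \<mu>" "\<mu> \<le> s" "\<mu> \<le> 2 * \<rho>" using True \<rho> by (auto simp: \<mu>_def)
  define L where "L = 2 powr (?n - \<epsilon> + 1) * unit_ball_vol ?n"
  have L: "0 \<le> L" by (simp add: L_def)
  have [measurable]: "ball y \<mu> \<in> sets borel" by simp
  have M: "carlM \<epsilon> = L * 2 powr \<epsilon> / \<epsilon>" by (simp add: carlM_def L_def)
  have M0: "0 \<le> carlM \<epsilon>" unfolding M using L \<epsilon> by auto
  have ker: "carl_kernel \<epsilon> x0 \<rho> X y s = s powr (- \<epsilon> - 1) * (indicator (ball y \<mu>) X * norm (X - y) powr (- (?n - \<epsilon>)))" for X
  proof -
    have n: "X \<in> ball y \<mu> \<longleftrightarrow> norm (X - y) < s \<and> norm (X - y) < 2 * \<rho>"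
      by (simp add: \<mu>_def dist_norm norm_minus_commute)
    have e: "\<epsilon> - ?n = - (?n - \<epsilon>)" by simp
    show ?thesis
      using True unfolding carl_kernel_def e indicator_def by (simp add: n del: mem_ball)
  qed
  have "(\<integral>\<^sup>+X. ennreal (k * carl_kernel \<epsilon> x0 \<rho> X y s) * alpha_sq d \<sigma> y s \<partial>lborel)
    = (\<integral>\<^sup>+X. ennreal (k * s powr (- \<epsilon> - 1)) * alpha_sq d \<sigma> y s * ennreal (indicator (ball y \<mu>) X * norm (X - y) powr (- (?n - \<epsilon>))) \<partial>lborel)"
    unfolding ker
  proof (rule nn_integral_cong)
    fix X
    have *: "ennreal (k * (p * q)) * x = ennreal (k * p) * x * ennreal q" if "0 \<le> p" "0 \<le> q" for p q x
    proof -
      have "ennreal (k * (p * q)) = ennreal (k * p) * ennreal q"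
        using that k by (simp add: mult.assoc flip: ennreal_mult)
      then show ?thesis by (simp only: mult_ac)
    qed
    show "ennreal (k * (s powr (- \<epsilon> - 1) * (indicator (ball y \<mu>) X * norm (X - y) powr (- (?n - \<epsilon>))))) * alpha_sq d \<sigma> y s
      = ennreal (k * s powr (- \<epsilon> - 1)) * alpha_sq d \<sigma> y s * ennreal (indicator (ball y \<mu>) X * norm (X - y) powr (- (?n - \<epsilon>)))"
      by (rule *) auto
  qed
  also have "\<dots> = ennreal (k * s powr (- \<epsilon> - 1)) * alpha_sq d \<sigma> y s *
      (\<integral>\<^sup>+X. ennreal (indicator (ball y \<mu>) X * norm (X - y) powr (- (?n - \<epsilon>))) \<partial>lborel)"
    by (intro nn_integral_cmult) measurable
  also have "\<dots> \<le> ennreal (k * s powr (- \<epsilon> - 1)) * alpha_sq d \<sigma> y s * ennreal (L * (2 * \<mu>) powr \<epsilon> / \<epsilon>)"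
    unfolding L_def by (intro mult_left_mono nn_integral_norm_powr_ball \<epsilon> \<mu>) auto
  also have "L * (2 * \<mu>) powr \<epsilon> / \<epsilon> = carlM \<epsilon> * \<mu> powr \<epsilon>" unfolding M by (subst powr_mult) simp
  also have "ennreal (k * s powr (- \<epsilon> - 1)) * alpha_sq d \<sigma> y s * ennreal (carlM \<epsilon> * \<mu> powr \<epsilon>)
    = ennreal (k * carlM \<epsilon>) * (ennreal (\<mu> powr \<epsilon> * s powr (- \<epsilon> - 1)) * alpha_sq d \<sigma> y s)"
  proof -
    have "ennreal (k * s powr (- \<epsilon> - 1)) * ennreal (carlM \<epsilon> * \<mu> powr \<epsilon>) = ennreal (k * carlM \<epsilon>) * ennreal (\<mu> powr \<epsilon> * s powr (- \<epsilon> - 1))"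
      using k M0 by (simp add: mult_ac flip: ennreal_mult)
    from arg_cong[OF this, of "\<lambda>c. c * alpha_sq d \<sigma> y s"] show ?thesis by (simp only: mult_ac)
  qed
  also have "\<dots> \<le> ennreal (k * carlM \<epsilon>) * (indicator {0<..<3 * \<rho>} s * (ennreal (1 / s) * alpha_sq d \<sigma> y s)
        + indicator {3 * \<rho>..} s * ennreal ((2 * \<rho>) powr \<epsilon> * s powr (- \<epsilon> - 1)))"
  proof (intro mult_left_mono)
    show "ennreal (\<mu> powr \<epsilon> * s powr (- \<epsilon> - 1)) * alpha_sq d \<sigma> y s
      \<le> indicator {0<..<3 * \<rho>} s * (ennreal (1 / s) * alpha_sq d \<sigma> y s) + indicator {3 * \<rho>..} s * ennreal ((2 * \<rho>) powr \<epsilon> * s powr (- \<epsilon> - 1))"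
    proof (cases "s < 3 * \<rho>")
      case s: True
      have "\<mu> powr \<epsilon> * s powr (- \<epsilon> - 1) \<le> s powr \<epsilon> * s powr (- \<epsilon> - 1)"
        using \<mu> \<epsilon> by (intro mult_right_mono powr_mono2) auto
      also have "\<dots> = 1 / s"
      proof -
        have "s powr \<epsilon> * s powr (- \<epsilon> - 1) = s powr (- 1)" by (simp flip: powr_add)
        then show ?thesis using True by (simp add: powr_minus_divide)
      qed
      finally have "ennreal (\<mu> powr \<epsilon> * s powr (- \<epsilon> - 1)) * alpha_sq d \<sigma> y s \<le> ennreal (1 / s) * alpha_sq d \<sigma> y s"
        by (intro mult_right_mono ennreal_leI) auto
      then show ?thesis using s True by simp
    next
      case s: False
      have "ennreal (\<mu> powr \<epsilon> * s powr (- \<epsilon> - 1)) * alpha_sq d \<sigma> y s \<le> ennreal ((2 * \<rho>) powr \<epsilon> * s powr (- \<epsilon> - 1)) * 1"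
        using \<mu> \<epsilon> by (intro mult_mono alpha_sq_le_1 ennreal_leI mult_right_mono powr_mono2) auto
      then show ?thesis using s by simp
    qed
  qed auto
  finally show ?thesis using True by simp
qed

lemma nn_integral_powr_tail:
  assumes "0 < \<epsilon>" "0 < \<rho>"
  shows "(\<integral>\<^sup>+s. indicator {3 * \<rho>..} s * ennreal ((2 * \<rho>) powr \<epsilon> * s powr (- \<epsilon> - 1)) \<partial>lborel) \<le> ennreal (1 / \<epsilon>)"
proof -
  have h: "((\<lambda>s. s powr (- \<epsilon> - 1)) has_integral - ((3 * \<rho>) powr (- \<epsilon> - 1 + 1)) / (- \<epsilon> - 1 + 1)) {3 * \<rho>..}"
    using assms by (intro has_integral_powr_to_inf) auto
  have "(\<integral>\<^sup>+s. ennreal (s powr (- \<epsilon> - 1)) * indicator {3 * \<rho>..} s \<partial>lborel) = ennreal ((3 * \<rho>) powr (- \<epsilon>) / \<epsilon>)"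
    using nn_integral_has_integral_lebesgue[OF _ h] by (simp add: mult.commute ennreal_mult' ennreal_indicator)
  note I = this
  have "(\<integral>\<^sup>+s. indicator {3 * \<rho>..} s * ennreal ((2 * \<rho>) powr \<epsilon> * s powr (- \<epsilon> - 1)) \<partial>lborel)
    = (\<integral>\<^sup>+s. ennreal ((2 * \<rho>) powr \<epsilon>) * (ennreal (s powr (- \<epsilon> - 1)) * indicator {3 * \<rho>..} s) \<partial>lborel)"
    by (intro nn_integral_cong) (simp add: ennreal_mult mult_ac)
  also have "\<dots> = ennreal ((2 * \<rho>) powr \<epsilon>) * ennreal ((3 * \<rho>) powr (- \<epsilon>) / \<epsilon>)"
    unfolding I[symmetric] by (intro nn_integral_cmult) measurable
  also have "\<dots> = ennreal ((2 * \<rho>) powr \<epsilon> * (3 * \<rho>) powr (- \<epsilon>) / \<epsilon>)" using assms by (simp flip: ennreal_mult)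
  also have "\<dots> \<le> ennreal (1 / \<epsilon>)"
  proof (intro ennreal_leI divide_right_mono)
    have "(2 * \<rho>) powr \<epsilon> * (3 * \<rho>) powr (- \<epsilon>) \<le> (3 * \<rho>) powr \<epsilon> * (3 * \<rho>) powr (- \<epsilon>)"
      using assms by (intro mult_right_mono powr_mono2) auto
    then show "(2 * \<rho>) powr \<epsilon> * (3 * \<rho>) powr (- \<epsilon>) \<le> 1" using assms by (simp flip: powr_add)
  qed (use assms in auto)
  finally show ?thesis .
qed

lemma alpha_sq_pair_measurable[measurable]:
  "(\<lambda>p. alpha_sq d \<sigma> (fst p) (snd p)) \<in> borel_measurable (\<sigma> \<Otimes>\<^sub>M lborel)"
proof -
  have s: "sets (\<sigma> \<Otimes>\<^sub>M (lborel :: real measure)) = sets (borel \<Otimes>\<^sub>M borel)"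
    by (intro sets_pair_measure_cong sets_\<sigma>) simp
  have "(\<lambda>p. alpha_sq d \<sigma> (fst p) (snd p)) \<in> borel_measurable (borel \<Otimes>\<^sub>M borel)"
    using alpha_sq_measurable[of d \<sigma>] by (simp only: case_prod_unfold)
  then show ?thesis unfolding measurable_cong_sets[OF s refl] .
qed

text \<open>After the pointwise bound only a jointly measurable kernel is integrated, and Tonelli
  moves the integral over X inside. Small scales are controlled by rectifiability in the ball of
  radius 3\<rho>, large ones by the tail; Ahlfors regularity leads back from 3\<rho> to
  \<rho>.\<close>

lemma carleson:
  fixes f :: "'a \<Rightarrow> 'b::real_normed_vector"
  assumes \<epsilon>: "0 < \<epsilon>" "\<epsilon> < real DIM('a)" and K: "0 \<le> K" and UR: "uniformly_rectifiable d C0 \<Gamma> \<sigma>"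
    and f: "\<And>X y. X \<notin> \<Gamma> \<Longrightarrow> y \<in> \<Gamma> \<Longrightarrow> dist X y \<le> 2 * infdist X \<Gamma> \<Longrightarrow> norm (f X) \<le> K * tail \<epsilon> y (infdist X \<Gamma>)"
    and x0: "x0 \<in> \<Gamma>" and \<rho>: "0 < \<rho>"
  shows "(\<integral>\<^sup>+X\<in>ball x0 \<rho> - \<Gamma>. ennreal ((norm (f X))\<^sup>2 * infdist X \<Gamma> powr (real d - real DIM('a))) \<partial>lebesgue)
    \<le> ennreal (carlK \<epsilon> K * carlM \<epsilon> * (C0 + 1 / \<epsilon>) * (C\<^sup>2 * 3 ^ d)) * emeasure \<sigma> (ball x0 \<rho>)"
proof -
  have C0: "0 \<le> C0" using UR by (simp add: uniformly_rectifiable_def)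
  have k: "0 \<le> carlK \<epsilon> K" unfolding carlK_def using C_pos tailK_pos[OF \<epsilon>(1)] by (intro mult_nonneg_nonneg) auto
  have M: "0 \<le> carlM \<epsilon>" unfolding carlM_def using \<epsilon> by (intro divide_nonneg_nonneg mult_nonneg_nonneg) auto
  let ?G = "\<lambda>X y s. ennreal (carlK \<epsilon> K * carl_kernel \<epsilon> x0 \<rho> X y s) * alpha_sq d \<sigma> y s"
  let ?B = "ball x0 (3 * \<rho>)"
  let ?T1 = "\<lambda>y s. indicator {0<..<3 * \<rho>} s * (ennreal (1 / s) * alpha_sq d \<sigma> y s)"
  let ?T2 = "\<lambda>s. indicator {3 * \<rho>..} s * ennreal ((2 * \<rho>) powr \<epsilon> * s powr (- \<epsilon> - 1))"
  have [measurable]: "?B \<in> sets borel" "?B \<in> sets \<sigma>" "{0<..<3 * \<rho>} \<in> sets borel" "{3 * \<rho>..} \<in> sets borel"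
    by (auto simp: sets_\<sigma>)
  interpret L: sigma_finite_measure "lborel :: real measure" by (rule sigma_finite_lborel)
  interpret L2: sigma_finite_measure "lborel :: 'a measure" by (rule sigma_finite_lborel)
  interpret P: pair_sigma_finite "lborel :: 'a measure" \<sigma> ..
  interpret Q: pair_sigma_finite \<sigma> "lborel :: real measure" ..
  have "(\<integral>\<^sup>+X\<in>ball x0 \<rho> - \<Gamma>. ennreal ((norm (f X))\<^sup>2 * infdist X \<Gamma> powr (real d - real DIM('a))) \<partial>lebesgue)
    \<le> (\<integral>\<^sup>+X. \<integral>\<^sup>+y. \<integral>\<^sup>+s. ?G X y s \<partial>lborel \<partial>\<sigma> \<partial>lebesgue)"
  proof (rule nn_integral_mono)
    fix X
    show "ennreal ((norm (f X))\<^sup>2 * infdist X \<Gamma> powr (real d - real DIM('a))) * indicator (ball x0 \<rho> - \<Gamma>) X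
      \<le> (\<integral>\<^sup>+y. \<integral>\<^sup>+s. ?G X y s \<partial>lborel \<partial>\<sigma>)"
    proof (cases "X \<in> ball x0 \<rho> - \<Gamma>")
      case True
      then have "ennreal ((norm (f X))\<^sup>2 * infdist X \<Gamma> powr (real d - real DIM('a))) \<le> (\<integral>\<^sup>+y. \<integral>\<^sup>+s. ?G X y s \<partial>lborel \<partial>\<sigma>)"
        using f by (intro carleson_pointwise \<epsilon> K x0) auto
      then show ?thesis using True by simp
    qed simp
  qed
  \<comment> \<open>Lebesgue measure is the completion of the Borel one; the product theorems are
    applied to the latter.\<close>
  also have "\<dots> = (\<integral>\<^sup>+X. \<integral>\<^sup>+y. \<integral>\<^sup>+s. ?G X y s \<partial>lborel \<partial>\<sigma> \<partial>lborel)"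
    by (rule nn_integral_completion)
  also have "\<dots> = (\<integral>\<^sup>+y. \<integral>\<^sup>+X. \<integral>\<^sup>+s. ?G X y s \<partial>lborel \<partial>lborel \<partial>\<sigma>)"
    using P.Fubini[of "\<lambda>(X, y). \<integral>\<^sup>+s. ?G X y s \<partial>lborel"] by simp
  also have "\<dots> = (\<integral>\<^sup>+y. \<integral>\<^sup>+s. \<integral>\<^sup>+X. ?G X y s \<partial>lborel \<partial>lborel \<partial>\<sigma>)"
  proof (rule nn_integral_cong)
    fix y
    show "(\<integral>\<^sup>+X. \<integral>\<^sup>+s. ?G X y s \<partial>lborel \<partial>lborel) = (\<integral>\<^sup>+s. \<integral>\<^sup>+X. ?G X y s \<partial>lborel \<partial>lborel)"
      using lborel_pair.Fubini[of "\<lambda>(X, s). ?G X y s"] by simp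
  qed
  also have "\<dots> \<le> (\<integral>\<^sup>+y. \<integral>\<^sup>+s. ennreal (carlK \<epsilon> K * carlM \<epsilon>) * (indicator ?B y * (?T1 y s + ?T2 s)) \<partial>lborel \<partial>\<sigma>)"
    by (intro nn_integral_mono carl_kernel_integral \<epsilon> \<rho> k)
  also have "\<dots> = ennreal (carlK \<epsilon> K * carlM \<epsilon>) * (\<integral>\<^sup>+y. \<integral>\<^sup>+s. indicator ?B y * (?T1 y s + ?T2 s) \<partial>lborel \<partial>\<sigma>)"
  proof -
    have "(\<integral>\<^sup>+s. ennreal (carlK \<epsilon> K * carlM \<epsilon>) * (indicator ?B y * (?T1 y s + ?T2 s)) \<partial>lborel)
      = ennreal (carlK \<epsilon> K * carlM \<epsilon>) * (\<integral>\<^sup>+s. indicator ?B y * (?T1 y s + ?T2 s) \<partial>lborel)" for y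
      by (intro nn_integral_cmult) measurable
    then show ?thesis by (simp only:) (intro nn_integral_cmult, measurable)
  qed
  also have "(\<integral>\<^sup>+y. \<integral>\<^sup>+s. indicator ?B y * (?T1 y s + ?T2 s) \<partial>lborel \<partial>\<sigma>)
    = (\<integral>\<^sup>+y. \<integral>\<^sup>+s. indicator ?B y * ?T1 y s \<partial>lborel \<partial>\<sigma>) + (\<integral>\<^sup>+y. \<integral>\<^sup>+s. indicator ?B y * ?T2 s \<partial>lborel \<partial>\<sigma>)"
  proof -
    have "(\<integral>\<^sup>+s. indicator ?B y * (?T1 y s + ?T2 s) \<partial>lborel)
      = (\<integral>\<^sup>+s. indicator ?B y * ?T1 y s \<partial>lborel) + (\<integral>\<^sup>+s. indicator ?B y * ?T2 s \<partial>lborel)" for y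
      unfolding distrib_left by (intro nn_integral_add) measurable
    then show ?thesis by (simp only:) (intro nn_integral_add, measurable)
  qed
  also have "\<dots> \<le> ennreal C0 * emeasure \<sigma> ?B + ennreal (1 / \<epsilon>) * emeasure \<sigma> ?B"
  proof (rule add_mono)
    have "(\<integral>\<^sup>+y. \<integral>\<^sup>+s. indicator ?B y * ?T1 y s \<partial>lborel \<partial>\<sigma>) = (\<integral>\<^sup>+s. \<integral>\<^sup>+y. indicator ?B y * ?T1 y s \<partial>\<sigma> \<partial>lborel)"
      using Q.Fubini[of "\<lambda>(y, s). indicator ?B y * ?T1 y s"] by simp
    \<comment> \<open>Here \<open>alpha_sq\<close> \<le> \<alpha>^2 leads back to \<alpha> itself.
      Only monotonicity of the integral is used on that side, where measurability is
      unknown.\<close>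
    also have "\<dots> \<le> (\<integral>\<^sup>+s\<in>{0<..<3 * \<rho>}. (\<integral>\<^sup>+y\<in>\<Gamma> \<inter> ?B. (alpha d \<sigma> y s)\<^sup>2 \<partial>\<sigma>) * ennreal (1 / s) \<partial>lborel)"
    proof (rule nn_integral_mono)
      fix s :: real
      show "(\<integral>\<^sup>+y. indicator ?B y * ?T1 y s \<partial>\<sigma>) \<le> (\<integral>\<^sup>+y\<in>\<Gamma> \<inter> ?B. (alpha d \<sigma> y s)\<^sup>2 \<partial>\<sigma>) * ennreal (1 / s) * indicator {0<..<3 * \<rho>} s"
      proof (cases "s \<in> {0<..<3 * \<rho>}")
        case True
        have "(\<integral>\<^sup>+y. indicator ?B y * ?T1 y s \<partial>\<sigma>) = (\<integral>\<^sup>+y. ennreal (1 / s) * (indicator ?B y * alpha_sq d \<sigma> y s) \<partial>\<sigma>)"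
          using True by (intro nn_integral_cong) (simp add: mult_ac)
        also have "\<dots> = ennreal (1 / s) * (\<integral>\<^sup>+y. indicator ?B y * alpha_sq d \<sigma> y s \<partial>\<sigma>)"
          by (intro nn_integral_cmult) measurable
        also have "\<dots> \<le> ennreal (1 / s) * (\<integral>\<^sup>+y\<in>\<Gamma> \<inter> ?B. (alpha d \<sigma> y s)\<^sup>2 \<partial>\<sigma>)"
        proof (rule mult_left_mono[OF nn_integral_mono_AE])
          show "AE y in \<sigma>. indicator ?B y * alpha_sq d \<sigma> y s \<le> (alpha d \<sigma> y s)\<^sup>2 * indicator (\<Gamma> \<inter> ?B) y"
            using AE_in_\<Gamma>
          proof eventually_elim
            case (elim y)
            then show ?case using alpha_sq_le[of s d \<sigma> y] True by (simp add: indicator_def)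
          qed
        qed simp
        finally show ?thesis using True by (simp add: mult.commute)
      qed simp
    qed
    also have "\<dots> \<le> ennreal C0 * emeasure \<sigma> ?B"
      using UR x0 \<rho> unfolding uniformly_rectifiable_def by auto
    finally show "(\<integral>\<^sup>+y. \<integral>\<^sup>+s. indicator ?B y * ?T1 y s \<partial>lborel \<partial>\<sigma>) \<le> ennreal C0 * emeasure \<sigma> ?B" .
    have "(\<integral>\<^sup>+y. \<integral>\<^sup>+s. indicator ?B y * ?T2 s \<partial>lborel \<partial>\<sigma>) = (\<integral>\<^sup>+y. indicator ?B y * (\<integral>\<^sup>+s. ?T2 s \<partial>lborel) \<partial>\<sigma>)"
      by (intro nn_integral_cong nn_integral_cmult) measurable
    also have "\<dots> \<le> (\<integral>\<^sup>+y. ennreal (1 / \<epsilon>) * indicator ?B y \<partial>\<sigma>)"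
      unfolding mult.commute[of "ennreal (1 / \<epsilon>)"]
      by (intro nn_integral_mono mult_left_mono nn_integral_powr_tail[OF \<epsilon>(1) \<rho>]) auto
    also have "\<dots> = ennreal (1 / \<epsilon>) * emeasure \<sigma> ?B"
      by (intro nn_integral_cmult_indicator) (simp add: sets_\<sigma>)
    finally show "(\<integral>\<^sup>+y. \<integral>\<^sup>+s. indicator ?B y * ?T2 s \<partial>lborel \<partial>\<sigma>) \<le> ennreal (1 / \<epsilon>) * emeasure \<sigma> ?B" .
  qed
  also have "ennreal C0 * emeasure \<sigma> ?B + ennreal (1 / \<epsilon>) * emeasure \<sigma> ?B = ennreal (C0 + 1 / \<epsilon>) * emeasure \<sigma> ?B"
    using C0 \<epsilon> by (simp add: ennreal_plus distrib_right)
  also have "emeasure \<sigma> ?B \<le> ennreal (C\<^sup>2 * 3 ^ d) * emeasure \<sigma> (ball x0 \<rho>)"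
  proof -
    have "emeasure \<sigma> ?B \<le> ennreal (C * (3 * \<rho>) ^ d)" using x0 \<rho> by (intro emeasure_ball_le_center) auto
    also have "\<dots> = ennreal (C\<^sup>2 * 3 ^ d) * ennreal (\<rho> ^ d / C)"
      using C_pos \<rho> by (simp add: power_mult_distrib power2_eq_square flip: ennreal_mult)
    also have "\<dots> \<le> ennreal (C\<^sup>2 * 3 ^ d) * emeasure \<sigma> (ball x0 \<rho>)"
      by (intro mult_left_mono emeasure_ball_ge x0 \<rho>) auto
    finally show ?thesis .
  qed
  finally have "(\<integral>\<^sup>+X\<in>ball x0 \<rho> - \<Gamma>. ennreal ((norm (f X))\<^sup>2 * infdist X \<Gamma> powr (real d - real DIM('a))) \<partial>lebesgue)
    \<le> ennreal (carlK \<epsilon> K * carlM \<epsilon>) * (ennreal (C0 + 1 / \<epsilon>) * (ennreal (C\<^sup>2 * 3 ^ d) * emeasure \<sigma> (ball x0 \<rho>)))"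
    by (simp add: mult_left_mono)
  also have "\<dots> = ennreal (carlK \<epsilon> K * carlM \<epsilon> * (C0 + 1 / \<epsilon>) * (C\<^sup>2 * 3 ^ d)) * emeasure \<sigma> (ball x0 \<rho>)"
  proof -
    have "ennreal u * (ennreal v * (ennreal w * x)) = ennreal (u * v * w) * x" if "0 \<le> u" "0 \<le> v" "0 \<le> w" for u v w x
      using that by (simp add: ennreal_mult mult.assoc)
    moreover have "0 \<le> carlK \<epsilon> K * carlM \<epsilon>" "0 \<le> C0 + 1 / \<epsilon>" "0 \<le> C\<^sup>2 * 3 ^ d" using k M C0 \<epsilon> by auto
    ultimately show ?thesis by (simp only:)
  qed
  finally show ?thesis .
qed

end

section \<open>The decomposition\<close>

lemma grad_eq:
  assumes "GDERIV f X :> D"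
  shows "grad f X = D"
  unfolding grad_def
proof (rule the_equality)
  show "GDERIV f X :> D" by (rule assms)
  fix D' assume "GDERIV f X :> D'"
  then have "(\<lambda>h. h \<bullet> D') = (\<lambda>h. h \<bullet> D)"
    using assms unfolding gderiv_def by (rule has_derivative_unique)
  then have "(D' - D) \<bullet> D' = (D' - D) \<bullet> D" by (rule fun_cong)
  then have "(D' - D) \<bullet> (D' - D) = 0" unfolding inner_diff_right[of "D' - D"] by (simp only: diff_self)
  then show "D' = D" by simp
qed

context ahlfors begin

lemma set_integral_eq:
  fixes g :: "'a \<Rightarrow> 'b::{banach, second_countable_topology}"
  assumes [measurable]: "g \<in> borel_measurable borel"
  shows "(LINT y:\<Gamma>|\<sigma>. g y) = (\<integral>y. g y \<partial>\<sigma>)"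
  unfolding set_lebesgue_integral_def
proof (rule integral_cong_AE)
  show "AE y in \<sigma>. indicat_real \<Gamma> y *\<^sub>R g y = g y"
    using AE_in_\<Gamma> by eventually_elim simp
qed measurable

lemma D_fun_eq: "D_fun d \<Gamma> \<sigma> \<beta> X = A \<beta> X powr (- (1 / \<beta>))"
proof -
  have "- real d - \<beta> = - (real d + \<beta>)" by simp
  then show ?thesis unfolding D_fun_def riesz_def by (subst set_integral_eq) simp_all
qed

lemma riesz_measurable[measurable]: "riesz d \<sigma> p \<in> borel_measurable borel"
  unfolding riesz_def[abs_def] by measurable

lemma riesz_vec_measurable[measurable]: "riesz_vec d \<sigma> p \<in> borel_measurable borel"
  unfolding riesz_vec_def[abs_def] by measurable

section \<open>The coefficient b\<close>

definition "expo \<beta> q = q / \<beta> - (1::real)"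
text \<open>\<beta> / (d + \<beta>) cancels the constant in the gradient of D_\<beta>.\<close>

definition "kap \<beta> q = kapP \<beta> q * \<beta> / (real d + \<beta>)"
definition "coef \<beta> q X = kap \<beta> q * (A (2 * \<beta>) X powr expo \<beta> q * A \<beta> X powr (- (2 * expo \<beta> q)))"

lemma A_powr_GDERIV:
  assumes X: "X \<notin> \<Gamma>" and p: "0 < p"
  shows "GDERIV (\<lambda>X. A p X powr k) X :> (- (k * A p X powr k * ((real d + p) / A p X))) *\<^sub>R S p X"
proof -
  have A: "0 < A p X" by (rule A_bounds(3)[OF X p])
  have "GDERIV (\<lambda>X. A p X powr k) X :> (k * A p X powr (k - 1)) *\<^sub>R ((- (real d + p)) *\<^sub>R S p X)"
    by (rule GDERIV_DERIV_compose[OF riesz_GDERIV[OF X p] has_real_derivative_powr[OF A]])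
  moreover have "A p X powr (k - 1) = A p X powr k / A p X" using A by (simp add: powr_diff)
  moreover have "k * (x / a) * (- c) = - (k * x * (c / a))" for x a c :: real by simp
  ultimately show ?thesis by (simp only: scaleR_scaleR)
qed

lemma D_fun_GDERIV:
  assumes X: "X \<notin> \<Gamma>" and \<beta>: "0 < \<beta>"
  shows "GDERIV (D_fun d \<Gamma> \<sigma> \<beta>) X :> ((real d + \<beta>) / \<beta> * A \<beta> X powr (- (1 / \<beta>)) / A \<beta> X) *\<^sub>R S \<beta> X"
  using A_powr_GDERIV[OF X \<beta>, of "- (1 / \<beta>)"] unfolding D_fun_eq[abs_def] by (simp add: mult_ac)

text \<open>b is a constant times a power of A_(2\<beta>) / A_\<beta>^2, so its gradient is b times
  the exponent times a logarithmic gradient.\<close>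

lemma coef_GDERIV:
  assumes X: "X \<notin> \<Gamma>" and \<beta>: "0 < \<beta>"
  shows "GDERIV (coef \<beta> q) X :> (- (expo \<beta> q * coef \<beta> q X)) *\<^sub>R logrel \<beta> X"
proof -
  let ?e = "expo \<beta> q"
  have \<beta>2: "0 < 2 * \<beta>" using \<beta> by simp
  define P where "P = A (2 * \<beta>) X powr ?e"
  define Q where "Q = A \<beta> X powr (- (2 * ?e))"
  have "GDERIV (\<lambda>X. A (2 * \<beta>) X powr ?e * A \<beta> X powr (- (2 * ?e))) X :>
      P *\<^sub>R ((- (- (2 * ?e) * Q * ((real d + \<beta>) / A \<beta> X))) *\<^sub>R S \<beta> X)
      + Q *\<^sub>R ((- (?e * P * ((real d + 2 * \<beta>) / A (2 * \<beta>) X))) *\<^sub>R S (2 * \<beta>) X)"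
    unfolding P_def Q_def by (rule GDERIV_mult[OF A_powr_GDERIV[OF X \<beta>2] A_powr_GDERIV[OF X \<beta>]])
  also have "P *\<^sub>R ((- (- (2 * ?e) * Q * ((real d + \<beta>) / A \<beta> X))) *\<^sub>R S \<beta> X)
      + Q *\<^sub>R ((- (?e * P * ((real d + 2 * \<beta>) / A (2 * \<beta>) X))) *\<^sub>R S (2 * \<beta>) X)
    = (- (?e * (P * Q))) *\<^sub>R logrel \<beta> X"
    unfolding logrel_def scaleR_diff_right scaleR_scaleR by (simp add: mult_ac)
  finally have 1: "GDERIV (\<lambda>X. A (2 * \<beta>) X powr ?e * A \<beta> X powr (- (2 * ?e))) X :> (- (?e * (P * Q))) *\<^sub>R logrel \<beta> X" .
  have "GDERIV (\<lambda>X. kap \<beta> q * (A (2 * \<beta>) X powr ?e * A \<beta> X powr (- (2 * ?e)))) X :>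
      kap \<beta> q *\<^sub>R ((- (?e * (P * Q))) *\<^sub>R logrel \<beta> X) + (P * Q) *\<^sub>R 0"
    unfolding P_def Q_def by (rule GDERIV_mult[OF GDERIV_const 1[unfolded P_def Q_def]])
  then show ?thesis unfolding coef_def[abs_def] by (simp add: P_def Q_def mult_ac)
qed

definition "rat1 \<beta> = lowA (2 * \<beta>) / (upA \<beta>)\<^sup>2"
definition "rat2 \<beta> = upA (2 * \<beta>) / (lowA \<beta>)\<^sup>2"
definition "coefU \<beta> q = kap \<beta> q * (rat1 \<beta> powr expo \<beta> q + rat2 \<beta> powr expo \<beta> q)"
definition "coefL \<beta> q = (1 / kap \<beta> q) * (rat1 \<beta> powr (- expo \<beta> q) + rat2 \<beta> powr (- expo \<beta> q))"

lemma kap_pos: "0 < \<beta> \<Longrightarrow> 0 \<le> q \<Longrightarrow> 0 < kap \<beta> q"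
  using kapP_pos[of \<beta> q] by (auto simp: kap_def intro!: divide_pos_pos mult_pos_pos)

text \<open>A_(2\<beta>) and A_\<beta>^2 are both comparable with r^(-2\<beta>), so r cancels in
  their quotient.\<close>

lemma coef_bounds:
  assumes X: "X \<notin> \<Gamma>" and \<beta>: "0 < \<beta>" and q: "0 \<le> q"
  shows "0 < coef \<beta> q X" "coef \<beta> q X \<le> coefU \<beta> q" "1 / coef \<beta> q X \<le> coefL \<beta> q"
proof -
  let ?r = "infdist X \<Gamma>" and ?e = "expo \<beta> q"
  have r: "0 < ?r" by (rule infdist_pos[OF X])
  have \<beta>2: "0 < 2 * \<beta>" using \<beta> by simp
  note b1 = A_bounds[OF X \<beta>] and b2 = A_bounds[OF X \<beta>2] and kp = kap_pos[OF \<beta> q]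
  define x where "x = A (2 * \<beta>) X / (A \<beta> X)\<^sup>2"
  have x0: "0 < x" using b1 b2 by (simp add: x_def)
  have rr: "?r powr (- (2 * \<beta>)) = (?r powr (- \<beta>))\<^sup>2" by (simp add: power2_eq_square flip: powr_add)
  have r0: "0 < ?r powr (- \<beta>)" using r by simp
  have can: "(k * ?r powr (- (2 * \<beta>))) / (k' * ?r powr (- \<beta>))\<^sup>2 = k / k'\<^sup>2" for k k'
    unfolding rr using r0 by (simp add: power_mult_distrib)
  have u: "0 < upA \<beta>" "0 < upA (2 * \<beta>)" using quo_pos(3) \<beta> \<beta>2 by auto
  have x1: "rat1 \<beta> \<le> x"
  proof -
    have "rat1 \<beta> = (lowA (2 * \<beta>) * ?r powr (- (2 * \<beta>))) / (upA \<beta> * ?r powr (- \<beta>))\<^sup>2" unfolding rat1_def can ..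
    also have "\<dots> \<le> x" unfolding x_def using b1 b2 by (intro frac_le power_mono) auto
    finally show ?thesis .
  qed
  have x2: "x \<le> rat2 \<beta>"
  proof -
    have "x \<le> (upA (2 * \<beta>) * ?r powr (- (2 * \<beta>))) / (lowA \<beta> * ?r powr (- \<beta>))\<^sup>2"
      unfolding x_def using b1 b2 u lowA_pos[of \<beta>] r0 by (intro frac_le power_mono zero_less_power mult_nonneg_nonneg) auto
    then show ?thesis unfolding rat2_def can .
  qed
  have rat1: "0 < rat1 \<beta>" using lowA_pos[of "2 * \<beta>"] u by (simp add: rat1_def)
  have c: "coef \<beta> q X = kap \<beta> q * x powr ?e"
  proof -
    have "((A \<beta> X)\<^sup>2) powr ?e = A \<beta> X powr (2 * ?e)" using b1(3) by (simp add: powr_powr flip: powr_numeral)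
    then have "x powr ?e = A (2 * \<beta>) X powr ?e / A \<beta> X powr (2 * ?e)" unfolding x_def by (simp add: powr_divide)
    then show ?thesis unfolding coef_def by (simp add: powr_minus divide_inverse)
  qed
  show "0 < coef \<beta> q X" unfolding c using kp x0 by simp
  show "coef \<beta> q X \<le> coefU \<beta> q"
    unfolding c coefU_def using kp by (intro mult_left_mono powr_between_le[OF rat1 x1 x2]) auto
  have "1 / coef \<beta> q X = (1 / kap \<beta> q) * x powr (- ?e)" unfolding c by (simp add: powr_minus divide_inverse)
  also have "\<dots> \<le> coefL \<beta> q"
    unfolding coefL_def using kp by (intro mult_left_mono powr_between_le[OF rat1 x1 x2]) auto
  finally show "1 / coef \<beta> q X \<le> coefL \<beta> q" .
qed

section \<open>The remainder field and the final bounds\<close>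

text \<open>The field \<open>V\<close> of the theorem: the residual divided by D_\<beta>^(-(q+1)),
  that is, by A_\<beta>^((q+1)/\<beta>).\<close>

definition "field \<beta> q X = A \<beta> X powr (- ((q + 1) / \<beta>)) *\<^sub>R resid \<beta> q X"

text \<open>A count of powers of A_\<beta>: (q+1)/\<beta> from D_\<beta>, -2e from b and -1/\<beta>
  - 1 from the gradient add up to -e, with e = q/\<beta> - 1, the power present in
  \<open>resid\<close>.\<close>

lemma field_eq:
  assumes X: "X \<notin> \<Gamma>" and \<beta>: "0 < \<beta>" and q: "0 \<le> q"
  shows "D_fun d \<Gamma> \<sigma> \<beta> X powr (- (q + 1)) *\<^sub>R (coef \<beta> q X *\<^sub>R grad (D_fun d \<Gamma> \<sigma> \<beta>) X + field \<beta> q X) = S q X"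
proof -
  let ?a = "A \<beta> X" and ?b = "A (2 * \<beta>) X" and ?e = "expo \<beta> q"
  have a: "0 < ?a" and b: "0 < ?b" using A_bounds(3)[OF X] \<beta> by auto
  have D: "D_fun d \<Gamma> \<sigma> \<beta> X powr (- (q + 1)) = ?a powr ((q + 1) / \<beta>)"
  proof -
    have "- (1 / \<beta>) * - (q + 1) = (q + 1) / \<beta>" by (simp add: divide_inverse algebra_simps)
    then show ?thesis unfolding D_fun_eq by (simp only: powr_powr)
  qed
  have g: "grad (D_fun d \<Gamma> \<sigma> \<beta>) X = ((real d + \<beta>) / \<beta> * ?a powr (- (1 / \<beta>)) / ?a) *\<^sub>R S \<beta> X"
    by (rule grad_eq[OF D_fun_GDERIV[OF X \<beta>]])
  have pw: "?a powr ((q + 1) / \<beta>) * (?a powr (- (2 * ?e)) * (?a powr (- (1 / \<beta>)) / ?a)) = ?a powr (- ?e)"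
  proof -
    have "?a powr (- (1 / \<beta>)) / ?a = ?a powr (- (1 / \<beta>) - 1)" using a by (simp add: powr_diff)
    then have "?a powr ((q + 1) / \<beta>) * (?a powr (- (2 * ?e)) * (?a powr (- (1 / \<beta>)) / ?a))
      = ?a powr ((q + 1) / \<beta> + (- (2 * ?e) + (- (1 / \<beta>) - 1)))" by (simp only: powr_add)
    also have "(q + 1) / \<beta> + (- (2 * ?e) + (- (1 / \<beta>) - 1)) = - ?e" using \<beta> by (simp add: expo_def field_simps)
    finally show ?thesis .
  qed
  have k: "kap \<beta> q * ((real d + \<beta>) / \<beta>) = kapP \<beta> q" using \<beta> by (simp add: kap_def add_nonneg_pos)
  have quo: "(?b / ?a) powr ?e = ?b powr ?e * ?a powr (- ?e)" unfolding powr_divide powr_minus by (rule divide_inverse)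
  have "?a powr ((q + 1) / \<beta>) * (coef \<beta> q X * ((real d + \<beta>) / \<beta> * ?a powr (- (1 / \<beta>)) / ?a))
    = (kap \<beta> q * ((real d + \<beta>) / \<beta>)) * ?b powr ?e * (?a powr ((q + 1) / \<beta>) * (?a powr (- (2 * ?e)) * (?a powr (- (1 / \<beta>)) / ?a)))"
    unfolding coef_def by simp
  also have "\<dots> = kapP \<beta> q * (?b / ?a) powr ?e" unfolding k pw quo by simp
  finally have 1: "?a powr ((q + 1) / \<beta>) *\<^sub>R (coef \<beta> q X *\<^sub>R grad (D_fun d \<Gamma> \<sigma> \<beta>) X) = (kapP \<beta> q * (?b / ?a) powr ?e) *\<^sub>R S \<beta> X"
    unfolding g scaleR_scaleR by simp
  have "?a powr ((q + 1) / \<beta>) * ?a powr (- ((q + 1) / \<beta>)) = 1" using a by (simp flip: powr_add)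
  then have 2: "?a powr ((q + 1) / \<beta>) *\<^sub>R field \<beta> q X = resid \<beta> q X" unfolding field_def scaleR_scaleR by simp
  show ?thesis unfolding D scaleR_add_right 1 2 by (simp add: resid_def expo_def)
qed

definition "fieldK \<epsilon> \<beta> q = lowA \<beta> powr (- ((q + 1) / \<beta>)) * residK \<epsilon> \<beta> q"
definition "dgradK \<epsilon> \<beta> q = lowA \<beta> powr (- (1 / \<beta>)) * (\<bar>expo \<beta> q\<bar> * coefU \<beta> q) * gradK \<epsilon> \<beta>"

lemma A_powr_le:
  assumes X: "X \<notin> \<Gamma>" and \<beta>: "0 < \<beta>" and s: "0 \<le> s"
  shows "A \<beta> X powr (- (s / \<beta>)) \<le> lowA \<beta> powr (- (s / \<beta>)) * infdist X \<Gamma> powr s"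
proof -
  have "A \<beta> X powr (- (s / \<beta>)) \<le> (lowA \<beta> * infdist X \<Gamma> powr (- \<beta>)) powr (- (s / \<beta>))"
    using A_bounds(1)[OF X \<beta>] lowA_pos[of \<beta>] infdist_pos[OF X] \<beta> s by (intro powr_mono2') auto
  also have "\<dots> = lowA \<beta> powr (- (s / \<beta>)) * infdist X \<Gamma> powr s"
    using \<beta> by (simp add: powr_mult powr_powr)
  finally show ?thesis .
qed

text \<open>The power of A_\<beta> is at most a multiple of r^(q+1), which cancels the decay of the
  residual.\<close>

lemma field_le:
  assumes X: "X \<notin> \<Gamma>" and y: "y \<in> \<Gamma>" "dist X y \<le> 2 * infdist X \<Gamma>"
    and \<beta>: "0 < \<beta>" and q: "0 \<le> q" and \<epsilon>: "0 < \<epsilon>" "\<epsilon> < \<beta>" "\<epsilon> < 1"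
  shows "norm (field \<beta> q X) \<le> fieldK \<epsilon> \<beta> q * tail \<epsilon> y (infdist X \<Gamma>)"
proof -
  let ?r = "infdist X \<Gamma>"
  have r: "0 < ?r" by (rule infdist_pos[OF X])
  have "norm (field \<beta> q X) = A \<beta> X powr (- ((q + 1) / \<beta>)) * norm (resid \<beta> q X)" by (simp add: field_def)
  also have "\<dots> \<le> (lowA \<beta> powr (- ((q + 1) / \<beta>)) * ?r powr (q + 1)) * (residK \<epsilon> \<beta> q * tail \<epsilon> y ?r * ?r powr (- (q + 1)))"
    using q by (intro mult_mono A_powr_le[OF X \<beta>] resid_bound[OF X y \<beta> q \<epsilon>]) auto
  also have "\<dots> = fieldK \<epsilon> \<beta> q * tail \<epsilon> y ?r * (?r powr (q + 1) * ?r powr (- (q + 1)))"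
    unfolding fieldK_def by (simp only: mult_ac)
  also have "?r powr (q + 1) * ?r powr (- (q + 1)) = 1" using r by (simp flip: powr_add)
  finally show ?thesis by simp
qed

text \<open>D_\<beta> is at most a multiple of r, which cancels the 1 / r of
  \<open>logrel_bound\<close>.\<close>

lemma grad_coef_le:
  assumes X: "X \<notin> \<Gamma>" and y: "y \<in> \<Gamma>" "dist X y \<le> 2 * infdist X \<Gamma>"
    and \<beta>: "0 < \<beta>" and q: "0 \<le> q" and \<epsilon>: "0 < \<epsilon>" "\<epsilon> < \<beta>"
  shows "norm (D_fun d \<Gamma> \<sigma> \<beta> X *\<^sub>R grad (coef \<beta> q) X) \<le> dgradK \<epsilon> \<beta> q * tail \<epsilon> y (infdist X \<Gamma>)"
proof -
  let ?r = "infdist X \<Gamma>"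
  have r: "0 < ?r" by (rule infdist_pos[OF X])
  note cb = coef_bounds[OF X \<beta> q]
  have "norm (D_fun d \<Gamma> \<sigma> \<beta> X *\<^sub>R grad (coef \<beta> q) X)
    = A \<beta> X powr (- (1 / \<beta>)) * (\<bar>expo \<beta> q\<bar> * coef \<beta> q X * norm (logrel \<beta> X))"
    unfolding grad_eq[OF coef_GDERIV[OF X \<beta>]] D_fun_eq using cb(1) by (simp add: abs_mult)
  also have "\<dots> \<le> (lowA \<beta> powr (- (1 / \<beta>)) * ?r powr 1) * (\<bar>expo \<beta> q\<bar> * coefU \<beta> q * (gradK \<epsilon> \<beta> * tail \<epsilon> y ?r / ?r))"
    using cb by (intro mult_mono mult_left_mono A_powr_le[OF X \<beta>] logrel_bound[OF X y \<epsilon>] mult_nonneg_nonneg) auto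
  also have "\<dots> = dgradK \<epsilon> \<beta> q * tail \<epsilon> y ?r" using r unfolding dgradK_def by simp
  finally show ?thesis .
qed

lemma tail_le:
  assumes \<epsilon>: "0 < \<epsilon>"
  shows "tail \<epsilon> y r \<le> 1 / (1 - 2 powr (- \<epsilon>))"
proof -
  have g: "(2::real) powr (- \<epsilon> * real j) = (2 powr (- \<epsilon>)) ^ j" for j by (simp add: powr_powr flip: powr_realpow)
  have l: "(2::real) powr (- \<epsilon>) < 1" using \<epsilon> by (simp add: powr_less_one)
  have "tail \<epsilon> y r \<le> (\<Sum>j. (2 powr (- \<epsilon>)) ^ j)"
    unfolding tail_def
  proof (rule suminf_le)
    show "2 powr (- \<epsilon> * real j) * alpha1 d \<sigma> y (2 * (2 ^ j * (4 * r))) \<le> (2 powr (- \<epsilon>)) ^ j" for j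
      unfolding g using alpha1_le_1 by (simp add: mult_left_le)
    show "summable (\<lambda>j. 2 powr (- \<epsilon> * real j) * alpha1 d \<sigma> y (2 * (2 ^ j * (4 * r))))" by (rule tail_bounds(3)[OF \<epsilon>])
    show "summable (\<lambda>j. ((2::real) powr (- \<epsilon>)) ^ j)" using l by (intro summable_geometric) auto
  qed
  also have "\<dots> = 1 / (1 - 2 powr (- \<epsilon>))" using l by (intro suminf_geometric) auto
  finally show ?thesis .
qed

text \<open>\<open>f\<close> matters only off \<Gamma>, where the Borel function \<open>g\<close>
  agrees with it and supplies measurability; a function built with \<open>grad\<close> is
  unspecified on \<Gamma>. The uniform bound takes y nearest to X and sums the geometric
  series.\<close>

lemma CM_of_tail_bound:
  fixes f :: "'a \<Rightarrow> 'b::euclidean_space"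
  assumes \<epsilon>: "0 < \<epsilon>" "\<epsilon> < real DIM('a)" and K: "0 \<le> K" and UR: "uniformly_rectifiable d C0 \<Gamma> \<sigma>"
    and g: "g \<in> borel_measurable borel" "\<And>X. X \<notin> \<Gamma> \<Longrightarrow> f X = g X"
    and f: "\<And>X y. X \<notin> \<Gamma> \<Longrightarrow> y \<in> \<Gamma> \<Longrightarrow> dist X y \<le> 2 * infdist X \<Gamma> \<Longrightarrow> norm (f X) \<le> K * tail \<epsilon> y (infdist X \<Gamma>)"
    and C1: "carlK \<epsilon> K * carlM \<epsilon> * (C0 + 1 / \<epsilon>) * (C\<^sup>2 * 3 ^ d) \<le> C1"
  shows "CM d \<Gamma> \<sigma> C1 f"
    and "X \<notin> \<Gamma> \<Longrightarrow> norm (f X) \<le> K * (1 / (1 - 2 powr (- \<epsilon>)))"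
proof -
  have bd: "norm (f X) \<le> K * (1 / (1 - 2 powr (- \<epsilon>)))" if X: "X \<notin> \<Gamma>" for X
  proof -
    obtain y where y: "y \<in> \<Gamma>" "dist X y = infdist X \<Gamma>" by (rule nearest)
    have "norm (f X) \<le> K * tail \<epsilon> y (infdist X \<Gamma>)" using infdist_pos[OF X] y by (intro f X) auto
    also have "\<dots> \<le> K * (1 / (1 - 2 powr (- \<epsilon>)))" by (intro mult_left_mono tail_le \<epsilon> K)
    finally show ?thesis .
  qed
  then show "X \<notin> \<Gamma> \<Longrightarrow> norm (f X) \<le> K * (1 / (1 - 2 powr (- \<epsilon>)))" .
  show "CM d \<Gamma> \<sigma> C1 f"
    unfolding CM_def
  proof (intro conjI ballI allI impI)
    have "g \<in> borel_measurable (lebesgue_on (- \<Gamma>))"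
      using g(1) by (intro measurable_restrict_space1 measurable_completion) simp
    then show "f \<in> borel_measurable (lebesgue_on (- \<Gamma>))"
      by (rule measurable_cong[THEN iffD1, rotated]) (use g(2) in \<open>auto simp: space_restrict_space\<close>)
    show "\<exists>K. AE X in lebesgue_on (- \<Gamma>). norm (f X) \<le> K"
      by (intro exI[of _ "K * (1 / (1 - 2 powr (- \<epsilon>)))"] AE_I2 bd) (simp add: space_restrict_space)
    fix x \<rho> assume "x \<in> \<Gamma>" "(0::real) < \<rho>"
    from carleson[OF \<epsilon> K UR f this]
    have "(\<integral>\<^sup>+X\<in>ball x \<rho> - \<Gamma>. ennreal ((norm (f X))\<^sup>2 * infdist X \<Gamma> powr (real d - real DIM('a))) \<partial>lebesgue)
      \<le> ennreal (carlK \<epsilon> K * carlM \<epsilon> * (C0 + 1 / \<epsilon>) * (C\<^sup>2 * 3 ^ d)) * emeasure \<sigma> (ball x \<rho>)" .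
    also have "\<dots> \<le> ennreal C1 * emeasure \<sigma> (ball x \<rho>)" by (intro mult_right_mono ennreal_leI C1) auto
    finally show "(\<integral>\<^sup>+X\<in>ball x \<rho> - \<Gamma>. ennreal ((norm (f X))\<^sup>2 * infdist X \<Gamma> powr (real d - real DIM('a))) \<partial>lebesgue)
      \<le> ennreal C1 * emeasure \<sigma> (ball x \<rho>)" .
  qed
qed

definition "carlC \<epsilon> K C0 = carlK \<epsilon> K * carlM \<epsilon> * (C0 + 1 / \<epsilon>) * (C\<^sup>2 * 3 ^ d)"
text \<open>Neither \<Gamma> nor \<sigma> enters, so outside the locale this is a function of the
  space, d, C and its arguments: the uniformity that the theorem asserts. Absolute values make the
  factors nonnegative by construction.\<close>

definition "bound_const \<epsilon> \<beta> q C0 = Max {1, coefU \<beta> q, coefL \<beta> q, carlC \<epsilon> \<bar>fieldK \<epsilon> \<beta> q\<bar> C0, carlC \<epsilon> \<bar>dgradK \<epsilon> \<beta> q\<bar> C0,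
   \<bar>fieldK \<epsilon> \<beta> q\<bar> * (1 / (1 - 2 powr (- \<epsilon>)))}"

text \<open>Differentiability of b belongs to the conclusion because \<open>grad\<close> is a
  definite description, informative only where a gradient exists.\<close>

lemma decomposition:
  assumes \<beta>: "0 < \<beta>" and q: "q = real DIM('a) - real d - 2" "0 \<le> q" and \<epsilon>: "0 < \<epsilon>" "\<epsilon> < \<beta>" "\<epsilon> < 1"
    and UR: "uniformly_rectifiable d C0 \<Gamma> \<sigma>"
  defines "K \<equiv> bound_const \<epsilon> \<beta> q C0"
  shows "\<exists>b V. (\<forall>X\<in>- \<Gamma>. (LINT y:\<Gamma>|\<sigma>. (norm (X - y) powr (- real DIM('a))) *\<^sub>R (X - y)) =
          (D_fun d \<Gamma> \<sigma> \<beta> X powr (real d + 1 - real DIM('a))) *\<^sub>R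
            (b X *\<^sub>R grad (D_fun d \<Gamma> \<sigma> \<beta>) X + V X)) \<and>
       (\<forall>X\<in>- \<Gamma>. 1 / K \<le> b X \<and> b X \<le> K) \<and>
       b differentiable_on (- \<Gamma>) \<and>
       CM d \<Gamma> \<sigma> K (\<lambda>X. D_fun d \<Gamma> \<sigma> \<beta> X *\<^sub>R grad b X) \<and>
       (\<forall>X\<in>- \<Gamma>. norm (V X) \<le> K) \<and>
       CM d \<Gamma> \<sigma> K V"
proof (intro exI[of _ "coef \<beta> q"] exI[of _ "field \<beta> q"] conjI ballI)
  have Kge: "x \<le> K" if "x \<in> {1, coefU \<beta> q, coefL \<beta> q, carlC \<epsilon> \<bar>fieldK \<epsilon> \<beta> q\<bar> C0, carlC \<epsilon> \<bar>dgradK \<epsilon> \<beta> q\<bar> C0,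
   \<bar>fieldK \<epsilon> \<beta> q\<bar> * (1 / (1 - 2 powr (- \<epsilon>)))}" for x
    unfolding K_def bound_const_def by (rule Max_ge[OF _ that]) simp
  have \<epsilon>n: "\<epsilon> < real DIM('a)" using \<epsilon>(3) DIM_positive[where 'a='a] by linarith
  have K1: "0 < K" using Kge[of 1] by simp
  note V1 = CM_of_tail_bound[OF \<epsilon>(1) \<epsilon>n abs_ge_zero UR, of "field \<beta> q" "field \<beta> q" "fieldK \<epsilon> \<beta> q" K]
  have Vb: "norm (field \<beta> q X) \<le> \<bar>fieldK \<epsilon> \<beta> q\<bar> * tail \<epsilon> y (infdist X \<Gamma>)"
    if "X \<notin> \<Gamma>" "y \<in> \<Gamma>" "dist X y \<le> 2 * infdist X \<Gamma>" for X y
    using field_le[OF that \<beta> q(2) \<epsilon>] mult_right_mono[OF abs_ge_self tail_bounds(1)[OF \<epsilon>(1)], of "fieldK \<epsilon> \<beta> q" y "infdist X \<Gamma>"] by linarith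
  have gb: "norm (D_fun d \<Gamma> \<sigma> \<beta> X *\<^sub>R grad (coef \<beta> q) X) \<le> \<bar>dgradK \<epsilon> \<beta> q\<bar> * tail \<epsilon> y (infdist X \<Gamma>)"
    if "X \<notin> \<Gamma>" "y \<in> \<Gamma>" "dist X y \<le> 2 * infdist X \<Gamma>" for X y
    using grad_coef_le[OF that \<beta> q(2) \<epsilon>(1,2)] mult_right_mono[OF abs_ge_self tail_bounds(1)[OF \<epsilon>(1)], of "dgradK \<epsilon> \<beta> q" y "infdist X \<Gamma>"] by linarith
  have field_meas: "field \<beta> q \<in> borel_measurable borel"
    unfolding field_def[abs_def] resid_def[abs_def] by measurable
  have grad_meas: "(\<lambda>X. A \<beta> X powr (- (1 / \<beta>)) *\<^sub>R ((- (expo \<beta> q * coef \<beta> q X)) *\<^sub>R logrel \<beta> X)) \<in> borel_measurable borel"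
    unfolding coef_def logrel_def by measurable
  show "CM d \<Gamma> \<sigma> K (field \<beta> q)"
    by (rule V1(1)) (use field_meas Vb Kge in \<open>auto simp: carlC_def\<close>)
  show "CM d \<Gamma> \<sigma> K (\<lambda>X. D_fun d \<Gamma> \<sigma> \<beta> X *\<^sub>R grad (coef \<beta> q) X)"
  proof (rule CM_of_tail_bound(1)[OF \<epsilon>(1) \<epsilon>n abs_ge_zero UR grad_meas _ gb])
    show "D_fun d \<Gamma> \<sigma> \<beta> X *\<^sub>R grad (coef \<beta> q) X = A \<beta> X powr (- (1 / \<beta>)) *\<^sub>R ((- (expo \<beta> q * coef \<beta> q X)) *\<^sub>R logrel \<beta> X)"
      if "X \<notin> \<Gamma>" for X
      unfolding grad_eq[OF coef_GDERIV[OF that \<beta>]] D_fun_eq ..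
  qed (use Kge in \<open>auto simp: carlC_def\<close>)
  have "coef \<beta> q differentiable (at X)" if "X \<notin> \<Gamma>" for X
    using coef_GDERIV[OF that \<beta>, of q] unfolding gderiv_def differentiable_def by blast
  then show "coef \<beta> q differentiable_on (- \<Gamma>)"
    by (auto simp: differentiable_on_def intro: differentiable_at_withinI)
  fix X assume "X \<in> - \<Gamma>"
  then have X: "X \<notin> \<Gamma>" by simp
  note cb = coef_bounds[OF X \<beta> q(2)]
  have "1 / coef \<beta> q X \<le> K" using cb(3) Kge[of "coefL \<beta> q"] by simp
  then show "1 / K \<le> coef \<beta> q X" using K1 cb(1) by (simp add: field_simps)
  show "coef \<beta> q X \<le> K" using cb(2) Kge[of "coefU \<beta> q"] by simp
  have "norm (field \<beta> q X) \<le> \<bar>fieldK \<epsilon> \<beta> q\<bar> * (1 / (1 - 2 powr (- \<epsilon>)))"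
    by (rule CM_of_tail_bound(2)[OF \<epsilon>(1) \<epsilon>n abs_ge_zero UR field_meas refl Vb order_refl X])
  then show "norm (field \<beta> q X) \<le> K" using Kge[of "\<bar>fieldK \<epsilon> \<beta> q\<bar> * (1 / (1 - 2 powr (- \<epsilon>)))"] by simp
  have "(LINT y:\<Gamma>|\<sigma>. (norm (X - y) powr (- real DIM('a))) *\<^sub>R (X - y)) = S q X"
  proof -
    have "- real DIM('a) = - (real d + q + 2)" using q(1) by simp
    then show ?thesis unfolding riesz_vec_def by (subst set_integral_eq) simp_all
  qed
  also have "\<dots> = D_fun d \<Gamma> \<sigma> \<beta> X powr (- (q + 1)) *\<^sub>R (coef \<beta> q X *\<^sub>R grad (D_fun d \<Gamma> \<sigma> \<beta>) X + field \<beta> q X)"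
    by (rule field_eq[OF X \<beta> q(2), symmetric])
  also have "- (q + 1) = real d + 1 - real DIM('a)" using q(1) by simp
  finally show "(LINT y:\<Gamma>|\<sigma>. (norm (X - y) powr (- real DIM('a))) *\<^sub>R (X - y)) =
     D_fun d \<Gamma> \<sigma> \<beta> X powr (real d + 1 - real DIM('a)) *\<^sub>R (coef \<beta> q X *\<^sub>R grad (D_fun d \<Gamma> \<sigma> \<beta>) X + field \<beta> q X)" .
qed

lemma bound_const_ge_1: "1 \<le> bound_const \<epsilon> \<beta> q C0"
  unfolding bound_const_def by (rule Max_ge) auto

end

theorem lemma1p25:
  fixes d :: nat and C\<^sub>\<sigma> C\<^sub>0 \<beta> :: real
  assumes "0 < d" and "d < CARD('n::finite) - 1" and "\<beta> > 0"
  shows "\<exists>C\<^sub>1>0. \<forall>(\<Gamma> :: (real^'n) set) \<sigma>.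
    ahlfors_regular d C\<^sub>\<sigma> \<Gamma> \<sigma> \<longrightarrow> uniformly_rectifiable d C\<^sub>0 \<Gamma> \<sigma> \<longrightarrow>
    (\<exists>(b :: real^'n \<Rightarrow> real) (V :: real^'n \<Rightarrow> real^'n).
       (\<forall>X\<in>- \<Gamma>.
          (LINT y:\<Gamma>|\<sigma>. (norm (X - y) powr (- real CARD('n))) *\<^sub>R (X - y)) =
          (D_fun d \<Gamma> \<sigma> \<beta> X powr (real d + 1 - real CARD('n))) *\<^sub>R
            (b X *\<^sub>R grad (D_fun d \<Gamma> \<sigma> \<beta>) X + V X)) \<and>
       (\<forall>X\<in>- \<Gamma>. 1 / C\<^sub>1 \<le> b X \<and> b X \<le> C\<^sub>1) \<and>
       b differentiable_on (- \<Gamma>) \<and>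
       CM d \<Gamma> \<sigma> C\<^sub>1 (\<lambda>X. D_fun d \<Gamma> \<sigma> \<beta> X *\<^sub>R grad b X) \<and>
       (\<forall>X\<in>- \<Gamma>. norm (V X) \<le> C\<^sub>1) \<and>
       CM d \<Gamma> \<sigma> C\<^sub>1 V)"
proof -
  \<comment> \<open>\<epsilon> < \<beta> serves A_\<beta>; \<epsilon> < 1 serves S_q, which asks for
    \<epsilon> < q + 1 with q possibly 0.\<close>
  define \<epsilon> where "\<epsilon> = min \<beta> 1 / 2"
  define q where "q = real CARD('n) - real d - 2"
  have \<epsilon>: "0 < \<epsilon>" "\<epsilon> < \<beta>" "\<epsilon> < 1" using assms(3) by (auto simp: \<epsilon>_def)
  have q: "q = real DIM(real^'n) - real d - 2" "0 \<le> q" using assms(2) by (auto simp: q_def)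
  \<comment> \<open>Chosen before \<Gamma> and \<sigma>. That the second entry is at least 1 is
    known only inside the locale, that is, for nonempty \<Gamma>; hence the maximum.\<close>
  define C1 where "C1 = max 1 (ahlfors.bound_const TYPE(real^'n) d C\<^sub>\<sigma> \<epsilon> \<beta> q C\<^sub>0)"
  show ?thesis
  proof (intro exI[of _ C1] conjI allI impI)
    show "0 < C1" by (simp add: C1_def)
    fix \<Gamma> :: "(real^'n) set" and \<sigma> :: "(real^'n) measure"
    assume reg: "ahlfors_regular d C\<^sub>\<sigma> \<Gamma> \<sigma>" and UR: "uniformly_rectifiable d C\<^sub>0 \<Gamma> \<sigma>"
    show "\<exists>(b :: real^'n \<Rightarrow> real) (V :: real^'n \<Rightarrow> real^'n).
       (\<forall>X\<in>- \<Gamma>.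
          (LINT y:\<Gamma>|\<sigma>. (norm (X - y) powr (- real CARD('n))) *\<^sub>R (X - y)) =
          (D_fun d \<Gamma> \<sigma> \<beta> X powr (real d + 1 - real CARD('n))) *\<^sub>R
            (b X *\<^sub>R grad (D_fun d \<Gamma> \<sigma> \<beta>) X + V X)) \<and>
       (\<forall>X\<in>- \<Gamma>. 1 / C1 \<le> b X \<and> b X \<le> C1) \<and>
       b differentiable_on (- \<Gamma>) \<and>
       CM d \<Gamma> \<sigma> C1 (\<lambda>X. D_fun d \<Gamma> \<sigma> \<beta> X *\<^sub>R grad b X) \<and>
       (\<forall>X\<in>- \<Gamma>. norm (V X) \<le> C1) \<and>
       CM d \<Gamma> \<sigma> C1 V"
    proof (cases "\<Gamma> = {}")
      \<comment> \<open>For the empty set the integrals over \<Gamma> and \<open>D_fun\<close> are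
        0, and b = 1, V = 0 meet all conditions.\<close>
      case True
      have g: "grad (\<lambda>_::real^'n. 1::real) X = 0" for X by (intro grad_eq GDERIV_const)
      have "CM d \<Gamma> \<sigma> C1 (\<lambda>_::real^'n. 0::real^'n)"
        using True by (auto simp: CM_def)
      moreover have "D_fun d \<Gamma> \<sigma> \<beta> X = 0" for X
        using True by (simp add: D_fun_def set_lebesgue_integral_def)
      ultimately show ?thesis
        using True by (intro exI[of _ "\<lambda>_. 1"] exI[of _ "\<lambda>_. 0"])
          (simp add: g set_lebesgue_integral_def C1_def)
    next
      case False
      interpret ahlfors d C\<^sub>\<sigma> \<Gamma> \<sigma> using reg assms(1) False by unfold_locales
      have "C1 = bound_const \<epsilon> \<beta> q C\<^sub>0" unfolding C1_def using bound_const_ge_1[of \<epsilon> \<beta> q C\<^sub>0] by simp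
      then show ?thesis using decomposition[OF assms(3) q \<epsilon> UR] by simp
    qed
  qed
qed

end
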